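(* Under the setting and data assumptions (A1), (A2) described in the context, suppose the smallness condition $$h<\varepsilon\left(\frac{\|f\|_{0}}{\max\{\sqrt{\gamma},\sqrt{\varepsilon}/c_0\}}+\frac{c_3}{\sqrt{\varepsilon}}\|g\|_{H^{-1/2}(\Gamma_N)}\right)^{-1}M_4^{-1}$$ holds. Then the modified dynamic diffusion (DD) scheme $$a(u_{hb};u_{hb},v_{hb})=(f,v_{hb})+(g,v_{hb})_{\Gamma_N}\qquad\forall v_{hb}\in V_{hb}^{D}$$ admits a unique solution $u_{hb}\in V_{hb}^{D}$.
   Context: **Problem data.** $\Omega\subset\mathbb{R}^d$ ($d=2,3$) is a bounded domain with Lipschitz boundary $\Gamma=\bar\Gamma_D\cup\bar\Gamma_N$, $\Gamma_D\cap\Gamma_N=\emptyset$, with outward unit normal $\mathbf n$. The data are a constant diffusivity $\varepsilon>0$ ($0<\varepsilon\ll1$), $\beta\in[W^{1,\infty}(\Omega)]^d$, $0\le\sigma\in L^\infty(\Omega)$, $f\in L^2(\Omega)$, $g\in L^2(\Gamma_N)$, for the problem $-\varepsilon\Delta u+\beta\cdot\nabla u+\sigma u=f$ in $\Omega$, $u=0$ on $\Gamma_D$, $\varepsilon\nabla u\cdot\mathbf n=g$ on $\Gamma_N$. Assumptions: (A1) $\Gamma_D$ has positive $(d-1)$-dimensional measure and $\{\mathbf x\in\Gamma:\beta(\mathbf x)\cdot\mathbf n<0\}\subset\Gamma_D$. (A2) There are constants $\gamma,c_\sigma\ge0$, independent of $\varepsilon$, with $\sigma-\frac12\nabla\cdot\beta\ge\gamma$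 and $\|\sigma\|_{0,\infty}\le c_\sigma\gamma$ (so $\gamma=0$ forces $\sigma=0$). **Notation.** For $\omega\subset\Omega$, $\|\cdot\|_{m,\omega}$, $|\cdot|_{m,\omega}$ are the norm and semi-norm of $H^m(\omega)$ ($H^0=L^2$), $\|\cdot\|_{0,\infty,\omega}$ is the $L^\infty(\omega)$ norm (for vector fields, of the Euclidean length); $\omega$ is omitted if $\omega=\Omega$. $(\cdot,\cdot)$ and $(\cdot,\cdot)_{\Gamma_N}$ are the $L^2(\Omega)$ and $L^2(\Gamma_N)$ inner products. $H_D^1(\Omega)=\{v\in H^1(\Omega):v|_{\Gamma_D}=0\}$. $B(u,v)=\varepsilon(\nabla u,\nabla v)+(\beta\cdot\nabla u,v)+(\sigma u,v)$. **Discrete spaces.** $\mathcal T_h$ is a shape regular triangulation of $\Omega$ into triangles/tetrahedra, $h_T=\mathrm{diam}(T)$, $h=\max_{T\in\mathcal T_h}h_T$. $V_h\subset H^1(\Omega)$ is the usual (continuous, piecewise) linear element space; $\psi_T$ is the bubble function of degree $d+1$ on $T$ (the product of the barycentric coordinates of $T$, extended by zero, up to scaling); $V_b=\bigoplus_{T\in\mathcal T_h}\mathrm{span}\{\psi_T\}$, $V_h^D=V_h\cap H_D^1(\Omega)$, $V_{hb}^D=V_h^D\oplus V_b$. Any $w_{hb}\in V_{hb}^D$ is written uniquely $w_{hb}=w_h+w_b$ with $w_h\in V_h^D$, $w_b\in V_b$, and $\kappa_h(w_{hb}):=w_h$. **Modified DD scheme.** For $w_h\in V_h^D$ and $T\in\mathcal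 T_h$ put $R(w_h)=\beta\cdot\nabla w_h+\sigma w_h-f$, $A_T(w_h)=\|\beta\|_{0,\infty,T}|w_h|_{1,T}+\|\sigma\|_{0,\infty,T}\|w_h\|_{0,T}$, $P_{e_T}=\frac{\|\beta\|_{0,T}h_T}{2\varepsilon}$, and $\tau=\|f\|_{0,T}$ if $f|_T\ne0$, $\tau=1$ if $f|_T=0$ (so $\tau$ depends on $T$). The artificial diffusion is $\xi_T(w_h)=\frac{h_T\|R(w_h)\|_{0,T}}{A_T(w_h)+\tau}$ if $P_{e_T}>1$, and $\xi_T(w_h)=0$ otherwise. Set $D_T(w_{hb};u_{hb},v_{hb})=\int_T\xi_T(\kappa_h(w_{hb}))\nabla u_{hb}\cdot\nabla v_{hb}\,d\mathbf x$ and $a(w_{hb};u_{hb},v_{hb})=B(u_{hb},v_{hb})+\sum_{T\in\mathcal T_h}D_T(w_{hb};u_{hb},v_{hb})$. **Constants** ($c_i$ independent of $\varepsilon$ and of the mesh size). $c_0>0$ is a constant with $\|v\|_0\le c_0|v|_1$ for all $v\in H_D^1(\Omega)$. $c_1>0$ is a constant with $\|v_h\|_{0,T}\le c_1\|v_{hb}\|_{0,T}$ for all $v_{hb}=v_h+v_b\in V_{hb}^D$ and $T\in\mathcal T_h$. $c_3>0$ is a constant with $\|v\|_{H^{1/2}(\Gamma_N)}\le c_3|v|_1$ for all $v\in H_D^1(\Omega)$; $\|\cdot\|_{H^{-1/2}(\Gamma_N)}$ is the norm dual to $\|\cdot\|_{H^{1/2}(\Gamma_N)}$. Further, $$M_{3,T}=\begin{cases}\max\left\{\frac{\|\beta\|_{0,\infty,T}}{\sqrt\varepsilon},\frac{\|\sigma\|_{0,\infty,T}}{\sqrt\gamma}\right\},&\gamma>0,\\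 \|\beta\|_{0,\infty,T}\,\varepsilon^{-1/2},&\gamma=0,\end{cases}\qquad M_{4,T}=\frac{2\sqrt2\max\{1,c_1\}M_{3,T}}{\tau},\qquad M_4=\max_{T\in\mathcal T_h}M_{4,T}.$$ The right-hand side of the smallness condition is read as $+\infty$ if one of the inverted quantities is zero. *)

theory Defs
  imports "HOL-Analysis.Analysis" "HOL-Probability.Essential_Supremum"
begin

section \<open>Lebesgue spaces and their norms\<close>

definition L2_space :: "'a measure \<Rightarrow> ('a \<Rightarrow> 'b::real_normed_vector) set" where
  "L2_space M = {f. f \<in> borel_measurable M \<and> integrable M (\<lambda>x. (norm (f x))\<^sup>2)}"

definition L2_norm :: "'a measure \<Rightarrow> ('a \<Rightarrow> 'b::real_normed_vector) \<Rightarrow> real" where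
  "L2_norm M f = sqrt (\<integral>x. (norm (f x))\<^sup>2 \<partial>M)"

definition Linf_space :: "'a measure \<Rightarrow> ('a \<Rightarrow> 'b::real_normed_vector) set" where
  "Linf_space M = {f. f \<in> borel_measurable M \<and> (\<exists>C. AE x in M. norm (f x) \<le> C)}"

text \<open>The essential supremum needs a complete order, hence the detour through the extended
  reals; it is finite on \<^const>\<open>Linf_space\<close>.\<close>

definition Linf_norm :: "'a measure \<Rightarrow> ('a \<Rightarrow> 'b::real_normed_vector) \<Rightarrow> real" where
  "Linf_norm M f = real_of_ereal (esssup M (\<lambda>x. ereal (norm (f x))))"


section \<open>Weak derivatives and Sobolev spaces\<close>

text \<open>\<open>C1_test \<Omega> \<phi> D\<close>: \<open>\<phi>\<close> is a continuously differentiable function with compact support in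
  \<open>\<Omega>\<close>, and \<open>D\<close> is its gradient. Testing first-order weak derivatives with such functions
  is equivalent to testing with smooth ones (Gilbarg and Trudinger, Section 7.3).\<close>

definition C1_test :: "'a::euclidean_space set \<Rightarrow> ('a \<Rightarrow> real) \<Rightarrow> ('a \<Rightarrow> 'a) \<Rightarrow> bool" where
  "C1_test \<Omega> \<phi> D \<longleftrightarrow>
     (\<forall>x. GDERIV \<phi> x :> D x) \<and> continuous_on UNIV D \<and>
     compact (closure {x. \<phi> x \<noteq> 0}) \<and> closure {x. \<phi> x \<noteq> 0} \<subseteq> \<Omega>"

definition weak_gradient :: "'a::euclidean_space set \<Rightarrow> ('a \<Rightarrow> real) \<Rightarrow> ('a \<Rightarrow> 'a) \<Rightarrow> bool" where
  "weak_gradient \<Omega> v G \<longleftrightarrow>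
     (\<forall>K. compact K \<and> K \<subseteq> \<Omega> \<longrightarrow> integrable (lebesgue_on K) v \<and> integrable (lebesgue_on K) G) \<and>
     (\<forall>\<phi> D. C1_test \<Omega> \<phi> D \<longrightarrow>
        (\<integral>x. v x *\<^sub>R D x \<partial>lebesgue_on \<Omega>) = - (\<integral>x. \<phi> x *\<^sub>R G x \<partial>lebesgue_on \<Omega>))"

text \<open>The weak gradient is unique up to null sets; a representative is chosen.\<close>

definition wgrad :: "'a::euclidean_space set \<Rightarrow> ('a \<Rightarrow> real) \<Rightarrow> 'a \<Rightarrow> 'a" where
  "wgrad \<Omega> v = (SOME G. weak_gradient \<Omega> v G)"

definition wdiv :: "'a::euclidean_space set \<Rightarrow> ('a \<Rightarrow> 'a) \<Rightarrow> 'a \<Rightarrow> real" where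
  "wdiv \<Omega> \<beta> x = (\<Sum>b\<in>Basis. wgrad \<Omega> (\<lambda>y. \<beta> y \<bullet> b) x \<bullet> b)"

definition H1_space :: "'a::euclidean_space set \<Rightarrow> ('a \<Rightarrow> real) set" where
  "H1_space \<Omega> = {v \<in> L2_space (lebesgue_on \<Omega>).
     \<exists>G \<in> L2_space (lebesgue_on \<Omega>). weak_gradient \<Omega> v G}"

definition W1inf_space :: "'a::euclidean_space set \<Rightarrow> ('a \<Rightarrow> real) set" where
  "W1inf_space \<Omega> = {v \<in> Linf_space (lebesgue_on \<Omega>).
     \<exists>G \<in> Linf_space (lebesgue_on \<Omega>). weak_gradient \<Omega> v G}"

text \<open>\<open>|v|\<^sub>1\<^sub>,\<^sub>\<omega>\<close> for \<open>v\<close> in \<open>H\<^sup>1(\<Omega>)\<close> and \<open>\<omega>\<close> contained in \<open>\<Omega>\<close> up to a null set: the weak gradient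
  on \<open>\<omega>\<close> is the restriction of the one on \<open>\<Omega>\<close>.\<close>

definition H1_seminorm :: "'a::euclidean_space set \<Rightarrow> 'a set \<Rightarrow> ('a \<Rightarrow> real) \<Rightarrow> real" where
  "H1_seminorm \<Omega> \<omega> v = L2_norm (lebesgue_on \<omega>) (wgrad \<Omega> v)"


section \<open>Lipschitz domains, outward normals and surface measure\<close>

text \<open>Near each boundary point, \<open>\<Omega>\<close> is the strict epigraph, in some direction \<open>e\<close>, of a Lipschitz
  function on the hyperplane orthogonal to \<open>e\<close>.\<close>

definition lipschitz_domain :: "'a::euclidean_space set \<Rightarrow> bool" where
  "lipschitz_domain \<Omega> \<longleftrightarrow>
     open \<Omega> \<and> connected \<Omega> \<and> \<Omega> \<noteq> {} \<and> bounded \<Omega> \<and>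
     (\<forall>x\<in>frontier \<Omega>. \<exists>e r L \<phi>. norm e = 1 \<and> r > 0 \<and> L-lipschitz_on {z. z \<bullet> e = 0} \<phi> \<and>
        (\<forall>y\<in>ball x r. y \<in> \<Omega> \<longleftrightarrow> \<phi> (y - (y \<bullet> e) *\<^sub>R e) < y \<bullet> e))"

text \<open>\<open>\<nu>\<close> is the outward unit normal at \<open>x\<close> if, to first order, \<open>\<Omega>\<close> near \<open>x\<close> is the half-space
  \<open>{y. \<nu> \<bullet> (y - x) < 0}\<close>. For a Lipschitz domain such a (unique) \<open>\<nu>\<close> exists at almost every
  boundary point.\<close>

definition outward_normal :: "'a::euclidean_space set \<Rightarrow> 'a \<Rightarrow> 'a \<Rightarrow> bool" where
  "outward_normal \<Omega> x \<nu> \<longleftrightarrow> norm \<nu> = 1 \<and>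
     (\<forall>e>0. \<exists>\<delta>>0. \<forall>y\<in>ball x \<delta>.
        (\<nu> \<bullet> (y - x) > e * norm (y - x) \<longrightarrow> y \<notin> \<Omega>) \<and>
        (\<nu> \<bullet> (y - x) < - e * norm (y - x) \<longrightarrow> y \<in> \<Omega>))"

text \<open>The \<open>s\<close>-dimensional Hausdorff (outer) measure for \<open>s \<ge> 1\<close>, with the usual normalisation by
  the volume of the unit ball. The sets of a cover are required to be bounded because
  \<^const>\<open>diameter\<close> is meaningless for unbounded sets.\<close>

definition hausdorff_content :: "nat \<Rightarrow> real \<Rightarrow> 'a::euclidean_space set \<Rightarrow> ennreal" where
  "hausdorff_content s \<delta> A =
     (INF C \<in> {C :: nat \<Rightarrow> 'a set. A \<subseteq> (\<Union>i. C i) \<and> (\<forall>i. bounded (C i) \<and> diameter (C i) \<le> \<delta>)}.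
        \<Sum>i. ennreal (unit_ball_vol (real s) * (diameter (C i) / 2) ^ s))"

definition hausdorff_outer :: "nat \<Rightarrow> 'a::euclidean_space set \<Rightarrow> ennreal" where
  "hausdorff_outer s A = (SUP \<delta>\<in>{0<..}. hausdorff_content s \<delta> A)"

definition surface_measure :: "'a::euclidean_space measure" where
  "surface_measure = measure_of UNIV (sets borel) (hausdorff_outer (DIM('a) - 1))"

definition surface_on :: "'a::euclidean_space set \<Rightarrow> 'a measure" where
  "surface_on A = restrict_space surface_measure A"


section \<open>Traces and fractional boundary norms\<close>

text \<open>The trace is the continuous extension of \<open>v \<mapsto> v|\<^sub>\<Gamma>\<close> from \<open>H\<^sup>1(\<Omega>) \<inter> C(closure \<Omega>)\<close> to \<open>H\<^sup>1(\<Omega>)\<close>,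
  with values in \<open>L\<^sup>2(\<Gamma>)\<close>. It is stated as a relation, \<open>w\<close> being determined almost everywhere.\<close>

definition is_trace :: "'a::euclidean_space set \<Rightarrow> ('a \<Rightarrow> real) \<Rightarrow> ('a \<Rightarrow> real) \<Rightarrow> bool" where
  "is_trace \<Omega> v w \<longleftrightarrow> w \<in> L2_space (surface_on (frontier \<Omega>)) \<and>
     (\<exists>\<phi> :: nat \<Rightarrow> 'a \<Rightarrow> real.
        (\<forall>n. \<phi> n \<in> H1_space \<Omega> \<and> continuous_on (closure \<Omega>) (\<phi> n)) \<and>
        (\<lambda>n. L2_norm (lebesgue_on \<Omega>) (\<lambda>x. \<phi> n x - v x)) \<longlonglongrightarrow> 0 \<and>
        (\<lambda>n. H1_seminorm \<Omega> \<Omega> (\<lambda>x. \<phi> n x - v x)) \<longlonglongrightarrow> 0 \<and>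
        (\<lambda>n. L2_norm (surface_on (frontier \<Omega>)) (\<lambda>x. \<phi> n x - w x)) \<longlonglongrightarrow> 0)"

definition H1D_space :: "'a::euclidean_space set \<Rightarrow> 'a set \<Rightarrow> ('a \<Rightarrow> real) set" where
  "H1D_space \<Omega> \<Gamma>\<^sub>D = {v \<in> H1_space \<Omega>. (\<exists>w. is_trace \<Omega> v w) \<and>
     (\<forall>w. is_trace \<Omega> v w \<longrightarrow> (AE x in surface_on \<Gamma>\<^sub>D. w x = 0))}"

text \<open>Square of the Sobolev-Slobodeckij norm of \<open>H\<^sup>1\<^sup>/\<^sup>2\<close> of a subset of a hypersurface; the exponent
  of the kernel is \<open>(d - 1) + 2 \<cdot> 1/2 = d\<close>.\<close>

definition Hhalf_norm_sq :: "'a::euclidean_space set \<Rightarrow> ('a \<Rightarrow> real) \<Rightarrow> ennreal" where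
  "Hhalf_norm_sq A w =
     (\<integral>\<^sup>+x. ennreal ((w x)\<^sup>2) \<partial>surface_on A) +
     (\<integral>\<^sup>+x. (\<integral>\<^sup>+y. ennreal ((w x - w y)\<^sup>2 / norm (x - y) ^ DIM('a)) \<partial>surface_on A) \<partial>surface_on A)"

definition Hhalf_space :: "'a::euclidean_space set \<Rightarrow> ('a \<Rightarrow> real) set" where
  "Hhalf_space A = {w \<in> borel_measurable (surface_on A). Hhalf_norm_sq A w < \<infinity>}"

definition Hhalf_norm :: "'a::euclidean_space set \<Rightarrow> ('a \<Rightarrow> real) \<Rightarrow> real" where
  "Hhalf_norm A w = sqrt (enn2real (Hhalf_norm_sq A w))"

definition Hhalf_dual_norm :: "'a::euclidean_space set \<Rightarrow> ('a \<Rightarrow> real) \<Rightarrow> real" where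
  "Hhalf_dual_norm A g =
     (SUP w \<in> {w \<in> Hhalf_space A. Hhalf_norm A w \<le> 1}. \<bar>\<integral>x. g x * w x \<partial>surface_on A\<bar>)"


section \<open>Meshes and discrete spaces\<close>

definition mesh :: "'a::euclidean_space set \<Rightarrow> 'a set set \<Rightarrow> bool" where
  "mesh \<Omega> \<T> \<longleftrightarrow> triangulation \<T> \<and> (\<forall>T\<in>\<T>. int DIM('a) simplex T) \<and> \<Union>\<T> = closure \<Omega>"

definition inradius :: "'a::euclidean_space set \<Rightarrow> real" where
  "inradius T = Sup {r. 0 \<le> r \<and> (\<exists>x. cball x r \<subseteq> T)}"

text \<open>For a single mesh this only names a shape constant; it is a restriction for families of meshes.\<close>

definition shape_regular :: "real \<Rightarrow> 'a::euclidean_space set set \<Rightarrow> bool" where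
  "shape_regular \<rho> \<T> \<longleftrightarrow> (\<forall>T\<in>\<T>. diameter T \<le> \<rho> * inradius T)"

definition mesh_size :: "'a::euclidean_space set set \<Rightarrow> real" where
  "mesh_size \<T> = Max (diameter ` \<T>)"

text \<open>Discrete functions live on \<open>closure \<Omega>\<close>. They are represented by total functions vanishing
  elsewhere, so that equality of discrete functions is equality in HOL.\<close>

definition P1_space :: "'a::euclidean_space set \<Rightarrow> 'a set set \<Rightarrow> ('a \<Rightarrow> real) set" where
  "P1_space \<Omega> \<T> = {v. continuous_on (closure \<Omega>) v \<and> (\<forall>x. x \<notin> closure \<Omega> \<longrightarrow> v x = 0) \<and>
     (\<forall>T\<in>\<T>. \<exists>a c. \<forall>x\<in>T. v x = a \<bullet> x + c)}"

definition P1D_space :: "'a::euclidean_space set \<Rightarrow> 'a set \<Rightarrow> 'a set set \<Rightarrow> ('a \<Rightarrow> real) set" where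
  "P1D_space \<Omega> \<Gamma>\<^sub>D \<T> = P1_space \<Omega> \<T> \<inter> H1D_space \<Omega> \<Gamma>\<^sub>D"

definition vertices :: "'a::euclidean_space set \<Rightarrow> 'a set" where
  "vertices T = {p. p extreme_point_of T}"

definition barycentric :: "'a::euclidean_space set \<Rightarrow> 'a \<Rightarrow> 'a \<Rightarrow> real" where
  "barycentric T x = (THE c. (\<forall>p. p \<notin> vertices T \<longrightarrow> c p = 0) \<and>
     sum c (vertices T) = 1 \<and> (\<Sum>p\<in>vertices T. c p *\<^sub>R p) = x)"

definition bubble :: "'a::euclidean_space set \<Rightarrow> 'a \<Rightarrow> real" where
  "bubble T x = (if x \<in> T then \<Prod>p\<in>vertices T. barycentric T x p else 0)"

definition bubble_space :: "'a::euclidean_space set set \<Rightarrow> ('a \<Rightarrow> real) set" where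
  "bubble_space \<T> = {w. \<exists>c. w = (\<lambda>x. \<Sum>T\<in>\<T>. c T * bubble T x)}"

definition P1bD_space :: "'a::euclidean_space set \<Rightarrow> 'a set \<Rightarrow> 'a set set \<Rightarrow> ('a \<Rightarrow> real) set" where
  "P1bD_space \<Omega> \<Gamma>\<^sub>D \<T> =
     {w. \<exists>w\<^sub>h\<in>P1D_space \<Omega> \<Gamma>\<^sub>D \<T>. \<exists>w\<^sub>b\<in>bubble_space \<T>. w = (\<lambda>x. w\<^sub>h x + w\<^sub>b x)}"

definition kappa :: "'a::euclidean_space set \<Rightarrow> 'a set \<Rightarrow> 'a set set \<Rightarrow> ('a \<Rightarrow> real) \<Rightarrow> 'a \<Rightarrow> real" where
  "kappa \<Omega> \<Gamma>\<^sub>D \<T> w =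
     (THE w\<^sub>h. w\<^sub>h \<in> P1D_space \<Omega> \<Gamma>\<^sub>D \<T> \<and> (\<exists>w\<^sub>b\<in>bubble_space \<T>. w = (\<lambda>x. w\<^sub>h x + w\<^sub>b x)))"


section \<open>The modified dynamic diffusion scheme\<close>

definition bilinear_B :: "'a::euclidean_space set \<Rightarrow> real \<Rightarrow> ('a \<Rightarrow> 'a) \<Rightarrow> ('a \<Rightarrow> real) \<Rightarrow>
    ('a \<Rightarrow> real) \<Rightarrow> ('a \<Rightarrow> real) \<Rightarrow> real" where
  "bilinear_B \<Omega> \<epsilon> \<beta> \<sigma> u v =
     \<epsilon> * (\<integral>x. wgrad \<Omega> u x \<bullet> wgrad \<Omega> v x \<partial>lebesgue_on \<Omega>)
     + (\<integral>x. (\<beta> x \<bullet> wgrad \<Omega> u x) * v x \<partial>lebesgue_on \<Omega>)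
     + (\<integral>x. \<sigma> x * u x * v x \<partial>lebesgue_on \<Omega>)"

definition residual :: "'a::euclidean_space set \<Rightarrow> ('a \<Rightarrow> 'a) \<Rightarrow> ('a \<Rightarrow> real) \<Rightarrow> ('a \<Rightarrow> real) \<Rightarrow>
    ('a \<Rightarrow> real) \<Rightarrow> 'a \<Rightarrow> real" where
  "residual \<Omega> \<beta> \<sigma> f w x = \<beta> x \<bullet> wgrad \<Omega> w x + \<sigma> x * w x - f x"

definition A_scale :: "'a::euclidean_space set \<Rightarrow> ('a \<Rightarrow> 'a) \<Rightarrow> ('a \<Rightarrow> real) \<Rightarrow> 'a set \<Rightarrow>
    ('a \<Rightarrow> real) \<Rightarrow> real" where
  "A_scale \<Omega> \<beta> \<sigma> T w =
     Linf_norm (lebesgue_on T) \<beta> * H1_seminorm \<Omega> T w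
     + Linf_norm (lebesgue_on T) \<sigma> * L2_norm (lebesgue_on T) w"

text \<open>The norm of \<open>\<beta>\<close> in the Peclet number carries the subscript \<open>0,T\<close>, so it is the \<open>L\<^sup>2(T)\<close> norm.\<close>

definition peclet :: "real \<Rightarrow> ('a::euclidean_space \<Rightarrow> 'a) \<Rightarrow> 'a set \<Rightarrow> real" where
  "peclet \<epsilon> \<beta> T = L2_norm (lebesgue_on T) \<beta> * diameter T / (2 * \<epsilon>)"

definition tau :: "('a::euclidean_space \<Rightarrow> real) \<Rightarrow> 'a set \<Rightarrow> real" where
  "tau f T = (if AE x in lebesgue_on T. f x = 0 then 1 else L2_norm (lebesgue_on T) f)"

definition xi :: "'a::euclidean_space set \<Rightarrow> real \<Rightarrow> ('a \<Rightarrow> 'a) \<Rightarrow> ('a \<Rightarrow> real) \<Rightarrow> ('a \<Rightarrow> real) \<Rightarrow>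
    'a set \<Rightarrow> ('a \<Rightarrow> real) \<Rightarrow> real" where
  "xi \<Omega> \<epsilon> \<beta> \<sigma> f T w =
     (if peclet \<epsilon> \<beta> T > 1
      then diameter T * L2_norm (lebesgue_on T) (residual \<Omega> \<beta> \<sigma> f w) / (A_scale \<Omega> \<beta> \<sigma> T w + tau f T)
      else 0)"

definition DD_term :: "'a::euclidean_space set \<Rightarrow> 'a set \<Rightarrow> 'a set set \<Rightarrow> real \<Rightarrow> ('a \<Rightarrow> 'a) \<Rightarrow>
    ('a \<Rightarrow> real) \<Rightarrow> ('a \<Rightarrow> real) \<Rightarrow> 'a set \<Rightarrow>
    ('a \<Rightarrow> real) \<Rightarrow> ('a \<Rightarrow> real) \<Rightarrow> ('a \<Rightarrow> real) \<Rightarrow> real" where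
  "DD_term \<Omega> \<Gamma>\<^sub>D \<T> \<epsilon> \<beta> \<sigma> f T w u v =
     (\<integral>x. xi \<Omega> \<epsilon> \<beta> \<sigma> f T (kappa \<Omega> \<Gamma>\<^sub>D \<T> w) * (wgrad \<Omega> u x \<bullet> wgrad \<Omega> v x) \<partial>lebesgue_on T)"

definition DD_form :: "'a::euclidean_space set \<Rightarrow> 'a set \<Rightarrow> 'a set set \<Rightarrow> real \<Rightarrow> ('a \<Rightarrow> 'a) \<Rightarrow>
    ('a \<Rightarrow> real) \<Rightarrow> ('a \<Rightarrow> real) \<Rightarrow>
    ('a \<Rightarrow> real) \<Rightarrow> ('a \<Rightarrow> real) \<Rightarrow> ('a \<Rightarrow> real) \<Rightarrow> real" where
  "DD_form \<Omega> \<Gamma>\<^sub>D \<T> \<epsilon> \<beta> \<sigma> f w u v =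
     bilinear_B \<Omega> \<epsilon> \<beta> \<sigma> u v + (\<Sum>T\<in>\<T>. DD_term \<Omega> \<Gamma>\<^sub>D \<T> \<epsilon> \<beta> \<sigma> f T w u v)"

text \<open>\<open>M3\<close>, \<open>M4_loc\<close> and \<open>M4\<close> are the constants \<open>M\<^sub>3\<^sub>,\<^sub>T\<close>, \<open>M\<^sub>4\<^sub>,\<^sub>T\<close> and \<open>M\<^sub>4\<close> of the smallness condition.\<close>

definition M3 :: "real \<Rightarrow> real \<Rightarrow> ('a::euclidean_space \<Rightarrow> 'a) \<Rightarrow> ('a \<Rightarrow> real) \<Rightarrow> 'a set \<Rightarrow> real" where
  "M3 \<epsilon> \<gamma> \<beta> \<sigma> T =
     (if \<gamma> > 0
      then max (Linf_norm (lebesgue_on T) \<beta> / sqrt \<epsilon>) (Linf_norm (lebesgue_on T) \<sigma> / sqrt \<gamma>)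
      else Linf_norm (lebesgue_on T) \<beta> / sqrt \<epsilon>)"

definition M4_loc :: "real \<Rightarrow> real \<Rightarrow> ('a::euclidean_space \<Rightarrow> 'a) \<Rightarrow> ('a \<Rightarrow> real) \<Rightarrow> ('a \<Rightarrow> real) \<Rightarrow>
    real \<Rightarrow> 'a set \<Rightarrow> real" where
  "M4_loc \<epsilon> \<gamma> \<beta> \<sigma> f c\<^sub>1 T = 2 * sqrt 2 * max 1 c\<^sub>1 * M3 \<epsilon> \<gamma> \<beta> \<sigma> T / tau f T"

definition M4 :: "real \<Rightarrow> real \<Rightarrow> ('a::euclidean_space \<Rightarrow> 'a) \<Rightarrow> ('a \<Rightarrow> real) \<Rightarrow> ('a \<Rightarrow> real) \<Rightarrow>
    real \<Rightarrow> 'a set set \<Rightarrow> real" where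
  "M4 \<epsilon> \<gamma> \<beta> \<sigma> f c\<^sub>1 \<T> = Max (M4_loc \<epsilon> \<gamma> \<beta> \<sigma> f c\<^sub>1 ` \<T>)"

end

theory Submission imports Defs begin

text \<open>The scheme is a fixed point equation. For a given discrete function \<open>w\<close> the artificial diffusion \<open>\<xi>\<close>
is frozen, and the linear problem \<open>a(w; u, v) = F(v)\<close> is solved for \<open>u\<close>. In the energy norm
\<open>e(v)\<^sup>2 = \<epsilon> |v|\<^sub>1\<^sup>2 + \<gamma> \<parallel>v\<parallel>\<^sub>0\<^sup>2\<close> the map \<open>w \<mapsto> u\<close> is a contraction under the smallness condition, so it has exactly
one fixed point. Three estimates carry this.

\<^item> Coercivity: \<open>e(v)\<^sup>2 \<le> a(w; v, v)\<close>. On each cell the divergence theorem turns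
  \<open>2 (\<beta> \<bullet> \<nabla>v) v + v\<^sup>2 div \<beta>\<close> into a flux through the facets. The fluxes through interior facets cancel; through
  a boundary facet the flux is nonnegative, as \<open>v\<close> vanishes on the inflow part (\<open>transport_nonneg\<close>).
\<^item> A bound for solutions: \<open>e(u) \<le> C\<^sub>F\<close>, where \<open>C\<^sub>F\<close> is the sum that the smallness condition inverts. It follows by
  testing with \<open>v = u\<close> (\<open>solution_bound\<close>).
\<^item> Lipschitz continuity of the artificial diffusion: \<open>|\<xi>\<^sub>T(w) - \<xi>\<^sub>T(w')| \<le> h\<^sub>T M\<^sub>4\<^sub>,\<^sub>T e(w - w')\<close>.
  The residual and the denominator of \<open>\<xi>\<close> both change by at most \<open>A\<^sub>T(w - w')\<close>, and dropping the bubble part of a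
  function increases neither its gradient norm on \<open>T\<close> nor, beyond the factor \<open>c\<^sub>1\<close>, its \<open>L\<^sup>2\<close> norm
  (\<open>art_lipschitz\<close>).

If \<open>u\<close> and \<open>u'\<close> solve the problems for \<open>w\<close> and \<open>w'\<close>, testing the difference of the equations with \<open>u - u'\<close> gives
\<open>e(u - u') \<le> (h C\<^sub>F M\<^sub>4 / \<epsilon>) e(w - w')\<close>, and the factor is less than one (\<open>contraction\<close>).

The work lies in making these estimates available for the weak notions in which the problem is stated.
Gradients are weak gradients, so the divergence theorem is proved on polytopes by testing with
cut-off functions that steepen at the faces. Surface measure is Hausdorff measure; it is compared with
Lebesgue measure of the tube of thickness one over a piece of a plane, in both directions
(\<open>tube_le_hausdorff_outer\<close>, \<open>hausdorff_outer_null_of_tube\<close>).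
Dirichlet values are prescribed through traces, which are limits of boundary values of continuous \<open>H\<^sup>1\<close> functions. That the
discrete spaces contain the zero function and are closed under linear combinations rests on the uniqueness of traces
(\<open>zero_trace\<close>), which is again a consequence of the divergence theorem on one cell.\<close>

lemmas integrable_dominated = Bochner_Integration.integrable_bound
lemmas LINT_cong = Bochner_Integration.integral_cong

section \<open>Contractions in finite-dimensional function spaces\<close>

definition fun_space :: "('x \<Rightarrow> real) set \<Rightarrow> bool" where
 "fun_space V \<longleftrightarrow> (\<lambda>x. 0) \<in> V \<and> (\<forall>u\<in>V. \<forall>v\<in>V. \<forall>c. (\<lambda>x. u x + c * v x) \<in> V)"

definition linear_form :: "('x \<Rightarrow> real) set \<Rightarrow> (('x \<Rightarrow> real) \<Rightarrow> real) \<Rightarrow> bool" where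
 "linear_form V L \<longleftrightarrow> (\<forall>u\<in>V. \<forall>v\<in>V. \<forall>c. L (\<lambda>x. u x + c * v x) = L u + c * L v)"

definition bilinear_form :: "('x \<Rightarrow> real) set \<Rightarrow> (('x \<Rightarrow> real) \<Rightarrow> ('x \<Rightarrow> real) \<Rightarrow> real) \<Rightarrow> bool" where
 "bilinear_form V a \<longleftrightarrow>
   (\<forall>u\<in>V. linear_form V (a u)) \<and> (\<forall>v\<in>V. linear_form V (\<lambda>u. a u v))"

text \<open>Finite dimension of a space of functions is expressed by a finite set of points at which a function has to
vanish only if it is zero. This fits nodal values of finite elements and lends itself to induction over the points.\<close>

definition determined_by :: "'x set \<Rightarrow> ('x \<Rightarrow> real) set \<Rightarrow> bool" where
 "determined_by X V \<longleftrightarrow> (\<forall>v\<in>V. (\<forall>x\<in>X. v x = 0) \<longrightarrow> v = (\<lambda>x. 0))"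

lemma linear_form_zero:
 assumes "fun_space V" "linear_form V L"
 shows "L (\<lambda>x. 0) = 0"
proof -
 have z: "(\<lambda>x. 0) \<in> V" using assms(1) by (simp add: fun_space_def)
 have "L (\<lambda>x. 0 + 1 * 0) = L (\<lambda>x. 0) + 1 * L (\<lambda>x. 0)"
  using assms(2)[unfolded linear_form_def, rule_format, OF z z] .
 thus ?thesis by simp
qed

lemma bilinear_left:
 assumes "bilinear_form V a" "u \<in> V" "v \<in> V" "w \<in> V"
 shows "a (\<lambda>x. u x + c * v x) w = a u w + c * a v w"
 using assms unfolding bilinear_form_def linear_form_def by auto

lemma bilinear_right:
 assumes "bilinear_form V a" "u \<in> V" "v \<in> V" "w \<in> V"
 shows "a w (\<lambda>x. u x + c * v x) = a w u + c * a w v"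
 using assms unfolding bilinear_form_def linear_form_def by auto

lemma subspace_comb: "fun_space V \<Longrightarrow> u \<in> V \<Longrightarrow> v \<in> V \<Longrightarrow> (\<lambda>x. u x + c * v x) \<in> V"
 by (auto simp: fun_space_def)

lemma subspace_zero: "fun_space V \<Longrightarrow> (\<lambda>x. 0) \<in> V"
 by (auto simp: fun_space_def)

lemma subspace_diff: "fun_space V \<Longrightarrow> u \<in> V \<Longrightarrow> v \<in> V \<Longrightarrow> (\<lambda>x. u x - v x) \<in> V"
 using subspace_comb[of V u v "-1"] by simp

lemma form_nonneg:
 assumes "fun_space V" "bilinear_form V e" "\<And>v. v \<in> V \<Longrightarrow> v \<noteq> (\<lambda>x. 0) \<Longrightarrow> e v v > 0" "v \<in> V"
 shows "e v v \<ge> 0"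
proof (cases "v = (\<lambda>x. 0)")
 case True
 have "e v v = 0" using linear_form_zero[OF assms(1), of "e v"] assms(2,4) True
  by (auto simp: bilinear_form_def)
 thus ?thesis by simp
qed (use assms(3)[of v] assms(4) in force)

lemma bilinear_on_subset:
 "bilinear_form V a \<Longrightarrow> W \<subseteq> V \<Longrightarrow> bilinear_form W a"
 unfolding bilinear_form_def linear_form_def by blast

lemma linear_on_subset:
 "linear_form V a \<Longrightarrow> W \<subseteq> V \<Longrightarrow> linear_form W a"
 unfolding linear_form_def by blast

lemma subspace_vanishing:
 assumes "fun_space V" shows "fun_space {v\<in>V. v p = 0}"
 using assms unfolding fun_space_def by auto

lemma split_by_point_value:
 assumes V: "fun_space V" and b: "b \<in> V" "b p \<noteq> 0" and d: "d \<in> V" "d p = b p" and v: "v \<in> V"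
 obtains w where "w \<in> V" "w p = 0" "v = (\<lambda>x. w x + (v p / b p) * d x)"
proof
 show "(\<lambda>x. v x + (- (v p / b p)) * d x) \<in> V" by (rule subspace_comb[OF V v d(1)])
qed (use b d in auto)

text \<open>Induction over the determining points: the functions that vanish at \<open>p\<close> form a subspace \<open>W\<close> on which the problem is
solvable, and \<open>V\<close> is spanned by \<open>W\<close> and one more function, which is corrected so that \<open>a d\<close> vanishes on \<open>W\<close>.\<close>

lemma finite_dim_lax_milgram:
 assumes "finite X"
 shows "fun_space V \<Longrightarrow> determined_by X V \<Longrightarrow> bilinear_form V a \<Longrightarrow>
   (\<And>v. v \<in> V \<Longrightarrow> v \<noteq> (\<lambda>x. 0) \<Longrightarrow> a v v > 0) \<Longrightarrow> linear_form V L \<Longrightarrow>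
   \<exists>u\<in>V. \<forall>v\<in>V. a u v = L v"
 using assms
proof (induction X arbitrary: V L rule: finite_induct)
 case empty
 hence "V = {\<lambda>x. 0}" by (auto simp: determined_by_def fun_space_def)
 moreover have "a (\<lambda>x. 0) (\<lambda>x. 0) = 0"
  using linear_form_zero[OF empty(1), of "a (\<lambda>x. 0)"] empty(3) subspace_zero[OF empty(1)]
  by (auto simp: bilinear_form_def)
 moreover have "L (\<lambda>x. 0) = 0" using linear_form_zero[OF empty(1,5)] .
 ultimately show ?case by auto
next
 case (insert p X)
 note V = insert.prems(1) and bil = insert.prems(3) and pos = insert.prems(4) and L = insert.prems(5)
 define W where "W = {v\<in>V. v p = 0}"
 have W: "fun_space W" unfolding W_def by (rule subspace_vanishing[OF V])
 have WV: "W \<subseteq> V" by (auto simp: W_def)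
 have detW: "determined_by X W"
  using insert.prems(2) unfolding determined_by_def W_def by auto
 have solve: "\<exists>u\<in>W. \<forall>v\<in>W. a u v = M v" if "linear_form V M" for M
  by (rule insert.IH[OF W detW bilinear_on_subset[OF bil WV] _ linear_on_subset[OF that WV]])
    (use pos WV in auto)
 show ?case
 proof (cases "\<exists>b\<in>V. b p \<noteq> 0")
  case False
  hence "W = V" by (auto simp: W_def)
  thus ?thesis using solve[OF L] by simp
 next
  case True
  then obtain b where b: "b \<in> V" "b p \<noteq> 0" by auto
  obtain z where z: "z \<in> W" "\<And>v. v \<in> W \<Longrightarrow> a z v = a b v"
   using solve[of "a b"] bil b(1) by (auto simp: bilinear_form_def)
  have zV: "z \<in> V" using z WV by auto
  \<comment> \<open>\<open>z\<close> represents \<open>a b\<close> on \<open>W\<close>, so that \<open>a d\<close> vanishes there\<close>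
  define d where "d = (\<lambda>x. b x + (-1) * z x)"
  have d: "d \<in> V" "d p = b p"
   using subspace_diff[OF V b(1) zV] z(1) by (auto simp: d_def W_def)
  have dW: "a d v = 0" if "v \<in> W" for v
   using bilinear_left[OF bil b(1) zV, of v "-1"] that z(2)[OF that] WV by (auto simp: d_def)
  have add: "a d d > 0" using pos[OF d(1)] d(2) b(2) by fastforce
  obtain u where u: "u \<in> W" "\<And>v. v \<in> W \<Longrightarrow> a u v = L v" using solve[OF L] by auto
  have uV: "u \<in> V" using u WV by auto
  define t where "t = (L d - a u d) / a d d"
  define y where "y = (\<lambda>x. u x + t * d x)"
  have yV: "y \<in> V" unfolding y_def by (rule subspace_comb[OF V uV d(1)])
  have yv: "a y v = a u v + t * a d v" if "v \<in> V" for v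
   unfolding y_def by (rule bilinear_left[OF bil uV d(1) that])
  have "a y v = L v" if v: "v \<in> V" for v
  proof -
   obtain w where w: "w \<in> V" "w p = 0" "v = (\<lambda>x. w x + (v p / b p) * d x)"
    using split_by_point_value[OF V b d v] .
   have wW: "w \<in> W" using w by (auto simp: W_def)
   have "a y v = a y w + (v p / b p) * a y d"
    by (subst w(3)) (rule bilinear_right[OF bil w(1) d(1) yV])
   also have "a y w = L w" using yv[OF w(1)] dW[OF wW] u(2)[OF wW] by simp
   also have "a y d = L d" using yv[OF d(1)] add by (simp add: t_def)
   also have "L w + (v p / b p) * L d = L (\<lambda>x. w x + (v p / b p) * d x)"
    by (rule L[unfolded linear_form_def, rule_format, OF w(1) d(1), symmetric])
   also have "\<dots> = L v" by (rule arg_cong[OF w(3)[symmetric]])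
   finally show ?thesis .
  qed
  thus ?thesis using yV by blast
 qed
qed

definition edist :: "(('x \<Rightarrow> real) \<Rightarrow> ('x \<Rightarrow> real) \<Rightarrow> real) \<Rightarrow> ('x \<Rightarrow> real) \<Rightarrow> ('x \<Rightarrow> real) \<Rightarrow> real" where
 "edist e u v = sqrt (e (\<lambda>x. u x - v x) (\<lambda>x. u x - v x))"

lemma form_quadratic:
 assumes "bilinear_form V e" "fun_space V" "p \<in> V" "r \<in> V" "e p r = e r p"
 shows "e (\<lambda>x. p x + t * r x) (\<lambda>x. p x + t * r x) = e p p + 2 * t * e p r + t\<^sup>2 * e r r"
 using assms(5) by (simp add: bilinear_left[OF assms(1,3,4) subspace_comb[OF assms(2-4)]]
   bilinear_right[OF assms(1,3,4,3)] bilinear_right[OF assms(1,3,4,4)] algebra_simps power2_eq_square)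

lemma form_cauchy_schwarz:
 assumes V: "fun_space V" and e: "bilinear_form V e" "\<And>v. v \<in> V \<Longrightarrow> v \<noteq> (\<lambda>x. 0) \<Longrightarrow> e v v > 0"
  and pr: "p \<in> V" "r \<in> V" "e p r = e r p"
 shows "\<bar>e p r\<bar> \<le> sqrt (e p p) * sqrt (e r r)"
proof -
 have nonneg: "e v v \<ge> 0" if "v \<in> V" for v using form_nonneg[OF V e(1) _ that] e(2) by blast
 have "(e p r)\<^sup>2 \<le> e p p * e r r"
 proof (cases "e r r = 0")
  case True
  hence "r = (\<lambda>x. 0)" using e(2)[OF pr(2)] by force
  hence "e p r = 0" using linear_form_zero[OF V, of "e p"] pr e(1)
   by (auto simp: bilinear_form_def)
  thus ?thesis using True by simp
 next
  case False
  hence pos: "e r r > 0" using nonneg[OF pr(2)] by simp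
  \<comment> \<open>the quadratic polynomial at its minimum\<close>
  have "0 \<le> e p p + 2 * (- e p r / e r r) * e p r + (- e p r / e r r)\<^sup>2 * e r r"
   using nonneg[OF subspace_comb[OF V pr(1,2), of "- e p r / e r r"]] form_quadratic[where e = e, OF e(1) V pr, of "- e p r / e r r"] by simp
  also have "\<dots> = e p p - (e p r)\<^sup>2 / e r r"
   using pos by (simp add: power2_eq_square field_simps)
  finally show ?thesis using pos by (simp add: field_simps)
 qed
 hence "sqrt ((e p r)\<^sup>2) \<le> sqrt (e p p * e r r)" by (rule real_sqrt_le_mono)
 thus ?thesis by (simp add: real_sqrt_mult)
qed

text \<open>A Cauchy sequence has a weak limit, which the Lax-Milgram lemma represents by a function \<open>u\<close>. For \<open>z = s n - u\<close> the
square \<open>e z z\<close> is the limit of \<open>e (s n - s m) z\<close> for \<open>m \<rightarrow> \<infinity>\<close>, so the Cauchy property bounds the norm of \<open>z\<close>.\<close>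

lemma finite_dim_complete:
 fixes e :: "('x \<Rightarrow> real) \<Rightarrow> ('x \<Rightarrow> real) \<Rightarrow> real" and s :: "nat \<Rightarrow> 'x \<Rightarrow> real"
 assumes X: "finite X" "determined_by X V" and V: "fun_space V"
  and e: "bilinear_form V e" "\<And>u v. u \<in> V \<Longrightarrow> v \<in> V \<Longrightarrow> e u v = e v u"
   "\<And>v. v \<in> V \<Longrightarrow> v \<noteq> (\<lambda>x. 0) \<Longrightarrow> e v v > 0"
  and s: "\<And>n. s n \<in> V" and cauchy: "\<And>r. r > 0 \<Longrightarrow> \<exists>N. \<forall>m\<ge>N. \<forall>n\<ge>N. edist e (s m) (s n) < r"
 shows "\<exists>u\<in>V. (\<lambda>n. edist e (s n) u) \<longlonglongrightarrow> 0"
proof -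
 have diff: "e (\<lambda>x. p x - r x) v = e p v - e r v" if "p \<in> V" "r \<in> V" "v \<in> V" for p r v
  using bilinear_left[OF e(1) that, of "-1"] by simp
 have nonneg: "e v v \<ge> 0" if "v \<in> V" for v using form_nonneg[OF V e(1) _ that] e(3) by blast
 have bd: "\<bar>e (s m) v - e (s n) v\<bar> \<le> edist e (s m) (s n) * sqrt (e v v)" if v: "v \<in> V" for m n v
  using form_cauchy_schwarz[where e = e, OF V e(1,3) subspace_diff[OF V s[of m] s[of n]] v] e(2)[OF subspace_diff[OF V s[of m] s[of n]] v]
  by (simp add: diff[OF s s v] edist_def)
 have "convergent (\<lambda>n. e (s n) v)" if v: "v \<in> V" for v
 proof (rule Cauchy_convergent, rule CauchyI)
  fix r :: real assume r: "r > 0"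
  let ?n = "sqrt (e v v) + 1"
  have n: "?n > 0" using nonneg[OF v] by (simp add: add_nonneg_pos)
  obtain N where N: "\<And>m n. m \<ge> N \<Longrightarrow> n \<ge> N \<Longrightarrow> edist e (s m) (s n) < r / ?n" using cauchy[of "r / ?n"] r n by auto
  have "norm (e (s m) v - e (s n) v) < r" if mn: "m \<ge> N" "n \<ge> N" for m n
  proof -
   have "\<bar>e (s m) v - e (s n) v\<bar> \<le> r / ?n * sqrt (e v v)"
    using bd[OF v, of m n] mult_right_mono[OF less_imp_le[OF N[OF mn]], of "sqrt (e v v)"] nonneg[OF v] by simp
   also have "\<dots> < r / ?n * ?n" using r n by (intro mult_strict_left_mono) auto
   finally show ?thesis using n by simp
  qed
  thus "\<exists>M. \<forall>m\<ge>M. \<forall>n\<ge>M. norm (e (s m) v - e (s n) v) < r" by blast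
 qed
 then obtain L where L: "\<And>v. v \<in> V \<Longrightarrow> (\<lambda>n. e (s n) v) \<longlonglongrightarrow> L v" unfolding convergent_def by metis
 have "linear_form V L"
  unfolding linear_form_def
 proof (intro ballI allI)
  fix u v c assume uv: "u \<in> V" "v \<in> V"
  have "(\<lambda>n. e (s n) u + c * e (s n) v) \<longlonglongrightarrow> L u + c * L v" by (intro tendsto_intros L uv)
  hence "(\<lambda>n. e (s n) (\<lambda>x. u x + c * v x)) \<longlonglongrightarrow> L u + c * L v" by (simp add: bilinear_right[OF e(1) uv s])
  thus "L (\<lambda>x. u x + c * v x) = L u + c * L v" using L[OF subspace_comb[OF V uv]] LIMSEQ_unique by blast
 qed
 then obtain u where u: "u \<in> V" "\<And>v. v \<in> V \<Longrightarrow> e u v = L v"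
  using finite_dim_lax_milgram[OF X(1) V X(2) e(1) e(3)] by blast
 have "(\<lambda>n. edist e (s n) u) \<longlonglongrightarrow> 0"
 proof (rule LIMSEQ_I)
  fix r :: real assume r: "r > 0"
  then obtain N where N: "\<And>m n. m \<ge> N \<Longrightarrow> n \<ge> N \<Longrightarrow> edist e (s m) (s n) < r / 2" using cauchy[of "r / 2"] by auto
  have "norm (edist e (s n) u - 0) < r" if n: "n \<ge> N" for n
  proof -
   define z where "z = (\<lambda>x. s n x - u x)"
   have z: "z \<in> V" unfolding z_def by (rule subspace_diff[OF V s u(1)])
   let ?D = "sqrt (e z z)"
   have zz: "e z z = e (s n) z - L z" using diff[OF s[of n] u(1) z] u(2)[OF z] by (simp add: z_def)
   have "(\<lambda>m. e (s n) z - e (s m) z) \<longlonglongrightarrow> e z z" unfolding zz by (intro tendsto_intros L z)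
   hence "e z z \<le> r / 2 * ?D"
   proof (rule LIMSEQ_le_const2, intro exI[of _ N] allI impI)
    fix m assume m: "m \<ge> N"
    have "e (s n) z - e (s m) z \<le> edist e (s n) (s m) * ?D" using bd[OF z, of n m] by linarith
    also have "\<dots> \<le> r / 2 * ?D" using N[OF n m] nonneg[OF z] by (intro mult_right_mono) auto
    finally show "e (s n) z - e (s m) z \<le> r / 2 * ?D" .
   qed
   hence dd: "?D * ?D \<le> r / 2 * ?D" using nonneg[OF z] by simp
   have "?D \<le> r / 2"
   proof (cases "e z z = 0")
    case False
    hence "?D > 0" using nonneg[OF z] by simp
    thus ?thesis by (rule mult_right_le_imp_le[OF dd])
   qed (use r in simp)
   thus ?thesis using r nonneg[OF z] by (simp add: edist_def flip: z_def)
  qed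
  thus "\<exists>no. \<forall>n\<ge>no. norm (edist e (s n) u - 0) < r" by blast
 qed
 thus ?thesis using u(1) by blast
qed

text \<open>Banach's fixed point theorem for the solution map \<open>w \<mapsto> S w\<close>. The map exists by the finite-dimensional Lax-Milgram
lemma; its contraction property is asked only of pairs of solutions, which is how it arises from energy estimates.\<close>

theorem contraction_unique_solution:
 fixes e :: "('x \<Rightarrow> real) \<Rightarrow> ('x \<Rightarrow> real) \<Rightarrow> real"
 assumes X: "finite X" "determined_by X V" and V: "fun_space V"
  and e: "bilinear_form V e" "\<And>u v. u \<in> V \<Longrightarrow> v \<in> V \<Longrightarrow> e u v = e v u"
   "\<And>v. v \<in> V \<Longrightarrow> v \<noteq> (\<lambda>x. 0) \<Longrightarrow> e v v > 0"
  and a: "\<And>w. w \<in> V \<Longrightarrow> bilinear_form V (a w)"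
   "\<And>w v. w \<in> V \<Longrightarrow> v \<in> V \<Longrightarrow> a w v v \<ge> e v v"
  and L: "linear_form V L"
  and q: "0 \<le> q" "q < 1"
  and contr: "\<And>w w' u u'. w \<in> V \<Longrightarrow> w' \<in> V \<Longrightarrow> u \<in> V \<Longrightarrow> u' \<in> V \<Longrightarrow>
   (\<forall>v\<in>V. a w u v = L v) \<Longrightarrow> (\<forall>v\<in>V. a w' u' v = L v) \<Longrightarrow>
   edist e u u' \<le> q * edist e w w'"
 shows "\<exists>!u. u \<in> V \<and> (\<forall>v\<in>V. a u u v = L v)"
proof -
 have nonneg: "e v v \<ge> 0" if "v \<in> V" for v using form_nonneg[OF V e(1) _ that] e(3) by blast
 have dnn: "edist e u v \<ge> 0" if "u \<in> V" "v \<in> V" for u v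
  using nonneg[OF subspace_diff[OF V that]] by (simp add: edist_def)
 have d0: "u = v" if "u \<in> V" "v \<in> V" "edist e u v \<le> 0" for u v
 proof (rule ccontr)
  assume "u \<noteq> v"
  hence "(\<lambda>x. u x - v x) \<noteq> (\<lambda>x. 0)" by (auto simp: fun_eq_iff)
  thus False using e(3)[OF subspace_diff[OF V that(1,2)]] that(3) by (simp add: edist_def)
 qed
 have tri: "edist e u w \<le> edist e u v + edist e v w" if "u \<in> V" "v \<in> V" "w \<in> V" for u v w
 proof -
  define p r where "p = (\<lambda>x. u x - v x)" and "r = (\<lambda>x. v x - w x)"
  have pr: "p \<in> V" "r \<in> V" using that by (auto simp: p_def r_def intro!: subspace_diff[OF V])
  have sym: "e p r = e r p" by (rule e(2)[OF pr])
  have "edist e u w = sqrt (e p p + 2 * e p r + e r r)"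
   using form_quadratic[where e = e, OF e(1) V pr sym, of 1] by (simp add: edist_def p_def r_def)
  also have "\<dots> \<le> sqrt (e p p) + sqrt (e r r)"
  proof (rule real_le_lsqrt)
   have "e p r \<le> sqrt (e p p) * sqrt (e r r)" using form_cauchy_schwarz[where e = e, OF V e(1,3) pr sym] by simp
   thus "e p p + 2 * e p r + e r r \<le> (sqrt (e p p) + sqrt (e r r))\<^sup>2"
    using nonneg pr by (simp add: power2_sum real_sqrt_mult)
  qed (use nonneg pr in auto)
  finally show ?thesis by (simp add: edist_def p_def r_def)
 qed
 have "\<exists>u\<in>V. \<forall>v\<in>V. a w u v = L v" if w: "w \<in> V" for w
  by (rule finite_dim_lax_milgram[OF X(1) V X(2) a(1)[OF w] _ L])
    (use a(2)[OF w] e(3) in \<open>force intro: less_le_trans\<close>)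
 then obtain S where S: "\<And>w. w \<in> V \<Longrightarrow> S w \<in> V" "\<And>w v. w \<in> V \<Longrightarrow> v \<in> V \<Longrightarrow> a w (S w) v = L v"
  by metis
 have SC: "edist e (S w) (S w') \<le> q * edist e w w'" if "w \<in> V" "w' \<in> V" for w w'
  using contr[of w w' "S w" "S w'"] that S by blast
 define s where "s n = (S ^^ n) (\<lambda>x. 0)" for n
 have sV: "s n \<in> V" for n by (induction n) (auto simp: s_def subspace_zero[OF V] S)
 have step: "edist e (s n) (s (Suc n)) \<le> q ^ n * edist e (s 0) (s 1)" for n
 proof (induction n)
  case (Suc n)
  have "edist e (s (Suc n)) (s (Suc (Suc n))) \<le> q * edist e (s n) (s (Suc n))"
   using SC[OF sV[of n] sV[of "Suc n"]] by (simp add: s_def)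
  also have "\<dots> \<le> q * (q ^ n * edist e (s 0) (s 1))" by (rule mult_left_mono[OF Suc q(1)])
  finally show ?case by simp
 qed simp
 define C where "C = edist e (s 0) (s 1) / (1 - q)"
 have C: "C \<ge> 0" using dnn[OF sV sV] q by (simp add: C_def)
 have far: "edist e (s n) (s (n + k)) \<le> C * q ^ n" for n k
 proof -
  have "edist e (s n) (s (n + k)) \<le> (\<Sum>i<k. q ^ (n + i)) * edist e (s 0) (s 1)"
  proof (induction k)
   case 0
   have "e (\<lambda>x. 0) (\<lambda>x. 0) = 0"
    using linear_form_zero[OF V, of "e (\<lambda>x. 0)"] subspace_zero[OF V] e(1)
    by (auto simp: bilinear_form_def)
   thus ?case by (simp add: edist_def)
  next
   case (Suc k)
   have "edist e (s n) (s (n + Suc k)) \<le> edist e (s n) (s (n + k)) + edist e (s (n+k)) (s (Suc (n + k)))"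
    using tri[OF sV sV sV] by simp
   also have "\<dots> \<le> (\<Sum>i<k. q ^ (n + i)) * edist e (s 0) (s 1) + q ^ (n + k) * edist e (s 0) (s 1)"
    using Suc step[of "n + k"] by simp
   finally show ?case by (simp add: algebra_simps)
  qed
  also have "(\<Sum>i<k. q ^ (n + i)) = q ^ n * ((1 - q ^ k) / (1 - q))"
   using q by (simp add: power_add sum_distrib_left[symmetric] sum_gp_strict)
  also have "q ^ n * ((1 - q ^ k) / (1 - q)) * edist e (s 0) (s 1) \<le> q ^ n * (1 / (1 - q)) * edist e (s 0) (s 1)"
   using q dnn[OF sV sV] by (intro mult_right_mono mult_left_mono divide_right_mono) auto
  finally show ?thesis by (simp add: C_def mult.commute)
 qed
 have dsym: "edist e u v = edist e v u" if "u \<in> V" "v \<in> V" for u v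
 proof -
  define p where "p = (\<lambda>x. u x - v x)"
  have p: "p \<in> V" using that by (auto simp: p_def intro!: subspace_diff[OF V])
  have z: "(\<lambda>x. 0) \<in> V" by (rule subspace_zero[OF V])
  have m: "(\<lambda>x. 0 + (-1) * p x) \<in> V" by (rule subspace_comb[OF V z p])
  have "e (\<lambda>x. 0 + (-1) * p x) (\<lambda>x. 0 + (-1) * p x) = e p p"
   using linear_form_zero[OF V, of "e p"] linear_form_zero[OF V, of "\<lambda>u. e u p"]
    linear_form_zero[OF V, of "e (\<lambda>x. 0)"] e(1) p z
   by (simp only: bilinear_left[OF e(1) z p m] bilinear_right[OF e(1) z p z] bilinear_right[OF e(1) z p p])
     (auto simp: bilinear_form_def)
  thus ?thesis by (simp add: edist_def p_def)
 qed
 have cauchy: "\<exists>N. \<forall>m\<ge>N. \<forall>n\<ge>N. edist e (s m) (s n) < r" if r: "r > 0" for r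
 proof -
  have "(\<lambda>n. C * q ^ n) \<longlonglongrightarrow> C * 0" using q by (intro tendsto_intros) auto
  hence "eventually (\<lambda>n. C * q ^ n < r) sequentially" using r by (auto dest: order_tendstoD(2))
  then obtain N where N: "\<And>n. n \<ge> N \<Longrightarrow> C * q ^ n < r" by (auto simp: eventually_sequentially)
  have "edist e (s m) (s n) < r" if "m \<ge> N" "n \<ge> N" for m n
  proof (cases "m \<le> n")
   case True
   thus ?thesis using far[of m "n - m"] N[OF that(1)] by simp
  next
   case False
   thus ?thesis using far[of n "m - n"] N[OF that(2)] dsym[OF sV sV, of m n] by simp
  qed
  thus ?thesis by blast
 qed
 obtain u where u: "u \<in> V" "(\<lambda>n. edist e (s n) u) \<longlonglongrightarrow> 0"
  using finite_dim_complete[OF X V e sV cauchy] by blast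
 have "edist e u (S u) \<le> 0"
 proof (rule LIMSEQ_le_const)
  have "(\<lambda>n. edist e (s (Suc n)) u + q * edist e (s n) u) \<longlonglongrightarrow> 0 + q * 0"
   by (intro tendsto_intros u(2) LIMSEQ_Suc)
  thus "(\<lambda>n. edist e (s (Suc n)) u + q * edist e (s n) u) \<longlonglongrightarrow> 0" by simp
  have "edist e u (S u) \<le> edist e (s (Suc n)) u + q * edist e (s n) u" for n
  proof -
   have "edist e u (S u) \<le> edist e u (s (Suc n)) + edist e (s (Suc n)) (S u)"
    by (rule tri) (auto simp: u sV S)
   moreover have "edist e (s (Suc n)) (S u) \<le> q * edist e (s n) u"
    using SC[OF sV u(1)] by (simp add: s_def)
   ultimately show ?thesis using dsym[OF u(1) sV[of "Suc n"]] by simp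
  qed
  thus "\<exists>N. \<forall>n\<ge>N. edist e u (S u) \<le> edist e (s (Suc n)) u + q * edist e (s n) u" by blast
 qed
 hence fixed: "u = S u" by (rule d0[OF u(1) S(1)[OF u(1)]])
 show ?thesis
 proof (rule ex1I)
  show "u \<in> V \<and> (\<forall>v\<in>V. a u u v = L v)" using S(2)[OF u(1)] fixed u(1) by simp
  fix y assume y: "y \<in> V \<and> (\<forall>v\<in>V. a y y v = L v)"
  have "edist e y u \<le> q * edist e y u"
   using contr[of y u y u] y u(1) S(2)[OF u(1)] fixed by simp
  hence "(1 - q) * edist e y u \<le> 0" by (simp add: algebra_simps)
  hence "edist e y u \<le> 0" using q by (simp add: mult_le_0_iff)
  thus "y = u" using d0 y u(1) by blast
 qed
qed

abbreviation ind :: "'a set \<Rightarrow> 'a \<Rightarrow> real" where "ind \<equiv> indicator"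

section \<open>Square-integrable and bounded functions\<close>

lemma L2_norm_nonneg [simp]: "L2_norm M f \<ge> 0"
 by (simp add: L2_norm_def integral_nonneg_AE)

lemma L2_norm_square: "(L2_norm M f)\<^sup>2 = (LINT x|M. (norm (f x))\<^sup>2)"
 by (simp add: L2_norm_def integral_nonneg_AE)

lemma L2_inner_integrable:
 fixes f g :: "'x \<Rightarrow> 'b::euclidean_space"
 assumes "f \<in> L2_space M" "g \<in> L2_space M"
 shows "integrable M (\<lambda>x. f x \<bullet> g x)"
proof (rule integrable_dominated)
 show "integrable M (\<lambda>x. (norm (f x))\<^sup>2 + (norm (g x))\<^sup>2)" using assms by (auto simp: L2_space_def)
 show "(\<lambda>x. f x \<bullet> g x) \<in> borel_measurable M" using assms by (auto simp: L2_space_def)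
 have "\<bar>f x \<bullet> g x\<bar> \<le> (norm (f x))\<^sup>2 + (norm (g x))\<^sup>2" for x
  using Cauchy_Schwarz_ineq2[of "f x" "g x"] sum_squares_bound[of "norm (f x)" "norm (g x)"]
   mult_nonneg_nonneg[OF norm_ge_zero[of "f x"] norm_ge_zero[of "g x"]] by linarith
 thus "AE x in M. norm (f x \<bullet> g x) \<le> norm ((norm (f x))\<^sup>2 + (norm (g x))\<^sup>2)" by auto
qed

lemma norm_comb_square:
 fixes a b :: "'b::real_inner"
 shows "(norm (a + c *\<^sub>R b))\<^sup>2 = (norm a)\<^sup>2 + 2 * c * (a \<bullet> b) + c\<^sup>2 * (norm b)\<^sup>2"
 unfolding power2_norm_eq_inner
 by (simp add: inner_add_left inner_add_right inner_commute[of b a] power2_eq_square algebra_simps)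

lemma L2_space_comb:
 fixes f g :: "'x \<Rightarrow> 'b::euclidean_space"
 assumes "f \<in> L2_space M" "g \<in> L2_space M"
 shows "(\<lambda>x. f x + c *\<^sub>R g x) \<in> L2_space M"
proof -
 note norm_comb_square[of "f _" c "g _"]
 thus ?thesis using assms L2_inner_integrable[OF assms] by (auto simp: L2_space_def)
qed

lemma L2_space_diff:
 fixes f g :: "'x \<Rightarrow> 'b::euclidean_space"
 assumes "f \<in> L2_space M" "g \<in> L2_space M"
 shows "(\<lambda>x. f x - g x) \<in> L2_space M"
 using L2_space_comb[OF assms, of "-1"] by simp

text \<open>The quadratic polynomial \<open>t \<mapsto> \<parallel>f + t g\<parallel>\<^sup>2\<close> is nonnegative. This form covers square-integrable functions that are not
identified up to null sets.\<close>

lemma L2_cauchy_schwarz: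
 fixes f g :: "'x \<Rightarrow> 'b::euclidean_space"
 assumes f: "f \<in> L2_space M" and g: "g \<in> L2_space M"
 shows "\<bar>\<integral>x. f x \<bullet> g x \<partial>M\<bar> \<le> L2_norm M f * L2_norm M g"
proof -
 define A B C where "A = (LINT x|M. (norm (f x))\<^sup>2)" and "B = (LINT x|M. f x \<bullet> g x)"
  and "C = (LINT x|M. (norm (g x))\<^sup>2)"
 have int: "integrable M (\<lambda>x. (norm (f x))\<^sup>2)" "integrable M (\<lambda>x. (norm (g x))\<^sup>2)" "integrable M (\<lambda>x. f x \<bullet> g x)"
  using assms L2_inner_integrable[OF assms] by (auto simp: L2_space_def)
 have quad: "0 \<le> A + 2 * t * B + t\<^sup>2 * C" for t
 proof -
  have "0 \<le> (LINT x|M. (norm (f x + t *\<^sub>R g x))\<^sup>2)" by (simp add: integral_nonneg_AE)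
  also have "\<dots> = (LINT x|M. (norm (f x))\<^sup>2 + 2 * t * (f x \<bullet> g x) + t\<^sup>2 * (norm (g x))\<^sup>2)"
   by (intro LINT_cong refl norm_comb_square)
  also have "\<dots> = A + 2 * t * B + t\<^sup>2 * C" using int by (simp add: A_def B_def C_def)
  finally show ?thesis .
 qed
 have nn: "A \<ge> 0" "C \<ge> 0" by (simp_all add: A_def C_def integral_nonneg_AE)
 have "B\<^sup>2 \<le> A * C"
 proof (cases "C = 0")
  case True
  have "B = 0"
  proof (rule ccontr)
   assume "B \<noteq> 0"
   hence "2 * (- (A + 1) / (2 * B)) * B = - (A + 1)" by simp
   thus False using quad[of "- (A + 1) / (2 * B)"] True by simp
  qed
  thus ?thesis using True by simp
 next
  case False
  hence "C > 0" using nn by simp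
  have "0 \<le> A - B\<^sup>2 / C" using quad[of "- B / C"] \<open>C > 0\<close> by (simp add: power2_eq_square field_simps)
  thus ?thesis using \<open>C > 0\<close> by (simp add: field_simps)
 qed
 hence "\<bar>B\<bar> \<le> sqrt (A * C)" by (simp add: real_le_rsqrt)
 thus ?thesis by (simp add: A_def B_def C_def L2_norm_def real_sqrt_mult)
qed

lemma L2_norm_triangle:
 fixes f g :: "'x \<Rightarrow> 'b::euclidean_space"
 assumes "f \<in> L2_space M" "g \<in> L2_space M"
 shows "L2_norm M (\<lambda>x. f x + g x) \<le> L2_norm M f + L2_norm M g"
proof (rule power2_le_imp_le)
 have int: "integrable M (\<lambda>x. (norm (f x))\<^sup>2)" "integrable M (\<lambda>x. (norm (g x))\<^sup>2)" "integrable M (\<lambda>x. f x \<bullet> g x)"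
  using assms L2_inner_integrable[OF assms] by (auto simp: L2_space_def)
 have "(L2_norm M (\<lambda>x. f x + g x))\<^sup>2 = (LINT x|M. (norm (f x))\<^sup>2 + 2 * (f x \<bullet> g x) + (norm (g x))\<^sup>2)"
  unfolding L2_norm_square by (intro LINT_cong refl)
   (simp add: power2_norm_eq_inner inner_add_left inner_add_right inner_commute algebra_simps)
 also have "\<dots> = (L2_norm M f)\<^sup>2 + 2 * (LINT x|M. f x \<bullet> g x) + (L2_norm M g)\<^sup>2"
  unfolding L2_norm_square using int by simp
 also have "\<dots> \<le> (L2_norm M f + L2_norm M g)\<^sup>2"
  using L2_cauchy_schwarz[OF assms] by (simp add: power2_sum)
 finally show "(L2_norm M (\<lambda>x. f x + g x))\<^sup>2 \<le> (L2_norm M f + L2_norm M g)\<^sup>2" .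
qed simp

lemma L2_norm_scale: "L2_norm M (\<lambda>x. c *\<^sub>R f x) = \<bar>c\<bar> * L2_norm M f"
 by (simp add: L2_norm_def power_mult_distrib real_sqrt_mult)

lemma L2_norm_diff_le:
 fixes f g :: "'x \<Rightarrow> 'b::euclidean_space"
 assumes "f \<in> L2_space M" "g \<in> L2_space M"
 shows "\<bar>L2_norm M f - L2_norm M g\<bar> \<le> L2_norm M (\<lambda>x. f x - g x)"
proof -
 have "L2_norm M f \<le> L2_norm M (\<lambda>x. f x - g x) + L2_norm M g"
  using L2_norm_triangle[OF L2_space_diff[OF assms] assms(2)] by simp
 moreover have "L2_norm M g \<le> L2_norm M (\<lambda>x. g x - f x) + L2_norm M f"
  using L2_norm_triangle[OF L2_space_diff[OF assms(2,1)] assms(1)] by simp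
 moreover have "L2_norm M (\<lambda>x. g x - f x) = L2_norm M (\<lambda>x. f x - g x)"
  by (simp add: L2_norm_def norm_minus_commute)
 ultimately show ?thesis by linarith
qed

lemma L2_space_bound:
 fixes f :: "'x \<Rightarrow> 'b::euclidean_space" and g :: "'x \<Rightarrow> 'c::euclidean_space"
 assumes "f \<in> borel_measurable M" "g \<in> L2_space M" "AE x in M. norm (f x) \<le> C * norm (g x)"
 shows "f \<in> L2_space M"
proof -
 have "integrable M (\<lambda>x. (norm (f x))\<^sup>2)"
 proof (rule integrable_dominated)
  show "integrable M (\<lambda>x. C\<^sup>2 * (norm (g x))\<^sup>2)" using assms(2) by (auto simp: L2_space_def)
  show "(\<lambda>x. (norm (f x))\<^sup>2) \<in> borel_measurable M" using assms(1) by measurable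
  show "AE x in M. norm ((norm (f x))\<^sup>2) \<le> norm (C\<^sup>2 * (norm (g x))\<^sup>2)"
   using assms(3)
  proof (rule AE_mp, intro AE_I2 impI)
   fix x assume "norm (f x) \<le> C * norm (g x)"
   hence "(norm (f x))\<^sup>2 \<le> (C * norm (g x))\<^sup>2" by (rule power_mono) simp
   thus "norm ((norm (f x))\<^sup>2) \<le> norm (C\<^sup>2 * (norm (g x))\<^sup>2)" by (simp add: power_mult_distrib)
  qed
 qed
 thus ?thesis using assms(1) by (simp add: L2_space_def)
qed

lemma L2_norm_bound:
 fixes f :: "'x \<Rightarrow> 'b::euclidean_space" and g :: "'x \<Rightarrow> 'c::euclidean_space"
 assumes "f \<in> borel_measurable M" "g \<in> L2_space M" "AE x in M. norm (f x) \<le> C * norm (g x)" "C \<ge> 0"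
 shows "L2_norm M f \<le> C * L2_norm M g"
proof (rule power2_le_imp_le)
 have "(L2_norm M f)\<^sup>2 \<le> (LINT x|M. C\<^sup>2 * (norm (g x))\<^sup>2)" unfolding L2_norm_square
 proof (rule integral_mono_AE)
  show "integrable M (\<lambda>x. (norm (f x))\<^sup>2)" using L2_space_bound[OF assms(1,2,3)] by (simp add: L2_space_def)
  show "integrable M (\<lambda>x. C\<^sup>2 * (norm (g x))\<^sup>2)" using assms(2) by (auto simp: L2_space_def)
  show "AE x in M. (norm (f x))\<^sup>2 \<le> C\<^sup>2 * (norm (g x))\<^sup>2"
   using assms(3) by eventually_elim (metis norm_ge_zero power_mono power_mult_distrib)
 qed
 also have "\<dots> = (C * L2_norm M g)\<^sup>2" by (simp add: power_mult_distrib L2_norm_square)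
 finally show "(L2_norm M f)\<^sup>2 \<le> (C * L2_norm M g)\<^sup>2" .
qed (use assms(4) in simp)

lemma L2_norm_cong_AE:
 fixes f g :: "'x \<Rightarrow> 'b::euclidean_space"
 assumes "f \<in> borel_measurable M" "g \<in> borel_measurable M" "AE x in M. f x = g x"
 shows "L2_norm M f = L2_norm M g"
 unfolding L2_norm_def
 by (intro arg_cong[of _ _ sqrt] integral_cong_AE) (use assms in auto)

lemma L2_space_cong_AE:
 fixes f g :: "'x \<Rightarrow> 'b::euclidean_space"
 assumes "f \<in> borel_measurable M" "g \<in> L2_space M" "AE x in M. f x = g x"
 shows "f \<in> L2_space M"
 by (rule L2_space_bound[OF assms(1,2), of 1]) (use assms(3) in auto)

lemma bounded_imp_L2:
 fixes f :: "'x \<Rightarrow> 'b::euclidean_space"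
 assumes "f \<in> borel_measurable M" "finite_measure M" "AE x in M. norm (f x) \<le> C"
 shows "f \<in> L2_space M"
 by (rule L2_space_bound[of _ _ "\<lambda>x. 1 :: real" C]) (use assms in \<open>auto simp: L2_space_def intro!: finite_measure.integrable_const\<close>)

lemma AE_le_Linf_norm:
 assumes "f \<in> Linf_space M"
 shows "AE x in M. norm (f x) \<le> Linf_norm M f"
proof -
 obtain C where C: "AE x in M. norm (f x) \<le> C" and f: "f \<in> borel_measurable M"
  using assms by (auto simp: Linf_space_def)
 have le: "esssup M (\<lambda>x. ereal (norm (f x))) \<le> ereal C"
  by (rule esssup_I) (use C f in auto)
 have ae: "AE x in M. ereal (norm (f x)) \<le> esssup M (\<lambda>x. ereal (norm (f x)))" by (rule esssup_AE)
 show ?thesis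
 proof (cases "esssup M (\<lambda>x. ereal (norm (f x)))")
  case (real r)
  thus ?thesis using ae by (simp add: Linf_norm_def)
 next
  case PInf thus ?thesis using le by simp
 next
  case MInf thus ?thesis using ae by (auto elim: AE_mp)
 qed
qed

text \<open>An essential supremum of norms is nonnegative unless the measure is zero; in that case it is \<open>-\<infinity>\<close>, which
\<^const>\<open>real_of_ereal\<close> sends to \<open>0\<close>, as it does the value \<open>\<infinity>\<close> for a function that is not measurable.\<close>

lemma Linf_norm_nonneg:
 fixes f :: "'x \<Rightarrow> 'b::real_normed_vector"
 shows "Linf_norm M f \<ge> 0"
proof (rule ccontr)
 assume neg: "\<not> ?thesis"
 define s where "s = esssup M (\<lambda>x. ereal (norm (f x)))"
 obtain r where r: "s = ereal r" "r < 0"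
  using neg by (cases s) (auto simp: Linf_norm_def s_def)
 have meas: "(\<lambda>x. ereal (norm (f x))) \<in> borel_measurable M"
  using r esssup_non_measurable[of "\<lambda>x. ereal (norm (f x))" M] by (auto simp: s_def top_ereal_def)
 have "AE x in M. ereal (norm (f x)) \<le> s" unfolding s_def by (rule esssup_AE)
 hence "AE x in M. False"
 proof (rule AE_mp, intro AE_I2 impI)
  fix x assume "ereal (norm (f x)) \<le> s"
  hence "norm (f x) \<le> r" using r by simp
  thus False using r(2) norm_ge_zero[of "f x"] by linarith
 qed
 hence "AE x in M. ereal (norm (f x)) \<le> ereal (r - 1)" by (auto elim: AE_mp)
 hence "s \<le> ereal (r - 1)" unfolding s_def by (rule esssup_I[OF meas])
 thus False using r by simp
qed

context
 fixes \<Omega> T :: "'a::euclidean_space set"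
 assumes meas: "\<Omega> \<in> sets lebesgue" "T \<in> sets lebesgue" and neg: "negligible (T - \<Omega>)"
begin

lemma AE_lebesgue_on_mono:
 assumes "AE x in lebesgue_on \<Omega>. P x"
 shows "AE x in lebesgue_on T. P x"
proof -
 have "AE x in lebesgue. x \<in> \<Omega> \<longrightarrow> P x" using assms meas by (simp add: AE_restrict_space_iff)
 moreover have "AE x in lebesgue. x \<notin> T - \<Omega>"
  using neg by (intro AE_not_in) (simp add: negligible_iff_null_sets)
 ultimately have "AE x in lebesgue. x \<in> T \<longrightarrow> P x" by eventually_elim auto
 thus ?thesis using meas by (simp add: AE_restrict_space_iff)
qed

lemma measurable_lebesgue_on_mono:
 fixes f :: "'a \<Rightarrow> 'b::euclidean_space"
 assumes "f \<in> borel_measurable (lebesgue_on \<Omega>)"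
 shows "f \<in> borel_measurable (lebesgue_on T)"
proof -
 have "f \<in> borel_measurable (lebesgue_on (T \<inter> \<Omega>))"
  using measurable_restrict_mono[OF assms, of "T \<inter> \<Omega>"] by simp
 moreover have "T - (T - \<Omega>) = T \<inter> \<Omega>" by auto
 moreover have "T - \<Omega> \<in> null_sets (lebesgue_on T)"
  using neg meas by (auto simp: null_sets_restrict_space negligible_iff_null_sets)
 ultimately show ?thesis using borel_measurable_diff_null[OF _ meas(2), of "T - \<Omega>" f] by simp
qed

lemma integrable_lebesgue_on_mono:
 fixes f :: "'a \<Rightarrow> 'b::euclidean_space"
 assumes "integrable (lebesgue_on \<Omega>) f"
 shows "integrable (lebesgue_on T) f"
proof -
 have "integrable lebesgue (\<lambda>x. indicator T x *\<^sub>R f x)"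
 proof (rule integrable_dominated)
  show "integrable lebesgue (\<lambda>x. indicator \<Omega> x *\<^sub>R f x)"
   using assms meas by (simp add: integrable_restrict_space)
  have "f \<in> borel_measurable (lebesgue_on T)"
   using assms by (intro measurable_lebesgue_on_mono) auto
  thus "(\<lambda>x. ind T x *\<^sub>R f x) \<in> borel_measurable lebesgue"
   using meas by (simp add: borel_measurable_restrict_space_iff)
  have "AE x in lebesgue. x \<notin> T - \<Omega>"
   using neg by (intro AE_not_in) (simp add: negligible_iff_null_sets)
  thus "AE x in lebesgue. norm (ind T x *\<^sub>R f x) \<le> norm (ind \<Omega> x *\<^sub>R f x)"
   by eventually_elim (auto simp: indicator_def)
 qed
 thus ?thesis using meas by (simp add: integrable_restrict_space)
qed

lemma L2_space_lebesgue_on_mono: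
 fixes f :: "'a \<Rightarrow> 'b::euclidean_space"
 assumes "f \<in> L2_space (lebesgue_on \<Omega>)"
 shows "f \<in> L2_space (lebesgue_on T)"
 using assms measurable_lebesgue_on_mono integrable_lebesgue_on_mono[of "\<lambda>x. (norm (f x))\<^sup>2"]
 by (auto simp: L2_space_def)

lemma Linf_space_lebesgue_on_mono:
 fixes f :: "'a \<Rightarrow> 'b::euclidean_space"
 assumes "f \<in> Linf_space (lebesgue_on \<Omega>)"
 shows "f \<in> Linf_space (lebesgue_on T)"
 using assms measurable_lebesgue_on_mono AE_lebesgue_on_mono by (fastforce simp: Linf_space_def)

end

section \<open>Cut-off functions\<close>

text \<open>A piecewise quadratic \<open>C\<^sup>1\<close> step from \<open>0\<close> (up to \<open>1\<close>) to \<open>1\<close> (from \<open>3\<close>); its derivative \<open>cutoff'\<close> is the hat function of integral \<open>1\<close>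
on \<open>[1, 3]\<close>. The step begins at \<open>1\<close>, not at \<open>0\<close>, so that products of rescaled steps have compact support inside an open polytope.\<close>

definition cutoff :: "real \<Rightarrow> real" where
 "cutoff s = ((max 0 (s - 1))\<^sup>2 - 2 * (max 0 (s - 2))\<^sup>2 + (max 0 (s - 3))\<^sup>2) / 2"

definition cutoff' :: "real \<Rightarrow> real" where
 "cutoff' s = max 0 (s - 1) - 2 * max 0 (s - 2) + max 0 (s - 3)"

lemma DERIV_pos_part_square: "((\<lambda>s. (max 0 (s::real))\<^sup>2) has_real_derivative 2 * max 0 s) (at s)"
proof (cases s "0::real" rule: linorder_cases)
 case less
 have "((\<lambda>s. 0) has_real_derivative 0) (at s)" by simp
 hence "((\<lambda>s. (max 0 s)\<^sup>2) has_real_derivative 0) (at s)"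
  by (rule DERIV_cong_ev[THEN iffD1, rotated -1])
    (use less eventually_nhds_in_open[of "{..<0}" s] in \<open>auto elim!: eventually_mono\<close>)
 thus ?thesis using less by simp
next
 case greater
 have "((\<lambda>s. s\<^sup>2) has_real_derivative 2 * s) (at s)" by (auto intro!: derivative_eq_intros)
 hence "((\<lambda>s. (max 0 s)\<^sup>2) has_real_derivative 2 * s) (at s)"
  by (rule DERIV_cong_ev[THEN iffD1, rotated -1])
    (use greater eventually_nhds_in_open[of "{0<..}" s] in \<open>auto elim!: eventually_mono\<close>)
 thus ?thesis using greater by simp
next
 case equal
 have "((\<lambda>h::real. (max 0 h)\<^sup>2 / h) \<longlongrightarrow> 0) (at 0)"
 proof (rule tendsto_0_le[where K = 1])
  show "((\<lambda>h::real. h) \<longlongrightarrow> 0) (at 0)" by simp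
  show "\<forall>\<^sub>F h in at (0::real). norm ((max 0 h)\<^sup>2 / h) \<le> norm h * 1"
   by (rule always_eventually) (auto simp: max_def power2_eq_square)
 qed
 thus ?thesis using equal by (simp add: DERIV_def)
qed

lemma DERIV_cutoff: "(cutoff has_real_derivative cutoff' s) (at s)"
proof -
 have *: "((\<lambda>s. (max 0 (s - k))\<^sup>2) has_real_derivative 2 * max 0 (s - k)) (at s)" for k :: real
 proof -
  have "((\<lambda>s. s - k) has_real_derivative 1) (at s)" by (auto intro!: derivative_eq_intros)
  from DERIV_chain2[of "\<lambda>s. (max 0 s)\<^sup>2" "2 * max 0 (s - k)" "\<lambda>s. s - k" s 1 UNIV, OF DERIV_pos_part_square this]
  show ?thesis by simp
 qed
 have "((\<lambda>s. ((max 0 (s - 1))\<^sup>2 - 2 * (max 0 (s - 2))\<^sup>2 + (max 0 (s - 3))\<^sup>2) / 2) has_real_derivative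
   (2 * max 0 (s - 1) - 2 * (2 * max 0 (s - 2)) + 2 * max 0 (s - 3)) / 2) (at s)"
  by (intro DERIV_cdivide DERIV_add DERIV_diff DERIV_cmult *)
 moreover have "(2 * max 0 (s - 1) - 2 * (2 * max 0 (s - 2)) + 2 * max 0 (s - 3)) / 2 = cutoff' s"
  by (simp add: cutoff'_def)
 ultimately show ?thesis unfolding cutoff_def[abs_def] by simp
qed

lemma cutoff_low [simp]: "s \<le> 1 \<Longrightarrow> cutoff s = 0" "s \<le> 1 \<Longrightarrow> cutoff' s = 0"
 by (auto simp: cutoff_def cutoff'_def)

lemma cutoff_high [simp]: "s \<ge> 3 \<Longrightarrow> cutoff s = 1" "s \<ge> 3 \<Longrightarrow> cutoff' s = 0"
 by (auto simp: cutoff_def cutoff'_def power2_eq_square algebra_simps)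

lemma cutoff'_bounds: "0 \<le> cutoff' s" "cutoff' s \<le> 1"
 by (auto simp: cutoff'_def max_def)

lemma cutoff_mono: "s \<le> t \<Longrightarrow> cutoff s \<le> cutoff t"
 by (rule DERIV_nonneg_imp_nondecreasing) (use DERIV_cutoff cutoff'_bounds in blast)+

lemma cutoff_bounds: "0 \<le> cutoff s" "cutoff s \<le> 1"
 using cutoff_mono[of "min s 1" s] cutoff_mono[of s "max s 3"] by auto

lemma continuous_cutoff' [continuous_intros]: "continuous_on A f \<Longrightarrow> continuous_on A (\<lambda>x. cutoff' (f x))"
 unfolding cutoff'_def by (intro continuous_intros)

lemma continuous_cutoff [continuous_intros]: "continuous_on A f \<Longrightarrow> continuous_on A (\<lambda>x. cutoff (f x))"
 unfolding cutoff_def by (intro continuous_intros) auto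

lemma measurable_cutoff [measurable]: "cutoff \<in> borel_measurable borel" "cutoff' \<in> borel_measurable borel"
 using continuous_cutoff[of UNIV id] continuous_cutoff'[of UNIV id]
 by (auto intro!: borel_measurable_continuous_onI)

lemma integral_cutoff': "integrable lborel cutoff'" "(LINT s|lborel. cutoff' s) = 1"
proof -
 have *: "has_bochner_integral lborel (\<lambda>x. cutoff' x * indicator {1 .. 3} x) (cutoff 3 - cutoff 1)"
  by (rule has_bochner_integral_FTC_Icc_nonneg) (auto intro: DERIV_cutoff cutoff'_bounds)
 moreover have "(\<lambda>x. cutoff' x * indicator {1 .. 3} x) = cutoff'"
 proof
  fix x show "cutoff' x * indicator {1 .. 3} x = cutoff' x"
   by (cases "x \<le> 1"; cases "x \<ge> 3") (auto simp: indicator_def)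
 qed
 ultimately show "integrable lborel cutoff'" "(LINT s|lborel. cutoff' s) = 1"
  by (auto simp: has_bochner_integral_iff)
qed

text \<open>For \<open>\<delta> \<rightarrow> 0\<close> this tends to the indicator function of the open polytope
\<open>{x. \<forall>i\<in>I. n i \<bullet> x < c i}\<close>, while its gradient concentrates in strips of width of order \<open>\<delta>\<close> along the faces.\<close>

definition polytope_cutoff :: "'i set \<Rightarrow> ('i \<Rightarrow> 'a::euclidean_space) \<Rightarrow> ('i \<Rightarrow> real) \<Rightarrow> real \<Rightarrow> 'a \<Rightarrow> real" where
 "polytope_cutoff I n c \<delta> x = (\<Prod>i\<in>I. cutoff ((c i - n i \<bullet> x) / \<delta>))"

definition polytope_cutoff_grad :: "'i set \<Rightarrow> ('i \<Rightarrow> 'a::euclidean_space) \<Rightarrow> ('i \<Rightarrow> real) \<Rightarrow> real \<Rightarrow> 'a \<Rightarrow> 'a" where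
 "polytope_cutoff_grad I n c \<delta> x =
   (\<Sum>i\<in>I. - (cutoff' ((c i - n i \<bullet> x) / \<delta>) / \<delta> * polytope_cutoff (I - {i}) n c \<delta> x) *\<^sub>R n i)"

lemma polytope_cutoff_bounds: "0 \<le> polytope_cutoff I n c \<delta> x" "polytope_cutoff I n c \<delta> x \<le> 1"
 unfolding polytope_cutoff_def by (auto intro!: prod_nonneg prod_le_1 simp: cutoff_bounds)

lemma continuous_polytope_cutoff: "continuous_on A (polytope_cutoff I n c \<delta>)"
 unfolding polytope_cutoff_def[abs_def] divide_inverse by (intro continuous_intros)

lemma measurable_polytope_cutoff [measurable]: "polytope_cutoff I n c \<delta> \<in> borel_measurable borel"
 by (intro borel_measurable_continuous_onI continuous_polytope_cutoff)

lemma continuous_polytope_cutoff_grad: "continuous_on A (polytope_cutoff_grad I n c \<delta>)"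
 unfolding polytope_cutoff_grad_def[abs_def] divide_inverse
 by (intro continuous_intros continuous_polytope_cutoff)

lemma GDERIV_polytope_cutoff:
 "GDERIV (polytope_cutoff I n c \<delta>) x :> polytope_cutoff_grad I n c \<delta> x"
proof -
 have "((\<lambda>x. cutoff ((c i - n i \<bullet> x) / \<delta>)) has_derivative
   (\<lambda>h. cutoff' ((c i - n i \<bullet> x) / \<delta>) * (- (n i \<bullet> h) / \<delta>))) (at x)" for i
 proof -
  have "((\<lambda>x. (c i - n i \<bullet> x) / \<delta>) has_derivative (\<lambda>h. - (n i \<bullet> h) / \<delta>)) (at x)"
   unfolding divide_inverse by (auto intro!: derivative_eq_intros)
  from has_derivative_compose[OF this DERIV_cutoff[unfolded has_field_derivative_def]]
  show ?thesis by simp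
 qed
 from has_derivative_prod[OF this] show ?thesis
  unfolding gderiv_def polytope_cutoff_def[abs_def] polytope_cutoff_grad_def
  by (rule has_derivative_eq_rhs)
    (auto simp: inner_sum_right fun_eq_iff inner_commute intro!: sum.cong)
qed

lemma polytope_cutoff_support:
 assumes "polytope_cutoff I n c \<delta> x \<noteq> 0" "finite I" "\<delta> > 0" "i \<in> I"
 shows "n i \<bullet> x \<le> c i - \<delta>"
proof (rule ccontr)
 assume "\<not> ?thesis"
 hence "(c i - n i \<bullet> x) / \<delta> \<le> 1" using assms(3) by (simp add: field_simps)
 hence "cutoff ((c i - n i \<bullet> x) / \<delta>) = 0" by simp
 hence "polytope_cutoff I n c \<delta> x = 0"
  unfolding polytope_cutoff_def using assms(2,4) by (intro prod_zero) auto
 thus False using assms(1) by simp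
qed

lemma GDERIV_continuous: "(\<And>x. GDERIV w x :> Dw x) \<Longrightarrow> continuous_on S w"
 by (auto intro!: has_derivative_continuous_on intro: has_derivative_at_withinI simp: gderiv_def)

lemma C1_test_polytope_cutoff:
 fixes n :: "'i \<Rightarrow> 'a::euclidean_space"
 assumes I: "finite I" and \<delta>: "\<delta> > 0" and w: "\<And>x. GDERIV w x :> Dw x" "continuous_on UNIV Dw"
  and bdd: "bounded {x. \<forall>i\<in>I. n i \<bullet> x \<le> c i}"
  and sub: "{x. \<forall>i\<in>I. n i \<bullet> x < c i} \<subseteq> \<Omega>"
 shows "C1_test \<Omega> (\<lambda>x. w x * polytope_cutoff I n c \<delta> x)
   (\<lambda>x. w x *\<^sub>R polytope_cutoff_grad I n c \<delta> x + polytope_cutoff I n c \<delta> x *\<^sub>R Dw x)"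
proof -
 let ?K = "{x. \<forall>i\<in>I. n i \<bullet> x \<le> c i - \<delta>}"
 have K: "closed ?K" "?K \<subseteq> \<Omega>" "bounded ?K"
 proof -
  have "?K = (\<Inter>i\<in>I. {x. n i \<bullet> x \<le> c i - \<delta>})" by auto
  thus "closed ?K" by (auto intro!: closed_halfspace_le)
  show "?K \<subseteq> \<Omega>" using sub \<delta> by force
  show "bounded ?K" by (rule bounded_subset[OF bdd]) (use \<delta> in force)
 qed
 have cl: "closure {x. w x * polytope_cutoff I n c \<delta> x \<noteq> 0} \<subseteq> ?K"
  using polytope_cutoff_support[OF _ I \<delta>] by (intro closure_minimal K(1)) auto
 have contw: "continuous_on UNIV w"
  using w(1) by (auto intro!: has_derivative_continuous_on simp: gderiv_def)
 show ?thesis unfolding C1_test_def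
 proof (intro conjI allI)
  show "GDERIV (\<lambda>x. w x * polytope_cutoff I n c \<delta> x) x :>
    w x *\<^sub>R polytope_cutoff_grad I n c \<delta> x + polytope_cutoff I n c \<delta> x *\<^sub>R Dw x" for x
   by (rule GDERIV_mult[OF w(1) GDERIV_polytope_cutoff])
  show "continuous_on UNIV (\<lambda>x. w x *\<^sub>R polytope_cutoff_grad I n c \<delta> x + polytope_cutoff I n c \<delta> x *\<^sub>R Dw x)"
   by (intro continuous_intros contw w(2) continuous_polytope_cutoff continuous_polytope_cutoff_grad)
  show "compact (closure {x. w x * polytope_cutoff I n c \<delta> x \<noteq> 0})"
   using bounded_subset[OF K(3) cl] by (simp add: compact_eq_bounded_closed)
  show "closure {x. w x * polytope_cutoff I n c \<delta> x \<noteq> 0} \<subseteq> \<Omega>" using cl K(2) by auto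
 qed
qed

lemma polytope_cutoff_tendsto:
 fixes n :: "'i \<Rightarrow> 'a::euclidean_space"
 assumes "finite I" "\<And>k. d k > 0" "d \<longlonglongrightarrow> 0"
 shows "(\<lambda>k. polytope_cutoff I n c (d k) x) \<longlonglongrightarrow> ind {x. \<forall>i\<in>I. n i \<bullet> x < c i} x"
proof (cases "\<forall>i\<in>I. n i \<bullet> x < c i")
 case True
 have "\<forall>\<^sub>F k in sequentially. cutoff ((c i - n i \<bullet> x) / d k) = 1" if "i \<in> I" for i
 proof -
  have "\<forall>\<^sub>F k in sequentially. d k < (c i - n i \<bullet> x) / 3"
   using True that by (intro order_tendstoD(2)[OF assms(3)]) auto
  thus ?thesis
   by eventually_elim (use assms(2) in \<open>auto simp: field_simps\<close>)
 qed
 hence "\<forall>\<^sub>F k in sequentially. \<forall>i\<in>I. cutoff ((c i - n i \<bullet> x) / d k) = 1"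
  using assms(1) by (simp add: eventually_ball_finite)
 hence "\<forall>\<^sub>F k in sequentially. polytope_cutoff I n c (d k) x = 1"
  by eventually_elim (simp add: polytope_cutoff_def)
 thus ?thesis using True by (simp add: tendsto_eventually)
next
 case False
 then obtain i where i: "i \<in> I" "c i - n i \<bullet> x \<le> 0" by force
 have "polytope_cutoff I n c (d k) x = 0" for k
 proof -
  have "(c i - n i \<bullet> x) / d k \<le> 1" using i(2) assms(2)[of k] by (simp add: divide_nonpos_pos order_trans)
  hence "cutoff ((c i - n i \<bullet> x) / d k) = 0" by simp
  thus ?thesis unfolding polytope_cutoff_def using assms(1) i(1) by (intro prod_zero) auto
 qed
 thus ?thesis using False by simp
qed

section \<open>Weak gradients\<close>

text \<open>Boxes are stable under intersection and generate the Borel sets, so a function whose integral over each box vanishes has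
vanishing integral over each Borel set. The total integral handles complements.\<close>

lemma zero_on_boxes_imp_AE_zero_borel:
 fixes g :: "'a::euclidean_space \<Rightarrow> real"
 assumes M: "sets M = sets borel" and g: "integrable M g" and box: "\<And>a b. (\<integral>x\<in>box a b. g x \<partial>M) = 0"
  and tot: "(LINT x|M. g x) = 0"
 shows "AE x in M. g x = 0"
proof -
 have sp: "space M = UNIV" using sets_eq_imp_space_eq[OF M] by simp
 have si: "set_integrable M A g" if "A \<in> sets M" for A
  unfolding set_integrable_def by (rule integrable_mult_indicator[OF that g])
 have borel0: "(\<integral>x\<in>A. g x \<partial>M) = 0" if A: "A \<in> sets borel" for A
 proof -
  let ?G = "range (\<lambda>(a, b). box a b :: 'a set)"
  have sb: "sigma_sets UNIV ?G = sets borel" by (simp add: borel_eq_box)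
  have "Int_stable ?G" by (auto simp: Int_stable_def box_Int_box)
  moreover have "?G \<subseteq> Pow UNIV" by auto
  moreover have "A \<in> sigma_sets UNIV ?G" using A sb by simp
  ultimately show ?thesis
  proof (induction rule: sigma_sets_induct_disjoint)
   case (basic A) thus ?case using box by auto
  next
   case empty show ?case by (simp add: set_lebesgue_integral_def)
  next
   case (compl A)
   hence "A \<in> sets borel" using sb by simp
   hence *: "A \<in> sets M" "UNIV - A \<in> sets M" using M by auto
   have "(LINT x|M. g x) = (\<integral>x\<in>A \<union> (UNIV - A). g x \<partial>M)"
    by (simp add: set_lebesgue_integral_def)
   also have "\<dots> = (\<integral>x\<in>A. g x \<partial>M) + (\<integral>x\<in>UNIV - A. g x \<partial>M)"
    using si[OF *(1)] si[OF *(2)] by (intro set_integral_Un) auto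
   finally show ?case using compl tot by simp
  next
   case (union A)
   have A: "A i \<in> sets M" for i using union(2) sb M by (auto simp: image_subset_iff)
   have "(\<integral>x\<in>(\<Union>i. A i). g x \<partial>M) = (\<Sum>i. \<integral>x\<in>A i. g x \<partial>M)"
    by (rule lebesgue_integral_countable_add) (use A union(1) si in \<open>auto simp: disjoint_family_on_def\<close>)
   thus ?case using union by simp
  qed
 qed
 have "AE x in M. g x = (\<lambda>x. 0) x"
  by (rule density_unique_real[OF g]) (use borel0 M in auto)
 thus ?thesis by simp
qed

text \<open>A Lebesgue integrable function agrees almost everywhere with a Borel function.\<close>

lemma zero_on_boxes_imp_AE_zero:
 fixes g :: "'a::euclidean_space \<Rightarrow> real"
 assumes g: "integrable lebesgue g" and box: "\<And>a b. (\<integral>x\<in>box a b. g x \<partial>lebesgue) = 0"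
  and tot: "(LINT x|lebesgue. g x) = 0"
 shows "AE x in lebesgue. g x = 0"
proof -
 obtain h where h: "h \<in> borel_measurable lborel" "AE x in lborel. g x = h x"
  using completion_ex_borel_measurable_real[OF borel_measurable_integrable[OF g]] by blast
 have hc: "AE x in lebesgue. g x = h x" by (rule AE_completion[OF h(2)])
 have hL: "h \<in> borel_measurable lebesgue" using h(1) by (rule measurable_completion)
 have eq: "(LINT x|lborel. ind A x * h x) = (LINT x|lebesgue. ind A x * g x)" if "A \<in> sets borel" for A
 proof -
  have "(LINT x|lborel. ind A x * h x) = (LINT x|lebesgue. ind A x * h x)"
   using h(1) that by (intro integral_completion[symmetric] borel_measurable_times borel_measurable_indicator) auto
  also have "\<dots> = (LINT x|lebesgue. ind A x * g x)"
   by (intro integral_cong_AE borel_measurable_times borel_measurable_indicator hL borel_measurable_integrable[OF g])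
    (use that hc in auto)
  finally show ?thesis .
 qed
 have "integrable lebesgue h" using integrable_cong_AE[OF borel_measurable_integrable[OF g] hL hc] g by simp
 hence "integrable lborel h" using h(1) by (simp add: integrable_completion)
 hence "AE x in lborel. h x = 0"
  using eq[of "box _ _"] eq[of UNIV] box tot
  by (intro zero_on_boxes_imp_AE_zero_borel) (auto simp: set_lebesgue_integral_def)
 hence "AE x in lebesgue. h x = 0" by (rule AE_completion)
 with hc show ?thesis by eventually_elim simp
qed

lemma integral_lebesgue_on_eq_lborel:
 fixes f :: "'a::euclidean_space \<Rightarrow> 'b::euclidean_space"
 assumes "S \<in> sets lebesgue" "f \<in> borel_measurable borel" "\<And>x. x \<notin> S \<Longrightarrow> f x = 0"
 shows "(LINT x|lebesgue_on S. f x) = (LINT x|lborel. f x)"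
proof -
 have "(LINT x|lebesgue_on S. f x) = (LINT x|lebesgue. ind S x *\<^sub>R f x)"
  using assms(1) by (intro integral_restrict_space) simp
 also have "\<dots> = (LINT x|lebesgue. f x)"
  by (intro LINT_cong) (use assms(3) in \<open>auto simp: indicator_def\<close>)
 also have "\<dots> = (LINT x|lborel. f x)" using assms(2) by (intro integral_completion) simp
 finally show ?thesis .
qed

lemma integral_lebesgue_on_support:
 fixes f :: "'a::euclidean_space \<Rightarrow> 'b::euclidean_space"
 assumes "S \<in> sets lebesgue" "S' \<in> sets lebesgue" "S \<subseteq> S'" "\<And>x. x \<notin> S \<Longrightarrow> f x = 0"
 shows "(LINT x|lebesgue_on S. f x) = (LINT x|lebesgue_on S'. f x)"
proof -
 have "(LINT x|lebesgue. ind S x *\<^sub>R f x) = (LINT x|lebesgue. ind S' x *\<^sub>R f x)"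
  by (intro LINT_cong) (use assms(3,4) in \<open>auto simp: indicator_def\<close>)
 thus ?thesis using assms(1,2) by (simp add: integral_restrict_space)
qed

lemma integrable_lebesgue_on_support:
 fixes f :: "'a::euclidean_space \<Rightarrow> 'b::euclidean_space"
 assumes "S \<in> sets lebesgue" "S' \<in> sets lebesgue" "S \<subseteq> S'" "\<And>x. x \<notin> S \<Longrightarrow> f x = 0"
  and "integrable (lebesgue_on S) f"
 shows "integrable (lebesgue_on S') f"
proof -
 have "integrable lebesgue (\<lambda>x. ind S x *\<^sub>R f x)"
  using assms(1,5) by (simp add: integrable_restrict_space)
 also have "(\<lambda>x. ind S x *\<^sub>R f x) = (\<lambda>x. ind S' x *\<^sub>R f x)"
  using assms(3,4) by (auto simp: indicator_def fun_eq_iff)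
 finally show ?thesis using assms(2) by (simp add: integrable_restrict_space)
qed

lemma C1_test_zero_outside:
 assumes "C1_test \<Omega> \<phi> D" "x \<notin> closure {x. \<phi> x \<noteq> 0}"
 shows "\<phi> x = 0" "D x = 0"
proof -
 show "\<phi> x = 0" using assms(2) closure_subset[of "{x. \<phi> x \<noteq> 0}"] by auto
 have "((\<lambda>y. 0) has_derivative (\<lambda>h. 0)) (at x)" by simp
 hence "(\<phi> has_derivative (\<lambda>h. 0)) (at x)"
  by (rule has_derivative_transform_within_open[of _ _ _ _ "- closure {x. \<phi> x \<noteq> 0}"])
    (use assms(2) closure_subset[of "{x. \<phi> x \<noteq> 0}"] in auto)
 moreover have "(\<phi> has_derivative (\<lambda>h. h \<bullet> D x)) (at x)"
  using assms(1) by (simp add: C1_test_def gderiv_def)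
 ultimately have "(\<lambda>h. h \<bullet> D x) = (\<lambda>h. 0)" by (metis has_derivative_unique)
 from fun_cong[OF this, of "D x"] show "D x = 0" by simp
qed

lemma C1_test_support:
 assumes "C1_test \<Omega> \<phi> D"
 obtains K where "compact K" "K \<subseteq> \<Omega>" "\<And>x. x \<notin> K \<Longrightarrow> \<phi> x = 0" "\<And>x. x \<notin> K \<Longrightarrow> D x = 0"
proof
 show "compact (closure {x. \<phi> x \<noteq> 0})" "closure {x. \<phi> x \<noteq> 0} \<subseteq> \<Omega>"
  using assms by (simp_all add: C1_test_def)
qed (erule C1_test_zero_outside[OF assms])+

lemma C1_test_continuous: "C1_test \<Omega> \<phi> D \<Longrightarrow> continuous_on A \<phi>"
 by (auto intro!: has_derivative_continuous_on intro: has_derivative_at_withinI simp: gderiv_def C1_test_def)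

lemma compact_continuous_bound:
 fixes f :: "'a::topological_space \<Rightarrow> 'b::real_normed_vector"
 assumes "compact K" "continuous_on K f"
 obtains B where "B > 0" "\<And>x. x \<in> K \<Longrightarrow> norm (f x) \<le> B"
 using compact_imp_bounded[OF compact_continuous_image[OF assms(2,1)]] unfolding bounded_pos by auto

lemma C1_test_bounded:
 assumes t: "C1_test \<Omega> \<phi> D"
 obtains B where "B > 0" "\<And>x. \<bar>\<phi> x\<bar> \<le> B" "\<And>x. norm (D x) \<le> B"
proof -
 obtain K where K: "compact K" "\<And>x. x \<notin> K \<Longrightarrow> \<phi> x = 0" "\<And>x. x \<notin> K \<Longrightarrow> D x = 0"
  by (rule C1_test_support[OF t]) blast
 have "continuous_on K D" using t continuous_on_subset by (auto simp: C1_test_def)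
 then obtain B2 where B2: "B2 > 0" "\<And>x. x \<in> K \<Longrightarrow> norm (D x) \<le> B2"
  by (rule compact_continuous_bound[OF K(1)]) blast
 obtain B1 where B1: "B1 > 0" "\<And>x. x \<in> K \<Longrightarrow> norm (\<phi> x) \<le> B1"
  by (rule compact_continuous_bound[OF K(1) C1_test_continuous[OF t]]) blast
 have "\<bar>\<phi> x\<bar> \<le> max B1 B2 \<and> norm (D x) \<le> max B1 B2" for x
  using B1(1) B1(2)[of x] B2(2)[of x] K(2,3)[of x] by (cases "x \<in> K") auto
 thus ?thesis by (intro that[of "max B1 B2"]) (auto simp: less_max_iff_disj B1)
qed

lemma weak_gradientD:
 assumes "weak_gradient \<Omega> v G"
 shows "\<And>K. compact K \<Longrightarrow> K \<subseteq> \<Omega> \<Longrightarrow> integrable (lebesgue_on K) v"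
  "\<And>K. compact K \<Longrightarrow> K \<subseteq> \<Omega> \<Longrightarrow> integrable (lebesgue_on K) G"
  "\<And>\<phi> D. C1_test \<Omega> \<phi> D \<Longrightarrow>
    (LINT x|lebesgue_on \<Omega>. v x *\<^sub>R D x) = - (LINT x|lebesgue_on \<Omega>. \<phi> x *\<^sub>R G x)"
 using assms unfolding weak_gradient_def by blast+

lemma weak_gradient_test_integrable:
 assumes wg: "weak_gradient \<Omega> v G" and t: "C1_test \<Omega> \<phi> D" and \<Omega>: "\<Omega> \<in> sets lebesgue"
 shows "integrable (lebesgue_on (\<Omega> :: 'a::euclidean_space set)) (\<lambda>x. v x *\<^sub>R D x)" "integrable (lebesgue_on \<Omega>) (\<lambda>x. \<phi> x *\<^sub>R G x)"
proof -
 obtain K where K: "compact K" "K \<subseteq> \<Omega>" "\<And>x. x \<notin> K \<Longrightarrow> \<phi> x = 0" "\<And>x. x \<notin> K \<Longrightarrow> D x = 0"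
  by (rule C1_test_support[OF t]) blast
 have Km: "K \<in> sets lebesgue" using K(1) by (simp add: borel_compact)
 have supp: "integrable (lebesgue_on \<Omega>) F" if "\<And>x. x \<notin> K \<Longrightarrow> F x = 0" "integrable (lebesgue_on K) F" for F :: "'a \<Rightarrow> 'a"
  by (rule integrable_lebesgue_on_support[OF Km \<Omega> K(2) that])
 have vG: "integrable (lebesgue_on K) v" "integrable (lebesgue_on K) G"
  using weak_gradientD(1,2)[OF wg K(1,2)] by auto
 obtain B where B: "B > 0" "\<And>x. \<bar>\<phi> x\<bar> \<le> B" "\<And>x. norm (D x) \<le> B" by (rule C1_test_bounded[OF t]) blast
 have [measurable]: "\<phi> \<in> borel_measurable borel" "D \<in> borel_measurable borel"
  using t C1_test_continuous[OF t] by (auto intro!: borel_measurable_continuous_onI simp: C1_test_def)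
 have m: "\<phi> \<in> borel_measurable (lebesgue_on K)" "D \<in> borel_measurable (lebesgue_on K)"
  by (auto intro!: measurable_restrict_space1 measurable_completion)
 have "integrable (lebesgue_on K) (\<lambda>x. v x *\<^sub>R D x)"
 proof (rule integrable_dominated)
  show "integrable (lebesgue_on K) (\<lambda>x. B *\<^sub>R v x)" using vG by simp
  show "(\<lambda>x. v x *\<^sub>R D x) \<in> borel_measurable (lebesgue_on K)" using m vG by measurable
  show "AE x in lebesgue_on K. norm (v x *\<^sub>R D x) \<le> norm (B *\<^sub>R v x)"
  proof (intro AE_I2)
   fix x
   have "norm (v x *\<^sub>R D x) \<le> \<bar>v x\<bar> * B" using mult_left_mono[OF B(3)[of x] abs_ge_zero[of "v x"]] by simp
   thus "norm (v x *\<^sub>R D x) \<le> norm (B *\<^sub>R v x)" using B(1) by (simp add: abs_mult mult.commute)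
  qed
 qed
 thus "integrable (lebesgue_on \<Omega>) (\<lambda>x. v x *\<^sub>R D x)"
  by (rule supp[rotated]) (simp add: K)
 have "integrable (lebesgue_on K) (\<lambda>x. \<phi> x *\<^sub>R G x)"
 proof (rule integrable_dominated)
  show "integrable (lebesgue_on K) (\<lambda>x. B *\<^sub>R G x)" using vG by simp
  show "(\<lambda>x. \<phi> x *\<^sub>R G x) \<in> borel_measurable (lebesgue_on K)" using m vG by measurable
  show "AE x in lebesgue_on K. norm (\<phi> x *\<^sub>R G x) \<le> norm (B *\<^sub>R G x)"
   using B by (intro AE_I2) (simp add: mult_right_mono)
 qed
 thus "integrable (lebesgue_on \<Omega>) (\<lambda>x. \<phi> x *\<^sub>R G x)"
  by (rule supp[rotated]) (simp add: K)
qed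

lemma weak_gradient_comb:
 assumes u: "weak_gradient \<Omega> u G" and v: "weak_gradient \<Omega> v H" and \<Omega>: "\<Omega> \<in> sets lebesgue"
 shows "weak_gradient \<Omega> (\<lambda>x. u x + c * v x) (\<lambda>x. G x + c *\<^sub>R H x)"
 unfolding weak_gradient_def
proof (intro conjI allI impI)
 fix K assume "compact K \<and> K \<subseteq> \<Omega>"
 thus "integrable (lebesgue_on K) (\<lambda>x. u x + c * v x)" "integrable (lebesgue_on K) (\<lambda>x. G x + c *\<^sub>R H x)"
  using weak_gradientD(1,2)[OF u, of K] weak_gradientD(1,2)[OF v, of K] by auto
next
 fix \<phi> D assume t: "C1_test \<Omega> \<phi> D"
 note iu = weak_gradient_test_integrable[OF u t \<Omega>] and iv = weak_gradient_test_integrable[OF v t \<Omega>]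
 have "(LINT x|lebesgue_on \<Omega>. (u x + c * v x) *\<^sub>R D x) = (LINT x|lebesgue_on \<Omega>. u x *\<^sub>R D x + c *\<^sub>R (v x *\<^sub>R D x))"
  by (simp add: algebra_simps)
 also have "\<dots> = (LINT x|lebesgue_on \<Omega>. u x *\<^sub>R D x) + c *\<^sub>R (LINT x|lebesgue_on \<Omega>. v x *\<^sub>R D x)"
  using iu iv by (simp del: scaleR_scaleR)
 also have "\<dots> = - ((LINT x|lebesgue_on \<Omega>. \<phi> x *\<^sub>R G x) + c *\<^sub>R (LINT x|lebesgue_on \<Omega>. \<phi> x *\<^sub>R H x))"
  using weak_gradientD(3)[OF u t] weak_gradientD(3)[OF v t] by simp
 also have "\<dots> = - (LINT x|lebesgue_on \<Omega>. \<phi> x *\<^sub>R G x + c *\<^sub>R (\<phi> x *\<^sub>R H x))"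
  using iu iv by (simp del: scaleR_scaleR)
 finally show "(LINT x|lebesgue_on \<Omega>. (u x + c * v x) *\<^sub>R D x) = - (LINT x|lebesgue_on \<Omega>. \<phi> x *\<^sub>R (G x + c *\<^sub>R H x))"
  by (simp add: algebra_simps)
qed

lemma weak_gradient_subset:
 assumes v: "weak_gradient \<Omega> v G" and \<Omega>: "\<Omega> \<in> sets lebesgue" "\<Omega>' \<in> sets lebesgue" "\<Omega>' \<subseteq> \<Omega>"
 shows "weak_gradient \<Omega>' v G"
 unfolding weak_gradient_def
proof (intro conjI allI impI)
 fix K assume "compact K \<and> K \<subseteq> \<Omega>'"
 thus "integrable (lebesgue_on K) v" "integrable (lebesgue_on K) G"
  using weak_gradientD(1,2)[OF v, of K] \<Omega>(3) by auto
next
 fix \<phi> D assume t: "C1_test \<Omega>' \<phi> D"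
 hence t': "C1_test \<Omega> \<phi> D" using \<Omega> by (auto simp: C1_test_def)
 have z: "\<phi> x = 0" "D x = 0" if "x \<notin> \<Omega>'" for x
  by (rule C1_test_support[OF t], use that in blast)+
 have "(LINT x|lebesgue_on \<Omega>'. v x *\<^sub>R D x) = (LINT x|lebesgue_on \<Omega>. v x *\<^sub>R D x)"
  "(LINT x|lebesgue_on \<Omega>'. \<phi> x *\<^sub>R G x) = (LINT x|lebesgue_on \<Omega>. \<phi> x *\<^sub>R G x)"
  by (rule integral_lebesgue_on_support[OF \<Omega>(2,1,3)], simp add: z)+
 thus "(LINT x|lebesgue_on \<Omega>'. v x *\<^sub>R D x) = - (LINT x|lebesgue_on \<Omega>'. \<phi> x *\<^sub>R G x)"
  using weak_gradientD(3)[OF v t'] by simp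
qed

text \<open>Through this the cut-off functions of polytopes serve for boxes as well.\<close>

lemma box_as_polytope:
 fixes a b :: "'a::euclidean_space"
 defines "n \<equiv> \<lambda>(e, s). if s then e else - e" and "c \<equiv> \<lambda>(e, s). if s then b \<bullet> e else - (a \<bullet> e)"
 shows "{x. \<forall>i\<in>Basis \<times> (UNIV :: bool set). n i \<bullet> x < c i} = box a b"
  "{x. \<forall>i\<in>Basis \<times> (UNIV :: bool set). n i \<bullet> x \<le> c i} = cbox a b"
 by (auto simp: n_def c_def box_def cbox_def inner_commute UNIV_bool)

text \<open>Both gradients give the same integral against the cut-off functions of the box, which converge to its indicator function.\<close>

lemma weak_gradient_integral_box:
 fixes \<Omega> :: "'a::euclidean_space set"
 assumes G: "weak_gradient \<Omega> v G" "weak_gradient \<Omega> v G'" and \<Omega>: "\<Omega> \<in> sets lebesgue" and ab: "cbox a b \<subseteq> \<Omega>"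
 shows "(LINT x|lebesgue. ind (box a b) x *\<^sub>R (G x - G' x)) = 0"
proof -
 define n :: "'a \<times> bool \<Rightarrow> 'a" where "n = (\<lambda>(e, s). if s then e else - e)"
 define c :: "'a \<times> bool \<Rightarrow> real" where "c = (\<lambda>(e, s). if s then b \<bullet> e else - (a \<bullet> e))"
 define I where "I = (Basis :: 'a set) \<times> (UNIV :: bool set)"
 have bx: "{x. \<forall>i\<in>I. n i \<bullet> x < c i} = box a b" "{x. \<forall>i\<in>I. n i \<bullet> x \<le> c i} = cbox a b"
  using box_as_polytope[of b a] by (simp_all add: n_def c_def I_def)
 have I: "finite I" by (simp add: I_def)
 define d where "d k = 1 / (real k + 1)" for k
 have d: "d k > 0" "d \<longlonglongrightarrow> 0" for k
  unfolding d_def using LIMSEQ_inverse_real_of_nat by (auto simp: inverse_eq_divide add.commute)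
 define \<phi> where "\<phi> k = polytope_cutoff I n c (d k)" for k
 let ?H = "\<lambda>x. G x - G' x"
 let ?E = "\<lambda>x. ind (cbox a b) x *\<^sub>R ?H x"
 have int: "integrable (lebesgue_on (cbox a b)) ?H"
  using weak_gradientD(2)[OF G(1) _ ab] weak_gradientD(2)[OF G(2) _ ab] by simp
 hence intb: "integrable lebesgue (\<lambda>x. ?E x)"
  by (simp add: integrable_restrict_space)
 have zout: "\<phi> k x = 0" if "x \<notin> box a b" for k x
 proof (rule ccontr)
  assume "\<phi> k x \<noteq> 0"
  hence "\<forall>i\<in>I. n i \<bullet> x \<le> c i - d k"
   unfolding \<phi>_def using polytope_cutoff_support[OF _ I d(1)] by blast
  thus False using that d(1)[of k] bx(1) by force
 qed
 have t: "C1_test \<Omega> (\<phi> k) (polytope_cutoff_grad I n c (d k))" for k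
  using C1_test_polytope_cutoff[OF I d(1), of "\<lambda>x. 1" "\<lambda>x. 0" n c \<Omega> k] bx ab box_subset_cbox[of a b]
  by (auto simp: GDERIV_const \<phi>_def)
 have zero: "(LINT x|lebesgue. \<phi> k x *\<^sub>R (?E x)) = 0" for k
 proof -
  have "(LINT x|lebesgue. \<phi> k x *\<^sub>R (?E x))
    = (LINT x|lebesgue. ind \<Omega> x *\<^sub>R (\<phi> k x *\<^sub>R ?H x))"
  proof (intro LINT_cong refl)
   fix x
   show "\<phi> k x *\<^sub>R (?E x) = ind \<Omega> x *\<^sub>R (\<phi> k x *\<^sub>R ?H x)"
   proof (cases "x \<in> box a b")
    case True
    hence "x \<in> cbox a b" using box_subset_cbox by blast
    moreover from this have "x \<in> \<Omega>" using ab by blast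
    ultimately show ?thesis by simp
   next
    case False
    thus ?thesis using zout[OF False, of k] by simp
   qed
  qed
  also have "\<dots> = (LINT x|lebesgue_on \<Omega>. \<phi> k x *\<^sub>R ?H x)"
   using \<Omega> by (simp add: integral_restrict_space)
  also have "\<dots> = (LINT x|lebesgue_on \<Omega>. \<phi> k x *\<^sub>R G x) - (LINT x|lebesgue_on \<Omega>. \<phi> k x *\<^sub>R G' x)"
   using weak_gradient_test_integrable(2)[OF G(1) t \<Omega>] weak_gradient_test_integrable(2)[OF G(2) t \<Omega>]
   by (simp add: scaleR_diff_right)
  also have "\<dots> = 0"
  proof -
   have "- (LINT x|lebesgue_on \<Omega>. \<phi> k x *\<^sub>R G x) = - (LINT x|lebesgue_on \<Omega>. \<phi> k x *\<^sub>R G' x)"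
    using weak_gradientD(3)[OF G(1) t] weak_gradientD(3)[OF G(2) t] by metis
   thus ?thesis by simp
  qed
  finally show ?thesis .
 qed
 have "(\<lambda>k. \<integral>x. \<phi> k x *\<^sub>R (?E x) \<partial>lebesgue)
   \<longlonglongrightarrow> (LINT x|lebesgue. ind (box a b) x *\<^sub>R (?E x))"
 proof (rule integral_dominated_convergence[where w = "\<lambda>x. norm (?E x)"])
  have m\<phi>: "\<phi> k \<in> borel_measurable lebesgue" for k
   unfolding \<phi>_def by (intro measurable_completion) simp
  note mH = borel_measurable_integrable[OF intb]
  show "(\<lambda>x. ind (box a b) x *\<^sub>R (?E x)) \<in> borel_measurable lebesgue"
   by (rule borel_measurable_scaleR[OF borel_measurable_indicator mH]) simp
  show "(\<lambda>x. \<phi> k x *\<^sub>R (?E x)) \<in> borel_measurable lebesgue" for k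
   by (rule borel_measurable_scaleR[OF m\<phi> mH])
  show "AE x in lebesgue. (\<lambda>k. \<phi> k x *\<^sub>R (?E x))
   \<longlonglongrightarrow> ind (box a b) x *\<^sub>R (?E x)"
   using polytope_cutoff_tendsto[OF I d, of n c] unfolding bx \<phi>_def
   by (intro AE_I2 tendsto_intros)
  show "AE x in lebesgue. norm (\<phi> k x *\<^sub>R (?E x))
    \<le> norm (?E x)" for k
  proof (intro AE_I2)
   fix x
   have "norm (\<phi> k x *\<^sub>R y) \<le> norm y" for y :: 'a
   proof -
    have "norm (\<phi> k x *\<^sub>R y) = \<phi> k x * norm y" by (simp add: \<phi>_def polytope_cutoff_bounds(1))
    also have "\<dots> \<le> 1 * norm y"
     unfolding \<phi>_def by (rule mult_right_mono[OF polytope_cutoff_bounds(2) norm_ge_zero])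
    finally show ?thesis by simp
   qed
   thus "norm (\<phi> k x *\<^sub>R (?E x)) \<le> norm (?E x)" .
  qed
 qed (use intb in \<open>rule integrable_norm\<close>)
 hence "(LINT x|lebesgue. ind (box a b) x *\<^sub>R (?E x)) = 0"
  unfolding zero by (simp add: LIMSEQ_const_iff)
 also have "(\<lambda>x. ind (box a b) x *\<^sub>R (?E x)) = (\<lambda>x. ind (box a b) x *\<^sub>R ?H x)"
  using box_subset_cbox[of a b] by (auto simp: indicator_def fun_eq_iff)
 finally show ?thesis .
qed

text \<open>An open set is a countable union of closed boxes; on each of them the components of \<open>G - G'\<close> have vanishing integrals
over all smaller boxes.\<close>

lemma weak_gradient_unique:
 fixes \<Omega> :: "'a::euclidean_space set"
 assumes \<Omega>: "open \<Omega>" and G: "weak_gradient \<Omega> v G" "weak_gradient \<Omega> v G'"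
 shows "AE x in lebesgue_on \<Omega>. G x = G' x"
proof -
 have \<Omega>m: "\<Omega> \<in> sets lebesgue" using \<Omega> by simp
 let ?H = "\<lambda>x. G x - G' x"
 have box0: "AE x in lebesgue. x \<in> cbox a b \<longrightarrow> G x = G' x" if ab: "cbox a b \<subseteq> \<Omega>" for a b
 proof -
  have int: "integrable (lebesgue_on (cbox a b)) ?H"
   using weak_gradientD(2)[OF G(1) _ ab] weak_gradientD(2)[OF G(2) _ ab] by simp
  hence intc: "integrable lebesgue (\<lambda>x. ind (cbox a b) x *\<^sub>R ?H x)"
   by (simp add: integrable_restrict_space)
  have "integrable lebesgue (\<lambda>x. ind (box a b) x *\<^sub>R (ind (cbox a b) x *\<^sub>R ?H x))"
   by (rule integrable_mult_indicator[OF _ intc]) simp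
  also have "(\<lambda>x. ind (box a b) x *\<^sub>R (ind (cbox a b) x *\<^sub>R ?H x)) = (\<lambda>x. ind (box a b) x *\<^sub>R ?H x)"
   using box_subset_cbox[of a b] by (auto simp: indicator_def fun_eq_iff)
  finally have intb: "integrable lebesgue (\<lambda>x. ind (box a b) x *\<^sub>R ?H x)" .
  have comp: "AE x in lebesgue. (ind (box a b) x *\<^sub>R ?H x) \<bullet> e = 0" for e
  proof (rule zero_on_boxes_imp_AE_zero)
   show "integrable lebesgue (\<lambda>x. (ind (box a b) x *\<^sub>R ?H x) \<bullet> e)" by (rule integrable_inner_left[OF intb])
   show "(LINT x|lebesgue. (ind (box a b) x *\<^sub>R ?H x) \<bullet> e) = 0"
    using intb weak_gradient_integral_box[OF G \<Omega>m ab] by (subst integral_inner_left) auto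
   fix a' b' :: 'a
   let ?a = "\<Sum>i\<in>Basis. max (a' \<bullet> i) (a \<bullet> i) *\<^sub>R i" and ?b = "\<Sum>i\<in>Basis. min (b' \<bullet> i) (b \<bullet> i) *\<^sub>R i"
   have bb: "box a' b' \<inter> box a b = box ?a ?b" "cbox ?a ?b \<subseteq> cbox a b"
    unfolding box_Int_box[of a' b' a b] Int_interval[of a' b' a b, symmetric] by auto
   have "(\<integral>x\<in>box a' b'. (ind (box a b) x *\<^sub>R ?H x) \<bullet> e \<partial>lebesgue)
     = (LINT x|lebesgue. (ind (box a' b' \<inter> box a b) x *\<^sub>R ?H x) \<bullet> e)"
    unfolding set_lebesgue_integral_def
    by (intro LINT_cong) (auto simp: indicator_def)
   also have "\<dots> = 0"
   proof -
    have "integrable lebesgue (\<lambda>x. ind (box a' b') x *\<^sub>R (ind (box a b) x *\<^sub>R ?H x))"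
     by (rule integrable_mult_indicator[OF _ intb]) simp
    hence "integrable lebesgue (\<lambda>x. ind (box a' b' \<inter> box a b) x *\<^sub>R ?H x)"
     by (simp add: indicator_inter_arith)
    thus ?thesis
     using weak_gradient_integral_box[OF G \<Omega>m order_trans[OF bb(2) ab]]
     unfolding bb(1) by (subst integral_inner_left) auto
   qed
   finally show "(\<integral>x\<in>box a' b'. (ind (box a b) x *\<^sub>R ?H x) \<bullet> e \<partial>lebesgue) = 0" .
  qed
  have "AE x in lebesgue. \<forall>e\<in>Basis. (ind (box a b) x *\<^sub>R ?H x) \<bullet> e = 0"
   by (rule AE_finite_allI[OF finite_Basis comp])
  moreover have "AE x in lebesgue. x \<notin> cbox a b - box a b"
   using negligible_frontier_interval[of a b] by (intro AE_not_in) (simp add: negligible_iff_null_sets)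
  ultimately show ?thesis
  proof eventually_elim
   case (elim x)
   thus ?case by (auto simp: euclidean_eq_iff[where 'a='a] inner_diff_left)
  qed
 qed
 obtain \<D> where D: "countable \<D>" "\<And>X. X \<in> \<D> \<Longrightarrow> X \<subseteq> \<Omega>" "\<And>X. X \<in> \<D> \<Longrightarrow> \<exists>a b. X = cbox a b" "\<Union>\<D> = \<Omega>"
  by (rule open_countable_Union_open_cbox[OF \<Omega>]) blast
 have "AE x in lebesgue. \<forall>X\<in>\<D>. x \<in> X \<longrightarrow> G x = G' x"
  unfolding AE_ball_countable[OF D(1)] using D(2,3) box0 by blast
 hence "AE x in lebesgue. x \<in> \<Omega> \<longrightarrow> G x = G' x"
  by eventually_elim (use D(4) in auto)
 thus ?thesis using \<Omega>m by (simp add: AE_restrict_space_iff)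
qed

lemma wgrad_eq:
 assumes "open \<Omega>" "weak_gradient \<Omega> v G"
 shows "AE x in lebesgue_on \<Omega>. wgrad \<Omega> v x = G x"
 using weak_gradient_unique[OF assms(1) _ assms(2)] someI[of "weak_gradient \<Omega> v", OF assms(2)]
 by (auto simp: wgrad_def)

lemma weak_gradient_wgrad:
 assumes "weak_gradient \<Omega> v G" shows "weak_gradient \<Omega> v (wgrad \<Omega> v)"
 using someI[of "weak_gradient \<Omega> v", OF assms] by (simp add: wgrad_def)

lemma integrable_indicator_bounded:
 fixes S :: "'a::euclidean_space set" and B :: real
 assumes "bounded S" "S \<in> sets borel"
 shows "integrable lborel (\<lambda>x. ind S x * B)"
 using emeasure_bounded_finite[OF assms(1)] assms(2)
 by (intro integrable_mult_left integrable_real_indicator) simp_all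

section \<open>Weak gradients of Lipschitz functions\<close>

lemma GDERIV_directional_limit:
 fixes v :: "'a::euclidean_space \<Rightarrow> real"
 assumes D: "GDERIV v x :> D"
 shows "(\<lambda>h. (v (x + h *\<^sub>R e) - v x) / h) \<midarrow>0\<rightarrow> D \<bullet> e"
proof -
 have "(v has_derivative (\<lambda>h. h \<bullet> D)) (at x)" using D by (simp add: gderiv_def)
 moreover have "((\<lambda>t. x + t *\<^sub>R e) has_derivative (\<lambda>t. t *\<^sub>R e)) (at 0)"
  by (auto intro!: derivative_eq_intros)
 ultimately have "((\<lambda>t. v (x + t *\<^sub>R e)) has_derivative (\<lambda>t. (t *\<^sub>R e) \<bullet> D)) (at 0)"
  using has_derivative_compose[of "\<lambda>t. x + t *\<^sub>R e" "\<lambda>t. t *\<^sub>R e" 0 UNIV v "\<lambda>h. h \<bullet> D"] by simp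
 moreover have "(\<lambda>t. (t *\<^sub>R e) \<bullet> D) = (*) (D \<bullet> e)" by (auto simp: inner_commute mult.commute)
 ultimately have "((\<lambda>t. v (x + t *\<^sub>R e)) has_real_derivative (D \<bullet> e)) (at 0)"
  by (simp add: has_field_derivative_def)
 thus ?thesis by (simp add: DERIV_def)
qed

text \<open>Difference quotients have integral zero by translation invariance; they are bounded by the Lipschitz constant and
converge to the directional derivative off \<open>N\<close>.\<close>

lemma integral_gradient_zero:
 fixes u :: "'a::euclidean_space \<Rightarrow> real"
 assumes lip: "L-lipschitz_on UNIV u" and supp: "\<And>x. x \<notin> ball 0 R \<Longrightarrow> u x = 0" and N: "negligible N"
  and D: "\<And>x. x \<notin> N \<Longrightarrow> GDERIV u x :> D x" "D \<in> borel_measurable borel"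
 shows "(LINT x|lborel. D x) = 0"
proof -
 have L: "L \<ge> 0" using lip by (rule lipschitz_on_nonneg)
 have [measurable]: "u \<in> borel_measurable borel"
  using lipschitz_on_continuous_on[OF lip] by (rule borel_measurable_continuous_onI)
 note D(2)[measurable]
 have cu: "continuous_on (cball 0 R) u"
  by (rule continuous_on_subset[OF lipschitz_on_continuous_on[OF lip] subset_UNIV])
 obtain B where B: "B > 0" "\<And>x. x \<in> cball 0 R \<Longrightarrow> norm (u x) \<le> B"
  by (rule compact_continuous_bound[OF compact_cball cu]) blast
 have intu: "integrable lborel u"
 proof (rule integrable_dominated)
  show "integrable lborel (\<lambda>x. ind (cball 0 R) x * B)"
   by (rule integrable_indicator_bounded) auto
  show "AE x in lborel. norm (u x) \<le> norm (ind (cball 0 R) x * B)"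
  proof (intro AE_I2)
   fix x show "norm (u x) \<le> norm (ind (cball 0 R) x * B)"
    using B(1) B(2)[of x] supp[of x] by (cases "x \<in> cball 0 R") auto
  qed
 qed simp
 have AEN: "AE x in lborel. x \<notin> N"
 proof -
  have "AE x in lebesgue. x \<notin> N" using N by (intro AE_not_in) (simp add: negligible_iff_null_sets)
  thus ?thesis by (simp add: AE_completion_iff)
 qed
 have dom: "integrable lborel (\<lambda>x. ind (cball 0 (R + 1) :: 'a set) x * L)"
  by (rule integrable_indicator_bounded) auto
 have comp: "integrable lborel (\<lambda>x. D x \<bullet> e)" "(LINT x|lborel. D x \<bullet> e) = 0" if e: "e \<in> Basis" for e
 proof -
  define q where "q k x = (u (x + (1 / (real k + 1)) *\<^sub>R e) - u x) * (real k + 1)" for k x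
  have norme: "norm e = 1" using e by simp
  have tr: "integrable lborel (\<lambda>x. u (x + v))" "(LINT x|lborel. u (x + v)) = (LINT x|lborel. u x)" for v
  proof -
   have *: "distr lborel borel ((+) v) = (lborel :: 'a measure)" by (rule lborel_distr_plus)
   show "(LINT x|lborel. u (x + v)) = (LINT x|lborel. u x)"
    by (subst (2) *[symmetric]) (simp add: integral_distr add.commute)
   have "integrable (distr lborel borel ((+) v)) u" using intu * by simp
   thus "integrable lborel (\<lambda>x. u (x + v))" by (simp add: integrable_distr_eq add.commute)
  qed
  have q0: "(LINT x|lborel. q k x) = 0" for k
   unfolding q_def using tr[of "(1 / (real k + 1)) *\<^sub>R e"] intu by simp
  have bnd: "norm (q k x) \<le> ind (cball 0 (R + 1)) x * L" for k x
  proof (cases "x \<in> cball 0 (R + 1)")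
   case True
   have "\<bar>u (x + (1 / (real k + 1)) *\<^sub>R e) - u x\<bar> \<le> L * norm ((1 / (real k + 1)) *\<^sub>R e)"
    using lipschitz_onD[OF lip, of "x + (1 / (real k + 1)) *\<^sub>R e" x] by (simp add: dist_norm)
   also have "\<dots> = L / (real k + 1)" using norme by simp
   finally have "\<bar>u (x + (1 / (real k + 1)) *\<^sub>R e) - u x\<bar> * (real k + 1) \<le> L"
    by (simp add: pos_le_divide_eq)
   thus ?thesis using True unfolding q_def by (simp add: abs_mult)
  next
   case False
   hence x: "norm x > R + 1" by simp
   have "norm x \<le> norm (x + (1 / (real k + 1)) *\<^sub>R e) + norm ((1 / (real k + 1)) *\<^sub>R e)"
    using norm_triangle_ineq4[of "x + (1 / (real k + 1)) *\<^sub>R e" "(1 / (real k + 1)) *\<^sub>R e"] by simp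
   also have "norm ((1 / (real k + 1)) *\<^sub>R e) \<le> 1" using norme by simp
   finally have "u (x + (1 / (real k + 1)) *\<^sub>R e) = 0" "u x = 0" using x by (auto intro!: supp)
   thus ?thesis using False by (simp add: q_def)
  qed
  have lim: "(\<lambda>k. q k x) \<longlonglongrightarrow> D x \<bullet> e" if "x \<notin> N" for x
  proof -
   have "(\<lambda>h. (u (x + h *\<^sub>R e) - u x) / h) \<midarrow>0\<rightarrow> D x \<bullet> e"
    by (rule GDERIV_directional_limit[OF D(1)[OF that]])
   moreover have "filterlim (\<lambda>k. 1 / (real k + 1)) (at 0) sequentially"
    using LIMSEQ_inverse_real_of_nat by (auto simp: filterlim_at inverse_eq_divide add.commute)
   ultimately have "(\<lambda>k. (u (x + (1 / (real k + 1)) *\<^sub>R e) - u x) / (1 / (real k + 1))) \<longlonglongrightarrow> D x \<bullet> e"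
    by (rule filterlim_compose)
   thus ?thesis by (simp add: q_def[abs_def])
  qed
  have mq: "q k \<in> borel_measurable lborel" for k unfolding q_def by measurable
  have AElim: "AE x in lborel. (\<lambda>k. q k x) \<longlonglongrightarrow> D x \<bullet> e" using AEN by eventually_elim (rule lim)
  show "integrable lborel (\<lambda>x. D x \<bullet> e)"
   by (rule integrable_dominated_convergence[of "\<lambda>x. D x \<bullet> e" lborel q, OF _ mq dom AElim]) (use bnd in auto)
  have "(\<lambda>k. \<integral>x. q k x \<partial>lborel) \<longlonglongrightarrow> (LINT x|lborel. D x \<bullet> e)"
   by (rule integral_dominated_convergence[OF _ mq dom AElim]) (use bnd in auto)
  thus "(LINT x|lborel. D x \<bullet> e) = 0" unfolding q0 by (simp add: LIMSEQ_const_iff)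
 qed
 show ?thesis
 proof (cases "integrable lborel D")
  case True
  show ?thesis
   by (rule euclidean_eqI) (use True comp(2) in \<open>simp flip: integral_inner_left\<close>)
 qed (rule not_integrable_integral_eq)
qed

lemma C1_test_lipschitz:
 fixes \<phi> :: "'a::euclidean_space \<Rightarrow> real"
 assumes t: "C1_test \<Omega> \<phi> D" and B: "\<And>x. norm (D x) \<le> B"
 shows "B-lipschitz_on UNIV \<phi>"
proof (rule bounded_derivative_imp_lipschitz)
 show "(\<phi> has_derivative (\<lambda>h. h \<bullet> D x)) (at x within UNIV)" for x
  using t by (simp add: C1_test_def gderiv_def)
 show "onorm (\<lambda>h. h \<bullet> D x) \<le> B" for x
 proof (rule onorm_le)
  fix h
  have "\<bar>h \<bullet> D x\<bar> \<le> norm h * norm (D x)" by (rule Cauchy_Schwarz_ineq2)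
  also have "\<dots> \<le> norm h * B" by (rule mult_left_mono[OF B norm_ge_zero])
  finally show "norm (h \<bullet> D x) \<le> B * norm h" by (simp add: mult.commute)
 qed
 show "0 \<le> B" using B[of 0] norm_ge_zero order_trans by blast
qed simp

lemma lipschitz_gradient_bound:
 fixes v :: "'a::euclidean_space \<Rightarrow> real"
 assumes lip: "L-lipschitz_on UNIV v" and D: "GDERIV v x :> D"
 shows "norm D \<le> L"
proof -
 have L: "L \<ge> 0" using lip by (rule lipschitz_on_nonneg)
 have lim: "(\<lambda>h. (v (x + h *\<^sub>R D) - v x) / h) \<midarrow>0\<rightarrow> D \<bullet> D"
  by (rule GDERIV_directional_limit[OF D])
 have "D \<bullet> D \<le> L * norm D"
 proof (rule tendsto_upperbound[OF lim])
  show "\<forall>\<^sub>F h in at 0. (v (x + h *\<^sub>R D) - v x) / h \<le> L * norm D"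
  proof (rule eventually_at_filter[THEN iffD2], rule always_eventually, intro allI impI)
   fix h :: real assume "h \<noteq> 0"
   have "\<bar>v (x + h *\<^sub>R D) - v x\<bar> \<le> L * norm (h *\<^sub>R D)"
    using lipschitz_onD[OF lip, of "x + h *\<^sub>R D" x] by (simp add: dist_norm)
   hence "\<bar>(v (x + h *\<^sub>R D) - v x) / h\<bar> \<le> L * norm D" using \<open>h \<noteq> 0\<close> by (simp add: field_simps)
   thus "(v (x + h *\<^sub>R D) - v x) / h \<le> L * norm D" by linarith
  qed
 qed simp
 hence "norm D * norm D \<le> L * norm D" by (simp add: power2_norm_eq_inner[symmetric] power2_eq_square)
 thus ?thesis using L by (cases "norm D = 0") auto
qed

text \<open>Integration by parts is \<open>integral_gradient_zero\<close> for the product of \<open>v\<close> with a test function. For a bubble function the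
exceptional set \<open>N\<close> is the boundary of a simplex.\<close>

lemma weak_gradient_lipschitz:
 fixes v :: "'a::euclidean_space \<Rightarrow> real"
 assumes lip: "L-lipschitz_on UNIV v" and N: "negligible N"
  and D: "\<And>x. x \<notin> N \<Longrightarrow> GDERIV v x :> D x" "D \<in> borel_measurable borel" and \<Omega>: "\<Omega> \<in> sets lebesgue"
 shows "weak_gradient \<Omega> v D"
 unfolding weak_gradient_def
proof (intro conjI allI impI)
 have contv: "continuous_on UNIV v" by (rule lipschitz_on_continuous_on[OF lip])
 have [measurable]: "v \<in> borel_measurable borel" using contv by (rule borel_measurable_continuous_onI)
 note D(2)[measurable]
 have AEN: "AE x in lebesgue. x \<notin> N" using N by (intro AE_not_in) (simp add: negligible_iff_null_sets)
 {
  fix K assume "compact K \<and> K \<subseteq> \<Omega>"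
  hence K: "compact K" by simp
  have fin: "finite_measure (lebesgue_on K)" using K by (intro finite_measure_lebesgue_on lmeasurable_compact)
  obtain B where B: "B > 0" "\<And>x. x \<in> K \<Longrightarrow> norm (v x) \<le> B"
   by (rule compact_continuous_bound[OF K continuous_on_subset[OF contv subset_UNIV]]) blast
  have "v \<in> borel_measurable (lebesgue_on K)"
   by (intro measurable_restrict_space1 measurable_completion) simp
  thus "integrable (lebesgue_on K) v"
   by (intro finite_measure.integrable_const_bound[OF fin, of _ B] AE_I2) (simp_all add: B(2)[unfolded real_norm_def])
  note fin
  thus "integrable (lebesgue_on K) D"
  proof (rule finite_measure.integrable_const_bound[where B = L])
   have "AE x in lebesgue. norm (D x) \<le> L"
    using AEN by eventually_elim (use lipschitz_gradient_bound[OF lip D(1)] in auto)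
   thus "AE x in lebesgue_on K. norm (D x) \<le> L"
    using borel_compact[OF K] by (subst AE_restrict_space_iff) (auto elim: AE_mp)
   show "D \<in> borel_measurable (lebesgue_on K)" using D(2)
    by (intro measurable_restrict_space1 measurable_completion) simp
  qed
 }
 fix \<phi> E assume t: "C1_test \<Omega> \<phi> E"
 obtain B where B: "B > 0" "\<And>x. \<bar>\<phi> x\<bar> \<le> B" "\<And>x. norm (E x) \<le> B" by (rule C1_test_bounded[OF t]) blast
 have lip\<phi>: "B-lipschitz_on UNIV \<phi>" by (rule C1_test_lipschitz[OF t B(3)])
 obtain K where K: "compact K" "K \<subseteq> \<Omega>" "\<And>x. x \<notin> K \<Longrightarrow> \<phi> x = 0" "\<And>x. x \<notin> K \<Longrightarrow> E x = 0"
  by (rule C1_test_support[OF t]) blast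
 have Kb: "K \<in> sets borel" using K(1) by (rule borel_compact)
 have [measurable]: "\<phi> \<in> borel_measurable borel" "E \<in> borel_measurable borel"
  using t C1_test_continuous[OF t] by (auto intro!: borel_measurable_continuous_onI simp: C1_test_def)
 obtain R where R: "\<And>x. x \<in> K \<Longrightarrow> norm x < R" using compact_imp_bounded[OF K(1)] by (auto simp: bounded_pos_less)
 obtain M where M: "M > 0" "\<And>x. x \<in> K \<Longrightarrow> norm (v x) \<le> M"
  by (rule compact_continuous_bound[OF K(1) continuous_on_subset[OF contv]]) auto
 have L: "L \<ge> 0" using lip by (rule lipschitz_on_nonneg)
 have est: "\<bar>v x * \<phi> x - v y * \<phi> y\<bar> \<le> (M * B + B * L) * dist x y" if "x \<in> K" for x y
 proof -
  have "\<bar>v x * \<phi> x - v y * \<phi> y\<bar> = \<bar>v x * (\<phi> x - \<phi> y) + \<phi> y * (v x - v y)\<bar>" by (simp add: algebra_simps)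
  also have "\<dots> \<le> \<bar>v x\<bar> * \<bar>\<phi> x - \<phi> y\<bar> + \<bar>\<phi> y\<bar> * \<bar>v x - v y\<bar>" by (metis abs_mult abs_triangle_ineq)
  also have "\<dots> \<le> M * (B * dist x y) + B * (L * dist x y)"
   using M B(2)[of y] B(1) L that lipschitz_onD[OF lip, of x y] lipschitz_onD[OF lip\<phi>, of x y]
   by (intro add_mono mult_mono) (auto simp: dist_real_def)
  finally show ?thesis by (simp add: algebra_simps)
 qed
 have lipu: "(M * B + B * L)-lipschitz_on UNIV (\<lambda>x. v x * \<phi> x)"
 proof (rule lipschitz_onI)
  fix x y
  show "dist (v x * \<phi> x) (v y * \<phi> y) \<le> (M * B + B * L) * dist x y"
  proof (cases "x \<in> K \<or> y \<in> K")
   case True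
   thus ?thesis using est[of x y] est[of y x] by (auto simp: dist_real_def dist_commute abs_minus_commute)
  next
   case False
   thus ?thesis using K(3) M B L by auto
  qed
 qed (use M B L in auto)
 have "(LINT x|lborel. v x *\<^sub>R E x + \<phi> x *\<^sub>R D x) = 0"
 proof (rule integral_gradient_zero[OF lipu _ N])
  show "v x * \<phi> x = 0" if "x \<notin> ball 0 R" for x using K(3)[of x] R[of x] that by auto
  show "GDERIV (\<lambda>x. v x * \<phi> x) x :> v x *\<^sub>R E x + \<phi> x *\<^sub>R D x" if "x \<notin> N" for x
   by (rule GDERIV_mult[OF D(1)[OF that]]) (use t in \<open>simp add: C1_test_def\<close>)
 qed measurable
 moreover have "integrable lborel (\<lambda>x. v x *\<^sub>R E x)"
 proof (rule integrable_dominated[of _ "\<lambda>x. ind K x * (M * B)"])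
  show "integrable lborel (\<lambda>x. ind K x * (M * B))"
   by (rule integrable_indicator_bounded[OF compact_imp_bounded[OF K(1)] Kb])
  show "AE x in lborel. norm (v x *\<^sub>R E x) \<le> norm (ind K x * (M * B))"
  proof (intro AE_I2)
   fix x show "norm (v x *\<^sub>R E x) \<le> norm (ind K x * (M * B))"
    using M B K(4)[of x] by (cases "x \<in> K") (auto simp: abs_mult intro!: mult_mono)
  qed
 qed measurable
 moreover have "integrable lborel (\<lambda>x. \<phi> x *\<^sub>R D x)"
 proof (rule integrable_dominated[of _ "\<lambda>x. ind K x * (B * L)"])
  show "integrable lborel (\<lambda>x. ind K x * (B * L))"
   by (rule integrable_indicator_bounded[OF compact_imp_bounded[OF K(1)] Kb])
  have "AE x in lborel. x \<notin> N" using AEN by (simp add: AE_completion_iff)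
  thus "AE x in lborel. norm (\<phi> x *\<^sub>R D x) \<le> norm (ind K x * (B * L))"
  proof eventually_elim
   fix x assume "x \<notin> N"
   thus "norm (\<phi> x *\<^sub>R D x) \<le> norm (ind K x * (B * L))"
    using M B L K(3)[of x] lipschitz_gradient_bound[OF lip D(1)[of x]]
    by (cases "x \<in> K") (auto simp: abs_mult intro!: mult_mono)
  qed
 qed measurable
 ultimately have "(LINT x|lborel. v x *\<^sub>R E x) + (LINT x|lborel. \<phi> x *\<^sub>R D x) = 0"
  by (simp add: Bochner_Integration.integral_add)
 moreover have "(LINT x|lebesgue_on \<Omega>. v x *\<^sub>R E x) = (LINT x|lborel. v x *\<^sub>R E x)"
  by (rule integral_lebesgue_on_eq_lborel[OF \<Omega>]) (use K(2,3,4) in auto)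
 moreover have "(LINT x|lebesgue_on \<Omega>. \<phi> x *\<^sub>R D x) = (LINT x|lborel. \<phi> x *\<^sub>R D x)"
  by (rule integral_lebesgue_on_eq_lborel[OF \<Omega>]) (use K(2,3,4) in auto)
 ultimately show "(LINT x|lebesgue_on \<Omega>. v x *\<^sub>R E x) = - (LINT x|lebesgue_on \<Omega>. \<phi> x *\<^sub>R D x)"
  by (simp add: eq_neg_iff_add_eq_0)
qed

section \<open>The divergence theorem on polytopes\<close>

abbreviation foot_point :: "'a::euclidean_space \<Rightarrow> real \<Rightarrow> 'a \<Rightarrow> 'a" where
 "foot_point n c x \<equiv> x - (n \<bullet> x - c) *\<^sub>R n"

text \<open>The flux of the vector field \<open>q\<close> through a piece \<open>F\<close> of the plane \<open>n \<bullet> x = c\<close>. The surface integral is written as a volume integral over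
the slab of thickness one around the plane, in which every point carries the value at its foot point. This
makes it a limit of volume integrals over thin strips without reference to a surface measure.\<close>

definition flux :: "'a::euclidean_space set \<Rightarrow> 'a \<Rightarrow> real \<Rightarrow> ('a \<Rightarrow> 'a) \<Rightarrow> real" where
 "flux F n c q = (LINT x|lborel. ind {x. \<bar>n \<bullet> x - c\<bar> < 1/2} x *
   (ind F (foot_point n c x) * (q (foot_point n c x) \<bullet> n)))"

lemma integral_lborel_translation:
 fixes f :: "'a::euclidean_space \<Rightarrow> real"
 assumes "f \<in> borel_measurable borel"
 shows "(LINT x|lborel. f (x + v)) = (LINT x|lborel. f x)"
proof -
 have *: "distr lborel borel ((+) v) = (lborel :: 'a measure)" by (rule lborel_distr_plus)
 show ?thesis
  by (subst (2) *[symmetric]) (simp add: integral_distr assms add.commute)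
qed

text \<open>This moves the mass of a function that lives in a thin strip along the normal, over a slab of thickness one; it is how
integrals over strips are compared with \<open>flux\<close>.\<close>

lemma integral_average_translations:
 fixes f :: "'a::euclidean_space \<Rightarrow> real"
 assumes f[measurable]: "f \<in> borel_measurable borel" and bdd: "\<And>x. \<bar>f x\<bar> \<le> B" and supp: "\<And>x. norm x > R \<Longrightarrow> f x = 0"
  and n: "norm n = 1"
 shows "(LINT x|lborel. f x) = (LINT x|lborel. (LINT t|lborel. ind {-1/2..1/2} t * f (x + t *\<^sub>R n)))"
proof -
 let ?F = "\<lambda>x t. ind {-1/2..1/2::real} t * f (x + t *\<^sub>R n)"
 have B: "B \<ge> 0" using bdd[of 0] by linarith
 have int: "integrable (lborel \<Otimes>\<^sub>M lborel) (case_prod ?F)"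
 proof (rule integrable_dominated)
  have "integrable (lborel :: ('a \<times> real) measure) (\<lambda>z. ind (cball 0 (R + 1) \<times> {-1/2..1/2}) z * B)"
   by (rule integrable_indicator_bounded) (auto intro: bounded_Times borel_closed closed_Times)
  thus "integrable (lborel \<Otimes>\<^sub>M lborel) (\<lambda>z :: 'a \<times> real. ind (cball 0 (R + 1) \<times> {-1/2..1/2}) z * B)"
   by (simp add: lborel_prod)
  show "case_prod ?F \<in> borel_measurable (lborel \<Otimes>\<^sub>M lborel)" by measurable
  show "AE z in lborel \<Otimes>\<^sub>M lborel. norm (case_prod ?F z) \<le> norm (ind (cball 0 (R + 1) \<times> {-1/2..1/2}) z * B)"
  proof (intro AE_I2)
   fix z :: "'a \<times> real"
   obtain x t where z: "z = (x, t)" by (cases z)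
   show "norm (case_prod ?F z) \<le> norm (ind (cball 0 (R + 1) \<times> {-1/2..1/2}) z * B)"
   proof (cases "t \<in> {-1/2..1/2} \<and> norm x \<le> R + 1")
    case True
    thus ?thesis using bdd[of "x + t *\<^sub>R n"] B by (simp add: z)
   next
    case False
    have "f (x + t *\<^sub>R n) = 0" if "t \<in> {-1/2..1/2}" "norm x > R + 1"
    proof (rule supp)
     have "norm x \<le> norm (x + t *\<^sub>R n) + norm (t *\<^sub>R n)" using norm_triangle_ineq4[of "x + t *\<^sub>R n" "t *\<^sub>R n"] by simp
     also have "norm (t *\<^sub>R n) \<le> 1" using that n by auto
     finally show "norm (x + t *\<^sub>R n) > R" using that by simp
    qed
    hence e: "ind {-1/2..1/2} t * f (x + t *\<^sub>R n) = 0"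
     using False by (cases "t \<in> {-1/2..1/2}") auto
    show ?thesis unfolding z prod.case e by simp
   qed
  qed
 qed
 have "(LINT x|lborel. (LINT t|lborel. ?F x t)) = (LINT t|lborel. (LINT x|lborel. ?F x t))"
  by (rule lborel_pair.Fubini_integral[OF int, symmetric])
 also have "\<dots> = (LINT t|lborel. ind {-1/2..1/2::real} t * (LINT x|lborel. f x))"
  by (simp add: integral_lborel_translation)
 also have "\<dots> = (LINT x|lborel. f x)" by simp
 finally show ?thesis by simp
qed

locale polytope =
 fixes I :: "'i set" and n :: "'i \<Rightarrow> 'a::euclidean_space" and c :: "'i \<Rightarrow> real" and T :: "'a set"
 assumes finite_faces: "finite I" and unit: "\<And>i. i \<in> I \<Longrightarrow> norm (n i) = 1"
  and not_parallel: "\<And>i j. i \<in> I \<Longrightarrow> j \<in> I \<Longrightarrow> i \<noteq> j \<Longrightarrow> n i \<noteq> n j \<and> n i \<noteq> - n j"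
  and T_def: "T = {x. \<forall>i\<in>I. n i \<bullet> x \<le> c i}" and bounded_T: "bounded T"
begin

lemma closed_T: "closed T"
proof -
 have "T = (\<Inter>i\<in>I. {x. n i \<bullet> x \<le> c i})" by (auto simp: T_def)
 thus ?thesis by (auto intro!: closed_halfspace_le)
qed

lemma compact_T: "compact T" using closed_T bounded_T by (simp add: compact_eq_bounded_closed)

lemma negligible_boundary: "negligible (T - {x. \<forall>i\<in>I. n i \<bullet> x < c i})"
proof (rule negligible_subset)
 show "negligible (\<Union>i\<in>I. {x. n i \<bullet> x = c i})"
 proof (intro negligible_Union ballI)
  show "finite ((\<lambda>i. {x. n i \<bullet> x = c i}) ` I)" using finite_faces by simp
  fix X assume "X \<in> (\<lambda>i. {x. n i \<bullet> x = c i}) ` I"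
  then obtain i where i: "i \<in> I" "X = {x. n i \<bullet> x = c i}" by auto
  have "n i \<noteq> 0" using unit[OF i(1)] by auto
  thus "negligible X" unfolding i(2) by (intro negligible_hyperplane) simp
 qed
 show "T - {x. \<forall>i\<in>I. n i \<bullet> x < c i} \<subseteq> (\<Union>i\<in>I. {x. n i \<bullet> x = c i})"
  by (force simp: T_def)
qed

text \<open>The foot point on the face \<open>i\<close> lies in the plane of another face only for \<open>x\<close> in a hyperplane: as \<open>n j\<close> is not parallel to
\<open>n i\<close>, the component of \<open>n j\<close> orthogonal to \<open>n i\<close> is not zero.\<close>

lemma negligible_slice:
 assumes i: "i \<in> I" and j: "j \<in> I" "j \<noteq> i"
 shows "negligible {x. n j \<bullet> (x - (n i \<bullet> x - c i) *\<^sub>R n i) = c j}"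
proof -
 define a where "a = n j - (n j \<bullet> n i) *\<^sub>R n i"
 have "a \<noteq> 0"
 proof
  assume "a = 0"
  hence e: "n j = (n j \<bullet> n i) *\<^sub>R n i" by (simp add: a_def)
  hence "norm (n j) = \<bar>n j \<bullet> n i\<bar> * norm (n i)" by (metis norm_scaleR)
  hence "\<bar>n j \<bullet> n i\<bar> = 1" using unit j i by simp
  hence "n j = n i \<or> n j = - n i" using e by (auto simp: abs_if split: if_splits)
  thus False using not_parallel[of j i] i j by auto
 qed
 hence "negligible {x. a \<bullet> x = c j - c i * (n j \<bullet> n i)}" by (intro negligible_hyperplane) simp
 also have "{x. a \<bullet> x = c j - c i * (n j \<bullet> n i)} = {x. n j \<bullet> (x - (n i \<bullet> x - c i) *\<^sub>R n i) = c j}"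
  by (auto simp: a_def inner_diff_left inner_diff_right algebra_simps inner_commute)
 finally show ?thesis .
qed

text \<open>The derivative of the cut-off at the face \<open>i\<close> is an approximate delta function in the distance from this face. After
averaging over translations by \<open>t\<close> along the normal, the substitution \<open>t = c i - n i \<bullet> x - d k s\<close> turns this derivative into
\<open>cutoff' s\<close>, which does not depend on \<open>k\<close>, and dominated convergence applies in \<open>s\<close> and then in \<open>x\<close>. The limit is the integral over the slab that defines the flux.\<close>

lemma strip_limit:
 fixes h :: "'a \<Rightarrow> real"
 assumes i: "i \<in> I" and h: "continuous_on T h" and d: "\<And>k. d k > 0" "d \<longlonglongrightarrow> 0"
 defines "S \<equiv> \<lambda>x. x - (n i \<bullet> x - c i) *\<^sub>R n i"
 shows "(\<lambda>k. \<integral>x. ind T x * h x *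
    (cutoff' ((c i - n i \<bullet> x) / d k) / d k * polytope_cutoff (I - {i}) n c (d k) x) \<partial>lborel)
   \<longlonglongrightarrow> (LINT x|lborel. ind {x. \<bar>n i \<bullet> x - c i\<bar> < 1/2} x * (ind {y\<in>T. n i \<bullet> y = c i} (S x) * h (S x)))"
proof -
 define N C where "N = n i" and "C = c i"
 have N: "norm N = 1" "N \<bullet> N = 1" using unit[OF i] by (auto simp: N_def norm_eq_1)
 have Tb: "T \<in> sets borel" using closed_T by (rule borel_closed)
 obtain B where B: "B > 0" "\<And>x. x \<in> T \<Longrightarrow> norm (h x) \<le> B"
  by (rule compact_continuous_bound[OF compact_T h]) blast
 obtain R where R: "R > 0" "\<And>x. x \<in> T \<Longrightarrow> norm x \<le> R" using bounded_T by (auto simp: bounded_pos)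
 have hT[measurable]: "(\<lambda>x. ind T x * h x) \<in> borel_measurable borel"
  using borel_measurable_continuous_on_indicator[OF Tb h] by simp
 define q where "q k y = ind T y * h y * polytope_cutoff (I - {i}) n c (d k) y" for k y
 have q[measurable]: "q k \<in> borel_measurable borel" for k unfolding q_def by measurable
 have qb: "\<bar>q k y\<bar> \<le> B" for k y
 proof (cases "y \<in> T")
  case True
  hence "\<bar>q k y\<bar> = \<bar>h y\<bar> * polytope_cutoff (I - {i}) n c (d k) y"
   by (simp add: q_def abs_mult polytope_cutoff_bounds(1))
  also have "\<dots> \<le> B * 1" using B(2)[OF True] B(1) polytope_cutoff_bounds
   by (intro mult_mono) auto
  finally show ?thesis by simp
 qed (use B in \<open>simp add: q_def\<close>)
 have q0: "q k y = 0" if "y \<notin> T" for k y using that by (simp add: q_def)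
 let ?Q = "\<lambda>k x s. ind {-1/2..1/2} ((C - N \<bullet> x) - d k * s) * q k (S x - (d k * s) *\<^sub>R N) * cutoff' s"
 define J where "J k x = (LINT s|lborel. ?Q k x s)" for k x
 have S_alt: "S x = x + (C - N \<bullet> x) *\<^sub>R N" for x
  by (simp add: S_def N_def C_def algebra_simps)
 have NS: "N \<bullet> S x = C" for x by (simp add: S_alt inner_add_right N)
 have [measurable]: "S \<in> borel_measurable borel" unfolding S_alt[abs_def] by measurable
 have eqJ: "(LINT x|lborel. ind T x * h x *
    (cutoff' ((c i - n i \<bullet> x) / d k) / d k * polytope_cutoff (I - {i}) n c (d k) x)) = (LINT x|lborel. J k x)" for k
 proof -
  define f where "f x = q k x * (cutoff' ((C - N \<bullet> x) / d k) / d k)" for x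
  have f[measurable]: "f \<in> borel_measurable borel" unfolding f_def by measurable
  have inner: "(LINT t|lborel. ind {-1/2..1/2} t * f (x + t *\<^sub>R N)) = J k x" for x
  proof -
   have "(LINT t|lborel. ind {-1/2..1/2} t * f (x + t *\<^sub>R N))
    = \<bar>- d k\<bar> *\<^sub>R (LINT s|lborel. ind {-1/2..1/2} ((C - N \<bullet> x) + (- d k) * s) * f (x + ((C - N \<bullet> x) + (- d k) * s) *\<^sub>R N))"
    using d(1)[of k] by (intro lborel_integral_real_affine) simp
   also have "\<dots> = (LINT s|lborel. d k * (ind {-1/2..1/2} ((C - N \<bullet> x) + (- d k) * s) * f (x + ((C - N \<bullet> x) + (- d k) * s) *\<^sub>R N)))"
    using d(1)[of k] by simp
   also have "\<dots> = J k x" unfolding J_def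
   proof (intro LINT_cong refl)
    fix s
    have a: "x + ((C - N \<bullet> x) + (- d k) * s) *\<^sub>R N = S x - (d k * s) *\<^sub>R N"
     by (simp add: S_alt algebra_simps)
    have b: "C - N \<bullet> (S x - (d k * s) *\<^sub>R N) = d k * s" by (simp add: inner_diff_right NS N)
    show "d k * (ind {-1/2..1/2} ((C - N \<bullet> x) + (- d k) * s) * f (x + ((C - N \<bullet> x) + (- d k) * s) *\<^sub>R N))
     = ?Q k x s"
     unfolding a f_def b using d(1)[of k] by simp
   qed
   finally show ?thesis .
  qed
  have "(LINT x|lborel. f x) = (LINT x|lborel. (LINT t|lborel. ind {-1/2..1/2} t * f (x + t *\<^sub>R N)))"
  proof (rule integral_average_translations[OF f _ _ N(1)])
   show "\<bar>f x\<bar> \<le> B * (1 / d k)" for x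
    unfolding f_def abs_mult using qb[of k x] cutoff'_bounds[of "(C - N \<bullet> x) / d k"] d(1)[of k] B(1)
    by (intro mult_mono) (auto simp: divide_right_mono)
   show "f x = 0" if "norm x > R" for x using R(2)[of x] that q0[of x k] by (auto simp: f_def)
  qed
  thus ?thesis unfolding inner by (simp add: f_def q_def N_def C_def ac_simps)
 qed
 have Jm: "J k \<in> borel_measurable lborel" for k unfolding J_def[abs_def] by measurable
 have cutb: "norm (?Q k x s) \<le> B * cutoff' s" for k x s
 proof -
  have "\<bar>ind {-1/2..1/2} ((C - N \<bullet> x) - d k * s) * q k (S x - (d k * s) *\<^sub>R N)\<bar> \<le> B"
   using qb[of k "S x - (d k * s) *\<^sub>R N"] B(1) by (simp add: indicator_def)
  from mult_right_mono[OF this cutoff'_bounds(1)[of s]] show ?thesis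
   unfolding real_norm_def abs_mult[of _ "cutoff' s"] by (simp only: abs_of_nonneg[OF cutoff'_bounds(1)])
 qed
 have bndJ: "\<bar>J k x\<bar> \<le> ind (cball 0 (R + 1)) x * B" for k x
 proof (cases "norm x \<le> R + 1")
  case True
  have "\<bar>J k x\<bar> \<le> (LINT s|lborel. B * cutoff' s)" unfolding J_def
  proof (rule integral_abs_bound_integral)
   show "integrable lborel (\<lambda>s. B * cutoff' s)" using integral_cutoff' by simp
   thus "integrable lborel (\<lambda>s. ?Q k x s)"
    by (rule integrable_dominated) (use cutb B(1) cutoff'_bounds in \<open>auto simp: abs_mult\<close>)
  qed (rule cutb[unfolded real_norm_def])
  thus ?thesis using True integral_cutoff' by simp
 next
  case False
  have e: "?Q k x s = 0" for s
  proof (cases "(C - N \<bullet> x) - d k * s \<in> {-1/2..1/2}")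
   case True
   have "x = (S x - (d k * s) *\<^sub>R N) - ((C - N \<bullet> x) - d k * s) *\<^sub>R N" by (simp add: S_alt algebra_simps)
   hence "norm x \<le> norm (S x - (d k * s) *\<^sub>R N) + norm (((C - N \<bullet> x) - d k * s) *\<^sub>R N)"
    by (metis norm_triangle_ineq4)
   also have "norm (((C - N \<bullet> x) - d k * s) *\<^sub>R N) \<le> 1" using True N by auto
   finally have "S x - (d k * s) *\<^sub>R N \<notin> T" using R(2) False by force
   thus ?thesis by (simp add: q0)
  qed simp
  show ?thesis unfolding J_def e using False by simp
 qed
 let ?L = "\<lambda>x. ind {x. \<bar>n i \<bullet> x - c i\<bar> < 1/2} x * (ind {y\<in>T. n i \<bullet> y = c i} (S x) * h (S x))"
 have Leq: "?L x = ind {x. \<bar>n i \<bullet> x - c i\<bar> < 1/2} x * (ind T (S x) * h (S x))" for x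
  using NS[of x] by (simp add: N_def C_def indicator_def)
 have limJ: "(\<lambda>k. J k x) \<longlonglongrightarrow> ?L x"
  if x1: "N \<bullet> x - C \<noteq> 1/2" "N \<bullet> x - C \<noteq> - 1/2" and x2: "\<And>j. j \<in> I - {i} \<Longrightarrow> n j \<bullet> S x \<noteq> c j" for x
 proof -
  have "(\<lambda>k. J k x) \<longlonglongrightarrow> (LINT s|lborel. ?L x * cutoff' s)" unfolding J_def
  proof (rule integral_dominated_convergence[where w = "\<lambda>s. B * cutoff' s"])
   show "integrable lborel (\<lambda>s. B * cutoff' s)" using integral_cutoff' by simp
   show "AE s in lborel. norm (?Q k x s) \<le> B * cutoff' s" for k
   proof (intro AE_I2)
    fix s show "norm (?Q k x s) \<le> B * cutoff' s" by (rule cutb)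
   qed
   show "AE s in lborel. (\<lambda>k. ?Q k x s) \<longlonglongrightarrow> ?L x * cutoff' s"
   proof (intro AE_I2)
    fix s
    show "(\<lambda>k. ?Q k x s) \<longlonglongrightarrow> ?L x * cutoff' s"
    proof (cases "s \<le> 1")
     case True thus ?thesis by simp
    next
     case False
     have ds: "(\<lambda>k. (C - N \<bullet> x) - d k * s) \<longlonglongrightarrow> (C - N \<bullet> x) - 0 * s" by (intro tendsto_intros d(2))
     hence ds: "(\<lambda>k. (C - N \<bullet> x) - d k * s) \<longlonglongrightarrow> C - N \<bullet> x" by simp
     have y: "(\<lambda>k. S x - (d k * s) *\<^sub>R N) \<longlonglongrightarrow> S x - (0 * s) *\<^sub>R N" by (intro tendsto_intros d(2))
     hence y: "(\<lambda>k. S x - (d k * s) *\<^sub>R N) \<longlonglongrightarrow> S x" by simp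
     have yj: "(\<lambda>k. n j \<bullet> (S x - (d k * s) *\<^sub>R N)) \<longlonglongrightarrow> n j \<bullet> S x" for j by (intro tendsto_intros y)
     have i1: "(\<lambda>k. ind {-1/2..1/2} ((C - N \<bullet> x) - d k * s)) \<longlonglongrightarrow> ind {x. \<bar>n i \<bullet> x - c i\<bar> < 1/2} x"
     proof (cases "\<bar>N \<bullet> x - C\<bar> < 1/2")
      case True
      have "\<forall>\<^sub>F k in sequentially. (C - N \<bullet> x) - d k * s < 1/2"
       by (rule order_tendstoD(2)[OF ds]) (use True in linarith)
      moreover have "\<forall>\<^sub>F k in sequentially. (C - N \<bullet> x) - d k * s > -1/2"
       by (rule order_tendstoD(1)[OF ds]) (use True in linarith)
      ultimately have "\<forall>\<^sub>F k in sequentially. ind {-1/2..1/2} ((C - N \<bullet> x) - d k * s) = 1"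
       by eventually_elim simp
      thus ?thesis using True by (simp add: N_def C_def tendsto_eventually)
     next
      case False
      then consider "C - N \<bullet> x > 1/2" | "C - N \<bullet> x < -1/2" using x1 by linarith
      hence "\<forall>\<^sub>F k in sequentially. (C - N \<bullet> x) - d k * s > 1/2 \<or> (C - N \<bullet> x) - d k * s < -1/2"
      proof cases
       case 1
       show ?thesis using order_tendstoD(1)[OF ds 1] by (rule eventually_mono) (rule disjI1)
      next
       case 2
       show ?thesis using order_tendstoD(2)[OF ds 2] by (rule eventually_mono) (rule disjI2)
      qed
      hence "\<forall>\<^sub>F k in sequentially. ind {-1/2..1/2} ((C - N \<bullet> x) - d k * s) = 0"
       by eventually_elim auto
      thus ?thesis using False by (simp add: N_def C_def tendsto_eventually)
     qed
     have i2: "(\<lambda>k. q k (S x - (d k * s) *\<^sub>R N)) \<longlonglongrightarrow> ind T (S x) * h (S x)"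
     proof (cases "\<forall>j\<in>I - {i}. n j \<bullet> S x < c j")
      case True
      have "\<forall>\<^sub>F k in sequentially. \<forall>j\<in>I - {i}. 0 < c j - n j \<bullet> (S x - (d k * s) *\<^sub>R N) - 3 * d k"
      proof (subst eventually_ball_finite_distrib)
       show "finite (I - {i})" using finite_faces by simp
       show "\<forall>j\<in>I - {i}. \<forall>\<^sub>F k in sequentially. 0 < c j - n j \<bullet> (S x - (d k * s) *\<^sub>R N) - 3 * d k"
       proof
        fix j assume j: "j \<in> I - {i}"
        have "(\<lambda>k. c j - n j \<bullet> (S x - (d k * s) *\<^sub>R N) - 3 * d k) \<longlonglongrightarrow> c j - n j \<bullet> S x - 3 * 0"
         by (intro tendsto_intros yj d(2))
        moreover have "c j - n j \<bullet> S x - 3 * 0 > 0" using True j by simp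
        ultimately show "\<forall>\<^sub>F k in sequentially. 0 < c j - n j \<bullet> (S x - (d k * s) *\<^sub>R N) - 3 * d k"
         by (rule order_tendstoD(1))
       qed
      qed
      hence ev: "\<forall>\<^sub>F k in sequentially. S x - (d k * s) *\<^sub>R N \<in> T \<and> polytope_cutoff (I - {i}) n c (d k) (S x - (d k * s) *\<^sub>R N) = 1"
      proof eventually_elim
       case (elim k)
       have "n j \<bullet> (S x - (d k * s) *\<^sub>R N) \<le> c j" if "j \<in> I" for j
       proof (cases "j = i")
        case True
        thus ?thesis using NS[of x] d(1)[of k] False N
         by (simp add: inner_diff_right N_def C_def)
       next
        case False
        thus ?thesis using elim that d(1)[of k] by force
       qed
       moreover have "cutoff ((c j - n j \<bullet> (S x - (d k * s) *\<^sub>R N)) / d k) = 1" if "j \<in> I - {i}" for j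
        using bspec[OF elim that] d(1)[of k] by (intro cutoff_high) (simp add: field_simps)
       ultimately show ?case by (simp add: T_def polytope_cutoff_def)
      qed
      have ST: "S x \<in> T" unfolding T_def using True NS[of x] by (auto simp: N_def C_def) (metis DiffI empty_iff insert_iff less_imp_le order_refl)
      have "(\<lambda>k. h (S x - (d k * s) *\<^sub>R N)) \<longlonglongrightarrow> h (S x)"
       by (rule continuous_on_tendsto_compose[OF h y ST]) (use ev in \<open>auto elim!: eventually_mono\<close>)
      moreover have "\<forall>\<^sub>F k in sequentially. q k (S x - (d k * s) *\<^sub>R N) = h (S x - (d k * s) *\<^sub>R N)"
       using ev by eventually_elim (simp add: q_def)
      ultimately show ?thesis using ST by (simp add: tendsto_cong)
     next
      case False
      then obtain j where j: "j \<in> I - {i}" "n j \<bullet> S x > c j" using x2 by (meson linorder_neqE_linordered_idom)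
      have "\<forall>\<^sub>F k in sequentially. n j \<bullet> (S x - (d k * s) *\<^sub>R N) > c j"
       by (rule order_tendstoD(1)[OF yj j(2)])
      hence "\<forall>\<^sub>F k in sequentially. q k (S x - (d k * s) *\<^sub>R N) = 0"
      proof eventually_elim
       case (elim k)
       hence "S x - (d k * s) *\<^sub>R N \<notin> T" using j(1) unfolding T_def by force
       thus ?case by (rule q0)
      qed
      moreover have "S x \<notin> T" using j unfolding T_def by force
      ultimately show ?thesis by (simp add: tendsto_eventually)
     qed
     show ?thesis unfolding Leq by (intro tendsto_intros i1 i2)
    qed
   qed
  qed measurable
  thus ?thesis using integral_cutoff' by simp
 qed
 have AEx: "AE x in lborel. (N \<bullet> x - C \<noteq> 1/2 \<and> N \<bullet> x - C \<noteq> - 1/2) \<and> (\<forall>j\<in>I - {i}. n j \<bullet> S x \<noteq> c j)"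
 proof -
  have hyp: "AE x in lborel. a \<bullet> x \<noteq> b" if "a \<noteq> 0" for a :: 'a and b
  proof -
   have "AE x in lebesgue. x \<notin> {x. a \<bullet> x = b}"
    using negligible_hyperplane[of a b] that by (intro AE_not_in) (simp add: negligible_iff_null_sets)
   thus ?thesis by (simp add: AE_completion_iff)
  qed
  have "N \<noteq> 0" using N by auto
  have 1: "AE x in lborel. N \<bullet> x \<noteq> C + 1/2" "AE x in lborel. N \<bullet> x \<noteq> C - 1/2"
   using hyp[OF \<open>N \<noteq> 0\<close>] by auto
  have "AE x in lborel. \<forall>j\<in>I - {i}. n j \<bullet> S x \<noteq> c j"
  proof (rule AE_finite_allI)
   fix j assume j: "j \<in> I - {i}"
   have "AE x in lebesgue. x \<notin> {x. n j \<bullet> foot_point (n i) (c i) x = c j}"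
    using negligible_slice[OF i, of j] j by (intro AE_not_in) (simp add: negligible_iff_null_sets)
   thus "AE x in lborel. n j \<bullet> S x \<noteq> c j" by (simp add: AE_completion_iff S_def)
  qed (use finite_faces in simp)
  thus ?thesis using 1 by eventually_elim auto
 qed
 have "(\<lambda>k. \<integral>x. J k x \<partial>lborel) \<longlonglongrightarrow> (LINT x|lborel. ?L x)"
 proof (rule integral_dominated_convergence[where w = "\<lambda>x. ind (cball 0 (R + 1)) x * B"])
  show "?L \<in> borel_measurable lborel" 
  proof -
   have "(\<lambda>x. ind T (S x) * h (S x)) \<in> borel_measurable borel"
    using measurable_compose[OF \<open>S \<in> borel_measurable borel\<close> hT] by simp
   thus ?thesis unfolding Leq by measurable
  qed
  show "J k \<in> borel_measurable lborel" for k by (rule Jm)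
  show "integrable lborel (\<lambda>x. ind (cball 0 (R + 1) :: 'a set) x * B)"
   by (rule integrable_indicator_bounded) auto
  show "AE x in lborel. (\<lambda>k. J k x) \<longlonglongrightarrow> ?L x"
   using AEx by eventually_elim (rule limJ, auto)
  show "AE x in lborel. norm (J k x) \<le> ind (cball 0 (R + 1)) x * B" for k
   using bndJ by (intro AE_I2) simp
 qed
 thus ?thesis unfolding eqJ .
qed


text \<open>The weak gradients of the components of \<open>\<beta>\<close> are tested with \<open>w\<close> times a cut-off of the open polytope. In the limit the
terms with the derivative of the cut-off become the fluxes through the faces.
Only continuity of \<open>\<beta>\<close> up to the boundary and integrability of its weak derivatives enter, so the theorem applies both to a
\<open>W\<^sup>1\<^sup>,\<^sup>\<infinity>\<close> velocity field and to \<open>\<phi> N\<close> with \<open>\<phi>\<close> in \<open>H\<^sup>1\<close> continuous up to the boundary.\<close>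

lemma divergence_theorem:
 fixes \<beta> :: "'a \<Rightarrow> 'a" and G :: "'a \<Rightarrow> 'a \<Rightarrow> 'a"
 assumes \<Omega>: "\<Omega> \<in> sets lebesgue" "{x. \<forall>i\<in>I. n i \<bullet> x < c i} \<subseteq> \<Omega>"
  and \<beta>: "continuous_on T \<beta>" "\<And>b. b \<in> Basis \<Longrightarrow> weak_gradient \<Omega> (\<lambda>x. \<beta> x \<bullet> b) (G b)"
  and G: "\<And>b. b \<in> Basis \<Longrightarrow> integrable (lebesgue_on T) (G b)"
  and w: "\<And>x. GDERIV w x :> Dw x" "continuous_on UNIV Dw"
 shows "(LINT x|lebesgue_on T. \<beta> x \<bullet> Dw x) + (LINT x|lebesgue_on T. w x * (\<Sum>b\<in>Basis. G b x \<bullet> b))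
  = (\<Sum>i\<in>I. flux {y\<in>T. n i \<bullet> y = c i} (n i) (c i) (\<lambda>x. w x *\<^sub>R \<beta> x))"
proof -
 let ?T0 = "{x. \<forall>i\<in>I. n i \<bullet> x < c i}"
 define g where "g x = (\<Sum>b\<in>Basis. G b x \<bullet> b)" for x
 define d where "d k = 1 / (real k + 1)" for k
 have d: "d k > 0" "d \<longlonglongrightarrow> 0" for k
  unfolding d_def using LIMSEQ_inverse_real_of_nat by (auto simp: inverse_eq_divide add.commute)
 define P where "P k = polytope_cutoff I n c (d k)" for k
 define DP where "DP k = polytope_cutoff_grad I n c (d k)" for k
 have Tm: "T \<in> sets lebesgue" "T \<in> sets borel" using closed_T by auto
 have T0: "?T0 \<subseteq> T" by (auto simp: T_def intro: less_imp_le)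
 have "open ?T0"
 proof -
  have "?T0 = (\<Inter>i\<in>I. {x. n i \<bullet> x < c i})" by auto
  thus ?thesis using finite_faces by (auto intro!: open_halfspace_lt)
 qed
 hence T0m: "?T0 \<in> sets lebesgue" "?T0 \<in> sets borel" by auto
 have contw: "continuous_on A w" for A
  using w(1) by (auto intro!: has_derivative_continuous_on intro: has_derivative_at_withinI simp: gderiv_def)
 have fin: "finite_measure (lebesgue_on T)"
  by (rule finite_measure_lebesgue_on[OF lmeasurable_compact[OF compact_T]])
 have contint: "integrable (lebesgue_on T) h" if hc: "continuous_on T h" for h :: "'a \<Rightarrow> real"
 proof -
  obtain B where B: "B > 0" "\<And>x. x \<in> T \<Longrightarrow> norm (h x) \<le> B"
   by (rule compact_continuous_bound[OF compact_T hc]) blast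
  have "h \<in> borel_measurable (lebesgue_on T)" by (rule continuous_imp_measurable_on_sets_lebesgue[OF hc Tm(1)])
  thus ?thesis
   by (intro finite_measure.integrable_const_bound[OF fin, of _ B] AE_I2) (simp_all add: B(2)[unfolded real_norm_def])
 qed
 have Tint: "(LINT x|lebesgue_on \<Omega>. h x) = (LINT x|lebesgue_on T. h x)" if hz: "\<And>x. x \<notin> ?T0 \<Longrightarrow> h x = 0" for h :: "'a \<Rightarrow> real"
  by (rule trans[OF integral_lebesgue_on_support[OF T0m(1) \<Omega> hz, symmetric]
     integral_lebesgue_on_support[OF T0m(1) Tm(1) T0 hz]])
 have gint: "integrable (lebesgue_on T) g"
  unfolding g_def by (intro Bochner_Integration.integrable_sum integrable_inner_left G)
 obtain Bw where Bw: "Bw > 0" "\<And>x. x \<in> T \<Longrightarrow> norm (w x) \<le> Bw"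
  by (rule compact_continuous_bound[OF compact_T contw]) blast
 have wm: "w \<in> borel_measurable (lebesgue_on T)" by (rule continuous_imp_measurable_on_sets_lebesgue[OF contw Tm(1)])
 have wgint: "integrable (lebesgue_on T) (\<lambda>x. w x * g x)"
 proof (rule integrable_dominated)
  show "integrable (lebesgue_on T) (\<lambda>x. Bw * g x)" using gint by simp
  show "(\<lambda>x. w x * g x) \<in> borel_measurable (lebesgue_on T)" using wm gint by measurable
  show "AE x in lebesgue_on T. norm (w x * g x) \<le> norm (Bw * g x)"
   using Bw by (intro AE_I2) (simp add: abs_mult mult_right_mono)
 qed
 have PP: "0 \<le> P k x" "P k x \<le> 1" for k x by (simp_all add: P_def polytope_cutoff_bounds)
 have P0: "P k x = 0" "DP k x = 0" if xT: "x \<notin> ?T0" for k x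
 proof -
  obtain i where i: "i \<in> I" "c i - n i \<bullet> x \<le> 0" using xT by force
  have le: "(c i - n i \<bullet> x) / d k \<le> 1" using i(2) d(1)[of k] by (simp add: divide_nonpos_pos order_trans)
  have z: "polytope_cutoff J n c (d k) x = 0" if "i \<in> J" "J \<subseteq> I" for J
  proof -
   have "cutoff ((c i - n i \<bullet> x) / d k) = 0" using le by (rule cutoff_low(1))
   thus ?thesis unfolding polytope_cutoff_def
    using finite_subset[OF that(2) finite_faces] that(1) by (auto intro!: prod_zero bexI[of _ i])
  qed
  show "P k x = 0" unfolding P_def by (rule z) (use i in auto)
  show "DP k x = 0" unfolding DP_def polytope_cutoff_grad_def
  proof (rule sum.neutral, rule ballI)
   fix j assume "j \<in> I"
   show "- (cutoff' ((c j - n j \<bullet> x) / d k) / d k * polytope_cutoff (I - {j}) n c (d k) x) *\<^sub>R n j = 0"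
    using le z[of "I - {j}"] i(1) by (cases "j = i") auto
  qed
 qed
 have Plim: "(\<lambda>k. P k x) \<longlonglongrightarrow> ind ?T0 x" for x
  unfolding P_def by (rule polytope_cutoff_tendsto[OF finite_faces d])
 have AE0: "AE x in lebesgue_on T. x \<in> ?T0"
 proof -
  have "AE x in lebesgue. x \<notin> T - ?T0"
   using negligible_boundary by (intro AE_not_in) (simp add: negligible_iff_null_sets)
  hence "AE x in lebesgue. x \<in> T \<longrightarrow> x \<in> ?T0" by eventually_elim auto
  thus ?thesis using Tm by (simp add: AE_restrict_space_iff)
 qed
 have Pm: "P k \<in> borel_measurable (lebesgue_on T)" for k
  unfolding P_def by (rule continuous_imp_measurable_on_sets_lebesgue[OF continuous_polytope_cutoff Tm(1)])
 have limP: "(\<lambda>k. \<integral>x. P k x * h x \<partial>lebesgue_on T) \<longlonglongrightarrow> (LINT x|lebesgue_on T. h x)"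
  if h: "integrable (lebesgue_on T) h" for h :: "'a \<Rightarrow> real"
 proof (rule integral_dominated_convergence[where w = "\<lambda>x. norm (h x)"])
  show "(\<lambda>x. P k x * h x) \<in> borel_measurable (lebesgue_on T)" for k using Pm h by measurable
  show "AE x in lebesgue_on T. (\<lambda>k. P k x * h x) \<longlonglongrightarrow> h x"
   using AE0
  proof eventually_elim
   case (elim x)
   have "(\<lambda>k. P k x * h x) \<longlonglongrightarrow> ind ?T0 x * h x" by (intro tendsto_intros Plim)
   thus ?case using elim by simp
  qed
  show "AE x in lebesgue_on T. norm (P k x * h x) \<le> norm (h x)" for k
   using PP[of k] by (intro AE_I2) (simp add: abs_mult mult_left_le_one_le)
 qed (use h in auto)
 \<comment> \<open>the weak formulation, tested with \<open>w\<close> times the cut-off\<close>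
 have test: "C1_test \<Omega> (\<lambda>x. w x * P k x) (\<lambda>x. w x *\<^sub>R DP k x + P k x *\<^sub>R Dw x)" for k
  unfolding P_def DP_def
  by (rule C1_test_polytope_cutoff[OF finite_faces d(1) w _ \<Omega>(2)]) (use bounded_T in \<open>simp add: T_def\<close>)
 have eq: "(LINT x|lebesgue_on \<Omega>. \<beta> x \<bullet> (w x *\<^sub>R DP k x + P k x *\<^sub>R Dw x)) = - (LINT x|lebesgue_on \<Omega>. (w x * P k x) * g x)" for k
 proof -
  let ?D = "\<lambda>x. w x *\<^sub>R DP k x + P k x *\<^sub>R Dw x"
  have int: "integrable (lebesgue_on \<Omega>) (\<lambda>x. (\<beta> x \<bullet> b) *\<^sub>R ?D x)" "integrable (lebesgue_on \<Omega>) (\<lambda>x. (w x * P k x) *\<^sub>R G b x)"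
   if "b \<in> Basis" for b using weak_gradient_test_integrable[OF \<beta>(2)[OF that] test \<Omega>(1)] by auto
  have "(LINT x|lebesgue_on \<Omega>. \<beta> x \<bullet> ?D x) = (LINT x|lebesgue_on \<Omega>. (\<Sum>b\<in>Basis. ((\<beta> x \<bullet> b) *\<^sub>R ?D x) \<bullet> b))"
   by (subst euclidean_inner) simp
  also have "\<dots> = (\<Sum>b\<in>Basis. (LINT x|lebesgue_on \<Omega>. (\<beta> x \<bullet> b) *\<^sub>R ?D x) \<bullet> b)"
  proof -
   have "(LINT x|lebesgue_on \<Omega>. (\<Sum>b\<in>Basis. ((\<beta> x \<bullet> b) *\<^sub>R ?D x) \<bullet> b))
    = (\<Sum>b\<in>Basis. \<integral>x. ((\<beta> x \<bullet> b) *\<^sub>R ?D x) \<bullet> b \<partial>lebesgue_on \<Omega>)"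
    by (rule Bochner_Integration.integral_sum) (rule integrable_inner_left, rule int(1))
   also have "\<dots> = (\<Sum>b\<in>Basis. (LINT x|lebesgue_on \<Omega>. (\<beta> x \<bullet> b) *\<^sub>R ?D x) \<bullet> b)"
    by (rule sum.cong[OF refl], rule integral_inner_left, rule int(1))
   finally show ?thesis .
  qed
  also have "\<dots> = (\<Sum>b\<in>Basis. - ((LINT x|lebesgue_on \<Omega>. (w x * P k x) *\<^sub>R G b x) \<bullet> b))"
   using weak_gradientD(3)[OF \<beta>(2) test] by (intro sum.cong) auto
  also have "\<dots> = - (\<Sum>b\<in>Basis. \<integral>x. ((w x * P k x) *\<^sub>R G b x) \<bullet> b \<partial>lebesgue_on \<Omega>)"
   unfolding sum_negf using int(2) by (intro arg_cong[of _ _ uminus] sum.cong integral_inner_left[symmetric]) auto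
  also have "\<dots> = - (LINT x|lebesgue_on \<Omega>. (\<Sum>b\<in>Basis. ((w x * P k x) *\<^sub>R G b x) \<bullet> b))"
   by (rule arg_cong[of _ _ uminus], rule Bochner_Integration.integral_sum[symmetric], rule integrable_inner_left, rule int(2))
  also have "(\<lambda>x. \<Sum>b\<in>Basis. ((w x * P k x) *\<^sub>R G b x) \<bullet> b) = (\<lambda>x. (w x * P k x) * g x)"
   by (simp add: g_def sum_distrib_left)
  finally show ?thesis .
 qed
 define s where "s i k x = ind T x * (w x * (\<beta> x \<bullet> n i)) *
    (cutoff' ((c i - n i \<bullet> x) / d k) / d k * polytope_cutoff (I - {i}) n c (d k) x)" for i k x
 have hcont: "continuous_on T (\<lambda>x. w x * (\<beta> x \<bullet> n i))" for i by (intro continuous_intros contw \<beta>(1))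
 have sint: "integrable (lebesgue_on T) (s i k)" "(LINT x|lebesgue_on T. s i k x) = (LINT x|lborel. s i k x)" for i k
 proof -
  have "continuous_on T (\<lambda>x. (w x * (\<beta> x \<bullet> n i)) * (cutoff' ((c i - n i \<bullet> x) / d k) / d k * polytope_cutoff (I - {i}) n c (d k) x))"
   unfolding divide_inverse by (intro continuous_intros contw \<beta>(1) continuous_polytope_cutoff)
  from contint[OF this] show "integrable (lebesgue_on T) (s i k)"
   by (rule Bochner_Integration.integrable_cong[THEN iffD1, rotated -1]) (auto simp: s_def)
  have "(\<lambda>x. ind T x * (w x * (\<beta> x \<bullet> n i))) \<in> borel_measurable borel"
   using borel_measurable_continuous_on_indicator[OF Tm(2) hcont] by simp
  hence "s i k \<in> borel_measurable borel" unfolding s_def by measurable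
  thus "(LINT x|lebesgue_on T. s i k x) = (LINT x|lborel. s i k x)"
   by (rule integral_lebesgue_on_eq_lborel[OF Tm(1)]) (simp add: s_def)
 qed
 have Dint: "integrable (lebesgue_on T) (\<lambda>x. \<beta> x \<bullet> Dw x)"
  by (intro contint continuous_intros \<beta>(1) continuous_on_subset[OF w(2)]) auto
 have PDint: "integrable (lebesgue_on T) (\<lambda>x. P k x * (\<beta> x \<bullet> Dw x))" for k
  unfolding P_def by (intro contint continuous_intros \<beta>(1) continuous_on_subset[OF w(2)] continuous_polytope_cutoff) auto
 let ?D = "\<lambda>k x. w x *\<^sub>R DP k x + P k x *\<^sub>R Dw x"
 have eq2: "(LINT x|lebesgue_on T. P k x * (\<beta> x \<bullet> Dw x)) - (\<Sum>i\<in>I. \<integral>x. s i k x \<partial>lborel)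
   = - (LINT x|lebesgue_on T. P k x * (w x * g x))" for k
 proof -
  have "(LINT x|lebesgue_on \<Omega>. \<beta> x \<bullet> ?D k x)
   = (LINT x|lebesgue_on T. \<beta> x \<bullet> ?D k x)"
  proof (rule Tint)
   fix x assume "x \<notin> ?T0"
   from P0[OF this] show "\<beta> x \<bullet> ?D k x = 0" by simp
  qed
  also have "\<dots> = (LINT x|lebesgue_on T. P k x * (\<beta> x \<bullet> Dw x) - (\<Sum>i\<in>I. s i k x))"
   by (intro LINT_cong refl)
     (simp add: s_def DP_def polytope_cutoff_grad_def inner_add_right inner_sum_right sum_distrib_left sum_negf algebra_simps)
  also have "\<dots> = (LINT x|lebesgue_on T. P k x * (\<beta> x \<bullet> Dw x)) - (\<Sum>i\<in>I. \<integral>x. s i k x \<partial>lborel)"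
   using PDint sint(1) by (simp add: sint(2))
  finally have A: "(LINT x|lebesgue_on \<Omega>. \<beta> x \<bullet> ?D k x)
   = (LINT x|lebesgue_on T. P k x * (\<beta> x \<bullet> Dw x)) - (\<Sum>i\<in>I. \<integral>x. s i k x \<partial>lborel)" .
  have "(LINT x|lebesgue_on \<Omega>. (w x * P k x) * g x) = (LINT x|lebesgue_on T. (w x * P k x) * g x)"
  proof (rule Tint)
   fix x assume "x \<notin> ?T0"
   from P0[OF this] show "(w x * P k x) * g x = 0" by simp
  qed
  thus ?thesis using eq[of k] A by (simp add: ac_simps)
 qed
 have "(\<lambda>k. (LINT x|lebesgue_on T. P k x * (\<beta> x \<bullet> Dw x)) - (\<Sum>i\<in>I. \<integral>x. s i k x \<partial>lborel))
  \<longlonglongrightarrow> (LINT x|lebesgue_on T. \<beta> x \<bullet> Dw x) - (\<Sum>i\<in>I. flux {y\<in>T. n i \<bullet> y = c i} (n i) (c i) (\<lambda>x. w x *\<^sub>R \<beta> x))"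
 proof (intro tendsto_diff limP Dint tendsto_sum)
  fix i assume i: "i \<in> I"
  show "(\<lambda>k. \<integral>x. s i k x \<partial>lborel) \<longlonglongrightarrow> flux {y\<in>T. n i \<bullet> y = c i} (n i) (c i) (\<lambda>x. w x *\<^sub>R \<beta> x)"
   using strip_limit[OF i hcont[of i] d] by (simp add: s_def flux_def)
 qed
 moreover have "(\<lambda>k. - (LINT x|lebesgue_on T. P k x * (w x * g x))) \<longlonglongrightarrow> - (LINT x|lebesgue_on T. w x * g x)"
  by (intro tendsto_minus limP wgint)
 ultimately have "(LINT x|lebesgue_on T. \<beta> x \<bullet> Dw x) - (\<Sum>i\<in>I. flux {y\<in>T. n i \<bullet> y = c i} (n i) (c i) (\<lambda>x. w x *\<^sub>R \<beta> x))
   = - (LINT x|lebesgue_on T. w x * g x)"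
  unfolding eq2 using LIMSEQ_unique by blast
 thus ?thesis by (simp add: g_def)
qed

end

section \<open>Barycentric coordinates\<close>

locale full_simplex =
 fixes T :: "'a::euclidean_space set"
 assumes simplex_T: "int DIM('a) simplex T" and dim_ge_2: "DIM('a) \<ge> 2"
begin

abbreviation "C \<equiv> vertices T"
abbreviation "bary p x \<equiv> barycentric T x p"

lemma vertices_simplex: "finite C" "\<not> affine_dependent C" "card C = DIM('a) + 1" "convex hull C = T"
proof -
 obtain S where S: "finite S" "\<not> affine_dependent S" "int (card S) = int DIM('a) + 1" "T = convex hull S"
  using simplex_T unfolding simplex by auto
 have "C = S" unfolding vertices_def S(4) using extreme_point_of_convex_hull_affine_independent[OF S(2)] by auto
 thus "finite C" "\<not> affine_dependent C" "card C = DIM('a) + 1" "convex hull C = T" using S by auto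
qed

lemma affine_coefficients_unique:
 assumes "sum u C = 1" "sum w C = 1" "(\<Sum>p\<in>C. u p *\<^sub>R p) = (\<Sum>p\<in>C. w p *\<^sub>R p)" "p \<in> C"
 shows "u p = w p"
proof (rule ccontr)
 assume "u p \<noteq> w p"
 hence "\<exists>v. sum v C = 0 \<and> (\<exists>p\<in>C. v p \<noteq> 0) \<and> (\<Sum>p\<in>C. v p *\<^sub>R p) = 0"
  using assms by (intro exI[of _ "\<lambda>p. u p - w p"]) (auto simp: sum_subtractf scaleR_diff_left)
 thus False using vertices_simplex(2) affine_dependent_explicit_finite[OF vertices_simplex(1)] by blast
qed

lemma barycentric_exists:
 "\<exists>!u. (\<forall>p. p \<notin> C \<longrightarrow> u p = 0) \<and> sum u C = 1 \<and> (\<Sum>p\<in>C. u p *\<^sub>R p) = x"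
proof (rule ex_ex1I)
 have "affine hull C = UNIV" using vertices_simplex by (intro affine_independent_span_eq) auto
 hence "x \<in> affine hull C" by simp
 then obtain u where u: "sum u C = 1" "(\<Sum>p\<in>C. u p *\<^sub>R p) = x"
  unfolding affine_hull_finite[OF vertices_simplex(1)] by blast
 show "\<exists>u. (\<forall>p. p \<notin> C \<longrightarrow> u p = 0) \<and> sum u C = 1 \<and> (\<Sum>p\<in>C. u p *\<^sub>R p) = x"
  by (rule exI[of _ "\<lambda>p. if p \<in> C then u p else 0"]) (use u in \<open>auto cong: sum.cong\<close>)
next
 fix u w assume "(\<forall>p. p \<notin> C \<longrightarrow> u p = 0) \<and> sum u C = 1 \<and> (\<Sum>p\<in>C. u p *\<^sub>R p) = x"
  and "(\<forall>p. p \<notin> C \<longrightarrow> w p = 0) \<and> sum w C = 1 \<and> (\<Sum>p\<in>C. w p *\<^sub>R p) = x"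
 thus "u = w" using affine_coefficients_unique[of u w] by (metis ext)
qed

lemma barycentric: "(\<Sum>p\<in>C. bary p x) = 1" "(\<Sum>p\<in>C. bary p x *\<^sub>R p) = x"
 using theI'[OF barycentric_exists[of x]] unfolding barycentric_def by auto

lemma barycentric_eq: "sum u C = 1 \<Longrightarrow> (\<Sum>p\<in>C. u p *\<^sub>R p) = x \<Longrightarrow> p \<in> C \<Longrightarrow> bary p x = u p"
 using affine_coefficients_unique[of "\<lambda>p. bary p x" u p] barycentric[of x] by auto

text \<open>A barycentric coordinate is an affine function; the adjoint of its linear part, applied to \<open>1\<close>, is the gradient.\<close>

definition bgrad :: "'a \<Rightarrow> 'a" where "bgrad p = adjoint (\<lambda>x. bary p x - bary p 0) 1"

lemma bary_affine:
 assumes p: "p \<in> C"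
 shows "bary p x = bgrad p \<bullet> x + bary p 0"
proof -
 have "linear (\<lambda>x. bary p x - bary p 0)"
 proof (rule linearI)
  fix x y
  have "bary p (x + y) = bary p x + bary p y - bary p 0"
   by (rule barycentric_eq[OF _ _ p])
     (simp_all add: barycentric sum.distrib sum_subtractf scaleR_add_left scaleR_diff_left)
  thus "bary p (x + y) - bary p 0 = bary p x - bary p 0 + (bary p y - bary p 0)" by simp
 next
  fix r :: real and x
  have "bary p (r *\<^sub>R x) = r * bary p x + (1 - r) * bary p 0"
   by (rule barycentric_eq[OF _ _ p])
     (simp_all add: barycentric sum.distrib scaleR_add_left sum_distrib_left[symmetric]
      scaleR_scaleR[symmetric] scaleR_right.sum[symmetric] del: scaleR_scaleR)
  thus "bary p (r *\<^sub>R x) - bary p 0 = r *\<^sub>R (bary p x - bary p 0)" by (simp add: algebra_simps)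
 qed
 from adjoint_works[OF this, of x 1] show ?thesis by (simp add: bgrad_def inner_commute)
qed

lemma bary_affine_comb:
 assumes "p \<in> C" "finite S" "sum u S = 1"
 shows "bary p (\<Sum>q\<in>S. u q *\<^sub>R q) = (\<Sum>q\<in>S. u q * bary p q)"
proof -
 have "(\<Sum>q\<in>S. u q * bary p q) = (\<Sum>q\<in>S. u q * (bgrad p \<bullet> q) + u q * bary p 0)"
  by (rule sum.cong[OF refl], subst bary_affine[OF assms(1)], rule distrib_left)
 also have "\<dots> = (\<Sum>q\<in>S. u q * (bgrad p \<bullet> q)) + sum u S * bary p 0"
  by (simp only: sum.distrib sum_distrib_right)
 finally have "(\<Sum>q\<in>S. u q * bary p q) = (\<Sum>q\<in>S. u q * (bgrad p \<bullet> q)) + sum u S * bary p 0" .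
 thus ?thesis using bary_affine[OF assms(1), of "\<Sum>q\<in>S. u q *\<^sub>R q"] assms(3) by (simp add: inner_sum_right)
qed

lemma bary_vertex: "p \<in> C \<Longrightarrow> q \<in> C \<Longrightarrow> bary p q = (if p = q then 1 else 0)"
 by (rule barycentric_eq) (use vertices_simplex(1) in \<open>auto simp: if_distrib[of "\<lambda>c. c *\<^sub>R _"] cong: if_cong\<close>)

lemma continuous_bary: "p \<in> C \<Longrightarrow> continuous_on A (bary p)"
proof -
 assume p: "p \<in> C"
 have "continuous_on A (\<lambda>x. bgrad p \<bullet> x + bary p 0)" by (intro continuous_intros)
 thus ?thesis unfolding bary_affine[OF p, symmetric] .
qed

lemma simplex_bary: "x \<in> T \<longleftrightarrow> (\<forall>p\<in>C. 0 \<le> bary p x)"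
proof
 assume "x \<in> T"
 hence "x \<in> convex hull C" by (simp only: vertices_simplex(4))
 then obtain u where u: "\<forall>p\<in>C. 0 \<le> u p" "sum u C = 1" "(\<Sum>p\<in>C. u p *\<^sub>R p) = x"
  unfolding convex_hull_finite[OF vertices_simplex(1)] by blast
 show "\<forall>p\<in>C. 0 \<le> bary p x" using barycentric_eq[OF u(2,3)] u(1) by simp
next
 assume "\<forall>p\<in>C. 0 \<le> bary p x"
 hence "x \<in> convex hull C"
  unfolding convex_hull_finite[OF vertices_simplex(1)] using barycentric[of x] by (intro CollectI exI[of _ "\<lambda>p. bary p x"]) simp
 thus "x \<in> T" by (simp only: vertices_simplex(4))
qed

lemma interior_simplex_bary: "x \<in> interior T \<longleftrightarrow> (\<forall>p\<in>C. 0 < bary p x)"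
proof -
 have i: "interior T = {y. \<exists>u. (\<forall>x\<in>C. 0 < u x) \<and> sum u C = 1 \<and> (\<Sum>x\<in>C. u x *\<^sub>R x) = y}"
  using interior_convex_hull_explicit_minimal[OF vertices_simplex(2)] unfolding vertices_simplex(3,4) by simp
 show ?thesis
 proof
  assume "x \<in> interior T"
  then obtain u where u: "\<forall>p\<in>C. 0 < u p" "sum u C = 1" "(\<Sum>p\<in>C. u p *\<^sub>R p) = x"
   unfolding i by blast
  show "\<forall>p\<in>C. 0 < bary p x" using barycentric_eq[OF u(2,3)] u(1) by simp
 next
  assume "\<forall>p\<in>C. 0 < bary p x"
  thus "x \<in> interior T"
   unfolding i using barycentric[of x] by (intro CollectI exI[of _ "\<lambda>p. bary p x"]) simp
 qed
qed

lemma vertices_minus_nonempty: "p \<in> C \<Longrightarrow> q \<in> C \<Longrightarrow> \<exists>r\<in>C. r \<noteq> p \<and> r \<noteq> q"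
proof (rule ccontr)
 assume "p \<in> C" "q \<in> C" "\<not> (\<exists>r\<in>C. r \<noteq> p \<and> r \<noteq> q)"
 hence "C \<subseteq> {p, q}" by auto
 hence "card C \<le> card {p, q}" by (intro card_mono) auto
 also have "\<dots> \<le> 2" by (simp add: card_insert_if)
 finally show False using vertices_simplex(3) dim_ge_2 by simp
qed

lemma bgrad_nonzero: "p \<in> C \<Longrightarrow> bgrad p \<noteq> 0"
proof
 assume p: "p \<in> C" and z: "bgrad p = 0"
 obtain r where r: "r \<in> C" "r \<noteq> p" using vertices_minus_nonempty[OF p p] by auto
 have "bary p p = bary p r" using bary_affine[OF p, of p] bary_affine[OF p, of r] z by simp
 thus False using bary_vertex[OF p p] bary_vertex[OF p r(1)] r(2) by simp
qed

text \<open>The facet opposite to the vertex \<open>p\<close> lies in the zero set of the coordinate of \<open>p\<close>, which decreases in the outward direction; hence the normalised negative gradient.\<close>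

definition fnormal :: "'a \<Rightarrow> 'a" where "fnormal p = - ((1 / norm (bgrad p)) *\<^sub>R bgrad p)"
definition foffset :: "'a \<Rightarrow> real" where "foffset p = bary p 0 / norm (bgrad p)"

lemma bary_fnormal: "p \<in> C \<Longrightarrow> foffset p - fnormal p \<bullet> x = bary p x / norm (bgrad p)"
 using bary_affine[of p x] by (simp add: foffset_def fnormal_def add_divide_distrib)

lemma fnormal_le_iff:
 assumes "p \<in> C"
 shows "fnormal p \<bullet> x \<le> foffset p \<longleftrightarrow> 0 \<le> bary p x" "fnormal p \<bullet> x < foffset p \<longleftrightarrow> 0 < bary p x"
  "fnormal p \<bullet> x = foffset p \<longleftrightarrow> bary p x = 0"
proof -
 have n: "norm (bgrad p) > 0" using bgrad_nonzero[OF assms] by simp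
 have e: "fnormal p \<bullet> x = foffset p - bary p x / norm (bgrad p)" using bary_fnormal[OF assms, of x] by simp
 show "fnormal p \<bullet> x \<le> foffset p \<longleftrightarrow> 0 \<le> bary p x" "fnormal p \<bullet> x < foffset p \<longleftrightarrow> 0 < bary p x"
  "fnormal p \<bullet> x = foffset p \<longleftrightarrow> bary p x = 0"
  unfolding e using n by (auto simp: zero_le_divide_iff zero_less_divide_iff)
qed

lemma norm_fnormal: "p \<in> C \<Longrightarrow> norm (fnormal p) = 1"
 using bgrad_nonzero[of p] by (simp add: fnormal_def)

lemma compact_simplex_T: "compact T"
 using finite_imp_compact_convex_hull[OF vertices_simplex(1)] by (simp only: vertices_simplex(4))

lemma simplex_polytope: "polytope C fnormal foffset T"
proof
 show "finite C" by (rule vertices_simplex)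
 show "norm (fnormal p) = 1" if "p \<in> C" for p using norm_fnormal[OF that] .
 show "T = {x. \<forall>p\<in>C. fnormal p \<bullet> x \<le> foffset p}" using simplex_bary fnormal_le_iff(1) by auto
 show "bounded T" using compact_simplex_T by (rule compact_imp_bounded)
next
 fix p q assume pq: "p \<in> C" "q \<in> C" "p \<noteq> q"
 obtain r where r: "r \<in> C" "r \<noteq> p" "r \<noteq> q" using vertices_minus_nonempty[OF pq(1,2)] by auto
 have "fnormal q \<bullet> q < foffset q" "fnormal q \<bullet> r = foffset q" "fnormal p \<bullet> q = foffset p" "fnormal p \<bullet> r = foffset p"
  using fnormal_le_iff(2,3)[OF pq(1)] fnormal_le_iff(2,3)[OF pq(2)] bary_vertex pq r by auto
 note e = this
 show "fnormal p \<noteq> fnormal q \<and> fnormal p \<noteq> - fnormal q"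
 proof (intro conjI notI)
  assume "fnormal p = fnormal q"
  thus False using e by simp
 next
  assume "fnormal p = - fnormal q"
  hence "- (fnormal q \<bullet> q) = - (fnormal q \<bullet> r)" using e(3,4) by simp
  thus False using e(1,2) by simp
 qed
qed

definition facet :: "'a \<Rightarrow> 'a set" where "facet p = {x\<in>T. bary p x = 0}"

lemma facet_hull: "p \<in> C \<Longrightarrow> facet p = convex hull (C - {p})"
proof (intro set_eqI iffI)
 fix x assume p: "p \<in> C" and x: "x \<in> facet p"
 hence b: "\<forall>q\<in>C. 0 \<le> bary q x" "bary p x = 0" using simplex_bary by (auto simp: facet_def)
 have "(\<Sum>q\<in>C - {p}. bary q x) = 1" "(\<Sum>q\<in>C - {p}. bary q x *\<^sub>R q) = x"
  using barycentric[of x] b(2) sum.remove[OF vertices_simplex(1) p, of "\<lambda>q. bary q x"]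
   sum.remove[OF vertices_simplex(1) p, of "\<lambda>q. bary q x *\<^sub>R q"] by simp_all
 thus "x \<in> convex hull (C - {p})"
  using b vertices_simplex(1) by (subst convex_hull_finite) auto
next
 fix x assume p: "p \<in> C" and x: "x \<in> convex hull (C - {p})"
 then obtain u where u: "\<forall>q\<in>C - {p}. 0 \<le> u q" "sum u (C - {p}) = 1" "(\<Sum>q\<in>C - {p}. u q *\<^sub>R q) = x"
  using convex_hull_finite[of "C - {p}"] vertices_simplex(1) by auto
 have "bary p x = (\<Sum>q\<in>C - {p}. u q * bary p q)"
  using bary_affine_comb[OF p _ u(2)] vertices_simplex(1) u(3) by simp
 also have "\<dots> = 0" using bary_vertex[OF p] by (intro sum.neutral) auto
 finally show "x \<in> facet p" using x hull_mono[of "C - {p}" C convex] vertices_simplex(4) by (auto simp: facet_def)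
qed

text \<open>The relative interior of a facet, described by barycentric coordinates.\<close>

definition open_facet :: "'a \<Rightarrow> 'a set" where
 "open_facet p = {x. bary p x = 0 \<and> (\<forall>q\<in>C - {p}. 0 < bary q x)}"

lemma open_facet_subset: "p \<in> C \<Longrightarrow> open_facet p \<subseteq> facet p"
proof
 fix x assume p: "p \<in> C" and x: "x \<in> open_facet p"
 have "0 \<le> bary q x" if "q \<in> C" for q using x that by (cases "q = p") (auto simp: open_facet_def intro: less_imp_le)
 hence "x \<in> T" by (simp add: simplex_bary)
 thus "x \<in> facet p" using x by (simp add: open_facet_def facet_def)
qed

definition facet_center :: "'a \<Rightarrow> 'a" where
 "facet_center p = (\<Sum>q\<in>C - {p}. (1 / real DIM('a)) *\<^sub>R q)"

lemma facet_center: "p \<in> C \<Longrightarrow> facet_center p \<in> open_facet p"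
proof -
 assume p: "p \<in> C"
 have c: "card (C - {p}) = DIM('a)" using vertices_simplex(1,3) p by simp
 hence s: "(\<Sum>q\<in>C - {p}. 1 / real DIM('a)) = 1" by simp
 have b: "bary r (facet_center p) = (\<Sum>q\<in>C - {p}. (1 / real DIM('a)) * bary r q)" if "r \<in> C" for r
  unfolding facet_center_def by (rule bary_affine_comb[OF that _ s]) (use vertices_simplex(1) in simp)
 have "bary p (facet_center p) = 0" unfolding b[OF p] using bary_vertex[OF p] by (intro sum.neutral) auto
 moreover have "bary r (facet_center p) > 0" if r: "r \<in> C - {p}" for r
 proof -
  have "bary r (facet_center p) = (\<Sum>q\<in>C - {p}. if q = r then 1 / real DIM('a) else 0)"
   unfolding b[of r, OF DiffD1[OF r]] using bary_vertex[of r] r by (intro sum.cong) auto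
  also have "\<dots> = 1 / real DIM('a)" using r vertices_simplex(1) by simp
  finally show ?thesis by simp
 qed
 ultimately show ?thesis by (auto simp: open_facet_def)
qed

lemma bary_segment:
 assumes "p \<in> C" shows "bary p ((1 - t) *\<^sub>R x + t *\<^sub>R y) = (1 - t) * bary p x + t * bary p y"
 unfolding bary_affine[OF assms, of x] bary_affine[OF assms, of y] bary_affine[OF assms, of "(1 - t) *\<^sub>R x + t *\<^sub>R y"]
 by (simp add: inner_add_right algebra_simps)

lemma facet_closure:
 assumes p: "p \<in> C" and y: "y \<in> facet p" and t: "0 < t" "t \<le> 1"
 shows "(1 - t) *\<^sub>R y + t *\<^sub>R facet_center p \<in> open_facet p"
proof -
 have "0 \<le> bary q y" if "q \<in> C" for q using y that simplex_bary by (auto simp: facet_def)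
 thus ?thesis using facet_center[OF p] y t bary_segment p
  by (auto simp: open_facet_def facet_def intro!: add_nonneg_pos mult_nonneg_nonneg)
qed

lemma facet_eq_hull_imp:
 assumes p: "p \<in> C" and F: "facet p = convex hull E" and E: "\<not> affine_dependent E"
 shows "E = C - {p}"
proof -
 have i: "\<not> affine_dependent (C - {p})" using vertices_simplex(2) affine_dependent_subset by blast
 have e: "convex hull E = convex hull (C - {p})" using facet_hull[OF p] F by simp
 have "q \<in> E \<longleftrightarrow> q \<in> C - {p}" for q
  using extreme_point_of_convex_hull_affine_independent[OF i, of q]
   extreme_point_of_convex_hull_affine_independent[OF E, of q] unfolding e by simp
 thus ?thesis by blast
qed

text \<open>An affine function that vanishes at the vertices of a facet is a multiple of the barycentric coordinate of the
opposite vertex. Two cells with a common facet therefore have parallel normals there.\<close>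

lemma same_hyperplane:
 fixes \<nu> :: 'a
 assumes p: "p \<in> C" and z: "\<And>q. q \<in> C - {p} \<Longrightarrow> \<nu> \<bullet> q + c = 0"
 shows "\<nu> = (\<nu> \<bullet> p + c) *\<^sub>R bgrad p" "c = (\<nu> \<bullet> p + c) * bary p 0"
proof -
 define k where "k = \<nu> \<bullet> p + c"
 have e: "\<nu> \<bullet> x + c = k * bary p x" for x
 proof -
  have "\<nu> \<bullet> x + c = (\<Sum>q\<in>C. bary q x * (\<nu> \<bullet> q + c))"
  proof -
   have "(\<Sum>q\<in>C. bary q x * (\<nu> \<bullet> q + c)) = (\<Sum>q\<in>C. bary q x * (\<nu> \<bullet> q)) + (\<Sum>q\<in>C. bary q x) * c"
    by (simp only: distrib_left sum.distrib sum_distrib_right)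
   moreover have "\<nu> \<bullet> (\<Sum>q\<in>C. bary q x *\<^sub>R q) = (\<Sum>q\<in>C. bary q x * (\<nu> \<bullet> q))"
    by (simp only: inner_sum_right inner_scaleR_right)
   ultimately have "(\<Sum>q\<in>C. bary q x * (\<nu> \<bullet> q + c)) = \<nu> \<bullet> (\<Sum>q\<in>C. bary q x *\<^sub>R q) + (\<Sum>q\<in>C. bary q x) * c" by simp
   thus ?thesis using barycentric[of x] by simp
  qed
  also have "\<dots> = bary p x * k + (\<Sum>q\<in>C - {p}. bary q x * (\<nu> \<bullet> q + c))"
   unfolding k_def by (rule sum.remove[OF vertices_simplex(1) p])
  also have "(\<Sum>q\<in>C - {p}. bary q x * (\<nu> \<bullet> q + c)) = 0" using z by (intro sum.neutral) auto
  finally show ?thesis by simp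
 qed
 show c: "c = (\<nu> \<bullet> p + c) * bary p 0" using e[of 0] by (simp add: k_def)
 have "\<nu> \<bullet> x = (k *\<^sub>R bgrad p) \<bullet> x" for x
 proof -
  have "\<nu> \<bullet> x + c = k * (bgrad p \<bullet> x) + k * bary p 0"
   using e[of x] bary_affine[OF p, of x] by (simp add: distrib_left)
  moreover have "c = k * bary p 0" using e[of 0] by simp
  ultimately show ?thesis by simp
 qed
 hence "\<nu> = k *\<^sub>R bgrad p" by (metis vector_eq_rdot)
 thus "\<nu> = (\<nu> \<bullet> p + c) *\<^sub>R bgrad p" by (simp add: k_def)
qed

text \<open>Any interior point would do; the value of a function there fixes the coefficient of its bubble.\<close>

definition center :: 'a where "center = (\<Sum>q\<in>C. (1 / real (card C)) *\<^sub>R q)"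

lemma center_interior: "center \<in> interior T"
proof -
 have c: "card C > 0" using vertices_simplex(3) by simp
 have "bary p center = 1 / real (card C)" if "p \<in> C" for p
  by (rule barycentric_eq[OF _ _ that]) (use c in \<open>simp_all add: center_def\<close>)
 thus ?thesis using c by (simp add: interior_simplex_bary)
qed

subsection \<open>The bubble function\<close>

text \<open>On the simplex this polynomial is the bubble function; being smooth on the whole space, it provides the gradient inside and a Lipschitz bound.\<close>

definition bprod :: "'a \<Rightarrow> real" where "bprod x = (\<Prod>p\<in>C. bary p x)"
definition bprod_grad :: "'a \<Rightarrow> 'a" where "bprod_grad x = (\<Sum>p\<in>C. (\<Prod>q\<in>C - {p}. bary q x) *\<^sub>R bgrad p)"

lemma GDERIV_bary: "p \<in> C \<Longrightarrow> (bary p has_derivative (\<lambda>h. bgrad p \<bullet> h)) (at x)"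
proof -
 assume p: "p \<in> C"
 have "((\<lambda>x. bgrad p \<bullet> x + bary p 0) has_derivative (\<lambda>h. bgrad p \<bullet> h)) (at x)"
  by (auto intro!: derivative_eq_intros)
 thus ?thesis by (simp add: bary_affine[OF p, symmetric])
qed

lemma GDERIV_bprod: "GDERIV bprod x :> bprod_grad x"
 unfolding gderiv_def bprod_def[abs_def] bprod_grad_def
 by (rule has_derivative_eq_rhs[OF has_derivative_prod[OF GDERIV_bary]])
   (auto simp: inner_sum_right fun_eq_iff inner_commute mult.commute intro!: sum.cong)

lemma continuous_bprod_grad: "continuous_on A bprod_grad"
 unfolding bprod_grad_def[abs_def] by (intro continuous_intros continuous_bary) auto

lemma bubble_eq: "bubble T x = (if x \<in> T then bprod x else 0)"
 by (simp add: bubble_def bprod_def)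

lemma bubble_zero: "x \<notin> interior T \<Longrightarrow> bubble T x = 0"
proof -
 assume x: "x \<notin> interior T"
 show ?thesis
 proof (cases "x \<in> T")
  case True
  then obtain p where "p \<in> C" "bary p x = 0"
   using x simplex_bary interior_simplex_bary by force
  thus ?thesis using vertices_simplex(1) by (simp add: bubble_def prod_zero_iff) blast
 qed (simp add: bubble_def)
qed

lemma bubble_pos: "x \<in> interior T \<Longrightarrow> bubble T x > 0"
 using interior_subset[of T] interior_simplex_bary by (auto simp: bubble_def intro!: prod_pos)

text \<open>On the segment from a point inside to a point outside there is a boundary point, where the bubble vanishes.\<close>

lemma bubble_lipschitz: "\<exists>L. L-lipschitz_on UNIV (bubble T)"
proof -
 obtain B where B: "B > 0" "\<And>x. x \<in> T \<Longrightarrow> norm (bprod_grad x) \<le> B"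
  by (rule compact_continuous_bound[OF compact_simplex_T continuous_bprod_grad]) blast
 have convT: "convex T" using convex_convex_hull[of C] by (simp only: vertices_simplex(4))
 have lT: "B-lipschitz_on T bprod"
 proof (rule bounded_derivative_imp_lipschitz[OF _ convT])
  show "(bprod has_derivative (\<lambda>h. h \<bullet> bprod_grad x)) (at x within T)" for x
   using GDERIV_bprod[of x] by (auto simp: gderiv_def intro: has_derivative_at_withinI)
  show "onorm (\<lambda>h. h \<bullet> bprod_grad x) \<le> B" if "x \<in> T" for x
  proof (rule onorm_le)
   fix h
   have "\<bar>h \<bullet> bprod_grad x\<bar> \<le> norm h * norm (bprod_grad x)" by (rule Cauchy_Schwarz_ineq2)
   also have "\<dots> \<le> norm h * B" by (rule mult_left_mono[OF B(2)[OF that] norm_ge_zero])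
   finally show "norm (h \<bullet> bprod_grad x) \<le> B * norm h" by (simp add: mult.commute)
  qed
 qed (use B in simp)
 have lT2: "dist (bubble T x) (bubble T y) \<le> B * dist x y" if "x \<in> T" "y \<in> T" for x y
  using lipschitz_onD[OF lT that] that by (simp add: bubble_eq)
 have out: "dist (bubble T x) (bubble T y) \<le> B * dist x y" if x: "x \<in> T" and y: "y \<notin> T" for x y
 proof -
  have "closed_segment x y \<inter> frontier T \<noteq> {}"
   by (rule connected_Int_frontier) (use x y in auto)
  then obtain z where z: "z \<in> closed_segment x y" "z \<in> frontier T" by auto
  have zT: "z \<in> T" using z(2) compact_simplex_T by (metis compact_imp_closed frontier_subset_closed subsetD)
  have z0: "bubble T z = 0" using z(2) by (intro bubble_zero) (simp add: frontier_def)
  have y0: "bubble T y = 0" using y by (simp add: bubble_def)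
  have "dist (bubble T x) (bubble T y) \<le> B * dist x z" using lT2[OF x zT] z0 y0 by simp
  also have "\<dots> \<le> B * dist x y"
   using dist_in_closed_segment[OF z(1)] B(1) by (intro mult_left_mono) (auto simp: dist_commute)
  finally show ?thesis .
 qed
 have "B-lipschitz_on UNIV (bubble T)"
 proof (rule lipschitz_onI)
  fix x y show "dist (bubble T x) (bubble T y) \<le> B * dist x y"
  proof (cases "x \<in> T")
   case True thus ?thesis using lT2[of x y] out[of x y] by (cases "y \<in> T") auto
  next
   case False
   thus ?thesis using out[of y x] B(1) by (cases "y \<in> T") (auto simp: dist_commute bubble_def)
  qed
 qed (use B in simp)
 thus ?thesis by blast
qed

definition bubble_grad :: "'a \<Rightarrow> 'a" where "bubble_grad x = ind (interior T) x *\<^sub>R bprod_grad x"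

lemma bubble_grad_measurable: "bubble_grad \<in> borel_measurable borel"
 unfolding bubble_grad_def[abs_def]
 by (rule borel_measurable_continuous_on_indicator) (auto intro: continuous_bprod_grad)

lemma GDERIV_bubble: "x \<notin> frontier T \<Longrightarrow> GDERIV (bubble T) x :> bubble_grad x"
proof (cases "x \<in> interior T")
 case True
 have "(bubble T has_derivative (\<lambda>h. h \<bullet> bprod_grad x)) (at x)"
  by (rule has_derivative_transform_within_open[OF GDERIV_bprod[unfolded gderiv_def] open_interior True])
    (use interior_subset[of T] in \<open>auto simp: bubble_eq\<close>)
 thus ?thesis using True by (simp add: gderiv_def bubble_grad_def)
next
 case False
 assume "x \<notin> frontier T"
 hence x: "x \<in> - T" using False closure_subset[of T] by (auto simp: frontier_def)
 have o: "open (- T)" using compact_simplex_T by (simp add: compact_imp_closed open_Compl)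
 have "((\<lambda>x. 0::real) has_derivative (\<lambda>h. 0)) (at x)" by simp
 hence "(bubble T has_derivative (\<lambda>h. 0)) (at x)"
  by (rule has_derivative_transform_within_open[OF _ o x]) (simp add: bubble_def)
 thus ?thesis using False by (simp add: gderiv_def bubble_grad_def)
qed

lemma negligible_frontier_T: "negligible (frontier T)"
 using negligible_convex_frontier[OF convex_convex_hull[of C]] by (simp only: vertices_simplex(4))

end

section \<open>Hausdorff measure of pieces of hyperplanes\<close>

lemma hausdorff_content_mono: "A \<subseteq> B \<Longrightarrow> hausdorff_content s \<delta> A \<le> hausdorff_content s \<delta> B"
 unfolding hausdorff_content_def by (intro INF_superset_mono) auto

lemma hausdorff_outer_mono: "A \<subseteq> B \<Longrightarrow> hausdorff_outer s A \<le> hausdorff_outer s B"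
 unfolding hausdorff_outer_def by (intro SUP_mono') (simp add: hausdorff_content_mono)

lemma space_surface_measure [simp]: "space surface_measure = UNIV"
 and sets_surface_measure [simp]: "sets (surface_measure :: 'a::euclidean_space measure) = sets borel"
 by (simp_all add: surface_measure_def) (metis sets.sigma_sets_eq space_borel)

abbreviation hsurf :: "'a::euclidean_space set \<Rightarrow> ennreal" where
 "hsurf \<equiv> hausdorff_outer (DIM('a) - 1)"

text \<open>\<^const>\<open>measure_of\<close> is the zero measure unless its set function is a measure on the generated sigma-algebra. One set of
positive measure therefore certifies that Hausdorff measure is countably additive on the Borel sets.\<close>

lemma emeasure_surface_measure:
 fixes A B :: "'a::euclidean_space set"
 assumes pos: "emeasure (surface_measure :: 'a measure) A > 0" and B: "B \<in> sets borel"
 shows "emeasure surface_measure B = hsurf B"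
proof -
 have sb: "sigma_sets UNIV (sets borel :: 'a set set) = sets borel" by (metis sets.sigma_sets_eq space_borel)
 have "measure_space UNIV (sigma_sets UNIV (sets borel)) (hsurf :: 'a set \<Rightarrow> ennreal)"
 proof (rule ccontr)
  assume n: "\<not> ?thesis"
  have "emeasure (measure_of UNIV (sets borel) hsurf) A = 0"
   using n by (subst emeasure_measure_of_conv) auto
  thus False using pos by (simp add: surface_measure_def)
 qed
 thus ?thesis unfolding surface_measure_def
  by (subst emeasure_measure_of_conv) (use B sb in auto)
qed

text \<open>Of the order of \<open>r / \<rho>\<close> balls of radius \<open>2 \<rho>\<close> with centres along the normal cover the cylinder of radius \<open>\<rho>\<close> over \<open>y\<close>.\<close>

lemma tube_volume:
 fixes N y :: "'a::euclidean_space"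
 assumes N: "norm N = 1" and r: "r > 0" and \<rho>: "0 < \<rho>" "\<rho> \<le> 1"
 shows "emeasure lborel {x. \<bar>N \<bullet> x - c\<bar> \<le> r \<and> norm (foot_point N c x - y) \<le> \<rho>}
   \<le> ennreal ((2 * r + 1) * unit_ball_vol (real DIM('a)) * 2 ^ DIM('a) * \<rho> ^ (DIM('a) - 1))" (is "emeasure lborel ?Z \<le> _")
proof -
 define m where "m = nat \<lceil>2 * r / \<rho>\<rceil>"
 have m: "real m \<ge> 2 * r / \<rho>" "real m \<le> 2 * r / \<rho> + 1" using r \<rho> by (auto simp: m_def)
 define P where "P k = cball (y + (real k * \<rho> - r) *\<^sub>R N) (2 * \<rho>)" for k :: nat
 have cover: "?Z \<subseteq> (\<Union>k<m. P k)"
 proof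
  fix x assume x: "x \<in> ?Z"
  define t where "t = N \<bullet> x - c"
  define k0 where "k0 = nat \<lfloor>(t + r) / \<rho>\<rfloor>"
  have t: "\<bar>t\<bar> \<le> r" using x by (simp add: t_def)
  have mpos: "m > 0" using m(1) r \<rho> by (metis divide_pos_pos gr0I less_le_trans mult_pos_pos not_less of_nat_0 zero_less_numeral)
  have k0: "real k0 \<le> (t + r) / \<rho>" "(t + r) / \<rho> < real k0 + 1"
   using t \<rho> by (auto simp: k0_def of_nat_nat)
  define k where "k = min k0 (m - 1)"
  have km: "k < m" using mpos by (simp add: k_def)
  have "\<bar>t - (real k * \<rho> - r)\<bar> \<le> \<rho>"
  proof (cases "k0 \<le> m - 1")
   case True
   thus ?thesis using k0 \<rho> by (simp add: k_def field_simps abs_le_iff)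
  next
   case False
   hence k: "k = m - 1" "real k = real m - 1" using mpos by (auto simp: k_def)
   have "(t + r) / \<rho> \<le> 2 * r / \<rho>" using t \<rho> by (simp add: divide_right_mono)
   hence "t + r \<le> real m * \<rho>" using m(1) \<rho> by (simp add: pos_divide_le_eq mult.commute)
   moreover have "real k * \<rho> \<le> t + r"
   proof -
    have "real k \<le> real k0" using False k by linarith
    thus ?thesis using k0(1) \<rho> by (smt (verit) mult_right_mono pos_le_divide_eq)
   qed
   moreover have "real m * \<rho> = real k * \<rho> + \<rho>" unfolding k(2) by (simp add: algebra_simps)
   ultimately show ?thesis by linarith
  qed
  hence "norm ((t - (real k * \<rho> - r)) *\<^sub>R N) \<le> \<rho>" using N by simp
  moreover have "norm (x - t *\<^sub>R N - y) \<le> \<rho>" using x by (simp add: t_def)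
  moreover have "x - (y + (real k * \<rho> - r) *\<^sub>R N) = (x - t *\<^sub>R N - y) + (t - (real k * \<rho> - r)) *\<^sub>R N"
   by (simp add: algebra_simps)
  ultimately have "norm (x - (y + (real k * \<rho> - r) *\<^sub>R N)) \<le> 2 * \<rho>" by (smt (verit) norm_triangle_ineq)
  hence "x \<in> P k" by (simp add: P_def dist_norm norm_minus_commute)
  thus "x \<in> (\<Union>k<m. P k)" using km by auto
 qed
 have v: "emeasure lborel (P k) = ennreal (unit_ball_vol (real DIM('a)) * (2 * \<rho>) ^ DIM('a))" for k
  using \<rho> unfolding P_def by (subst emeasure_cball) auto
 have "emeasure lborel ?Z \<le> emeasure lborel (\<Union>k<m. P k)"
  by (rule emeasure_mono[OF cover]) (auto simp: P_def)
 also have "\<dots> \<le> (\<Sum>k<m. emeasure lborel (P k))"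
  by (rule emeasure_subadditive_finite) (auto simp: P_def)
 also have "\<dots> = ennreal (real m * (unit_ball_vol (real DIM('a)) * (2 * \<rho>) ^ DIM('a)))"
  unfolding v using \<rho> by (simp add: ennreal_mult ennreal_of_nat_eq_real_of_nat)
 also have "\<dots> \<le> ennreal ((2 * r + 1) * unit_ball_vol (real DIM('a)) * 2 ^ DIM('a) * \<rho> ^ (DIM('a) - 1))"
 proof (rule ennreal_leI)
  have "real m * \<rho> \<le> 2 * r + 1"
  proof -
   have "real m * \<rho> \<le> (2 * r / \<rho> + 1) * \<rho>" using m(2) \<rho> by (intro mult_right_mono) auto
   also have "\<dots> = 2 * r + \<rho>" using \<rho> by (simp add: field_simps)
   finally show ?thesis using \<rho> by simp
  qed
  hence "real m * \<rho> * (unit_ball_vol (real DIM('a)) * 2 ^ DIM('a) * \<rho> ^ (DIM('a) - 1))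
   \<le> (2 * r + 1) * (unit_ball_vol (real DIM('a)) * 2 ^ DIM('a) * \<rho> ^ (DIM('a) - 1))"
   using \<rho> by (intro mult_right_mono mult_nonneg_nonneg) auto
  moreover have "\<rho> ^ DIM('a) = \<rho> * \<rho> ^ (DIM('a) - 1)" by (simp add: power_eq_if)
  ultimately show "real m * (unit_ball_vol (real DIM('a)) * (2 * \<rho>) ^ DIM('a))
   \<le> (2 * r + 1) * unit_ball_vol (real DIM('a)) * 2 ^ DIM('a) * \<rho> ^ (DIM('a) - 1)"
   by (simp add: power_mult_distrib ac_simps)
 qed
 finally show ?thesis .
qed

text \<open>A cover of \<open>A\<close> by sets of small diameter gives a cover of the tube over \<open>A\<close> by cylinders, whose volumes are proportional to
the powers of the diameters that occur in the Hausdorff measure.\<close>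

lemma tube_le_hausdorff_outer:
 fixes N :: "'a::euclidean_space"
 assumes dim: "DIM('a) \<ge> 2" and N: "norm N = 1" and r: "r > 0"
 obtains K where "K > 0" "\<And>A c. {x. \<bar>N \<bullet> x - c\<bar> \<le> r \<and> foot_point N c x \<in> A} \<in> sets borel \<Longrightarrow>
  emeasure lborel {x. \<bar>N \<bullet> x - c\<bar> \<le> r \<and> foot_point N c x \<in> A} \<le> ennreal K * hsurf A"
proof -
 define s where "s = DIM('a) - 1"
 have s: "s \<ge> 1" using dim by (simp add: s_def)
 define V where "V = unit_ball_vol (real s)"
 have V: "V > 0" by (simp add: V_def)
 define K where "K = (2 * r + 1) * unit_ball_vol (real DIM('a)) * 2 ^ DIM('a)"
 have K: "K > 0" using r by (simp add: K_def)
 define K' where "K' = K * 2 ^ s / V"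
 have K': "K' > 0" using K V by (simp add: K'_def)
 have main: "emeasure lborel {x. \<bar>N \<bullet> x - c\<bar> \<le> r \<and> foot_point N c x \<in> A} \<le> ennreal K' * hausdorff_outer s A"
  if Bb: "{x. \<bar>N \<bullet> x - c\<bar> \<le> r \<and> foot_point N c x \<in> A} \<in> sets borel" for A c
 proof -
  define B where "B = {x. \<bar>N \<bullet> x - c\<bar> \<le> r \<and> foot_point N c x \<in> A}"
  define Z where "Z y \<rho> = {x. \<bar>N \<bullet> x - c\<bar> \<le> r \<and> norm (foot_point N c x - y) \<le> \<rho>}" for y \<rho>
  have Zc: "closed (Z y \<rho>)" for y \<rho>
  proof -
   have "Z y \<rho> = {x. \<bar>N \<bullet> x - c\<bar> \<le> r} \<inter> {x. norm (foot_point N c x - y) \<le> \<rho>}" by (auto simp: Z_def)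
   thus ?thesis by (auto intro!: closed_Int closed_Collect_le continuous_intros)
  qed
  have Zb: "Z y \<rho> \<in> sets borel" for y \<rho> using Zc by (rule borel_closed)
  have Zvol: "emeasure lborel (Z y \<rho>) \<le> ennreal (K * \<rho> ^ s)" if "0 < \<rho>" "\<rho> \<le> 1" for y \<rho>
   using tube_volume[OF N r that, of c y] by (simp add: Z_def K_def s_def)
  have le: "emeasure lborel B \<le> ennreal K' * (\<Sum>i. ennreal (V * (diameter (C i) / 2) ^ s)) + ennreal e"
   if C: "A \<subseteq> (\<Union>i. C i)" "\<And>i. bounded (C i)" "\<And>i. diameter (C i) \<le> 1/2" and e: "e > 0" for C :: "nat \<Rightarrow> 'a set" and e
  proof -
   have dnn: "diameter (C i) \<ge> 0" for i by (rule diameter_ge_0[OF C(2)])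
   \<comment> \<open>enlarge the diameters slightly, to make them positive\<close>
   have "\<exists>\<rho>. diameter (C i) \<le> \<rho> \<and> 0 < \<rho> \<and> \<rho> \<le> 1 \<and> K * \<rho> ^ s \<le> K * diameter (C i) ^ s + e * (1/2) ^ Suc i" for i
   proof -
    have lim: "((\<lambda>\<rho>. K * \<rho> ^ s) \<longlongrightarrow> K * diameter (C i) ^ s) (at_right (diameter (C i)))"
     by (intro tendsto_intros)
    have "\<forall>\<^sub>F \<rho> in at_right (diameter (C i)). K * \<rho> ^ s < K * diameter (C i) ^ s + e * (1/2) ^ Suc i"
     using e by (intro order_tendstoD(2)[OF lim]) simp
    moreover have "\<forall>\<^sub>F \<rho> in at_right (diameter (C i)). \<rho> < 1"
     using eventually_at_right_real[of "diameter (C i)" 1] C(3)[of i] by (auto elim: eventually_mono)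
    moreover have "\<forall>\<^sub>F \<rho> in at_right (diameter (C i)). \<rho> > diameter (C i)"
     by (simp add: eventually_at_right_less)
    ultimately have "\<forall>\<^sub>F \<rho> in at_right (diameter (C i)). diameter (C i) \<le> \<rho> \<and> 0 < \<rho> \<and> \<rho> \<le> 1 \<and> K * \<rho> ^ s \<le> K * diameter (C i) ^ s + e * (1/2) ^ Suc i"
     by eventually_elim (use dnn[of i] in auto)
    thus ?thesis by (rule eventually_happens'[OF trivial_limit_at_right_real])
   qed
   then obtain \<rho> where \<rho>: "\<And>i. diameter (C i) \<le> \<rho> i" "\<And>i. 0 < \<rho> i" "\<And>i. \<rho> i \<le> 1"
    "\<And>i. K * \<rho> i ^ s \<le> K * diameter (C i) ^ s + e * (1/2) ^ Suc i" by metis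
   define y where "y i = (SOME p. p \<in> C i)" for i
   have cover: "B \<subseteq> (\<Union>i. Z (y i) (\<rho> i))"
   proof
    fix x assume x: "x \<in> B"
    define p where "p = foot_point N c x"
    have "p \<in> A" using x by (simp add: B_def p_def)
    then obtain i where i: "p \<in> C i" using C(1) by auto
    hence "y i \<in> C i" unfolding y_def by (rule someI)
    hence "norm (p - y i) \<le> \<rho> i" using diameter_bounded_bound[OF C(2) i, of "y i"] \<rho>(1)[of i] by (simp add: dist_norm)
    hence "x \<in> Z (y i) (\<rho> i)" using x by (simp add: Z_def p_def B_def)
    thus "x \<in> (\<Union>i. Z (y i) (\<rho> i))" by auto
   qed
   have "emeasure lborel B \<le> emeasure lborel (\<Union>i. Z (y i) (\<rho> i))"
    by (rule emeasure_mono[OF cover]) (use Zb in auto)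
   also have "\<dots> \<le> (\<Sum>i. emeasure lborel (Z (y i) (\<rho> i)))"
    by (rule emeasure_subadditive_countably) (use Zb in auto)
   also have "\<dots> \<le> (\<Sum>i. ennreal K' * ennreal (V * (diameter (C i) / 2) ^ s) + ennreal (e * (1/2) ^ Suc i))"
   proof (rule suminf_le)
    fix i
    have "emeasure lborel (Z (y i) (\<rho> i)) \<le> ennreal (K * \<rho> i ^ s)" by (rule Zvol[OF \<rho>(2,3)])
    also have "\<dots> \<le> ennreal (K * diameter (C i) ^ s + e * (1/2) ^ Suc i)" by (rule ennreal_leI[OF \<rho>(4)])
    also have "\<dots> = ennreal (K * diameter (C i) ^ s) + ennreal (e * (1/2) ^ Suc i)"
     using K e dnn[of i] by (intro ennreal_plus) auto
    also have "K * diameter (C i) ^ s = K' * (V * (diameter (C i) / 2) ^ s)"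
     using V by (simp add: power_divide K'_def)
    also have "ennreal \<dots> = ennreal K' * ennreal (V * (diameter (C i) / 2) ^ s)"
     using K' V dnn[of i] by (intro ennreal_mult) auto
    finally show "emeasure lborel (Z (y i) (\<rho> i)) \<le> ennreal K' * ennreal (V * (diameter (C i) / 2) ^ s) + ennreal (e * (1/2) ^ Suc i)" .
   qed auto
   also have "\<dots> = ennreal K' * (\<Sum>i. ennreal (V * (diameter (C i) / 2) ^ s)) + (\<Sum>i. ennreal (e * (1/2) ^ Suc i))"
    by (subst suminf_add[symmetric]) (auto simp: ennreal_suminf_cmult)
   also have "(\<Sum>i. ennreal (e * (1/2) ^ Suc i)) = ennreal e"
    using e sums_mult[OF power_half_series, of e] by (intro suminf_ennreal_eq) auto
   finally show ?thesis .
  qed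
  have content: "emeasure lborel B \<le> ennreal K' * hausdorff_content s (1/2) A"
  proof (rule ennreal_le_epsilon)
   fix e :: real assume e: "e > 0" and fin: "ennreal K' * hausdorff_content s (1/2) A < top"
   have e2: "e / 2 > 0" using e by simp
   have "hausdorff_content s (1/2) A < top"
    using fin K' by (auto simp: ennreal_mult_less_top)
   hence "hausdorff_content s (1/2) A + 0 < hausdorff_content s (1/2) A + ennreal (e / 2 / K')"
    using e K' by (subst ennreal_add_left_cancel_less) auto
   hence "hausdorff_content s (1/2) A < hausdorff_content s (1/2) A + ennreal (e / 2 / K')" by simp
   then obtain C where C: "A \<subseteq> (\<Union>i. C i)" "\<And>i. bounded (C i)" "\<And>i. diameter (C i) \<le> 1/2"
    "(\<Sum>i. ennreal (V * (diameter (C i) / 2) ^ s)) < hausdorff_content s (1/2) A + ennreal (e / 2 / K')"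
    unfolding hausdorff_content_def[of s "1/2" A] INF_less_iff V_def by blast
   have "emeasure lborel B \<le> ennreal K' * (\<Sum>i. ennreal (V * (diameter (C i) / 2) ^ s)) + ennreal (e / 2)"
    by (rule le[OF C(1-3) e2])
   also have "\<dots> \<le> ennreal K' * (hausdorff_content s (1/2) A + ennreal (e / 2 / K')) + ennreal (e / 2)"
    using C(4) by (intro add_mono mult_left_mono) auto
   also have "\<dots> = ennreal K' * hausdorff_content s (1/2) A + (ennreal K' * ennreal (e / 2 / K') + ennreal (e / 2))"
    by (simp add: distrib_left add.assoc)
   also have "ennreal K' * ennreal (e / 2 / K') = ennreal (e / 2)"
    using K' e by (subst ennreal_mult[symmetric]) auto
   also have "ennreal (e / 2) + ennreal (e / 2) = ennreal e" using e by (subst ennreal_plus[symmetric]) auto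
   finally show "emeasure lborel B \<le> ennreal K' * hausdorff_content s (1/2) A + ennreal e" .
  qed
  also have "\<dots> \<le> ennreal K' * hausdorff_outer s A"
   unfolding hausdorff_outer_def by (intro mult_left_mono SUP_upper) auto
  finally show ?thesis by (simp add: B_def)
 qed
 show ?thesis by (rule that[OF K' main[unfolded s_def]])
qed

text \<open>The tube over a disc contains a ball.\<close>

lemma hausdorff_outer_plane_pos:
 fixes N x0 :: "'a::euclidean_space"
 assumes dim: "DIM('a) \<ge> 2" and N: "norm N = 1" and x0: "N \<bullet> x0 = c" and r: "r > 0"
  and sub: "{x. N \<bullet> x = c \<and> dist x x0 < r} \<subseteq> A"
 shows "hsurf A > 0"
proof -
 let ?D = "{x. N \<bullet> x = c \<and> dist x x0 < r}"
 let ?B = "{x. \<bar>N \<bullet> x - c\<bar> \<le> r \<and> foot_point N c x \<in> ?D}"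
 have NN: "N \<bullet> N = 1" using N by (simp add: norm_eq_1)
 obtain K where K: "K > 0" "?B \<in> sets borel \<Longrightarrow> emeasure lborel ?B \<le> ennreal K * hsurf ?D"
  by (rule tube_le_hausdorff_outer[OF dim N r]) blast
 have Beq: "?B = {x. \<bar>N \<bullet> x - c\<bar> \<le> r} \<inter> {x. dist (foot_point N c x) x0 < r}"
  by (auto simp: inner_diff_right NN)
 have Bb: "?B \<in> sets borel" unfolding Beq
  by (intro sets.Int borel_closed borel_open closed_Collect_le open_Collect_less continuous_intros)
 have cover: "ball x0 r \<subseteq> ?B"
 proof
  fix x assume x: "x \<in> ball x0 r"
  define p where "p = foot_point N c x"
  have Np: "N \<bullet> p = c" by (simp add: p_def inner_diff_right NN)
  have Nx: "\<bar>N \<bullet> x - c\<bar> \<le> r"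
  proof -
   have "N \<bullet> x - c = N \<bullet> (x - x0)" using x0 by (simp add: inner_diff_right)
   hence "\<bar>N \<bullet> x - c\<bar> \<le> norm N * norm (x - x0)" by (metis Cauchy_Schwarz_ineq2)
   thus ?thesis using x N by (simp add: dist_norm norm_minus_commute)
  qed
  have "(norm (p - x0))\<^sup>2 \<le> (norm (x - x0))\<^sup>2"
  proof -
   have a: "x - x0 = (p - x0) + (N \<bullet> x - c) *\<^sub>R N" by (simp add: p_def)
   have o: "(p - x0) \<bullet> N = 0" using Np x0 by (simp add: inner_diff_right inner_commute)
   show ?thesis unfolding a using norm_comb_square[of "p - x0" "N \<bullet> x - c" N] o by simp
  qed
  hence "dist p x0 < r" using x by (simp add: dist_norm norm_minus_commute)
  thus "x \<in> ?B" using Nx Np by (simp add: p_def)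
 qed
 have "0 < emeasure lborel (ball x0 r)" using r by (subst emeasure_ball) auto
 also have "\<dots> \<le> emeasure lborel ?B" by (rule emeasure_mono[OF cover]) (use Bb in simp)
 also have "\<dots> \<le> ennreal K * hsurf ?D" by (rule K(2)[OF Bb])
 finally have "hsurf ?D > 0" by (auto simp: zero_less_iff_neq_zero)
 thus ?thesis using hausdorff_outer_mono[OF sub, of "DIM('a) - 1"] by (rule less_le_trans)
qed

lemma hausdorff_content_finite_cover:
 assumes "finite J" "A \<subseteq> (\<Union>j\<in>J. D j)" "\<And>j. j \<in> J \<Longrightarrow> bounded (D j)" "\<And>j. j \<in> J \<Longrightarrow> diameter (D j) \<le> q"
  "q \<le> \<delta>" "0 \<le> q" "s \<ge> 1"
 shows "hausdorff_content s \<delta> A \<le> ennreal (real (card J) * (unit_ball_vol (real s) * (q / 2) ^ s))"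
proof -
 obtain h where h: "bij_betw h {0..<card J} J" using ex_bij_betw_nat_finite[OF assms(1)] by blast
 define C where "C i = (if i < card J then D (h i) else {})" for i
 have hJ: "h i \<in> J" if "i < card J" for i using h that by (auto simp: bij_betw_def)
 have "A \<subseteq> (\<Union>i. C i)"
 proof
  fix x assume "x \<in> A"
  then obtain j where j: "j \<in> J" "x \<in> D j" using assms(2) by auto
  then obtain i where "i < card J" "h i = j" using h unfolding bij_betw_def by (metis atLeastLessThan_iff imageE)
  thus "x \<in> (\<Union>i. C i)" using j by (auto simp: C_def)
 qed
 moreover have "bounded (C i)" "diameter (C i) \<le> q" for i using hJ[of i] assms(3,4,6) by (auto simp: C_def)
 ultimately have "hausdorff_content s \<delta> A \<le> (\<Sum>i. ennreal (unit_ball_vol (real s) * (diameter (C i) / 2) ^ s))"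
  unfolding hausdorff_content_def using assms(5) by (intro INF_lower) (auto intro: order_trans)
 also have "\<dots> = (\<Sum>i<card J. ennreal (unit_ball_vol (real s) * (diameter (C i) / 2) ^ s))"
  by (rule suminf_finite) (use assms(7) in \<open>auto simp: C_def power_0_left\<close>)
 also have "\<dots> \<le> (\<Sum>i<card J. ennreal (unit_ball_vol (real s) * (q / 2) ^ s))"
  using \<open>\<And>i. diameter (C i) \<le> q\<close> \<open>\<And>i. bounded (C i)\<close>
  by (intro sum_mono ennreal_leI mult_left_mono power_mono divide_right_mono) (auto intro: diameter_ge_0)
 also have "\<dots> = ennreal (real (card J) * (unit_ball_vol (real s) * (q / 2) ^ s))"
  using assms(6) by (simp add: ennreal_mult ennreal_of_nat_eq_real_of_nat)
 finally show ?thesis .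
qed

text \<open>In the coordinates \<open>t\<close> with respect to the vectors \<open>p - p\<^sub>0\<close> the convex hull lies in the unit cube of dimension \<open>s\<close>, which is divided
into \<open>m\<^sup>s\<close> cubes whose images have diameter at most \<open>M / m\<close>.\<close>

lemma hausdorff_outer_convex_hull_finite:
 fixes E :: "'a::euclidean_space set"
 assumes E: "finite E" "card E = Suc s" and s: "s \<ge> 1"
 shows "hausdorff_outer s (convex hull E) < top"
proof -
 obtain p0 where p0: "p0 \<in> E" using E by (metis card.empty equals0I nat.distinct(1))
 define E' where "E' = E - {p0}"
 have E': "finite E'" "card E' = s" using E p0 by (auto simp: E'_def)
 define M where "M = (\<Sum>p\<in>E'. norm (p - p0)) + 1"
 have M: "M > 0" unfolding M_def by (intro add_nonneg_pos sum_nonneg) auto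
 have bound: "hausdorff_content s \<delta> (convex hull E) \<le> ennreal (unit_ball_vol (real s) * (M / 2) ^ s)" if \<delta>: "\<delta> > 0" for \<delta>
 proof -
  obtain m :: nat where m: "real m > M / \<delta>" using reals_Archimedean2 by blast
  have mpos: "m > 0" using m M \<delta> by (metis divide_pos_pos gr0I not_less_iff_gr_or_eq of_nat_0 order_less_trans)
  define J where "J = (E' \<rightarrow>\<^sub>E {0..<m})"
  define D where "D k = {p0 + (\<Sum>p\<in>E'. t p *\<^sub>R (p - p0)) | t. \<forall>p\<in>E'. real (k p) / real m \<le> t p \<and> t p \<le> (real (k p) + 1) / real m}" for k :: "'a \<Rightarrow> nat"
  have Ddist: "dist x x' \<le> M / real m" if xk: "x \<in> D k" "x' \<in> D k" for x x' k
  proof -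
   obtain t t' where t: "x = p0 + (\<Sum>p\<in>E'. t p *\<^sub>R (p - p0))" "\<And>p. p \<in> E' \<Longrightarrow> real (k p) / real m \<le> t p \<and> t p \<le> (real (k p) + 1) / real m"
    and t': "x' = p0 + (\<Sum>p\<in>E'. t' p *\<^sub>R (p - p0))" "\<And>p. p \<in> E' \<Longrightarrow> real (k p) / real m \<le> t' p \<and> t' p \<le> (real (k p) + 1) / real m"
    using xk unfolding D_def by blast
   have e: "x - x' = (\<Sum>p\<in>E'. (t p - t' p) *\<^sub>R (p - p0))" by (simp add: t t' scaleR_diff_left sum_subtractf)
   have "dist x x' \<le> (\<Sum>p\<in>E'. norm ((t p - t' p) *\<^sub>R (p - p0)))" unfolding dist_norm e by (rule norm_sum)
   also have "\<dots> \<le> (\<Sum>p\<in>E'. (1 / real m) * norm (p - p0))"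
   proof (rule sum_mono)
    fix p assume p: "p \<in> E'"
    have "\<bar>t p - t' p\<bar> \<le> 1 / real m" using t(2)[OF p] t'(2)[OF p] by (simp add: add_divide_distrib abs_le_iff)
    thus "norm ((t p - t' p) *\<^sub>R (p - p0)) \<le> (1 / real m) * norm (p - p0)"
     by (simp only: norm_scaleR) (rule mult_right_mono, auto)
   qed
   also have "\<dots> = (\<Sum>p\<in>E'. norm (p - p0)) / real m" by (simp add: sum_divide_distrib)
   also have "\<dots> \<le> M / real m" by (intro divide_right_mono) (auto simp: M_def)
   finally show ?thesis .
  qed
  have Db: "bounded (D k)" for k
   unfolding bounded_two_points using Ddist by blast
  have Dd: "diameter (D k) \<le> M / real m" for k
   using Ddist M by (intro diameter_le) (auto simp: dist_norm)
  have cover: "convex hull E \<subseteq> (\<Union>k\<in>J. D k)"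
  proof
   fix x assume "x \<in> convex hull E"
   then obtain u where u: "\<And>p. p \<in> E \<Longrightarrow> 0 \<le> u p" "sum u E = 1" "(\<Sum>p\<in>E. u p *\<^sub>R p) = x"
    unfolding convex_hull_finite[OF E(1)] by auto
   have u1: "u p \<le> 1" if "p \<in> E" for p
    using member_le_sum[OF that _ E(1), of u] u that by auto
   have "x = p0 + (\<Sum>p\<in>E. u p *\<^sub>R (p - p0))"
    using u by (simp add: scaleR_diff_right sum_subtractf scaleR_left.sum[symmetric])
   also have "(\<Sum>p\<in>E. u p *\<^sub>R (p - p0)) = (\<Sum>p\<in>E'. u p *\<^sub>R (p - p0))"
    unfolding E'_def using sum.remove[OF E(1) p0, of "\<lambda>p. u p *\<^sub>R (p - p0)"] by simp
   finally have x: "x = p0 + (\<Sum>p\<in>E'. u p *\<^sub>R (p - p0))" .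
   define k where "k = restrict (\<lambda>p. min (nat \<lfloor>u p * real m\<rfloor>) (m - 1)) E'"
   have kJ: "k \<in> J" using mpos by (auto simp: k_def J_def)
   have "real (k p) / real m \<le> u p \<and> u p \<le> (real (k p) + 1) / real m" if p: "p \<in> E'" for p
   proof -
    have pE: "p \<in> E" using p by (simp add: E'_def)
    have um: "0 \<le> u p * real m" "u p * real m \<le> real m" using u(1)[OF pE] mult_right_mono[OF u1[OF pE], of "real m"] by auto
    define z where "z = nat \<lfloor>u p * real m\<rfloor>"
    have z: "real z \<le> u p * real m" "u p * real m < real z + 1" using um by (auto simp: z_def of_nat_nat)
    have kz: "k p = min z (m - 1)" using p by (simp add: k_def z_def)
    have "real (k p) \<le> u p * real m" using z kz by linarith
    moreover have "u p * real m \<le> real (k p) + 1" using z um kz mpos by (cases "z \<le> m - 1") auto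
    ultimately show ?thesis using mpos by (simp add: field_simps)
   qed
   hence "x \<in> D k" unfolding D_def using x by blast
   thus "x \<in> (\<Union>k\<in>J. D k)" using kJ by blast
  qed
  have "hausdorff_content s \<delta> (convex hull E) \<le> ennreal (real (card J) * (unit_ball_vol (real s) * (M / real m / 2) ^ s))"
  proof (rule hausdorff_content_finite_cover[OF _ cover Db Dd _ _ s])
   show "finite J" unfolding J_def by (intro finite_PiE) (auto simp: E')
   show "M / real m \<le> \<delta>" using m \<delta> mpos by (simp add: field_simps)
   show "0 \<le> M / real m" using M by simp
  qed
  also have "real (card J) * (unit_ball_vol (real s) * (M / real m / 2) ^ s) = unit_ball_vol (real s) * (M / 2) ^ s"
   using mpos E' by (simp add: J_def card_PiE power_divide prod_constant)
  finally show ?thesis .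
 qed
 have "hausdorff_outer s (convex hull E) \<le> ennreal (unit_ball_vol (real s) * (M / 2) ^ s)"
  unfolding hausdorff_outer_def by (rule SUP_least) (use bound in auto)
 thus ?thesis by (rule order.strict_trans1) simp
qed

text \<open>The converse comparison, for null sets. The tube over \<open>A\<close> is covered by nonoverlapping cubes of small total volume. By Fubini there is
a level \<open>t\<close> at which the sum of \<open>(diameter)\<^sup>s\<close> over the cubes that meet the plane at distance \<open>t\<close>
is small; their slices, shifted back by \<open>t\<close> along the normal, cover \<open>A\<close>.\<close>

lemma hausdorff_outer_null_of_tube:
 fixes N :: "'a::euclidean_space" and A :: "'a set"
 assumes dim: "DIM('a) \<ge> 2" and N: "norm N = 1" and A: "A \<in> sets borel" "bounded A" "A \<subseteq> {y. N \<bullet> y = c}"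
  and null: "emeasure lborel {x. \<bar>N \<bullet> x - c\<bar> < 1/2 \<and> foot_point N c x \<in> A} = 0"
 shows "hsurf A = 0"
proof -
 define s where "s = DIM('a) - 1"
 have s: "s \<ge> 1" "DIM('a) = Suc s" using dim by (simp_all add: s_def)
 define V where "V = unit_ball_vol (real s)"
 have V: "V > 0" by (simp add: V_def)
 have NN: "N \<bullet> N = 1" using N by (simp add: norm_eq_1)
 define Z where "Z = {x. \<bar>N \<bullet> x - c\<bar> < 1/2 \<and> foot_point N c x \<in> A}"
 have Zb: "Z \<in> sets borel"
 proof -
  have "Z = {x. \<bar>N \<bullet> x - c\<bar> < 1/2} \<inter> ((\<lambda>x. foot_point N c x) -` A \<inter> space borel)" by (auto simp: Z_def)
  moreover have "(\<lambda>x. foot_point N c x) \<in> borel_measurable borel" by measurable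
  ultimately show ?thesis using A(1)
   by (auto intro!: sets.Int borel_open open_Collect_less continuous_intros simp: measurable_sets)
 qed
 obtain R where R: "R > 0" "\<And>x. x \<in> A \<Longrightarrow> norm x \<le> R" using A(2) by (auto simp: bounded_pos)
 have Zbd: "norm x \<le> R + 1" if "x \<in> Z" for x
 proof -
  have "norm x \<le> norm (foot_point N c x) + norm ((N \<bullet> x - c) *\<^sub>R N)"
   using norm_triangle_ineq[of "foot_point N c x" "(N \<bullet> x - c) *\<^sub>R N"] by simp
  also have "\<dots> \<le> R + 1" using that R N by (intro add_mono) (auto simp: Z_def)
  finally show ?thesis .
 qed
 define b where "b = (R + 1) *\<^sub>R (One :: 'a)"
 have bi: "b \<bullet> i = R + 1" if "i \<in> Basis" for i using that by (simp add: b_def)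
 have Zbox: "Z \<subseteq> cbox (- b) b"
 proof
  fix x assume x: "x \<in> Z"
  have "\<bar>x \<bullet> i\<bar> \<le> R + 1" if "i \<in> Basis" for i using Basis_le_norm[OF that, of x] Zbd[OF x] by linarith
  thus "x \<in> cbox (- b) b" by (auto simp: mem_box bi abs_le_iff)  (smt (verit))
 qed
 have bne: "box (- b) b \<noteq> {}" using R by (simp add: box_ne_empty bi)
 define q where "q = sqrt (real DIM('a))"
 have q: "q > 0" by (simp add: q_def)
 have content: "hausdorff_content s \<delta> A \<le> ennreal (V * (2 * q ^ Suc s * \<eta>))" if \<delta>: "\<delta> > 0" and \<eta>: "\<eta> > 0" for \<delta> \<eta>
 proof -
  obtain U where U: "open U" "Z \<subseteq> U" "emeasure lborel (U - Z) \<le> ennreal \<eta>"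
   by (rule outer_regular_lborel_le[OF Zb \<eta>]) blast
  have Um: "emeasure lborel U \<le> ennreal \<eta>"
  proof -
   have "emeasure lborel U \<le> emeasure lborel (U - Z) + emeasure lborel Z"
    using U(1,2) Zb by (subst plus_emeasure) (auto intro!: emeasure_mono)
   thus ?thesis using U(3) null by (simp add: Z_def)
  qed
  \<comment> \<open>the gauge keeps the cubes inside U and their diameters below delta\<close>
  define g where "g x = (if x \<in> U then ball x (\<delta> / 2) \<inter> U else ball x 1)" for x
  have g: "gauge g" using U(1) \<delta> by (auto simp: gauge_def g_def)
  \<comment> \<open>dyadic cubes: all sides of \<open>cbox (- b) b\<close> have the same length\<close>
  obtain \<D> where D: "countable \<D>" "\<Union>\<D> \<subseteq> cbox (- b) b"
   "\<And>K. K \<in> \<D> \<Longrightarrow> interior K \<noteq> {} \<and> (\<exists>c d. K = cbox c d)"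
   "pairwise (\<lambda>A B. interior A \<inter> interior B = {}) \<D>"
   "\<And>K. K \<in> \<D> \<Longrightarrow> \<exists>x \<in> Z \<inter> K. K \<subseteq> g x"
   "\<And>u v. cbox u v \<in> \<D> \<Longrightarrow> \<exists>n. \<forall>i\<in>Basis. v \<bullet> i - u \<bullet> i = (b \<bullet> i - (- b) \<bullet> i) / 2 ^ n"
   "Z \<subseteq> \<Union>\<D>"
   by (rule covering_lemma[OF Zbox bne g]) blast
  define D where "D i = (if i \<in> to_nat_on \<D> ` \<D> then from_nat_into \<D> i else {})" for i :: nat
  have Dmem: "D i \<in> \<D> \<or> D i = {}" for i using D(1) by (auto simp: D_def)
  have Dcov: "Z \<subseteq> (\<Union>i. D i)"
  proof
   fix x assume "x \<in> Z"
   then obtain K where K: "K \<in> \<D>" "x \<in> K" using D(7) by auto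
   hence "D (to_nat_on \<D> K) = K" using D(1) by (simp add: D_def)
   thus "x \<in> (\<Union>i. D i)" using K(2) by auto
  qed
  have Dinj: "D i \<noteq> D j" if "i \<noteq> j" "D i \<noteq> {}" for i j
  proof
   assume e: "D i = D j"
   hence "i \<in> to_nat_on \<D> ` \<D>" "j \<in> to_nat_on \<D> ` \<D>" using that(2) by (auto simp: D_def split: if_splits)
   hence "to_nat_on \<D> (D i) = i" "to_nat_on \<D> (D j) = j" using D(1) by (auto simp: D_def)
   thus False using e that(1) by simp
  qed
  define dm where "dm i = diameter (D i)" for i
  have Dprop: "compact (D i)" "dm i \<le> \<delta>" "D i \<subseteq> U" "dm i ^ Suc s \<le> q ^ Suc s * measure lborel (D i)"
   "emeasure lborel (D i) = emeasure lborel (interior (D i))" for i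
  proof -
   have "compact (D i) \<and> dm i \<le> \<delta> \<and> D i \<subseteq> U \<and> dm i ^ Suc s \<le> q ^ Suc s * measure lborel (D i) \<and> emeasure lborel (D i) = emeasure lborel (interior (D i))"
   proof (cases "D i = {}")
    case True
    thus ?thesis using \<delta> by (simp add: dm_def)
   next
    case False
    hence K: "D i \<in> \<D>" using Dmem by blast
    obtain u v where uv: "D i = cbox u v" using D(3)[OF K] by auto
    obtain x where x: "x \<in> Z" "x \<in> D i" "D i \<subseteq> g x" using D(5)[OF K] by auto
    have gx: "g x = ball x (\<delta> / 2) \<inter> U" using x(1) U(2) by (auto simp: g_def)
    obtain n where n: "\<And>j. j \<in> Basis \<Longrightarrow> v \<bullet> j - u \<bullet> j = (b \<bullet> j - (- b) \<bullet> j) / 2 ^ n" using D(6) K uv by metis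
    define l where "l = 2 * (R + 1) / 2 ^ n"
    have l: "l > 0" using R by (simp add: l_def)
    have side: "v \<bullet> j - u \<bullet> j = l" if "j \<in> Basis" for j using n[OF that] bi[OF that] by (simp add: l_def)
    have "dm i \<le> \<delta>" unfolding dm_def
    proof (rule diameter_le)
     fix y z assume "y \<in> D i" "z \<in> D i"
     hence "dist x y < \<delta> / 2" "dist x z < \<delta> / 2" using x(3) gx by auto
     thus "norm (y - z) \<le> \<delta>" using dist_triangle2[of y z x] by (simp add: dist_norm[symmetric] dist_commute)
    qed (use \<delta> in simp)
    moreover have "dm i \<le> q * l" unfolding dm_def
    proof (rule diameter_le)
     fix y z assume yz: "y \<in> D i" "z \<in> D i"
     have "\<bar>(y - z) \<bullet> j\<bar> \<le> l" if j: "j \<in> Basis" for j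
      using yz side[OF j] j unfolding uv by (auto simp: mem_box inner_diff_left abs_le_iff) (smt (verit))+
     hence c: "((y - z) \<bullet> j)\<^sup>2 \<le> l\<^sup>2" if "j \<in> Basis" for j
      using that l by (metis abs_le_square_iff abs_of_pos)
     have "(norm (y - z))\<^sup>2 = (\<Sum>j\<in>Basis. ((y - z) \<bullet> j)\<^sup>2)"
      by (subst power2_norm_eq_inner, subst euclidean_inner) (simp add: power2_eq_square)
     also have "\<dots> \<le> (\<Sum>j\<in>(Basis :: 'a set). l\<^sup>2)" by (intro sum_mono c)
     also have "\<dots> = (q * l)\<^sup>2" by (simp add: q_def power_mult_distrib)
     finally show "norm (y - z) \<le> q * l" by (rule power2_le_imp_le) (use q l in simp)
    qed (use q l in simp)
    moreover have "measure lborel (D i) = l ^ Suc s"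
    proof -
     have "measure lborel (cbox u v) = (\<Prod>j\<in>Basis. (v - u) \<bullet> j)"
     proof (rule measure_lborel_cbox)
      fix j :: 'a assume "j \<in> Basis"
      from side[OF this] l show "u \<bullet> j \<le> v \<bullet> j" by linarith
     qed
     also have "\<dots> = (\<Prod>j\<in>(Basis :: 'a set). l)" using side by (intro prod.cong) (auto simp: inner_diff_left)
     finally show ?thesis using s(2) by (simp add: uv)
    qed
    moreover have "dm i \<ge> 0" unfolding dm_def uv by (rule diameter_ge_0) simp
    ultimately have "dm i ^ Suc s \<le> q ^ Suc s * measure lborel (D i)"
     by (metis power_mono power_mult_distrib)
    moreover have "emeasure lborel (D i) = emeasure lborel (interior (D i))"
     unfolding uv interior_cbox by (simp add: emeasure_lborel_cbox_eq emeasure_lborel_box_eq)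
    ultimately show ?thesis using \<open>dm i \<le> \<delta>\<close> x(3) gx uv by auto
   qed
   thus "compact (D i)" "dm i \<le> \<delta>" "D i \<subseteq> U" "dm i ^ Suc s \<le> q ^ Suc s * measure lborel (D i)"
    "emeasure lborel (D i) = emeasure lborel (interior (D i))" by auto
  qed
  have dm0: "dm i \<ge> 0" for i unfolding dm_def by (rule diameter_ge_0[OF compact_imp_bounded[OF Dprop(1)]])
  have Dfin: "emeasure lborel (D i) = ennreal (measure lborel (D i))" for i
   using emeasure_bounded_finite[OF compact_imp_bounded[OF Dprop(1)], of i] by (intro emeasure_eq_ennreal_measure) auto
  have Dsum: "(\<Sum>i. emeasure lborel (D i)) \<le> ennreal \<eta>"
  proof -
   have "disjoint_family (\<lambda>i. interior (D i))"
   proof (unfold disjoint_family_on_def, intro ballI impI)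
    fix i j :: nat assume "i \<noteq> j"
    show "interior (D i) \<inter> interior (D j) = {}"
     using pairwiseD[OF D(4), of "D i" "D j"] Dmem[of i] Dmem[of j] Dinj[OF \<open>i \<noteq> j\<close>] by (cases "D i = {}"; cases "D j = {}") auto
   qed
   hence "(\<Sum>i. emeasure lborel (interior (D i))) = emeasure lborel (\<Union>i. interior (D i))"
    by (intro suminf_emeasure) auto
   also have "\<dots> \<le> emeasure lborel U"
   proof (rule emeasure_mono)
    show "(\<Union>i. interior (D i)) \<subseteq> U" using Dprop(3) interior_subset by blast
    show "U \<in> sets lborel" using U(1) by simp
   qed
   finally show ?thesis using Um Dprop(5) by simp
  qed
  define E where "E i = (\<lambda>x. N \<bullet> x - c) ` D i" for i
  have Ec: "compact (E i)" for i unfolding E_def by (intro compact_continuous_image continuous_intros Dprop(1))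
  have Eb: "E i \<in> sets borel" for i using Ec by (rule borel_compact)
  have Em: "emeasure lborel (E i) \<le> ennreal (2 * dm i)" for i
  proof (cases "D i = {}")
   case True thus ?thesis by (simp add: E_def)
  next
   case False
   then obtain x0 where x0: "x0 \<in> D i" by auto
   have "E i \<subseteq> {(N \<bullet> x0 - c) - dm i .. (N \<bullet> x0 - c) + dm i}"
   proof
    fix t assume "t \<in> E i"
    then obtain x where x: "x \<in> D i" "t = N \<bullet> x - c" by (auto simp: E_def)
    have "\<bar>t - (N \<bullet> x0 - c)\<bar> = \<bar>N \<bullet> (x - x0)\<bar>" by (simp add: x inner_diff_right)
    also have "\<dots> \<le> norm N * norm (x - x0)" by (rule Cauchy_Schwarz_ineq2)
    also have "\<dots> \<le> dm i"
     using diameter_bounded_bound[OF compact_imp_bounded[OF Dprop(1)] x(1) x0] N by (simp add: dm_def dist_norm)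
    finally show "t \<in> {(N \<bullet> x0 - c) - dm i .. (N \<bullet> x0 - c) + dm i}" by (auto simp: abs_le_iff)
   qed
   hence "emeasure lborel (E i) \<le> emeasure lborel {(N \<bullet> x0 - c) - dm i .. (N \<bullet> x0 - c) + dm i}" by (intro emeasure_mono) auto
   also have "\<dots> = ennreal (2 * dm i)" using dm0[of i] by simp
   finally show ?thesis .
  qed
  \<comment> \<open>the sum of the s-th powers of the diameters of the cubes that meet level t\<close>
  define \<Psi> where "\<Psi> t = (\<Sum>i. ennreal (dm i ^ s) * indicator (E i) t)" for t :: real
  have int: "(\<integral>\<^sup>+t. \<Psi> t \<partial>lborel) \<le> ennreal (2 * q ^ Suc s * \<eta>)"
  proof -
   have "(\<integral>\<^sup>+t. \<Psi> t \<partial>lborel) = (\<Sum>i. \<integral>\<^sup>+t. ennreal (dm i ^ s) * indicator (E i) t \<partial>lborel)"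
    unfolding \<Psi>_def using Eb by (intro nn_integral_suminf) auto
   also have "\<dots> = (\<Sum>i. ennreal (dm i ^ s) * emeasure lborel (E i))"
    using Eb by (simp add: nn_integral_cmult_indicator)
   also have "\<dots> \<le> (\<Sum>i. ennreal (2 * q ^ Suc s) * emeasure lborel (D i))"
   proof (rule suminf_le)
    fix i
    have "ennreal (dm i ^ s) * emeasure lborel (E i) \<le> ennreal (dm i ^ s) * ennreal (2 * dm i)"
     by (rule mult_left_mono[OF Em]) simp
    also have "\<dots> = ennreal (2 * dm i ^ Suc s)" using dm0[of i] by (subst ennreal_mult[symmetric]) (auto simp: ac_simps)
    also have "\<dots> \<le> ennreal (2 * q ^ Suc s * measure lborel (D i))" using Dprop(4)[of i] by (intro ennreal_leI) simp
    also have "\<dots> = ennreal (2 * q ^ Suc s) * emeasure lborel (D i)" using q by (subst ennreal_mult) (auto simp: Dfin)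
    finally show "ennreal (dm i ^ s) * emeasure lborel (E i) \<le> ennreal (2 * q ^ Suc s) * emeasure lborel (D i)" .
   qed auto
   also have "\<dots> = ennreal (2 * q ^ Suc s) * (\<Sum>i. emeasure lborel (D i))" by (simp add: ennreal_suminf_cmult)
   also have "\<dots> \<le> ennreal (2 * q ^ Suc s) * ennreal \<eta>" by (rule mult_left_mono[OF Dsum]) simp
   also have "\<dots> = ennreal (2 * q ^ Suc s * \<eta>)" using q \<eta> by (subst ennreal_mult) auto
   finally show ?thesis .
  qed
  have "\<exists>t\<in>{-1/2<..<1/2}. \<Psi> t \<le> ennreal (2 * q ^ Suc s * \<eta>)"
  proof (rule ccontr)
   assume n: "\<not> ?thesis"
   define M where "M = ennreal (2 * q ^ Suc s * \<eta>)"
   have \<Psi>m: "\<Psi> \<in> borel_measurable borel" unfolding \<Psi>_def using Eb by measurable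
   have pos: "\<integral>\<^sup>+t. (\<Psi> t - M) * indicator {-1/2<..<1/2} t \<partial>lborel \<noteq> 0"
   proof
    assume "(\<integral>\<^sup>+t. (\<Psi> t - M) * indicator {-1/2<..<1/2} t \<partial>lborel) = 0"
    hence "AE t in lborel. (\<Psi> t - M) * indicator {-1/2<..<1/2::real} t = 0"
     using \<Psi>m by (subst (asm) nn_integral_0_iff_AE) auto
    hence "AE t in lborel. t \<notin> {-1/2<..<1/2::real}"
    proof eventually_elim
     case (elim t)
     show ?case
     proof
      assume t: "t \<in> {-1/2<..<1/2::real}"
      hence "\<Psi> t - M = 0" using elim by simp
      hence "\<Psi> t \<le> M" by (auto simp: diff_eq_0_iff_ennreal)
      thus False using n t unfolding M_def[symmetric] by blast
     qed
    qed
    hence "emeasure lborel {-1/2<..<1/2::real} = 0" by (subst (asm) AE_iff_measurable[of "{-1/2<..<1/2}"]) auto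
    thus False by simp
   qed
   have "(\<integral>\<^sup>+t. (\<Psi> t - M) * indicator {-1/2<..<1/2} t \<partial>lborel) + M
    = (\<integral>\<^sup>+t. (\<Psi> t - M) * indicator {-1/2<..<1/2} t \<partial>lborel) + (\<integral>\<^sup>+t. M * indicator {-1/2<..<1/2::real} t \<partial>lborel)"
    by (simp add: nn_integral_cmult_indicator)
   also have "\<dots> = (\<integral>\<^sup>+t. (\<Psi> t - M) * indicator {-1/2<..<1/2} t + M * indicator {-1/2<..<1/2} t \<partial>lborel)"
    using \<Psi>m by (intro nn_integral_add[symmetric]) auto
   also have "\<dots> \<le> (\<integral>\<^sup>+t. \<Psi> t \<partial>lborel)"
    using n unfolding M_def[symmetric]
    by (intro nn_integral_mono) (auto split: split_indicator simp: not_le diff_add_cancel_ennreal less_imp_le)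
   also have "\<dots> \<le> M" using int by (simp add: M_def)
   finally have "(\<integral>\<^sup>+t. (\<Psi> t - M) * indicator {-1/2<..<1/2} t \<partial>lborel) + M \<le> 0 + M" by simp
   hence "(\<integral>\<^sup>+t. (\<Psi> t - M) * indicator {-1/2<..<1/2} t \<partial>lborel) \<le> 0"
    unfolding add.commute[of _ M] by (subst (asm) ennreal_add_left_cancel_le) (auto simp: M_def)
   thus False using pos by simp
  qed
  then obtain t where t: "-1/2 < t" "t < 1/2" "\<Psi> t \<le> ennreal (2 * q ^ Suc s * \<eta>)" by auto
  define C where "C i = {y \<in> A. y + t *\<^sub>R N \<in> D i}" for i
  have Ct: "t \<in> E i" if "y \<in> C i" for y i
  proof -
   have "N \<bullet> (y + t *\<^sub>R N) - c = t" using that A(3) by (auto simp: C_def inner_add_right NN)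
   thus ?thesis using that unfolding E_def C_def by (metis (mono_tags, lifting) image_eqI mem_Collect_eq)
  qed
  have Cdist: "dist y z \<le> dm i" if "y \<in> C i" "z \<in> C i" for y z i
   using diameter_bounded_bound[OF compact_imp_bounded[OF Dprop(1)], of "y + t *\<^sub>R N" i "z + t *\<^sub>R N"] that
   by (simp add: C_def dm_def)
  have Cd: "diameter (C i) \<le> dm i * indicator (E i) t" for i
  proof (cases "C i = {}")
   case True thus ?thesis using dm0[of i] by (simp add: True)
  next
   case False
   hence "t \<in> E i" using Ct by auto
   thus ?thesis using Cdist by (simp, intro diameter_le) (use False in \<open>auto simp: dist_norm\<close>)
  qed
  have Cb: "bounded (C i)" for i using bounded_subset[OF A(2)] by (auto simp: C_def)
  have "hausdorff_content s \<delta> A \<le> (\<Sum>i. ennreal (V * (diameter (C i) / 2) ^ s))"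
   unfolding hausdorff_content_def V_def
  proof (rule INF_lower, intro CollectI conjI allI)
   show "A \<subseteq> (\<Union>i. C i)"
   proof
    fix y assume y: "y \<in> A"
    have "N \<bullet> (y + t *\<^sub>R N) - c = t" using y A(3) by (auto simp: inner_add_right NN)
    hence "y + t *\<^sub>R N \<in> Z" unfolding Z_def using t y by auto
    thus "y \<in> (\<Union>i. C i)" using Dcov y by (auto simp: C_def)
   qed
   fix i
   show "bounded (C i)" by (rule Cb)
   show "diameter (C i) \<le> \<delta>" using Cd[of i] Dprop(2)[of i] dm0[of i] \<delta> by (cases "t \<in> E i") auto
  qed
  also have "\<dots> \<le> (\<Sum>i. ennreal V * (ennreal (dm i ^ s) * indicator (E i) t))"
  proof (rule suminf_le)
   fix i
   have "(diameter (C i) / 2) ^ s \<le> (dm i * indicator (E i) t) ^ s"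
    using Cd[of i] diameter_ge_0[OF Cb[of i]] by (intro power_mono) auto
   also have "\<dots> = dm i ^ s * indicator (E i) t" using s(1) by (auto simp: indicator_def)
   finally have "ennreal (V * (diameter (C i) / 2) ^ s) \<le> ennreal (V * (dm i ^ s * indicator (E i) t))"
    using V by (intro ennreal_leI) simp
   also have "\<dots> = ennreal V * (ennreal (dm i ^ s) * indicator (E i) t)"
    using V dm0[of i] by (auto simp: ennreal_mult indicator_def)
   finally show "ennreal (V * (diameter (C i) / 2) ^ s) \<le> ennreal V * (ennreal (dm i ^ s) * indicator (E i) t)" .
  qed auto
  also have "\<dots> = ennreal V * \<Psi> t" unfolding \<Psi>_def by (simp add: ennreal_suminf_cmult)
  also have "\<dots> \<le> ennreal V * ennreal (2 * q ^ Suc s * \<eta>)" by (rule mult_left_mono[OF t(3)]) simp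
  also have "\<dots> = ennreal (V * (2 * q ^ Suc s * \<eta>))" using V q \<eta> by (subst ennreal_mult) auto
  finally show ?thesis .
 qed
 have "hausdorff_content s \<delta> A \<le> 0" if \<delta>: "\<delta> > 0" for \<delta>
 proof (rule ennreal_le_epsilon)
  fix e :: real assume e: "e > 0"
  have "V * (2 * q ^ Suc s * (e / (V * (2 * q ^ Suc s)))) = e" using V q by (simp add: field_simps)
  thus "hausdorff_content s \<delta> A \<le> 0 + ennreal e"
   using content[OF \<delta>, of "e / (V * (2 * q ^ Suc s))"] e V q by simp
 qed
 hence "hausdorff_outer s A \<le> 0" unfolding hausdorff_outer_def by (intro SUP_least) auto
 thus ?thesis by (simp add: s_def)
qed

section \<open>Meshes of Lipschitz domains\<close>

lemma flux_minus: "flux F (- n) (- c) q = - flux F n c q"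
proof -
 have s: "x - ((- n) \<bullet> x - (- c)) *\<^sub>R (- n) = foot_point n c x" for x by (simp add: algebra_simps)
 have a: "\<bar>(- n) \<bullet> x - (- c)\<bar> = \<bar>n \<bullet> x - c\<bar>" for x by (simp add: abs_minus_commute)
 show ?thesis unfolding flux_def s a inner_minus_right by simp
qed

lemma flux_nonneg:
 assumes "\<And>y. y \<in> F \<Longrightarrow> 0 \<le> q y \<bullet> n"
 shows "0 \<le> flux F n c q"
 unfolding flux_def by (intro integral_nonneg_AE AE_I2) (auto simp: indicator_def assms)

text \<open>A Lipschitz domain lies on one side of its boundary: just below a boundary point, with respect to the local graph, there is an open set that misses the domain.\<close>

lemma lipschitz_domain_interior_closure:
 assumes "lipschitz_domain \<Omega>"
 shows "interior (closure \<Omega>) = \<Omega>"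
proof
 have o: "open \<Omega>" using assms by (simp add: lipschitz_domain_def)
 show "\<Omega> \<subseteq> interior (closure \<Omega>)" by (rule interior_maximal[OF closure_subset o])
 show "interior (closure \<Omega>) \<subseteq> \<Omega>"
 proof (rule subsetI, rule ccontr)
  fix x assume x: "x \<in> interior (closure \<Omega>)" and nx: "x \<notin> \<Omega>"
  have "x \<in> frontier \<Omega>" using x nx interior_subset[of "closure \<Omega>"] interior_open[OF o] by (auto simp: frontier_def)
  then obtain e r L \<phi> where e: "norm e = 1" "r > 0" and L: "L-lipschitz_on {z. z \<bullet> e = 0} \<phi>"
   and graph: "\<And>y. y \<in> ball x r \<Longrightarrow> y \<in> \<Omega> \<longleftrightarrow> \<phi> (y - (y \<bullet> e) *\<^sub>R e) < y \<bullet> e"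
   using assms unfolding lipschitz_domain_def by blast
  have ee: "e \<bullet> e = 1" using e by (simp add: norm_eq_1)
  obtain r' where r': "r' > 0" "ball x r' \<subseteq> closure \<Omega>" using x by (auto simp: mem_interior)
  define s where "s = min r r' / 2"
  have s: "s > 0" "s < r" "s < r'" using e r' by (auto simp: s_def min_def)
  define y where "y = x - s *\<^sub>R e"
  have dy: "dist x y = s" using s e by (simp add: y_def dist_norm)
  have yr: "y \<in> ball x r" "y \<in> ball x r'" using dy s by auto
  define pr where "pr z = z - (z \<bullet> e) *\<^sub>R e" for z
  have prp: "pr z \<in> {z. z \<bullet> e = 0}" for z by (simp add: pr_def inner_diff_left ee)
  have pry: "pr y = pr x" by (simp add: pr_def y_def inner_diff_left ee algebra_simps)
  have xe: "\<phi> (pr x) \<ge> x \<bullet> e" using graph[of x] nx e by (simp add: pr_def)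
  define H where "H z = \<phi> (pr z) - z \<bullet> e" for z
  have contpr: "continuous_on UNIV pr" unfolding pr_def by (intro continuous_intros)
  have contH: "continuous_on UNIV H" unfolding H_def
   by (intro continuous_intros continuous_on_compose2[OF lipschitz_on_continuous_on[OF L] contpr]) (use prp in auto)
  have Hy: "H y > 0" using xe pry s by (simp add: H_def y_def inner_diff_left ee)
  define U where "U = {z. H z > 0} \<inter> ball x r"
  have "open {z. H z > 0}" using open_Collect_less[of "\<lambda>z. 0" H] contH by simp
  hence U: "open U" "y \<in> U" using Hy yr by (auto simp: U_def)
  have "U \<inter> \<Omega> = {}" using graph by (auto simp: U_def H_def pr_def)
  hence "U \<inter> closure \<Omega> = {}" using U(1) open_Int_closure_eq_empty by blast
  thus False using U(2) yr(2) r'(2) by auto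
 qed
qed

locale polyhedral_domain =
 fixes \<Omega> :: "'a::euclidean_space set" and \<T> :: "'a set set"
 assumes dim2: "DIM('a) \<ge> 2" and domain: "lipschitz_domain \<Omega>" and mesh: "mesh \<Omega> \<T>"
begin

abbreviation "vol \<equiv> lebesgue_on \<Omega>"
abbreviation "grad \<equiv> wgrad \<Omega>"

lemma open_domain: "open \<Omega>" and bounded_domain: "bounded \<Omega>" and nonempty_domain: "\<Omega> \<noteq> {}"
 using domain by (simp_all add: lipschitz_domain_def)

lemma compact_closure_domain: "compact (closure \<Omega>)"
 using bounded_domain by (simp add: compact_closure)

lemma domain_lebesgue: "\<Omega> \<in> sets lebesgue" using open_domain by simp

lemma finite_mesh: "finite \<T>" and Union_mesh: "\<Union>\<T> = closure \<Omega>"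
 using mesh by (simp_all add: mesh_def triangulation_def)

lemma mesh_nonempty: "\<T> \<noteq> {}"
proof
 assume "\<T> = {}"
 hence "closure \<Omega> = {}" using Union_mesh by simp
 thus False using nonempty_domain by (simp only: closure_eq_empty)
qed

lemma cell: "T \<in> \<T> \<Longrightarrow> full_simplex T"
 using mesh dim2 by (simp add: mesh_def full_simplex_def)

lemma cell_face: "T \<in> \<T> \<Longrightarrow> T' \<in> \<T> \<Longrightarrow> (T \<inter> T') face_of T"
 using mesh by (simp add: mesh_def triangulation_def)

lemma cell_subset: "T \<in> \<T> \<Longrightarrow> T \<subseteq> closure \<Omega>" using Union_mesh by auto

lemma cell_compact: "T \<in> \<T> \<Longrightarrow> compact T" using full_simplex.compact_simplex_T[OF cell] .

lemma cell_borel: "T \<in> \<T> \<Longrightarrow> T \<in> sets borel" using cell_compact by (rule borel_compact)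

lemma cell_lebesgue: "T \<in> \<T> \<Longrightarrow> T \<in> sets lebesgue" using cell_borel by simp

lemma interior_cell: "T \<in> \<T> \<Longrightarrow> interior T \<subseteq> \<Omega>"
 using interior_mono[OF cell_subset] lipschitz_domain_interior_closure[OF domain] by blast

lemma cell_subset_imp_eq:
 assumes "T \<in> \<T>" "T' \<in> \<T>" "x \<in> interior T" "x \<in> T'"
 shows "T \<subseteq> T'"
proof (rule ccontr)
 assume "\<not> T \<subseteq> T'"
 hence "T \<inter> T' \<noteq> T" by auto
 hence "(T \<inter> T') \<inter> interior T = {}"
  using face_of_disjoint_interior[OF cell_face[OF assms(1,2)]] by blast
 thus False using assms(3,4) interior_subset[of T] by auto
qed

lemma interiors_disjoint:
 assumes "T \<in> \<T>" "T' \<in> \<T>" "x \<in> interior T" "x \<in> interior T'"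
 shows "T = T'"
 using cell_subset_imp_eq[OF assms(1,2,3)] cell_subset_imp_eq[OF assms(2,1,4)] assms(3,4) interior_subset by blast

lemma cell_subset_eq: assumes "T \<in> \<T>" "T' \<in> \<T>" "T \<subseteq> T'" shows "T = T'"
proof -
 interpret full_simplex T by (rule cell[OF assms(1)])
 have "interior T \<noteq> {}" using center_interior by blast
 then obtain x where "x \<in> interior T" by auto
 thus ?thesis using interiors_disjoint[OF assms(1,2)] interior_mono[OF assms(3)] by blast
qed

lemma negligible_frontier_cell: "T \<in> \<T> \<Longrightarrow> negligible (frontier T)"
 using full_simplex.negligible_frontier_T[OF cell] .

lemma negligible_cell_diff: "T \<in> \<T> \<Longrightarrow> negligible (T - \<Omega>)"
 by (rule negligible_subset[OF negligible_frontier_cell])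
   (use interior_cell in \<open>auto simp: frontier_def closure_def\<close>)

lemma AE_not_frontier: "AE x in lebesgue. \<forall>T\<in>\<T>. x \<notin> frontier T"
proof (rule AE_finite_allI[OF finite_mesh])
 fix T assume "T \<in> \<T>"
 thus "AE x in lebesgue. x \<notin> frontier T"
  using negligible_frontier_cell by (intro AE_not_in) (simp add: negligible_iff_null_sets)
qed

lemma AE_indicator_sum: "AE x in lebesgue. ind \<Omega> x = (\<Sum>T\<in>\<T>. ind T x)"
 using AE_not_frontier
proof eventually_elim
 case (elim x)
 have int: "x \<in> interior T" if "T \<in> \<T>" "x \<in> T" for T
  using elim that closure_subset[of T] by (auto simp: frontier_def)
 show ?case
 proof (cases "x \<in> \<Omega>")
  case True
  then obtain T where T: "T \<in> \<T>" "x \<in> T" using Union_mesh closure_subset[of \<Omega>] by auto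
  have "x \<notin> T'" if "T' \<in> \<T> - {T}" for T'
   using interiors_disjoint[OF T(1), of T' x] int[OF T] int[of T'] that by blast
  hence "(\<Sum>T'\<in>\<T> - {T}. ind T' x) = 0" by (intro sum.neutral) (simp add: indicator_def)
  thus ?thesis using sum.remove[OF finite_mesh T(1), of "\<lambda>T. ind T x"] True T(2) by simp
 next
  case False
  hence "x \<notin> T" if "T \<in> \<T>" for T using int[OF that] interior_cell[OF that] by blast
  thus ?thesis using False by (simp add: indicator_def)
 qed
qed

lemma integral_domain_sum:
 fixes f :: "'a \<Rightarrow> 'b::euclidean_space"
 assumes f: "integrable vol f"
 shows "(LINT x|vol. f x) = (\<Sum>T\<in>\<T>. \<integral>x. f x \<partial>lebesgue_on T)"
proof -
 have iT: "integrable lebesgue (\<lambda>x. ind T x *\<^sub>R f x)" if "T \<in> \<T>" for T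
  using integrable_lebesgue_on_mono[OF domain_lebesgue cell_lebesgue[OF that] negligible_cell_diff[OF that] f]
   cell_lebesgue[OF that] by (simp add: integrable_restrict_space)
 have i\<Omega>: "integrable lebesgue (\<lambda>x. ind \<Omega> x *\<^sub>R f x)"
  using f domain_lebesgue by (simp add: integrable_restrict_space)
 have "(LINT x|vol. f x) = (LINT x|lebesgue. ind \<Omega> x *\<^sub>R f x)"
  using domain_lebesgue by (intro integral_restrict_space) simp
 also have "\<dots> = (LINT x|lebesgue. (\<Sum>T\<in>\<T>. ind T x *\<^sub>R f x))"
 proof (rule integral_cong_AE)
  show "(\<lambda>x. ind \<Omega> x *\<^sub>R f x) \<in> borel_measurable lebesgue" using i\<Omega> by (rule borel_measurable_integrable)
  show "(\<lambda>x. \<Sum>T\<in>\<T>. ind T x *\<^sub>R f x) \<in> borel_measurable lebesgue"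
   by (rule borel_measurable_sum) (rule borel_measurable_integrable[OF iT])
  show "AE x in lebesgue. ind \<Omega> x *\<^sub>R f x = (\<Sum>T\<in>\<T>. ind T x *\<^sub>R f x)"
   using AE_indicator_sum by eventually_elim (simp add: scaleR_left.sum)
 qed
 also have "\<dots> = (\<Sum>T\<in>\<T>. \<integral>x. ind T x *\<^sub>R f x \<partial>lebesgue)"
  by (rule Bochner_Integration.integral_sum) (rule iT)
 also have "\<dots> = (\<Sum>T\<in>\<T>. \<integral>x. f x \<partial>lebesgue_on T)"
  by (intro sum.cong refl integral_restrict_space[symmetric]) (use cell_lebesgue in simp)
 finally show ?thesis .
qed

lemma frontier_domain_cell: "T \<in> \<T> \<Longrightarrow> x \<in> frontier \<Omega> \<Longrightarrow> x \<notin> interior T"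
 using interior_cell interior_open[OF open_domain] by (auto simp: frontier_def)

subsection \<open>Facets and outward normals\<close>

abbreviation "nrm \<equiv> \<lambda>z. full_simplex.fnormal (fst z) (snd z)"
abbreviation "off \<equiv> \<lambda>z. full_simplex.foffset (fst z) (snd z)"
abbreviation "fct \<equiv> \<lambda>z. full_simplex.facet (fst z) (snd z)"

abbreviation "ofacet \<equiv> full_simplex.open_facet"
abbreviation "facet_flux T p \<equiv> flux (full_simplex.facet T p) (full_simplex.fnormal T p) (full_simplex.foffset T p)"

definition facets :: "('a set \<times> 'a) set" where "facets = Sigma \<T> vertices"

lemma finite_facets: "finite facets"
 unfolding facets_def using finite_mesh full_simplex.vertices_simplex(1)[OF cell] by auto

text \<open>If two cells lay on the same side of a common facet, their interiors would meet.\<close>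

lemma shared_facet_opposite:
 assumes z: "(T, p) \<in> facets" "(T', p') \<in> facets" "(T, p) \<noteq> (T', p')"
  and F: "full_simplex.facet T p = full_simplex.facet T' p'"
 shows "full_simplex.fnormal T' p' = - full_simplex.fnormal T p"
  "full_simplex.foffset T' p' = - full_simplex.foffset T p"
proof -
 have T: "T \<in> \<T>" "p \<in> vertices T" and T': "T' \<in> \<T>" "p' \<in> vertices T'" using z by (auto simp: facets_def)
 interpret A: full_simplex T by (rule cell[OF T(1)])
 interpret B: full_simplex T' by (rule cell[OF T'(1)])
 have E: "vertices T - {p} = vertices T' - {p'}"
 proof (rule B.facet_eq_hull_imp[OF T'(2)])
  show "B.facet p' = convex hull (vertices T - {p})" using F A.facet_hull[OF T(2)] by simp
  show "\<not> affine_dependent (vertices T - {p})" using A.vertices_simplex(2) affine_dependent_subset by blast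
 qed
 define k where "k = barycentric T' p p'"
 have k': "k = B.bgrad p' \<bullet> p + barycentric T' 0 p'" unfolding k_def by (rule B.bary_affine[OF T'(2)])
 have zz: "B.bgrad p' \<bullet> q + barycentric T' 0 p' = 0" if "q \<in> vertices T - {p}" for q
 proof -
  have q: "q \<in> vertices T'" "q \<noteq> p'" using that E by auto
  show ?thesis using B.bary_affine[OF T'(2), of q] B.bary_vertex[OF T'(2) q(1)] q(2) by simp
 qed
 have g: "B.bgrad p' = k *\<^sub>R A.bgrad p" "barycentric T' 0 p' = k * barycentric T 0 p"
  using A.same_hyperplane[OF T(2) zz] unfolding k'[symmetric] by blast+
 have bary': "barycentric T' x p' = k * barycentric T x p" for x
  using B.bary_affine[OF T'(2), of x] A.bary_affine[OF T(2), of x] g by (simp add: distrib_left)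
 have "k \<noteq> 0" using g(1) B.bgrad_nonzero[OF T'(2)] by auto
 moreover have "\<not> k > 0"
 proof
  assume k: "k > 0"
  define m where "m = A.facet_center p"
  have m: "m \<in> A.open_facet p" unfolding m_def by (rule A.facet_center[OF T(2)])
  have mB: "m \<in> B.open_facet p'" 
  proof -
   have "m = B.facet_center p'" unfolding m_def A.facet_center_def B.facet_center_def E ..
   thus ?thesis using B.facet_center[OF T'(2)] by simp
  qed
  define y where "y t = (1 - t) *\<^sub>R m + t *\<^sub>R p" for t :: real
  have yA: "y t \<in> interior T" if t: "0 < t" "t < 1" for t
  proof -
   have "0 < barycentric T (y t) q" if q: "q \<in> vertices T" for q
    using A.bary_segment[OF q, of t m p] m t A.bary_vertex[OF q T(2)] q
    by (cases "q = p") (auto simp: y_def A.open_facet_def)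
   thus ?thesis by (simp add: A.interior_simplex_bary)
  qed
  have lim: "(\<lambda>t. barycentric T' (y t) q) \<midarrow>0\<rightarrow> barycentric T' m q" if q: "q \<in> vertices T'" for q
  proof -
   have "(\<lambda>t. (1 - t) * barycentric T' m q + t * barycentric T' p q) \<midarrow>0\<rightarrow> (1 - 0) * barycentric T' m q + 0 * barycentric T' p q"
    by (intro tendsto_intros)
   thus ?thesis unfolding y_def B.bary_segment[OF q] by simp
  qed
  have "\<forall>\<^sub>F t in at_right (0::real). \<forall>q\<in>vertices T' - {p'}. 0 < barycentric T' (y t) q"
  proof (subst eventually_ball_finite_distrib)
   show "finite (vertices T' - {p'})" using B.vertices_simplex(1) by simp
   show "\<forall>q\<in>vertices T' - {p'}. \<forall>\<^sub>F t in at_right 0. 0 < barycentric T' (y t) q"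
   proof
    fix q assume q: "q \<in> vertices T' - {p'}"
    have "0 < barycentric T' m q" using mB q by (simp add: B.open_facet_def)
    thus "\<forall>\<^sub>F t in at_right 0. 0 < barycentric T' (y t) q"
     using q by (intro order_tendstoD(1)[OF tendsto_mono[OF at_le lim]]) auto
   qed
  qed
  moreover have "\<forall>\<^sub>F t in at_right (0::real). t \<in> {0<..<1}" by (rule eventually_at_right_real) simp
  ultimately have "\<forall>\<^sub>F t in at_right (0::real). y t \<in> interior T \<and> y t \<in> interior T'"
  proof eventually_elim
   case (elim t)
   hence a: "y t \<in> interior T" by (intro yA) auto
   hence "0 < barycentric T (y t) p" using A.interior_simplex_bary T(2) by blast
   hence "0 < barycentric T' (y t) p'" using k by (simp add: bary')
   hence "0 < barycentric T' (y t) q" if "q \<in> vertices T'" for q using elim(1) that by (cases "q = p'") auto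
   hence "y t \<in> interior T'" by (simp add: B.interior_simplex_bary)
   thus ?case using a by simp
  qed
  then obtain t where "y t \<in> interior T" "y t \<in> interior T'"
   using eventually_happens'[OF trivial_limit_at_right_real] by blast
  hence TT: "T = T'" by (rule interiors_disjoint[OF T(1) T'(1)])
  hence "p = p'" using E T(2) T'(2) by blast
  thus False using z(3) TT by simp
 qed
 ultimately have k: "k < 0" by simp
 show "B.fnormal p' = - A.fnormal p" unfolding B.fnormal_def A.fnormal_def g(1) using k by simp
 show "B.foffset p' = - A.foffset p" unfolding B.foffset_def A.foffset_def g(1) unfolding g(2) using k by simp
qed

text \<open>Another cell that contains a point of the open facet would share the whole facet, since cells meet in common faces. So
near such a point only \<open>T\<close> is present, and the domain agrees with the half-space of the facet.\<close>

lemma lone_facet_outward_normal: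
 assumes z: "(T, p) \<in> facets" and lone: "\<And>T' p'. (T', p') \<in> facets \<Longrightarrow> full_simplex.facet T' p' = full_simplex.facet T p \<Longrightarrow> (T', p') = (T, p)"
  and y: "y \<in> ofacet T p"
 shows "outward_normal \<Omega> y (full_simplex.fnormal T p)" "y \<in> frontier \<Omega>"
proof -
 have T: "T \<in> \<T>" "p \<in> vertices T" using z by (auto simp: facets_def)
 interpret A: full_simplex T by (rule cell[OF T(1)])
 let ?n = "A.fnormal p"
 have n1: "norm ?n = 1" by (rule A.norm_fnormal[OF T(2)])
 have yp: "barycentric T y p = 0" and yq: "\<And>q. q \<in> vertices T - {p} \<Longrightarrow> 0 < barycentric T y q"
  using y by (auto simp: A.open_facet_def)
 have yT: "y \<in> T" using A.open_facet_subset[OF T(2)] y by (auto simp: A.facet_def)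
 have other: "y \<notin> T'" if T': "T' \<in> \<T>" "T' \<noteq> T" for T'
 proof
  assume yT': "y \<in> T'"
  interpret B: full_simplex T' by (rule cell[OF T'(1)])
  have "(T \<inter> T') face_of (convex hull vertices T)" using cell_face[OF T(1) T'(1)] by (simp only: A.vertices_simplex(4))
  then obtain c where c: "c \<subseteq> vertices T" "T \<inter> T' = convex hull c"
   using face_of_convex_hull_affine_independent[OF A.vertices_simplex(2)] by auto
  have sub: "vertices T - {p} \<subseteq> c"
  proof
   fix q assume q: "q \<in> vertices T - {p}"
   show "q \<in> c"
   proof (rule ccontr)
    assume "q \<notin> c"
    hence "c \<subseteq> vertices T - {q}" using c(1) by auto
    hence "y \<in> convex hull (vertices T - {q})" using yT yT' c(2) hull_mono[of c "vertices T - {q}" convex] by blast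
    hence "y \<in> A.facet q" using A.facet_hull q by auto
    thus False using yq[OF q] by (simp add: A.facet_def)
   qed
  qed
  have "p \<notin> c"
  proof
   assume "p \<in> c"
   hence "c = vertices T" using sub c(1) by auto
   hence "T \<inter> T' = T" using c(2) A.vertices_simplex(4) by simp
   thus False using cell_subset_eq[OF T(1) T'(1)] T'(2) by blast
  qed
  hence c2: "c = vertices T - {p}" using sub c(1) by auto
  have F: "T \<inter> T' = A.facet p" using c(2) c2 A.facet_hull[OF T(2)] by simp
  have ci: "\<not> affine_dependent c" unfolding c2 using A.vertices_simplex(2) affine_dependent_subset by blast
  have "(T' \<inter> T) face_of (convex hull vertices T')" using cell_face[OF T'(1) T(1)] by (simp only: B.vertices_simplex(4))
  then obtain c' where c': "c' \<subseteq> vertices T'" "T' \<inter> T = convex hull c'"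
   using face_of_convex_hull_affine_independent[OF B.vertices_simplex(2)] by auto
  have c'i: "\<not> affine_dependent c'" using B.vertices_simplex(2) affine_dependent_subset c'(1) by blast
  have hcc: "convex hull c' = convex hull c" using c(2) c'(2) by (simp add: Int_commute)
  have "q \<in> c' \<longleftrightarrow> q \<in> c" for q
   using extreme_point_of_convex_hull_affine_independent[OF ci, of q]
    extreme_point_of_convex_hull_affine_independent[OF c'i, of q] unfolding hcc by simp
  hence cc: "c' = c" by blast
  have cardc: "card c' = DIM('a)" unfolding cc c2 using A.vertices_simplex(1,3) T(2) by simp
  have "card (vertices T' - c') = 1"
   using cardc B.vertices_simplex(1,3) c'(1) by (simp add: card_Diff_subset finite_subset)
  then obtain p' where p': "vertices T' - c' = {p'}" by (auto simp: card_1_singleton_iff)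
  hence p'v: "p' \<in> vertices T'" "c' = vertices T' - {p'}" using c'(1) by auto
  have "B.facet p' = A.facet p" using B.facet_hull[OF p'v(1)] p'v(2) c'(2) F by (simp add: Int_commute)
  thus False using lone[of T' p'] p'v(1) T' by (auto simp: facets_def)
 qed
 have "closed (\<Union>(\<T> - {T}))" using finite_mesh cell_compact by (intro closed_Union) (auto intro: compact_imp_closed)
 hence "open (- \<Union>(\<T> - {T}))" "y \<in> - \<Union>(\<T> - {T})" using other by auto
 then obtain d1 where d1: "d1 > 0" "ball y d1 \<subseteq> - \<Union>(\<T> - {T})" by (meson open_contains_ball)
 have "open {x. \<forall>q\<in>vertices T - {p}. 0 < barycentric T x q}"
 proof -
  have "{x. \<forall>q\<in>vertices T - {p}. 0 < barycentric T x q} = (\<Inter>q\<in>vertices T - {p}. {x. 0 < barycentric T x q})" by auto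
  also have "open \<dots>"
  proof (rule open_INT)
   show "finite (vertices T - {p})" using A.vertices_simplex(1) by simp
   show "\<forall>q\<in>vertices T - {p}. open {x. 0 < barycentric T x q}"
   proof
    fix q assume "q \<in> vertices T - {p}"
    hence "continuous_on UNIV (\<lambda>x. barycentric T x q)" by (intro A.continuous_bary) simp
    thus "open {x. 0 < barycentric T x q}" by (intro open_Collect_less continuous_on_const)
   qed
  qed
  finally show ?thesis .
 qed
 moreover have "y \<in> {x. \<forall>q\<in>vertices T - {p}. 0 < barycentric T x q}" using yq by simp
 ultimately obtain d2 where d2: "d2 > 0" "ball y d2 \<subseteq> {x. \<forall>q\<in>vertices T - {p}. 0 < barycentric T x q}"
  by (auto simp: open_contains_ball)
 define d where "d = min d1 d2"
 have d: "d > 0" using d1 d2 by (simp add: d_def)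
 have ny: "?n \<bullet> y = A.foffset p" using A.fnormal_le_iff(3)[OF T(2)] yp by simp
 have pos: "x \<notin> \<Omega>" if x: "x \<in> ball y d" "?n \<bullet> (x - y) > 0" for x
 proof -
  have "\<not> ?n \<bullet> x \<le> A.foffset p" using x(2) ny by (simp add: inner_diff_right)
  hence "x \<notin> T" using A.fnormal_le_iff(1)[OF T(2)] A.simplex_bary T(2) by auto
  moreover have "x \<notin> T'" if "T' \<in> \<T>" "T' \<noteq> T" for T' using d1(2) x(1) that by (auto simp: d_def)
  ultimately have "x \<notin> closure \<Omega>" unfolding Union_mesh[symmetric] by blast
  thus ?thesis using closure_subset by blast
 qed
 have neg: "x \<in> \<Omega>" if x: "x \<in> ball y d" "?n \<bullet> (x - y) < 0" for x
 proof -
  have "?n \<bullet> x < A.foffset p" using x(2) ny by (simp add: inner_diff_right)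
  hence "0 < barycentric T x p" using A.fnormal_le_iff(2)[OF T(2)] by simp
  moreover have "0 < barycentric T x q" if "q \<in> vertices T - {p}" for q using d2(2) x(1) that by (auto simp: d_def)
  ultimately have "x \<in> interior T" unfolding A.interior_simplex_bary by blast
  thus ?thesis using interior_cell[OF T(1)] by blast
 qed
 show "outward_normal \<Omega> y ?n"
  unfolding outward_normal_def
 proof (intro conjI n1 allI impI exI[of _ d] d ballI)
  fix e x :: real and x' assume e: "e > 0" and x: "x' \<in> ball y d"
  { assume "?n \<bullet> (x' - y) > e * norm (x' - y)"
   moreover have "e * norm (x' - y) \<ge> 0" using e by simp
   ultimately have "?n \<bullet> (x' - y) > 0" by linarith
   thus "x' \<notin> \<Omega>" by (rule pos[OF x]) }
  { assume "?n \<bullet> (x' - y) < - e * norm (x' - y)"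
   moreover have "- e * norm (x' - y) \<le> 0" using e by simp
   ultimately have "?n \<bullet> (x' - y) < 0" by linarith
   thus "x' \<in> \<Omega>" by (rule neg[OF x]) }
 qed
 have "y \<notin> \<Omega>"
 proof
  assume "y \<in> \<Omega>"
  then obtain r where r: "r > 0" "ball y r \<subseteq> \<Omega>" using open_domain by (auto simp: open_contains_ball)
  define s where "s = min d r / 2"
  have s: "0 < s" "s < d" "s < r" using d r by (auto simp: s_def min_def)
  have "y + s *\<^sub>R ?n \<in> ball y d" "y + s *\<^sub>R ?n \<in> ball y r" using s n1 by (auto simp: dist_norm)
  moreover have "?n \<bullet> (y + s *\<^sub>R ?n - y) > 0" using s n1 by (simp add: norm_eq_1)
  ultimately show False using pos r(2) by blast
 qed
 thus "y \<in> frontier \<Omega>" using yT cell_subset[OF T(1)] interior_open[OF open_domain] by (auto simp: frontier_def)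
qed

text \<open>The pairs of cell and vertex are grouped by the facet they describe. A facet that occurs twice contributes opposite fluxes, and no
facet occurs three times; a facet that occurs once is part of the boundary, with its normal pointing outward.\<close>

lemma boundary_flux_nonneg:
 assumes q: "continuous_on (closure \<Omega>) q"
  and pos: "\<And>T p y. (T, p) \<in> facets \<Longrightarrow>
   (\<forall>x\<in>ofacet T p. x \<in> frontier \<Omega> \<and> outward_normal \<Omega> x (full_simplex.fnormal T p)) \<Longrightarrow>
   y \<in> ofacet T p \<Longrightarrow> 0 \<le> q y \<bullet> full_simplex.fnormal T p"
 shows "0 \<le> (\<Sum>T\<in>\<T>. \<Sum>p\<in>vertices T. facet_flux T p q)"
proof -
 define h where "h z = flux (fct z) (nrm z) (off z) q" for z
 have "(\<Sum>T\<in>\<T>. \<Sum>p\<in>vertices T. facet_flux T p q) = sum h facets"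
  unfolding facets_def h_def using finite_mesh full_simplex.vertices_simplex(1)[OF cell]
  by (subst sum.Sigma) (auto simp: case_prod_beta)
 also have "\<dots> = (\<Sum>F\<in>fct ` facets. sum h {z\<in>facets. fct z = F})" by (rule sum.image_gen[OF finite_facets])
 also have "0 \<le> \<dots>"
 proof (rule sum_nonneg)
  fix F assume "F \<in> fct ` facets"
  then obtain z where z: "z \<in> facets" "fct z = F" by auto
  obtain T p where zTp: "z = (T, p)" by (cases z)
  have T: "T \<in> \<T>" "p \<in> vertices T" using z zTp by (auto simp: facets_def)
  interpret A: full_simplex T by (rule cell[OF T(1)])
  show "0 \<le> sum h {z\<in>facets. fct z = F}"
  proof (cases "{z'\<in>facets. fct z' = F} = {z}")
   case True
   have nn: "0 \<le> q y \<bullet> A.fnormal p" if y: "y \<in> A.open_facet p" for y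
   proof (rule pos[OF z(1)[unfolded zTp] _ y])
    have l: "(T', p') = (T, p)" if "(T', p') \<in> facets" "full_simplex.facet T' p' = full_simplex.facet T p" for T' p'
    proof -
     have "(T', p') \<in> {z'\<in>facets. fct z' = F}" using that z zTp by simp
     thus ?thesis unfolding True zTp by simp
    qed
    show "\<forall>x\<in>A.open_facet p. x \<in> frontier \<Omega> \<and> outward_normal \<Omega> x (A.fnormal p)"
     using lone_facet_outward_normal[OF z(1)[unfolded zTp] l] by blast
   qed
   have nnF: "0 \<le> q y \<bullet> A.fnormal p" if y: "y \<in> A.facet p" for y
   proof -
    define w where "w t = (1 - t) *\<^sub>R y + t *\<^sub>R A.facet_center p" for t :: real
    have wo: "w t \<in> A.open_facet p" if "0 < t" "t \<le> 1" for t unfolding w_def by (rule A.facet_closure[OF T(2) y that])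
    have wc: "w t \<in> closure \<Omega>" if "0 \<le> t" "t \<le> 1" for t
    proof (cases "t = 0")
     case True thus ?thesis using y cell_subset[OF T(1)] by (auto simp: w_def A.facet_def)
    next
     case False
     thus ?thesis using wo[of t] that A.open_facet_subset[OF T(2)] cell_subset[OF T(1)] by (force simp: A.facet_def)
    qed
    have "continuous_on {0..1} (\<lambda>t. q (w t) \<bullet> A.fnormal p)"
     by (intro continuous_intros continuous_on_compose2[OF q]) (use wc in \<open>auto simp: w_def intro!: continuous_intros\<close>)
    hence lim: "((\<lambda>t. q (w t) \<bullet> A.fnormal p) \<longlongrightarrow> q (w 0) \<bullet> A.fnormal p) (at 0 within {0..1})"
     by (auto simp: continuous_on_def)
    have "at (0::real) within {0..1} \<noteq> bot" by (simp add: at_within_Icc_at_right)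
    hence "0 \<le> q (w 0) \<bullet> A.fnormal p"
    proof (rule tendsto_lowerbound[OF lim, rotated])
     show "\<forall>\<^sub>F t in at 0 within {0..1}. 0 \<le> q (w t) \<bullet> A.fnormal p"
      unfolding eventually_at_filter by (rule always_eventually) (use nn wo in auto)
    qed
    thus ?thesis by (simp add: w_def)
   qed
   have "0 \<le> h z" unfolding h_def zTp by (rule flux_nonneg) (use nnF in simp)
   thus ?thesis unfolding True by simp
  next
   case False
   then obtain z' where z': "z' \<in> facets" "fct z' = F" "z' \<noteq> z" using z by blast
   have opp: "nrm b = - nrm a" "off b = - off a" if "a \<in> facets" "b \<in> facets" "a \<noteq> b" "fct a = F" "fct b = F" for a b
   proof -
    obtain T1 p1 T2 p2 where ab: "a = (T1, p1)" "b = (T2, p2)" by (cases a, cases b) auto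
    show "nrm b = - nrm a" "off b = - off a"
     using shared_facet_opposite[of T1 p1 T2 p2] that unfolding ab by simp_all
   qed
   have "{z'\<in>facets. fct z' = F} = {z, z'}"
   proof (rule ccontr)
    assume "{z'\<in>facets. fct z' = F} \<noteq> {z, z'}"
    then obtain a where a: "a \<in> facets" "fct a = F" "a \<noteq> z" "a \<noteq> z'" using z z' by blast
    have "nrm a = - nrm z" "nrm a = - nrm z'" "nrm z' = - nrm z"
     using opp[of z a] opp[of z' a] opp[of z z'] z z' a by auto
    hence "nrm z = - nrm z" by simp
    hence "nrm z = 0" by (metis eq_neg_iff_add_eq_0 scaleR_2 scaleR_eq_0_iff zero_neq_numeral)
    thus False using A.norm_fnormal[OF T(2)] by (simp add: zTp)
   qed
   hence "sum h {z'\<in>facets. fct z' = F} = h z + h z'" using z'(3) by simp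
   also have "h z' = - h z"
    unfolding h_def z'(2) z(2) opp(1)[OF z(1) z'(1) z'(3)[symmetric] z(2) z'(2)] opp(2)[OF z(1) z'(1) z'(3)[symmetric] z(2) z'(2)]
    by (rule flux_minus)
   finally show ?thesis by simp
  qed
 qed
 finally show ?thesis .
qed

end

section \<open>Traces\<close>

lemma emeasure_lborel_null_lebesgue:
 assumes "emeasure lebesgue Z = 0" "Z \<in> sets borel"
 shows "emeasure lborel Z = 0"
 using assms by simp

lemma H1_space_comb:
 assumes u: "u \<in> H1_space \<Omega>" and v: "v \<in> H1_space \<Omega>" and \<Omega>: "\<Omega> \<in> sets lebesgue"
 shows "(\<lambda>x. u x + c * v x) \<in> H1_space \<Omega>"
proof -
 obtain G H where G: "G \<in> L2_space (lebesgue_on \<Omega>)" "weak_gradient \<Omega> u G"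
  and H: "H \<in> L2_space (lebesgue_on \<Omega>)" "weak_gradient \<Omega> v H"
  using u v by (auto simp: H1_space_def)
 have "(\<lambda>x. u x + c *\<^sub>R v x) \<in> L2_space (lebesgue_on \<Omega>)"
  using u v by (intro L2_space_comb) (auto simp: H1_space_def)
 thus ?thesis
  using L2_space_comb[OF G(1) H(1), of c] weak_gradient_comb[OF G(2) H(2) \<Omega>, of c] by (auto simp: H1_space_def)
qed

lemma weak_gradient_zero: "\<Omega> \<in> sets lebesgue \<Longrightarrow> weak_gradient \<Omega> (\<lambda>x. 0) (\<lambda>x. 0)"
 by (simp add: weak_gradient_def)

text \<open>The chosen weak gradient of the zero function is zero only almost everywhere.\<close>

lemma H1_seminorm_zero: "open \<Omega> \<Longrightarrow> H1_seminorm \<Omega> \<Omega> (\<lambda>x. 0) = 0"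
proof -
 assume o: "open \<Omega>"
 have "AE x in lebesgue_on \<Omega>. wgrad \<Omega> (\<lambda>x. 0) x = 0"
  by (rule wgrad_eq[OF o weak_gradient_zero]) (use o in simp)
 hence "(LINT x|lebesgue_on \<Omega>. (norm (wgrad \<Omega> (\<lambda>x. 0) x))\<^sup>2) = 0"
  by (intro integral_eq_zero_AE) (auto elim: AE_mp)
 thus ?thesis by (simp add: H1_seminorm_def L2_norm_def)
qed

lemma wgrad_L2:
 assumes "open \<Omega>" "v \<in> H1_space \<Omega>" "wgrad \<Omega> v \<in> borel_measurable (lebesgue_on \<Omega>)"
 shows "wgrad \<Omega> v \<in> L2_space (lebesgue_on \<Omega>)"
proof -
 obtain G where G: "G \<in> L2_space (lebesgue_on \<Omega>)" "weak_gradient \<Omega> v G" using assms(2) by (auto simp: H1_space_def)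
 show ?thesis by (rule L2_space_cong_AE[OF assms(3) G(1) wgrad_eq[OF assms(1) G(2)]])
qed

lemma AE_eq_measurable_lebesgue_on:
 fixes f g :: "'a::euclidean_space \<Rightarrow> 'b::euclidean_space"
 assumes S: "S \<in> sets lebesgue" and g: "g \<in> borel_measurable (lebesgue_on S)" and eq: "AE x in lebesgue_on S. f x = g x"
 shows "f \<in> borel_measurable (lebesgue_on S)"
proof -
 define N where "N = {x \<in> S. f x \<noteq> g x}"
 have "AE x in lebesgue. x \<in> S \<longrightarrow> f x = g x" using eq S by (simp add: AE_restrict_space_iff)
 then obtain M where M: "{x. \<not> (x \<in> S \<longrightarrow> f x = g x)} \<subseteq> M" "M \<in> null_sets lebesgue"
  by (auto elim!: AE_E simp: null_sets_def)
 have "N \<in> null_sets lebesgue"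
  by (rule null_sets_completion_subset[OF _ M(2)]) (use M(1) in \<open>auto simp: N_def\<close>)
 hence N: "N \<in> null_sets (lebesgue_on S)" using S by (auto simp: null_sets_restrict_space N_def)
 have "g \<in> borel_measurable (lebesgue_on (S - N))" using borel_measurable_diff_null[OF N S] g by blast
 hence "f \<in> borel_measurable (lebesgue_on (S - N))"
  by (rule measurable_cong[THEN iffD2, rotated]) (auto simp: N_def)
 thus ?thesis using borel_measurable_diff_null[OF N S] by blast
qed

lemma H1_wgrad:
 assumes "open \<Omega>" "v \<in> H1_space \<Omega>"
 shows "wgrad \<Omega> v \<in> L2_space (lebesgue_on \<Omega>)" "weak_gradient \<Omega> v (wgrad \<Omega> v)"
proof -
 obtain G where G: "G \<in> L2_space (lebesgue_on \<Omega>)" "weak_gradient \<Omega> v G" using assms(2) by (auto simp: H1_space_def)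
 have "wgrad \<Omega> v \<in> borel_measurable (lebesgue_on \<Omega>)"
  by (rule AE_eq_measurable_lebesgue_on[OF _ _ wgrad_eq[OF assms(1) G(2)]]) (use G assms in \<open>auto simp: L2_space_def\<close>)
 thus "wgrad \<Omega> v \<in> L2_space (lebesgue_on \<Omega>)" by (rule wgrad_L2[OF assms])
 show "weak_gradient \<Omega> v (wgrad \<Omega> v)" by (rule weak_gradient_wgrad[OF G(2)])
qed

lemma wgrad_comb:
 assumes "open \<Omega>" "u \<in> H1_space \<Omega>" "v \<in> H1_space \<Omega>"
 shows "AE x in lebesgue_on \<Omega>. wgrad \<Omega> (\<lambda>x. u x + c * v x) x = wgrad \<Omega> u x + c *\<^sub>R wgrad \<Omega> v x"
 by (rule wgrad_eq[OF assms(1) weak_gradient_comb[OF H1_wgrad(2)[OF assms(1,2)] H1_wgrad(2)[OF assms(1,3)]]])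
   (use assms in simp)

context polyhedral_domain begin

text \<open>The tube over the relative boundary lies in finitely many hyperplanes.\<close>

lemma facet_rel_boundary_null:
 assumes z: "(T, p) \<in> facets"
 shows "hsurf (full_simplex.facet T p - ofacet T p) = 0"
proof -
 have T: "T \<in> \<T>" "p \<in> vertices T" using z by (auto simp: facets_def)
 interpret A: full_simplex T by (rule cell[OF T(1)])
 interpret P: polytope "vertices T" A.fnormal A.foffset T by (rule A.simplex_polytope)
 let ?N = "A.fnormal p" and ?c = "A.foffset p"
 let ?S = "\<lambda>q. {x \<in> T. barycentric T x p = 0 \<and> barycentric T x q = 0}" and ?P = "\<lambda>q. {x. A.fnormal q \<bullet> (foot_point ?N ?c x) = A.foffset q}"
 let ?B = "A.facet p - A.open_facet p"
 have Beq: "?B = (\<Union>q\<in>vertices T - {p}. (?S q))"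
 proof (intro set_eqI iffI)
  fix x assume x: "x \<in> ?B"
  hence f: "x \<in> T" "barycentric T x p = 0" by (auto simp: A.facet_def)
  then obtain q where q: "q \<in> vertices T - {p}" "\<not> 0 < barycentric T x q" using x by (auto simp: A.open_facet_def)
  moreover have "0 \<le> barycentric T x q" using f(1) q(1) A.simplex_bary by blast
  ultimately show "x \<in> (\<Union>q\<in>vertices T - {p}. (?S q))" using f by fastforce
 next
  fix x assume "x \<in> (\<Union>q\<in>vertices T - {p}. (?S q))"
  then obtain q where q: "q \<in> vertices T - {p}" "x \<in> T" "barycentric T x p = 0" "barycentric T x q = 0" by blast
  hence "\<not> 0 < barycentric T x q" by simp
  thus "x \<in> ?B" using q unfolding A.facet_def A.open_facet_def by blast
 qed
 have Bb: "?B \<in> sets borel"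
 proof -
  have "closed ?B" unfolding Beq
  proof (rule closed_UN)
   show "finite (vertices T - {p})" using A.vertices_simplex(1) by simp
   show "\<forall>q\<in>vertices T - {p}. closed (?S q)"
   proof
    fix q assume q: "q \<in> vertices T - {p}"
    have "(?S q) = T \<inter> {x. barycentric T x p = 0} \<inter> {x. barycentric T x q = 0}" by auto
    thus "closed (?S q)"
     using q T(2) A.continuous_bary[of p UNIV] A.continuous_bary[of q UNIV]
     by (simp add: closed_Int closed_Collect_eq compact_imp_closed[OF A.compact_simplex_T])
   qed
  qed
  thus ?thesis by (rule borel_closed)
 qed
 show ?thesis
 proof (rule hausdorff_outer_null_of_tube[OF dim2 A.norm_fnormal[OF T(2)] Bb])
  show "bounded ?B" using compact_imp_bounded[OF A.compact_simplex_T] by (rule bounded_subset) (auto simp: A.facet_def)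
  show "?B \<subseteq> {y. ?N \<bullet> y = ?c}" using A.fnormal_le_iff(3)[OF T(2)] by (auto simp: A.facet_def)
  let ?Z = "{x. \<bar>?N \<bullet> x - ?c\<bar> < 1/2 \<and> foot_point ?N ?c x \<in> ?B}"
  have "negligible (\<Union>q\<in>vertices T - {p}. (?P q))"
  proof (intro negligible_Union ballI)
   show "finite ((\<lambda>q. (?P q)) ` (vertices T - {p}))"
    using A.vertices_simplex(1) by simp
   fix X assume "X \<in> (\<lambda>q. (?P q)) ` (vertices T - {p})"
   thus "negligible X" using P.negligible_slice[OF T(2)] by auto
  qed
  moreover have "?Z \<subseteq> (\<Union>q\<in>vertices T - {p}. (?P q))"
   unfolding Beq using A.fnormal_le_iff(3) by auto
  ultimately have "negligible ?Z" by (rule negligible_subset)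
  hence "?Z \<in> null_sets lebesgue" by (simp add: negligible_iff_null_sets)
  hence "emeasure lebesgue ?Z = 0" by auto
  moreover have "?Z \<in> sets borel"
  proof -
   have "?Z = {x. \<bar>?N \<bullet> x - ?c\<bar> < 1/2} \<inter> ((\<lambda>x. foot_point ?N ?c x) -` ?B \<inter> space borel)" by auto
   moreover have "(\<lambda>x. foot_point ?N ?c x) \<in> borel_measurable borel" by measurable
   ultimately show ?thesis using Bb
    by (auto intro!: sets.Int borel_open open_Collect_less continuous_intros simp: measurable_sets)
  qed
  ultimately show "emeasure lborel ?Z = 0" by (rule emeasure_lborel_null_lebesgue)
 qed
qed

text \<open>The two cells fill both sides of the facet near a point of its relative interior, so this point is interior to the closure of the domain.\<close>

lemma shared_open_facet_interior:
 assumes z: "(T, p) \<in> facets" "(T', p') \<in> facets" "(T, p) \<noteq> (T', p')"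
  and F: "full_simplex.facet T p = full_simplex.facet T' p'" and y: "y \<in> ofacet T p"
 shows "y \<in> \<Omega>"
proof -
 have T: "T \<in> \<T>" "p \<in> vertices T" and T': "T' \<in> \<T>" "p' \<in> vertices T'" using z by (auto simp: facets_def)
 interpret A: full_simplex T by (rule cell[OF T(1)])
 interpret B: full_simplex T' by (rule cell[OF T'(1)])
 have n: "B.fnormal p' = - A.fnormal p" "B.foffset p' = - A.foffset p"
  using shared_facet_opposite[OF z F] by auto
 have yB: "y \<in> B.facet p'" using y A.open_facet_subset[OF T(2)] F by auto
 have E: "vertices T - {p} = vertices T' - {p'}"
 proof (rule B.facet_eq_hull_imp[OF T'(2)])
  show "B.facet p' = convex hull (vertices T - {p})" using F A.facet_hull[OF T(2)] by simp
  show "\<not> affine_dependent (vertices T - {p})" using A.vertices_simplex(2) affine_dependent_subset by blast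
 qed
 have yBo: "y \<in> B.open_facet p'"
 proof (rule ccontr)
  assume "y \<notin> B.open_facet p'"
  then obtain q where q: "q \<in> vertices T' - {p'}" "barycentric T' y q = 0"
   using yB by (fastforce simp: B.open_facet_def B.facet_def B.simplex_bary intro: antisym)
  have fy: "y \<in> B.facet q" using yB q by (simp add: B.facet_def)
  have "y \<in> convex hull (vertices T' - {p'})" using yB B.facet_hull[OF T'(2)] by simp
  then obtain u where u: "\<forall>r\<in>vertices T' - {p'}. 0 \<le> u r" "sum u (vertices T' - {p'}) = 1" "(\<Sum>r\<in>vertices T' - {p'}. u r *\<^sub>R r) = y"
   using convex_hull_finite[of "vertices T' - {p'}"] B.vertices_simplex(1) by auto
  have f: "finite (vertices T' - {p'})" using B.vertices_simplex(1) by simp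
  have "barycentric T' y q = (\<Sum>r\<in>vertices T' - {p'}. u r * barycentric T' r q)"
   using B.bary_affine_comb[OF _ f u(2), of q] q(1) u(3) by simp
  also have "\<dots> = (\<Sum>r\<in>vertices T' - {p'}. if r = q then u r else 0)"
   using q(1) by (intro sum.cong refl) (auto simp: B.bary_vertex)
  also have "\<dots> = u q" using q(1) f by simp
  finally have uq: "u q = 0" using q(2) by simp
  have qT: "q \<in> vertices T - {p}" using q(1) E by simp
  hence qC: "q \<in> vertices T" by blast
  have "barycentric T y q = (\<Sum>r\<in>vertices T - {p}. u r * barycentric T r q)"
   using A.bary_affine_comb[OF qC f u(2)] u(3) unfolding E by simp
  also have "\<dots> = (\<Sum>r\<in>vertices T - {p}. if r = q then u r else 0)"
   using qT by (intro sum.cong refl) (auto simp: A.bary_vertex)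
  also have "\<dots> = u q" using qT f unfolding E by simp
  finally have "barycentric T y q = 0" using uq by simp
  moreover have "0 < barycentric T y q" using y qT unfolding A.open_facet_def by blast
  ultimately show False by simp
 qed
 have "open {x. \<forall>q\<in>vertices S - {r}. 0 < barycentric S x q}" if S: "S \<in> \<T>" for S r
 proof -
  interpret S: full_simplex S by (rule cell[OF S])
  have "{x. \<forall>q\<in>vertices S - {r}. 0 < barycentric S x q} = (\<Inter>q\<in>vertices S - {r}. {x. 0 < barycentric S x q})" by auto
  also have "open \<dots>"
  proof (rule open_INT)
   show "finite (vertices S - {r})" using S.vertices_simplex(1) by simp
   show "\<forall>q\<in>vertices S - {r}. open {x. 0 < barycentric S x q}"
   proof
    fix q assume "q \<in> vertices S - {r}"
    hence "continuous_on UNIV (\<lambda>x. barycentric S x q)" by (intro S.continuous_bary) simp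
    thus "open {x. 0 < barycentric S x q}" by (intro open_Collect_less continuous_on_const)
   qed
  qed
  finally show ?thesis .
 qed
 hence o: "open ({x. \<forall>q\<in>vertices T - {p}. 0 < barycentric T x q} \<inter> {x. \<forall>q\<in>vertices T' - {p'}. 0 < barycentric T' x q})" (is "open ?U")
  using T(1) T'(1) by (intro open_Int) auto
 have yU: "y \<in> ?U" using y yBo by (auto simp: A.open_facet_def B.open_facet_def)
 have "?U \<subseteq> closure \<Omega>"
 proof
  fix x assume x: "x \<in> ?U"
  show "x \<in> closure \<Omega>"
  proof (cases "A.fnormal p \<bullet> x \<le> A.foffset p")
   case True
   hence "0 \<le> barycentric T x p" using A.fnormal_le_iff(1)[OF T(2)] by simp
   hence "x \<in> T" unfolding A.simplex_bary using x by (auto intro: less_imp_le)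
   thus ?thesis using cell_subset[OF T(1)] by auto
  next
   case False
   hence "B.fnormal p' \<bullet> x \<le> B.foffset p'" using n by simp
   hence "0 \<le> barycentric T' x p'" using B.fnormal_le_iff(1)[OF T'(2)] by simp
   hence "x \<in> T'" unfolding B.simplex_bary using x by (auto intro: less_imp_le)
   thus ?thesis using cell_subset[OF T'(1)] by auto
  qed
 qed
 hence "y \<in> interior (closure \<Omega>)" using o yU by (meson interior_maximal subsetD)
 thus ?thesis using lipschitz_domain_interior_closure[OF domain] by simp
qed

lemma frontier_facets: "frontier \<Omega> \<subseteq> (\<Union>z\<in>facets. full_simplex.facet (fst z) (snd z))"
proof
 fix x assume x: "x \<in> frontier \<Omega>"
 hence "x \<in> closure \<Omega>" by (simp add: frontier_def)
 then obtain T where T: "T \<in> \<T>" "x \<in> T" using Union_mesh by auto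
 interpret A: full_simplex T by (rule cell[OF T(1)])
 have "x \<notin> interior T" by (rule frontier_domain_cell[OF T(1) x])
 then obtain p where p: "p \<in> vertices T" "\<not> 0 < barycentric T x p" using A.interior_simplex_bary by auto
 hence "barycentric T x p = 0" using T(2) A.simplex_bary by force
 hence "x \<in> A.facet p" using T(2) by (simp add: A.facet_def)
 thus "x \<in> (\<Union>z\<in>facets. full_simplex.facet (fst z) (snd z))"
  using T(1) p(1) by (intro UN_I[of "(T, p)"]) (auto simp: facets_def)
qed

end

lemma space_surface_on [simp]: "space (surface_on S) = S"
 by (simp add: surface_on_def space_restrict_space)

lemma AE_surface_on: "S \<in> sets borel \<Longrightarrow> (AE x in surface_on S. P x) \<longleftrightarrow> (AE x in surface_measure. x \<in> S \<longrightarrow> P x)"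
 unfolding surface_on_def by (simp add: AE_restrict_space_iff)

lemma borel_measurable_surface_on:
 fixes h :: "'a::euclidean_space \<Rightarrow> real"
 shows "S \<in> sets borel \<Longrightarrow> h \<in> borel_measurable (surface_on S) \<longleftrightarrow> (\<lambda>x. ind S x * h x) \<in> borel_measurable borel"
 using borel_measurable_restrict_space_iff[of S "surface_measure :: 'a measure" h]
 unfolding surface_on_def by (simp add: mult.commute cong: measurable_cong_sets)

lemma continuous_measurable_surface_on:
 fixes v :: "'a::euclidean_space \<Rightarrow> real"
 assumes v: "continuous_on K v" and S: "S \<subseteq> K" "S \<in> sets borel"
 shows "v \<in> borel_measurable (surface_on S)"
proof -
 have "(\<lambda>x. ind S x *\<^sub>R v x) \<in> borel_measurable borel"
  by (rule borel_measurable_continuous_on_indicator[OF S(2) continuous_on_subset[OF v S(1)]])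
 thus ?thesis using S(2) by (simp add: borel_measurable_surface_on)
qed

context full_simplex begin

lemma open_facet_borel: "p \<in> C \<Longrightarrow> open_facet p \<in> sets borel"
proof -
 assume p: "p \<in> C"
 have "open_facet p = {x. bary p x = 0} \<inter> (\<Inter>q\<in>C - {p}. {x. 0 < bary q x})" by (auto simp: open_facet_def)
 moreover have "{x. bary p x = 0} \<in> sets borel"
  using continuous_bary[OF p, of UNIV] by (intro borel_closed closed_Collect_eq) auto
 moreover have "open (\<Inter>q\<in>C - {p}. {x. 0 < bary q x})"
 proof (rule open_INT)
  show "finite (C - {p})" using vertices_simplex(1) by simp
  show "\<forall>q\<in>C - {p}. open {x. 0 < bary q x}"
   using continuous_bary by (intro ballI open_Collect_less continuous_on_const) auto
 qed
 ultimately show ?thesis by auto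
qed

abbreviation foot :: "'a \<Rightarrow> 'a \<Rightarrow> 'a" where "foot p x \<equiv> x - (fnormal p \<bullet> x - foffset p) *\<^sub>R fnormal p"

text \<open>The image \<open>tube_measure\<close> of Lebesgue measure on the tube under the foot point map is the surface measure of the open facet in the form in which it
occurs in \<open>flux\<close>.\<close>

definition facet_tube :: "'a \<Rightarrow> 'a set" where
 "facet_tube p = {x. \<bar>fnormal p \<bullet> x - foffset p\<bar> < 1/2 \<and> foot p x \<in> open_facet p}"

definition tube_measure :: "'a \<Rightarrow> 'a measure" where
 "tube_measure p = distr (density lborel (indicator (facet_tube p))) borel (foot p)"

lemma sets_tube_measure [simp, measurable_cong]: "sets (tube_measure p) = sets borel"
 by (simp add: tube_measure_def)

lemma foot_measurable [measurable]: "foot p \<in> borel_measurable borel"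
 by measurable

lemma facet_tube_borel: "p \<in> C \<Longrightarrow> facet_tube p \<in> sets borel"
proof -
 assume p: "p \<in> C"
 have "facet_tube p = {x. \<bar>fnormal p \<bullet> x - foffset p\<bar> < 1/2} \<inter> (foot p -` open_facet p \<inter> space borel)"
  by (auto simp: facet_tube_def)
 thus ?thesis using open_facet_borel[OF p] measurable_sets[OF foot_measurable]
  by (auto intro!: sets.Int borel_open open_Collect_less continuous_intros)
qed

lemma bounded_facet_tube: "p \<in> C \<Longrightarrow> bounded (facet_tube p)"
proof -
 assume p: "p \<in> C"
 obtain B where B: "\<And>x. x \<in> T \<Longrightarrow> norm x \<le> B" using compact_imp_bounded[OF compact_simplex_T] by (auto simp: bounded_iff)
 have "norm x \<le> B + 1/2" if x: "x \<in> facet_tube p" for x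
 proof -
  have "foot p x \<in> T" using x open_facet_subset[OF p] by (auto simp: facet_tube_def facet_def)
  hence "norm (foot p x) \<le> B" by (rule B)
  moreover have "norm x \<le> norm (foot p x) + norm ((fnormal p \<bullet> x - foffset p) *\<^sub>R fnormal p)"
   using norm_triangle_ineq[of "foot p x" "(fnormal p \<bullet> x - foffset p) *\<^sub>R fnormal p"] by simp
  moreover have "norm ((fnormal p \<bullet> x - foffset p) *\<^sub>R fnormal p) \<le> 1/2"
   using x norm_fnormal[OF p] by (simp add: facet_tube_def)
  ultimately show ?thesis by linarith
 qed
 thus ?thesis by (auto simp: bounded_iff)
qed

lemma emeasure_tube_measure:
 assumes "p \<in> C" "A \<in> sets borel"
 shows "emeasure (tube_measure p) A = emeasure lborel {x \<in> facet_tube p. foot p x \<in> A}"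
proof -
 have m: "foot p -` A \<inter> space borel \<in> sets borel" by (rule measurable_sets[OF foot_measurable assms(2)])
 have "emeasure (tube_measure p) A = emeasure (density lborel (indicator (facet_tube p))) (foot p -` A)"
  unfolding tube_measure_def using m assms by (subst emeasure_distr) auto
 also have "\<dots> = emeasure lborel (facet_tube p \<inter> foot p -` A)"
  using m facet_tube_borel[OF assms(1)] by (intro emeasure_restricted) auto
 also have "facet_tube p \<inter> foot p -` A = {x \<in> facet_tube p. foot p x \<in> A}" by auto
 finally show ?thesis .
qed

lemma integral_tube_measure:
 fixes h :: "'a \<Rightarrow> real"
 assumes "p \<in> C" "h \<in> borel_measurable borel"
 shows "(LINT x|tube_measure p. h x) = (LINT x|lborel. ind (facet_tube p) x * h (foot p x))"
proof -
 have "(LINT x|tube_measure p. h x) = (LINT x|density lborel (indicator (facet_tube p)). h (foot p x))"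
  unfolding tube_measure_def using assms by (intro integral_distr) auto
 also have "density lborel (indicator (facet_tube p)) = density lborel (\<lambda>x. ennreal (ind (facet_tube p) x))"
  by (rule arg_cong[where f = "density lborel"]) (simp add: fun_eq_iff ennreal_indicator)
 also have "(\<integral>x. h (foot p x) \<partial>\<dots>) = (LINT x|lborel. ind (facet_tube p) x *\<^sub>R h (foot p x))"
  using assms facet_tube_borel[OF assms(1)] foot_measurable[of p] by (intro integral_density) auto
 finally show ?thesis by simp
qed

lemma finite_tube_measure: "p \<in> C \<Longrightarrow> finite_measure (tube_measure p)"
proof
 assume p: "p \<in> C"
 have "emeasure (tube_measure p) UNIV = emeasure lborel (facet_tube p)" using emeasure_tube_measure[OF p, of UNIV] by simp
 also have "\<dots> < \<infinity>" by (rule emeasure_bounded_finite[OF bounded_facet_tube[OF p]])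
 finally show "emeasure (tube_measure p) (space (tube_measure p)) \<noteq> \<infinity>" by (simp add: tube_measure_def)
qed

lemma AE_tube_measure: "p \<in> C \<Longrightarrow> AE x in tube_measure p. x \<in> open_facet p"
proof -
 assume p: "p \<in> C"
 have "{x \<in> facet_tube p. foot p x \<in> - open_facet p} = {}" by (auto simp: facet_tube_def)
 hence "emeasure (tube_measure p) (- open_facet p) = 0"
  using emeasure_tube_measure[OF p, of "- open_facet p"] open_facet_borel[OF p] by (simp only: borel_comp emeasure_empty)
 hence "- open_facet p \<in> null_sets (tube_measure p)" using open_facet_borel[OF p] by (auto simp: null_sets_def borel_comp)
 thus ?thesis using AE_not_in by fastforce
qed

end

text \<open>The assumption makes Hausdorff measure and \<^const>\<open>surface_measure\<close> agree on Borel sets; the Dirichlet boundary provides the set.\<close>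

locale trace_domain = polyhedral_domain \<Omega> \<T> for \<Omega> :: "'a::euclidean_space set" and \<T> +
 assumes surface_pos: "\<exists>A. emeasure (surface_measure :: 'a measure) A > 0"
begin

abbreviation "area \<equiv> surface_on (frontier \<Omega>)"

lemma surface_hausdorff: "B \<in> sets borel \<Longrightarrow> emeasure surface_measure (B :: 'a set) = hsurf B"
 using surface_pos emeasure_surface_measure by blast

lemma surface_frontier_finite: "emeasure surface_measure (frontier \<Omega>) < top"
proof -
 have fb: "fct z \<in> sets borel" if "z \<in> facets" for z
 proof -
  have T: "fst z \<in> \<T>" "snd z \<in> vertices (fst z)" using that by (auto simp: facets_def)
  interpret A: full_simplex "fst z" by (rule cell[OF T(1)])
  show ?thesis unfolding A.facet_hull[OF T(2)] using A.vertices_simplex(1)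
   by (intro borel_compact finite_imp_compact_convex_hull) simp
 qed
 have fin: "emeasure surface_measure (fct z) < top" if "z \<in> facets" for z
 proof -
  have T: "fst z \<in> \<T>" "snd z \<in> vertices (fst z)" using that by (auto simp: facets_def)
  interpret A: full_simplex "fst z" by (rule cell[OF T(1)])
  have "card (vertices (fst z) - {snd z}) = Suc (DIM('a) - 1)"
   using A.vertices_simplex(1,3) T(2) dim2 by simp
  hence "hsurf (convex hull (vertices (fst z) - {snd z})) < top"
   using A.vertices_simplex(1) dim2 by (intro hausdorff_outer_convex_hull_finite) auto
  thus ?thesis using surface_hausdorff[OF fb[OF that]] A.facet_hull[OF T(2)] by simp
 qed
 have "emeasure surface_measure (frontier \<Omega>) \<le> emeasure surface_measure (\<Union>z\<in>facets. fct z)"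
  using fb finite_facets by (intro emeasure_mono frontier_facets) (auto intro!: sets.finite_UN)
 also have "\<dots> \<le> (\<Sum>z\<in>facets. emeasure surface_measure (fct z))"
  using fb finite_facets by (intro emeasure_subadditive_finite) auto
 also have "\<dots> < top" using fin finite_facets by simp
 finally show ?thesis .
qed

lemma frontier_borel: "frontier \<Omega> \<in> sets borel" by (simp add: borel_closed)

lemma finite_surface_on: "S \<subseteq> frontier \<Omega> \<Longrightarrow> S \<in> sets borel \<Longrightarrow> finite_measure (surface_on S)"
proof
 assume S: "S \<subseteq> frontier \<Omega>" "S \<in> sets borel"
 have "emeasure (surface_on S) S = emeasure surface_measure S"
  unfolding surface_on_def using S by (simp add: emeasure_restrict_space)
 also have "\<dots> \<le> emeasure surface_measure (frontier \<Omega>)" using S frontier_borel by (intro emeasure_mono) auto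
 also have "\<dots> < top" by (rule surface_frontier_finite)
 finally show "emeasure (surface_on S) (space (surface_on S)) \<noteq> \<infinity>" by simp
qed

lemma continuous_L2_surface:
 assumes v: "continuous_on (closure \<Omega>) v" and S: "S \<subseteq> frontier \<Omega>" "S \<in> sets borel"
 shows "(v :: 'a \<Rightarrow> real) \<in> L2_space (surface_on S)"
proof -
 have Sc: "S \<subseteq> closure \<Omega>" using S(1) by (auto simp: frontier_def)
 obtain B where B: "B > 0" "\<And>x. x \<in> closure \<Omega> \<Longrightarrow> norm (v x) \<le> B"
  by (rule compact_continuous_bound[OF compact_closure_domain v]) blast
 show ?thesis
  by (rule bounded_imp_L2[OF continuous_measurable_surface_on[OF v Sc S(2)] finite_surface_on[OF S], of B])
    (use B(2) Sc in \<open>auto intro!: AE_I2\<close>)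
qed

lemma tube_measure_le_surface:
 assumes z: "(T, p) \<in> facets"
 obtains K where "K > 0" "\<And>h. h \<in> borel_measurable borel \<Longrightarrow>
  (\<integral>\<^sup>+x. h x \<partial>full_simplex.tube_measure T p) \<le> ennreal K * (\<integral>\<^sup>+x. h x * indicator (ofacet T p) x \<partial>surface_measure)"
proof -
 have T: "T \<in> \<T>" "p \<in> vertices T" using z by (auto simp: facets_def)
 interpret A: full_simplex T by (rule cell[OF T(1)])
 let ?N = "A.fnormal p" and ?c = "A.foffset p" and ?F = "A.open_facet p"
 obtain K where K: "K > 0" "\<And>A c. {x. \<bar>?N \<bullet> x - c\<bar> \<le> 1/2 \<and> x - (?N \<bullet> x - c) *\<^sub>R ?N \<in> A} \<in> sets borel \<Longrightarrow>
  emeasure lborel {x. \<bar>?N \<bullet> x - c\<bar> \<le> 1/2 \<and> x - (?N \<bullet> x - c) *\<^sub>R ?N \<in> A} \<le> ennreal K * hsurf A"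
  by (rule tube_le_hausdorff_outer[OF dim2 A.norm_fnormal[OF T(2)], of "1/2"]) auto
 define M where "M = scale_measure (ennreal K) (density surface_measure (indicator ?F))"
 have Fb: "?F \<in> sets surface_measure" using A.open_facet_borel[OF T(2)] by simp
 have sM: "sets (A.tube_measure p) = sets M" by (simp add: M_def)
 have le: "A.tube_measure p \<le> M"
 proof (rule le_measure[OF sM, THEN iffD2], intro ballI)
  fix B assume "B \<in> sets (A.tube_measure p)"
  hence B: "B \<in> sets borel" by simp
  let ?Z = "{x. \<bar>?N \<bullet> x - ?c\<bar> \<le> 1/2 \<and> A.foot p x \<in> ?F \<inter> B}"
  have FB: "?F \<inter> B \<in> sets borel" using B Fb by auto
  have "A.foot p -` (?F \<inter> B) \<inter> space borel \<in> sets borel" by (rule measurable_sets[OF A.foot_measurable FB])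
  moreover have "?Z = {x. \<bar>?N \<bullet> x - ?c\<bar> \<le> 1/2} \<inter> (A.foot p -` (?F \<inter> B) \<inter> space borel)" by auto
  moreover have "closed {x. \<bar>?N \<bullet> x - ?c\<bar> \<le> 1/2}" by (intro closed_Collect_le continuous_intros)
  ultimately have Zb: "?Z \<in> sets borel" by (simp add: borel_closed sets.Int)
  have "emeasure (A.tube_measure p) B \<le> emeasure lborel ?Z"
   unfolding A.emeasure_tube_measure[OF T(2) B] using Zb
   by (intro emeasure_mono) (auto simp: A.facet_tube_def)
  also have "\<dots> \<le> ennreal K * hsurf (?F \<inter> B)" by (rule K(2)[OF Zb])
  also have "hsurf (?F \<inter> B) = emeasure surface_measure (?F \<inter> B)"
   using surface_hausdorff[OF FB] by simp
  also have "ennreal K * \<dots> = emeasure M B"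
   unfolding M_def using Fb B by (simp add: emeasure_restricted)
  finally show "emeasure (A.tube_measure p) B \<le> emeasure M B" .
 qed
 show ?thesis
 proof (rule that[OF K(1)])
  fix h :: "'a \<Rightarrow> ennreal" assume h: "h \<in> borel_measurable borel"
  have hs: "h \<in> borel_measurable surface_measure" using h by (simp cong: measurable_cong_sets)
  have "(\<integral>\<^sup>+x. h x \<partial>A.tube_measure p) \<le> (\<integral>\<^sup>+x. h x \<partial>M)" by (rule nn_integral_mono_measure[OF sM le])
  also have "\<dots> = ennreal K * (\<integral>\<^sup>+x. h x \<partial>density surface_measure (indicator ?F))"
   unfolding M_def using hs by (intro nn_integral_scale_measure) auto
  also have "(\<integral>\<^sup>+x. h x \<partial>density surface_measure (indicator ?F)) = (\<integral>\<^sup>+x. h x * indicator ?F x \<partial>surface_measure)"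
   using hs Fb borel_measurable_indicator[OF Fb] by (subst nn_integral_density) (simp_all add: mult.commute)
  finally show "(\<integral>\<^sup>+x. h x \<partial>A.tube_measure p) \<le> ennreal K * (\<integral>\<^sup>+x. h x * indicator ?F x \<partial>surface_measure)" .
 qed
qed

end

lemma L2_integrable_finite:
 fixes f :: "'x \<Rightarrow> 'b::euclidean_space"
 assumes f: "f \<in> L2_space M" and M: "finite_measure M"
 shows "integrable M f"
proof (rule integrable_dominated)
 show "integrable M (\<lambda>x. 1 + (norm (f x))\<^sup>2)"
  using f finite_measure.integrable_const[OF M] by (intro Bochner_Integration.integrable_add) (auto simp: L2_space_def)
 show "f \<in> borel_measurable M" using f by (simp add: L2_space_def)
 have "a \<le> 1 + a\<^sup>2" for a :: real using zero_le_power2[of "a - 1"] zero_le_power2[of a] unfolding power2_diff power_one by linarith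
 thus "AE x in M. norm (f x) \<le> norm (1 + (norm (f x))\<^sup>2)" by simp
qed

context polyhedral_domain begin

lemma L2_norm_cell_square_sum:
 fixes f :: "'a \<Rightarrow> 'b::euclidean_space"
 assumes "f \<in> L2_space vol"
 shows "(L2_norm vol f)\<^sup>2 = (\<Sum>T\<in>\<T>. (L2_norm (lebesgue_on T) f)\<^sup>2)"
 using integral_domain_sum[of "\<lambda>x. (norm (f x))\<^sup>2"] assms by (simp add: L2_norm_square L2_space_def)

lemma L2_norm_cell_le:
 fixes f :: "'a \<Rightarrow> 'b::euclidean_space"
 assumes "f \<in> L2_space vol" "T \<in> \<T>"
 shows "L2_norm (lebesgue_on T) f \<le> L2_norm vol f"
proof (rule power2_le_imp_le)
 show "(L2_norm (lebesgue_on T) f)\<^sup>2 \<le> (L2_norm vol f)\<^sup>2"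
  unfolding L2_norm_cell_square_sum[OF assms(1)] using assms(2) finite_mesh
  by (intro member_le_sum) auto
qed simp

lemma L2_space_cell:
 fixes f :: "'a \<Rightarrow> 'b::euclidean_space"
 shows "f \<in> L2_space vol \<Longrightarrow> T \<in> \<T> \<Longrightarrow> f \<in> L2_space (lebesgue_on T)"
 by (rule L2_space_lebesgue_on_mono[OF domain_lebesgue cell_lebesgue negligible_cell_diff])

lemma finite_measure_cell: "T \<in> \<T> \<Longrightarrow> finite_measure (lebesgue_on T)"
 by (rule finite_measure_lebesgue_on[OF lmeasurable_compact[OF cell_compact]])

lemma continuous_L2_cell:
 fixes f :: "'a \<Rightarrow> 'b::euclidean_space"
 assumes "T \<in> \<T>" "continuous_on T f"
 shows "f \<in> L2_space (lebesgue_on T)"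
proof -
 obtain B where B: "B > 0" "\<And>x. x \<in> T \<Longrightarrow> norm (f x) \<le> B"
  by (rule compact_continuous_bound[OF cell_compact[OF assms(1)] assms(2)]) blast
 have "f \<in> borel_measurable (lebesgue_on T)"
  by (rule continuous_imp_measurable_on_sets_lebesgue[OF assms(2) cell_lebesgue[OF assms(1)]])
 thus ?thesis by (rule bounded_imp_L2[OF _ finite_measure_cell[OF assms(1)], of _ B]) (use B(2) in \<open>auto intro!: AE_I2\<close>)
qed

end

context trace_domain begin

text \<open>The divergence theorem for the field \<open>\<phi> n N\<close> on one cell, with a test function that vanishes on the other facets: the
flux through the facet \<open>p\<close> is bounded by the \<open>H\<^sup>1\<close> norm of \<open>\<phi> n\<close>.\<close>

lemma facet_flux_vanishes:
 assumes z: "(T, p) \<in> facets" and op: "ofacet T p \<subseteq> frontier \<Omega>"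
  and \<phi>: "\<And>n. \<phi> n \<in> H1_space \<Omega>" "\<And>n. continuous_on (closure \<Omega>) (\<phi> n)"
  and lim: "(\<lambda>n. L2_norm vol (\<phi> n)) \<longlonglongrightarrow> 0" "(\<lambda>n. H1_seminorm \<Omega> \<Omega> (\<phi> n)) \<longlonglongrightarrow> 0"
  and w: "\<And>x. GDERIV w x :> Dw x" "continuous_on UNIV Dw"
  and w0: "\<And>y q. y \<in> T \<Longrightarrow> q \<in> vertices T - {p} \<Longrightarrow> barycentric T y q = 0 \<Longrightarrow> w y = 0"
 shows "(\<lambda>n. \<integral>x. w x * (ind (frontier \<Omega>) x * \<phi> n x) \<partial>full_simplex.tube_measure T p) \<longlonglongrightarrow> 0"
proof -
 have T: "T \<in> \<T>" "p \<in> vertices T" using z by (auto simp: facets_def)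
 interpret A: full_simplex T by (rule cell[OF T(1)])
 interpret P: polytope "vertices T" A.fnormal A.foffset T by (rule A.simplex_polytope)
 let ?N = "A.fnormal p" and ?c = "A.foffset p"
 have N: "norm ?N = 1" "?N \<bullet> ?N = 1" using A.norm_fnormal[OF T(2)] by (auto simp: norm_eq_1)
 have contw: "continuous_on S w" for S
  by (rule GDERIV_continuous[OF w(1)])
 have contT: "continuous_on T (\<phi> n)" for n using \<phi>(2) cell_subset[OF T(1)] continuous_on_subset by blast
 have sub: "{x. \<forall>i\<in>vertices T. A.fnormal i \<bullet> x < A.foffset i} \<subseteq> \<Omega>"
  using A.fnormal_le_iff(2) A.interior_simplex_bary interior_cell[OF T(1)] by blast
 have W: "grad (\<phi> n) \<in> L2_space vol" "weak_gradient \<Omega> (\<phi> n) (grad (\<phi> n))" for n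
  using H1_wgrad[OF open_domain \<phi>(1)] by auto
 have WT: "grad (\<phi> n) \<in> L2_space (lebesgue_on T)" for n by (rule L2_space_cell[OF W(1) T(1)])
 have \<phi>L: "\<phi> n \<in> L2_space vol" for n using \<phi>(1) by (simp add: H1_space_def)
 have fl: "flux {y\<in>T. A.fnormal q \<bullet> y = A.foffset q} (A.fnormal q) (A.foffset q) (\<lambda>x. w x *\<^sub>R (\<phi> n x *\<^sub>R ?N)) = 0"
  if q: "q \<in> vertices T - {p}" for n q
 proof -
  have "ind {y\<in>T. A.fnormal q \<bullet> y = A.foffset q} y * ((w y *\<^sub>R (\<phi> n y *\<^sub>R ?N)) \<bullet> A.fnormal q) = 0" for y
  proof (cases "y \<in> T \<and> A.fnormal q \<bullet> y = A.foffset q")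
   case True
   hence "w y = 0" using w0[of y q] q A.fnormal_le_iff(3)[of q y] by simp
   thus ?thesis by simp
  qed simp
  thus ?thesis unfolding flux_def by (simp only: mult_zero_right Bochner_Integration.integral_zero)
 qed
 have eq: "(LINT x|A.tube_measure p. w x * (ind (frontier \<Omega>) x * \<phi> n x))
   = (LINT x|lebesgue_on T. \<phi> n x \<bullet> (?N \<bullet> Dw x)) + (LINT x|lebesgue_on T. (w x *\<^sub>R ?N) \<bullet> grad (\<phi> n) x)" for n
 proof -
  have wg: "weak_gradient \<Omega> (\<lambda>x. (\<phi> n x *\<^sub>R ?N) \<bullet> b) (\<lambda>x. (?N \<bullet> b) *\<^sub>R grad (\<phi> n) x)" for b
   using weak_gradient_comb[OF weak_gradient_zero[OF domain_lebesgue] W(2) domain_lebesgue, of "?N \<bullet> b" n]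
   by (simp add: mult.commute)
  have "(LINT x|lebesgue_on T. (\<phi> n x *\<^sub>R ?N) \<bullet> Dw x) + (LINT x|lebesgue_on T. w x * (\<Sum>b\<in>Basis. ((?N \<bullet> b) *\<^sub>R grad (\<phi> n) x) \<bullet> b))
   = (\<Sum>q\<in>vertices T. flux {y\<in>T. A.fnormal q \<bullet> y = A.foffset q} (A.fnormal q) (A.foffset q) (\<lambda>x. w x *\<^sub>R (\<phi> n x *\<^sub>R ?N)))"
   using contT L2_integrable_finite[OF WT finite_measure_cell[OF T(1)]]
   by (intro P.divergence_theorem[OF domain_lebesgue sub _ wg _ w]) (auto intro!: continuous_intros)
  also have "\<dots> = flux {y\<in>T. ?N \<bullet> y = ?c} ?N ?c (\<lambda>x. w x *\<^sub>R (\<phi> n x *\<^sub>R ?N))"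
   using fl by (subst sum.remove[OF A.vertices_simplex(1) T(2)]) simp
  also have "\<dots> = (LINT x|lborel. ind (A.facet_tube p) x * (w (A.foot p x) * (ind (frontier \<Omega>) (A.foot p x) * \<phi> n (A.foot p x))))"
   unfolding flux_def
  proof (rule LINT_cong[OF refl])
   fix x
   let ?y = "A.foot p x"
   show "ind {x. \<bar>?N \<bullet> x - ?c\<bar> < 1 / 2} x * (ind {y \<in> T. ?N \<bullet> y = ?c} ?y * (w ?y *\<^sub>R \<phi> n ?y *\<^sub>R ?N \<bullet> ?N))
    = ind (A.facet_tube p) x * (w ?y * (ind (frontier \<Omega>) ?y * \<phi> n ?y))"
   proof (cases "\<bar>?N \<bullet> x - ?c\<bar> < 1 / 2")
    case lt: True
    show ?thesis
    proof (cases "?y \<in> A.open_facet p")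
     case True
     hence "?y \<in> frontier \<Omega>" "?y \<in> T" "?N \<bullet> ?y = ?c"
      using op A.open_facet_subset[OF T(2)] A.fnormal_le_iff(3)[OF T(2), of ?y] by (auto simp: A.facet_def)
     thus ?thesis using lt True N by (simp add: A.facet_tube_def indicator_def)
    next
     case False
     have "w ?y = 0" if y: "?y \<in> T" "?N \<bullet> ?y = ?c"
     proof -
      have "barycentric T ?y p = 0" using y(2) A.fnormal_le_iff(3)[OF T(2), of ?y] by simp
      then obtain q where q: "q \<in> vertices T - {p}" "\<not> 0 < barycentric T ?y q"
       using False unfolding A.open_facet_def by blast
      moreover have "0 \<le> barycentric T ?y q" using y(1) q(1) A.simplex_bary by blast
      ultimately show ?thesis using w0[OF y(1) q(1)] by linarith
     qed
     thus ?thesis using False by (auto simp: A.facet_tube_def indicator_def)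
    qed
   qed (simp add: A.facet_tube_def)
  qed
  also have "\<dots> = (LINT x|A.tube_measure p. w x * (ind (frontier \<Omega>) x * \<phi> n x))"
  proof (rule A.integral_tube_measure[OF T(2), symmetric])
   have "w \<in> borel_measurable borel" by (rule borel_measurable_continuous_onI[OF contw])
   moreover have "(\<lambda>x. ind (frontier \<Omega>) x *\<^sub>R \<phi> n x) \<in> borel_measurable borel"
    by (rule borel_measurable_continuous_on_indicator[OF frontier_borel continuous_on_subset[OF \<phi>(2)]]) (simp add: frontier_def)
   ultimately show "(\<lambda>x. w x * (ind (frontier \<Omega>) x * \<phi> n x)) \<in> borel_measurable borel" by simp
  qed
  finally have "(LINT x|A.tube_measure p. w x * (ind (frontier \<Omega>) x * \<phi> n x)) =
    (LINT x|lebesgue_on T. (\<phi> n x *\<^sub>R ?N) \<bullet> Dw x) + (LINT x|lebesgue_on T. w x * (\<Sum>b\<in>Basis. ((?N \<bullet> b) *\<^sub>R grad (\<phi> n) x) \<bullet> b))"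
   by (rule sym)
  moreover have "(\<Sum>b\<in>Basis. ((?N \<bullet> b) *\<^sub>R grad (\<phi> n) x) \<bullet> b) = ?N \<bullet> grad (\<phi> n) x" for x
   by (subst euclidean_inner[of ?N]) simp
  ultimately show ?thesis by simp
 qed
 have D: "(\<lambda>x. ?N \<bullet> Dw x) \<in> L2_space (lebesgue_on T)" "(\<lambda>x. w x *\<^sub>R ?N) \<in> L2_space (lebesgue_on T)"
  using w(2) contw continuous_on_subset[OF w(2)] by (auto intro!: continuous_L2_cell[OF T(1)] continuous_intros)
 define B1 B2 where "B1 = L2_norm (lebesgue_on T) (\<lambda>x. ?N \<bullet> Dw x)" and "B2 = L2_norm (lebesgue_on T) (\<lambda>x. w x *\<^sub>R ?N)"
 have le: "norm (LINT x|A.tube_measure p. w x * (ind (frontier \<Omega>) x * \<phi> n x))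
   \<le> L2_norm vol (\<phi> n) * B1 + B2 * H1_seminorm \<Omega> \<Omega> (\<phi> n)" for n
 proof -
  have "\<bar>\<integral>x. \<phi> n x \<bullet> (?N \<bullet> Dw x) \<partial>lebesgue_on T\<bar> \<le> L2_norm (lebesgue_on T) (\<phi> n) * B1"
   unfolding B1_def by (rule L2_cauchy_schwarz[OF L2_space_cell[OF \<phi>L T(1)] D(1)])
  also have "\<dots> \<le> L2_norm vol (\<phi> n) * B1"
   by (rule mult_right_mono[OF L2_norm_cell_le[OF \<phi>L T(1)]]) (simp add: B1_def)
  finally have 1: "\<bar>\<integral>x. \<phi> n x \<bullet> (?N \<bullet> Dw x) \<partial>lebesgue_on T\<bar> \<le> L2_norm vol (\<phi> n) * B1" .
  have "\<bar>\<integral>x. (w x *\<^sub>R ?N) \<bullet> grad (\<phi> n) x \<partial>lebesgue_on T\<bar> \<le> B2 * L2_norm (lebesgue_on T) (grad (\<phi> n))"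
   unfolding B2_def by (rule L2_cauchy_schwarz[OF D(2) WT])
  also have "\<dots> \<le> B2 * H1_seminorm \<Omega> \<Omega> (\<phi> n)"
   unfolding H1_seminorm_def by (rule mult_left_mono[OF L2_norm_cell_le[OF W(1) T(1)]]) (simp add: B2_def)
  finally have 2: "\<bar>\<integral>x. (w x *\<^sub>R ?N) \<bullet> grad (\<phi> n) x \<partial>lebesgue_on T\<bar> \<le> B2 * H1_seminorm \<Omega> \<Omega> (\<phi> n)" .
  show ?thesis unfolding eq real_norm_def using 1 2 by linarith
 qed
 show ?thesis
 proof (rule Lim_null_comparison[OF always_eventually])
  show "\<forall>n. norm (LINT x|A.tube_measure p. w x * (ind (frontier \<Omega>) x * \<phi> n x))
   \<le> L2_norm vol (\<phi> n) * B1 + B2 * H1_seminorm \<Omega> \<Omega> (\<phi> n)" using le by blast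
  show "(\<lambda>n. L2_norm vol (\<phi> n) * B1 + B2 * H1_seminorm \<Omega> \<Omega> (\<phi> n)) \<longlonglongrightarrow> 0"
   using tendsto_add[OF tendsto_mult_right[OF lim(1), of B1] tendsto_mult_left[OF lim(2), of B2]] by simp
 qed
qed

lemma tube_L2_le_surface:
 assumes z: "(T, p) \<in> facets" and op: "ofacet T p \<subseteq> frontier \<Omega>"
 obtains K where "K > 0" "\<And>h. h \<in> L2_space area \<Longrightarrow>
  (\<lambda>x. ind (frontier \<Omega>) x * h x) \<in> L2_space (full_simplex.tube_measure T p) \<and>
  L2_norm (full_simplex.tube_measure T p) (\<lambda>x. ind (frontier \<Omega>) x * h x) \<le> K * L2_norm area (h :: 'a \<Rightarrow> real)"
proof -
 have T: "T \<in> \<T>" "p \<in> vertices T" using z by (auto simp: facets_def)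
 interpret A: full_simplex T by (rule cell[OF T(1)])
 obtain K where K: "K > 0" "\<And>h. h \<in> borel_measurable borel \<Longrightarrow>
  (\<integral>\<^sup>+x. h x \<partial>A.tube_measure p) \<le> ennreal K * (\<integral>\<^sup>+x. h x * indicator (A.open_facet p) x \<partial>surface_measure)"
  by (rule tube_measure_le_surface[OF z]) blast
 have main: "(\<lambda>x. ind (frontier \<Omega>) x * h x) \<in> L2_space (A.tube_measure p) \<and>
  L2_norm (A.tube_measure p) (\<lambda>x. ind (frontier \<Omega>) x * h x) \<le> sqrt K * L2_norm area h"
  if h: "h \<in> L2_space area" for h :: "'a \<Rightarrow> real"
 proof -
  define k where "k x = ind (frontier \<Omega>) x * h x" for x
  have km: "k \<in> borel_measurable borel"
   using h borel_measurable_surface_on[OF frontier_borel, of h] by (simp add: L2_space_def k_def[abs_def])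
  have hi: "integrable area (\<lambda>x. (h x)\<^sup>2)" using h by (simp add: L2_space_def)
  define S where "S = (L2_norm area h)\<^sup>2"
  have Seq: "S = (LINT x|area. (h x)\<^sup>2)" unfolding S_def by (simp add: L2_norm_square)
  have "(\<integral>\<^sup>+x. ennreal ((k x)\<^sup>2) \<partial>A.tube_measure p) \<le> ennreal K * (\<integral>\<^sup>+x. ennreal ((k x)\<^sup>2) * indicator (A.open_facet p) x \<partial>surface_measure)"
   by (rule K(2)) (use km in measurable)
  also have "(\<integral>\<^sup>+x. ennreal ((k x)\<^sup>2) * indicator (A.open_facet p) x \<partial>surface_measure) \<le> (\<integral>\<^sup>+x. ennreal ((h x)\<^sup>2) * indicator (frontier \<Omega>) x \<partial>surface_measure)"
   by (intro nn_integral_mono) (auto simp: k_def indicator_def)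
  also have "\<dots> = (\<integral>\<^sup>+x. ennreal ((h x)\<^sup>2) \<partial>area)"
   unfolding surface_on_def using frontier_borel by (subst nn_integral_restrict_space) auto
  also have "\<dots> = ennreal S" unfolding Seq by (rule nn_integral_eq_integral[OF hi]) simp
  finally have le: "(\<integral>\<^sup>+x. ennreal ((k x)\<^sup>2) \<partial>A.tube_measure p) \<le> ennreal (K * S)"
   using K(1) by (simp add: ennreal_mult' mult_left_mono S_def)
  have ki: "integrable (A.tube_measure p) (\<lambda>x. (k x)\<^sup>2)"
  proof (rule integrableI_nonneg)
   show "(\<lambda>x. (k x)\<^sup>2) \<in> borel_measurable (A.tube_measure p)" using km by measurable
   show "(\<integral>\<^sup>+x. ennreal ((k x)\<^sup>2) \<partial>A.tube_measure p) < \<infinity>" using le by (rule le_less_trans) simp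
  qed simp
  have "ennreal (LINT x|A.tube_measure p. (k x)\<^sup>2) \<le> ennreal (K * S)"
   using le nn_integral_eq_integral[OF ki] by simp
  hence "(LINT x|A.tube_measure p. (k x)\<^sup>2) \<le> K * S" using K(1) by (simp add: S_def)
  hence "L2_norm (A.tube_measure p) k \<le> sqrt (K * S)" unfolding L2_norm_def by simp
  also have "\<dots> = sqrt K * L2_norm area h" unfolding S_def real_sqrt_mult by simp
  finally have "L2_norm (A.tube_measure p) k \<le> sqrt K * L2_norm area h" .
  moreover have "k \<in> L2_space (A.tube_measure p)" using km ki by (simp add: L2_space_def cong: measurable_cong_sets)
  ultimately show ?thesis unfolding k_def[abs_def] by blast
 qed
 show ?thesis by (rule that[of "sqrt K"]) (use K(1) main in auto)
qed

text \<open>By the two previous lemmas the integral of \<open>g\<close> against every admissible test function vanishes. Cut-off functions of a box,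
multiplied with those of the remaining facets, turn this into vanishing integrals over boxes, so \<open>g\<close> is zero almost everywhere with
respect to \<open>tube_measure\<close>, and the set where it is not zero has a null tube.\<close>

lemma zero_trace_facet:
 assumes z: "(T, p) \<in> facets" and op: "ofacet T p \<subseteq> frontier \<Omega>"
  and \<phi>: "\<And>n. \<phi> n \<in> H1_space \<Omega>" "\<And>n. continuous_on (closure \<Omega>) (\<phi> n)"
  and lim: "(\<lambda>n. L2_norm vol (\<phi> n)) \<longlonglongrightarrow> 0" "(\<lambda>n. H1_seminorm \<Omega> \<Omega> (\<phi> n)) \<longlonglongrightarrow> 0"
  and g: "g \<in> L2_space area"
  and lg: "(\<lambda>n. L2_norm area (\<lambda>x. \<phi> n x - g x)) \<longlonglongrightarrow> 0"
 shows "AE x in surface_measure. x \<in> ofacet T p \<longrightarrow> g x = 0"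
proof -
 have T: "T \<in> \<T>" "p \<in> vertices T" using z by (auto simp: facets_def)
 interpret A: full_simplex T by (rule cell[OF T(1)])
 let ?N = "A.fnormal p" and ?c = "A.foffset p" and ?\<mu> = "A.tube_measure p"
 interpret F: finite_measure ?\<mu> by (rule A.finite_tube_measure[OF T(2)])
 obtain K where K: "K > 0" "\<And>h :: 'a \<Rightarrow> real. h \<in> L2_space area \<Longrightarrow>
  (\<lambda>x. ind (frontier \<Omega>) x * h x) \<in> L2_space ?\<mu> \<and>
  L2_norm ?\<mu> (\<lambda>x. ind (frontier \<Omega>) x * h x) \<le> K * L2_norm area h"
  by (rule tube_L2_le_surface[OF z op]) blast
 define g0 where "g0 x = ind (frontier \<Omega>) x * g x" for x
 define f0 where "f0 n x = ind (frontier \<Omega>) x * \<phi> n x" for n x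
 have \<phi>S: "\<phi> n \<in> L2_space area" for n
  by (rule continuous_L2_surface[OF \<phi>(2) subset_refl frontier_borel])
 have g0L: "g0 \<in> L2_space ?\<mu>" and f0L: "f0 n \<in> L2_space ?\<mu>" for n
  using K(2)[OF g] K(2)[OF \<phi>S[of n]] by (simp_all add: g0_def[abs_def] f0_def[abs_def])
 have diff: "L2_norm ?\<mu> (\<lambda>x. f0 n x - g0 x) \<le> K * L2_norm area (\<lambda>x. \<phi> n x - g x)" for n
  using K(2)[OF L2_space_diff[OF \<phi>S[of n] g]] by (simp add: g0_def f0_def right_diff_distrib)
 have dlim: "(\<lambda>n. L2_norm ?\<mu> (\<lambda>x. f0 n x - g0 x)) \<longlonglongrightarrow> 0"
  by (rule Lim_null_comparison[OF always_eventually tendsto_mult_right_zero[OF lg, of K]]) (use diff in simp)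
 have gm: "g0 \<in> borel_measurable borel" using g0L by (simp add: L2_space_def cong: measurable_cong_sets)
 have gi: "integrable ?\<mu> g0" by (rule L2_integrable_finite[OF g0L A.finite_tube_measure[OF T(2)]])
 have test: "(LINT x|?\<mu>. w x * g0 x) = 0"
  if w: "\<And>x. GDERIV w x :> Dw x" "continuous_on UNIV Dw" and wb: "\<And>x. \<bar>w x\<bar> \<le> 1"
   and w0: "\<And>y q. y \<in> T \<Longrightarrow> q \<in> vertices T - {p} \<Longrightarrow> barycentric T y q = 0 \<Longrightarrow> w y = 0" for w Dw
 proof -
  have contw: "continuous_on UNIV w"
   by (rule GDERIV_continuous[OF w(1)])
  have wm: "w \<in> borel_measurable ?\<mu>" using borel_measurable_continuous_onI[OF contw] by (simp cong: measurable_cong_sets)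
  have wL: "w \<in> L2_space ?\<mu>" by (rule bounded_imp_L2[OF wm A.finite_tube_measure[OF T(2)], of 1]) (use wb in simp)
  have 1: "(\<lambda>n. \<integral>x. w x * f0 n x \<partial>?\<mu>) \<longlonglongrightarrow> 0"
   unfolding f0_def by (rule facet_flux_vanishes[OF z op \<phi> lim w w0])
  have 2: "\<bar>(LINT x|?\<mu>. w x * f0 n x) - (LINT x|?\<mu>. w x * g0 x)\<bar> \<le> L2_norm ?\<mu> w * L2_norm ?\<mu> (\<lambda>x. f0 n x - g0 x)" for n
  proof -
   have "(LINT x|?\<mu>. w x * f0 n x) - (LINT x|?\<mu>. w x * g0 x) = (LINT x|?\<mu>. w x * f0 n x - w x * g0 x)"
    using L2_inner_integrable[OF wL f0L[of n]] L2_inner_integrable[OF wL g0L]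
    by (intro Bochner_Integration.integral_diff[symmetric]) auto
   also have "\<dots> = (LINT x|?\<mu>. w x \<bullet> (f0 n x - g0 x))" by (simp add: right_diff_distrib)
   finally show ?thesis using L2_cauchy_schwarz[OF wL L2_space_diff[OF f0L[of n] g0L]] by simp
  qed
  have "(\<lambda>n. (LINT x|?\<mu>. w x * f0 n x) - (LINT x|?\<mu>. w x * g0 x)) \<longlonglongrightarrow> 0"
   by (rule Lim_null_comparison[OF always_eventually tendsto_mult_right_zero[OF dlim, of "L2_norm ?\<mu> w"]]) (use 2 in simp)
  from tendsto_diff[OF 1 this] show ?thesis using LIMSEQ_const_iff by auto
 qed
 have box: "(\<integral>x\<in>box a b. g0 x \<partial>?\<mu>) = 0" for a b
 proof -
  define n1 :: "'a \<times> bool \<Rightarrow> 'a" where "n1 = (\<lambda>(e, s). if s then e else - e)"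
  define c1 :: "'a \<times> bool \<Rightarrow> real" where "c1 = (\<lambda>(e, s). if s then b \<bullet> e else - (a \<bullet> e))"
  define I1 where "I1 = (Basis :: 'a set) \<times> (UNIV :: bool set)"
  have boxI: "{x. \<forall>i\<in>I1. n1 i \<bullet> x < c1 i} = box a b"
   unfolding I1_def n1_def c1_def by (rule box_as_polytope(1))
  \<comment> \<open>the faces of the box and the other facets, as one family of half-spaces\<close>
  define n2 :: "('a \<times> bool) + 'a \<Rightarrow> 'a" where "n2 = case_sum n1 A.fnormal"
  define c2 where "c2 = case_sum c1 A.foffset"
  define I2 where "I2 = I1 <+> (vertices T - {p})"
  have fI: "finite I2" unfolding I2_def I1_def using A.vertices_simplex(1) by simp
  define d where "d k = 1 / (real k + 1)" for k
  have d: "d k > 0" "d \<longlonglongrightarrow> 0" for k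
   unfolding d_def using LIMSEQ_inverse_real_of_nat by (auto simp: inverse_eq_divide add.commute)
  define w where "w k = polytope_cutoff I2 n2 c2 (d k)" for k
  have z0: "(LINT x|?\<mu>. w k x * g0 x) = 0" for k
  proof (rule test)
   show "GDERIV (w k) x :> polytope_cutoff_grad I2 n2 c2 (d k) x" for x unfolding w_def by (rule GDERIV_polytope_cutoff)
   show "continuous_on UNIV (polytope_cutoff_grad I2 n2 c2 (d k))" by (rule continuous_polytope_cutoff_grad)
   show "\<bar>w k x\<bar> \<le> 1" for x using polytope_cutoff_bounds[of I2 n2 c2 "d k" x] by (simp add: w_def)
   show "w k y = 0" if y: "y \<in> T" "q \<in> vertices T - {p}" "barycentric T y q = 0" for y q
   proof (rule ccontr)
    assume "w k y \<noteq> 0"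
    moreover have "Inr q \<in> I2" using y(2) by (auto simp: I2_def)
    ultimately have "n2 (Inr q) \<bullet> y \<le> c2 (Inr q) - d k"
     unfolding w_def using polytope_cutoff_support[OF _ fI d(1)] by blast
    moreover have "A.fnormal q \<bullet> y = A.foffset q" using y A.fnormal_le_iff(3)[of q y] by simp
    ultimately show False using d(1)[of k] by (simp add: n2_def c2_def)
   qed
  qed
  have lim: "(\<lambda>k. w k x * g0 x) \<longlonglongrightarrow> ind (box a b) x * g0 x" if x: "x \<in> A.open_facet p" for x
  proof -
   have "(\<lambda>k. w k x) \<longlonglongrightarrow> ind {x. \<forall>i\<in>I2. n2 i \<bullet> x < c2 i} x"
    unfolding w_def by (rule polytope_cutoff_tendsto[OF fI d])
   moreover have "(\<forall>i\<in>I2. n2 i \<bullet> x < c2 i) \<longleftrightarrow> x \<in> box a b"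
   proof -
    have I2all: "(\<forall>i\<in>I2. P i) \<longleftrightarrow> (\<forall>i\<in>I1. P (Inl i)) \<and> (\<forall>q\<in>vertices T - {p}. P (Inr q))" for P
     unfolding I2_def by blast
    have "A.fnormal q \<bullet> x < A.foffset q" if "q \<in> vertices T - {p}" for q
     using x that A.fnormal_le_iff(2)[of q x] by (simp add: A.open_facet_def)
    hence "(\<forall>i\<in>I2. n2 i \<bullet> x < c2 i) \<longleftrightarrow> (\<forall>i\<in>I1. n1 i \<bullet> x < c1 i)"
     unfolding I2all n2_def c2_def by simp
    thus ?thesis unfolding boxI[symmetric] by simp
   qed
   ultimately have "(\<lambda>k. w k x) \<longlonglongrightarrow> ind (box a b) x" by (simp add: indicator_def)
   thus ?thesis by (intro tendsto_intros)
  qed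
  have "(\<lambda>k. \<integral>x. w k x * g0 x \<partial>?\<mu>) \<longlonglongrightarrow> (LINT x|?\<mu>. ind (box a b) x * g0 x)"
  proof (rule integral_dominated_convergence[where w = "\<lambda>x. \<bar>g0 x\<bar>"])
   show "(\<lambda>x. ind (box a b) x * g0 x) \<in> borel_measurable ?\<mu>" using gm by (simp cong: measurable_cong_sets)
   show "(\<lambda>x. w k x * g0 x) \<in> borel_measurable ?\<mu>" for k using gm by (simp add: w_def cong: measurable_cong_sets)
   show "integrable ?\<mu> (\<lambda>x. \<bar>g0 x\<bar>)" using gi by simp
   show "AE x in ?\<mu>. (\<lambda>k. w k x * g0 x) \<longlonglongrightarrow> ind (box a b) x * g0 x"
    using A.AE_tube_measure[OF T(2)] lim by (auto elim: AE_mp)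
   show "AE x in ?\<mu>. norm (w k x * g0 x) \<le> \<bar>g0 x\<bar>" for k
    using polytope_cutoff_bounds[of I2 n2 c2 "d k"] by (intro AE_I2) (simp add: w_def abs_mult mult_left_le_one_le)
  qed
  hence "(LINT x|?\<mu>. ind (box a b) x * g0 x) = 0" unfolding z0 using LIMSEQ_const_iff by metis
  thus ?thesis by (simp add: set_lebesgue_integral_def)
 qed
 have tot: "(LINT x|?\<mu>. g0 x) = 0"
 proof -
  have "bounded T" using compact_imp_bounded[OF A.compact_simplex_T] .
  then obtain a where a: "T \<subseteq> box (- a) a" by (rule bounded_subset_box_symmetric)
  have "AE x in ?\<mu>. g0 x = ind (box (- a) a) x * g0 x"
   using A.AE_tube_measure[OF T(2)]
  proof eventually_elim
   case (elim x)
   hence "x \<in> box (- a) a" using a A.open_facet_subset[OF T(2)] by (auto simp: A.facet_def)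
   thus ?case by simp
  qed
  hence "(LINT x|?\<mu>. g0 x) = (LINT x|?\<mu>. ind (box (- a) a) x * g0 x)"
   using gm by (intro integral_cong_AE) (auto cong: measurable_cong_sets)
  thus ?thesis using box[of "- a" a] by (simp add: set_lebesgue_integral_def)
 qed
 have "AE x in ?\<mu>. g0 x = 0"
  by (rule zero_on_boxes_imp_AE_zero_borel[OF A.sets_tube_measure gi box tot])
 hence "emeasure ?\<mu> {x \<in> space ?\<mu>. \<not> g0 x = 0} = 0"
  using gm by (subst (asm) AE_iff_measurable[OF _ refl]) (auto simp: A.tube_measure_def)
 moreover define Z where "Z = {x. g0 x \<noteq> 0} \<inter> A.open_facet p"
 have Zb: "{x. g0 x \<noteq> 0} \<in> sets borel" using gm by measurable
 ultimately have e0: "emeasure lborel {x \<in> A.facet_tube p. A.foot p x \<in> {x. g0 x \<noteq> 0}} = 0"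
  using A.emeasure_tube_measure[OF T(2) Zb] by (simp add: A.tube_measure_def)
 have ZZ: "Z \<in> sets borel" unfolding Z_def using Zb A.open_facet_borel[OF T(2)] by auto
 have "hsurf Z = 0"
 proof (rule hausdorff_outer_null_of_tube[OF dim2 A.norm_fnormal[OF T(2)] ZZ])
  have "Z \<subseteq> T" using A.open_facet_subset[OF T(2)] by (auto simp: Z_def A.facet_def)
  thus "bounded Z" using compact_imp_bounded[OF A.compact_simplex_T] bounded_subset by blast
  show "Z \<subseteq> {y. ?N \<bullet> y = ?c}" using A.fnormal_le_iff(3)[OF T(2)] by (auto simp: Z_def A.open_facet_def)
  have "{x. \<bar>?N \<bullet> x - ?c\<bar> < 1/2 \<and> A.foot p x \<in> Z} = {x \<in> A.facet_tube p. A.foot p x \<in> {x. g0 x \<noteq> 0}}"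
   by (auto simp: Z_def A.facet_tube_def)
  thus "emeasure lborel {x. \<bar>?N \<bullet> x - ?c\<bar> < 1/2 \<and> A.foot p x \<in> Z} = 0" using e0 by (simp only:)
 qed
 hence "Z \<in> null_sets surface_measure" using surface_hausdorff[OF ZZ] ZZ by (simp add: null_sets_def)
 hence "AE x in surface_measure. x \<notin> Z" by (rule AE_not_in)
 thus ?thesis
 proof eventually_elim
  case (elim x)
  thus ?case using op by (auto simp: Z_def g0_def)
 qed
qed

text \<open>Traces are unique: a sequence that tends to zero in \<open>H\<^sup>1\<close> cannot have nonzero boundary values in the limit. The boundary consists of
the open facets that belong to one cell only, up to relative boundaries of facets.\<close>

lemma zero_trace:
 assumes "is_trace \<Omega> (\<lambda>x. 0) g"
 shows "AE x in area. g x = 0"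
proof -
 obtain \<phi> where g: "g \<in> L2_space area"
  and \<phi>: "\<And>n. \<phi> n \<in> H1_space \<Omega>" "\<And>n. continuous_on (closure \<Omega>) (\<phi> n)"
  and lim: "(\<lambda>n. L2_norm vol (\<phi> n)) \<longlonglongrightarrow> 0" "(\<lambda>n. H1_seminorm \<Omega> \<Omega> (\<phi> n)) \<longlonglongrightarrow> 0"
  and lg: "(\<lambda>n. L2_norm area (\<lambda>x. \<phi> n x - g x)) \<longlonglongrightarrow> 0"
  using assms unfolding is_trace_def by auto
 have fac: "AE x in surface_measure. x \<in> fct z \<longrightarrow> x \<in> frontier \<Omega> \<longrightarrow> g x = 0" if "z \<in> facets" for z
 proof -
  obtain T p where zz: "z = (T, p)" by (cases z)
  have z: "(T, p) \<in> facets" using that zz by simp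
  have T: "T \<in> \<T>" "p \<in> vertices T" using z by (auto simp: facets_def)
  interpret A: full_simplex T by (rule cell[OF T(1)])
  have "A.facet p \<in> sets borel" unfolding A.facet_hull[OF T(2)] using A.vertices_simplex(1)
   by (intro borel_compact finite_imp_compact_convex_hull) simp
  hence b: "A.facet p - A.open_facet p \<in> sets borel" using A.open_facet_borel[OF T(2)] by auto
  hence "A.facet p - A.open_facet p \<in> null_sets surface_measure"
   using facet_rel_boundary_null[OF z] surface_hausdorff[OF b] by (simp add: null_sets_def)
  hence bd: "AE x in surface_measure. x \<notin> A.facet p - A.open_facet p" by (rule AE_not_in)
  have "AE x in surface_measure. x \<in> A.open_facet p \<longrightarrow> x \<in> frontier \<Omega> \<longrightarrow> g x = 0"
  proof (cases "\<exists>T' p'. (T', p') \<in> facets \<and> full_simplex.facet T' p' = A.facet p \<and> (T', p') \<noteq> (T, p)")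
   case True
   then obtain T' p' where *: "(T', p') \<in> facets" "full_simplex.facet T' p' = A.facet p" "(T', p') \<noteq> (T, p)" by blast
   have "y \<in> \<Omega>" if "y \<in> A.open_facet p" for y
    by (rule shared_open_facet_interior[OF z *(1) *(3)[symmetric] *(2)[symmetric] that])
   thus ?thesis using interior_open[OF open_domain] by (auto simp: frontier_def)
  next
   case False
   have "A.open_facet p \<subseteq> frontier \<Omega>" using lone_facet_outward_normal(2)[OF z] False by blast
   from zero_trace_facet[OF z this \<phi> lim g lg] show ?thesis by (auto elim: AE_mp)
  qed
  with bd show ?thesis
  proof eventually_elim
   case (elim x)
   thus ?case by (auto simp: zz)
  qed
 qed
 have "AE x in surface_measure. \<forall>z\<in>facets. x \<in> fct z \<longrightarrow> x \<in> frontier \<Omega> \<longrightarrow> g x = 0"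
  by (rule AE_finite_allI[OF finite_facets fac])
 hence "AE x in surface_measure. x \<in> frontier \<Omega> \<longrightarrow> g x = 0"
 proof eventually_elim
  case (elim x)
  thus ?case using frontier_facets by blast
 qed
 thus ?thesis by (simp add: AE_surface_on[OF frontier_borel])
qed

lemma is_trace_continuous:
 assumes "v \<in> H1_space \<Omega>" "continuous_on (closure \<Omega>) v"
 shows "is_trace \<Omega> v v"
 unfolding is_trace_def
proof (intro conjI exI[of _ "\<lambda>n. v"] allI)
 show "v \<in> L2_space area" by (rule continuous_L2_surface[OF assms(2) subset_refl frontier_borel])
qed (use assms H1_seminorm_zero[OF open_domain] in \<open>simp_all add: L2_norm_def\<close>)

text \<open>The difference of a trace of \<open>v\<close> and the boundary values of \<open>v\<close> is a trace of zero.\<close>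

lemma H1D_continuous_iff:
 assumes v: "v \<in> H1_space \<Omega>" "continuous_on (closure \<Omega>) v" and \<Gamma>: "\<Gamma> \<subseteq> frontier \<Omega>" "\<Gamma> \<in> sets borel"
 shows "v \<in> H1D_space \<Omega> \<Gamma> \<longleftrightarrow> (AE x in surface_on \<Gamma>. v x = 0)"
proof
 assume "v \<in> H1D_space \<Omega> \<Gamma>"
 thus "AE x in surface_on \<Gamma>. v x = 0" using is_trace_continuous[OF v] by (simp add: H1D_space_def)
next
 assume ae: "AE x in surface_on \<Gamma>. v x = 0"
 have "AE x in surface_on \<Gamma>. w x = 0" if w: "is_trace \<Omega> v w" for w
 proof -
  obtain \<phi> where wL: "w \<in> L2_space area"
   and \<phi>: "\<And>n. \<phi> n \<in> H1_space \<Omega>" "\<And>n. continuous_on (closure \<Omega>) (\<phi> n)"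
   and lim: "(\<lambda>n. L2_norm vol (\<lambda>x. \<phi> n x - v x)) \<longlonglongrightarrow> 0" "(\<lambda>n. H1_seminorm \<Omega> \<Omega> (\<lambda>x. \<phi> n x - v x)) \<longlonglongrightarrow> 0"
   and lg: "(\<lambda>n. L2_norm area (\<lambda>x. \<phi> n x - w x)) \<longlonglongrightarrow> 0"
   using w unfolding is_trace_def by auto
  have "is_trace \<Omega> (\<lambda>x. 0) (\<lambda>x. w x - v x)"
   unfolding is_trace_def
  proof (intro conjI exI[of _ "\<lambda>n x. \<phi> n x - v x"] allI)
   show "(\<lambda>x. w x - v x) \<in> L2_space area"
    by (rule L2_space_diff[OF wL continuous_L2_surface[OF v(2) subset_refl frontier_borel]])
   show "(\<lambda>x. \<phi> n x - v x) \<in> H1_space \<Omega>" for n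
    using H1_space_comb[OF \<phi>(1) v(1) domain_lebesgue, where c = "-1"] by simp
   show "continuous_on (closure \<Omega>) (\<lambda>x. \<phi> n x - v x)" for n using \<phi>(2) v(2) by (intro continuous_intros)
  qed (use lim lg in simp_all)
  hence "AE x in area. w x - v x = 0" by (rule zero_trace)
  hence "AE x in surface_measure. x \<in> frontier \<Omega> \<longrightarrow> w x - v x = 0" by (simp add: AE_surface_on[OF frontier_borel])
  moreover have "AE x in surface_measure. x \<in> \<Gamma> \<longrightarrow> v x = 0" using ae by (simp add: AE_surface_on[OF \<Gamma>(2)])
  ultimately have "AE x in surface_measure. x \<in> \<Gamma> \<longrightarrow> w x = 0"
  proof eventually_elim
   case (elim x)
   thus ?case using \<Gamma>(1) by auto
  qed
  thus ?thesis by (simp add: AE_surface_on[OF \<Gamma>(2)])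
 qed
 thus "v \<in> H1D_space \<Omega> \<Gamma>" using v(1) is_trace_continuous[OF v] by (auto simp: H1D_space_def)
qed

end

section \<open>The discrete spaces\<close>

lemma weak_gradient_cong:
 assumes "\<And>x. x \<in> \<Omega> \<Longrightarrow> u x = v x" "weak_gradient \<Omega> u G"
 shows "weak_gradient \<Omega> v G"
 unfolding weak_gradient_def
proof (intro conjI allI impI)
 fix K assume K: "compact K \<and> K \<subseteq> \<Omega>"
 have "integrable (lebesgue_on K) u" using weak_gradientD(1)[OF assms(2)] K by blast
 thus "integrable (lebesgue_on K) v"
  by (rule Bochner_Integration.integrable_cong[OF refl, THEN iffD1, rotated]) (use K assms(1) in auto)
 show "integrable (lebesgue_on K) G" using weak_gradientD(2)[OF assms(2)] K by blast
next
 fix \<phi> D assume t: "C1_test \<Omega> \<phi> D"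
 have "(LINT x|lebesgue_on \<Omega>. v x *\<^sub>R D x) = (LINT x|lebesgue_on \<Omega>. u x *\<^sub>R D x)"
  by (rule LINT_cong) (use assms(1) in auto)
 thus "(LINT x|lebesgue_on \<Omega>. v x *\<^sub>R D x) = - (LINT x|lebesgue_on \<Omega>. \<phi> x *\<^sub>R G x)"
  using weak_gradientD(3)[OF assms(2) t] by simp
qed

lemma weak_gradient_sum:
 assumes "finite I" "\<And>i. i \<in> I \<Longrightarrow> weak_gradient \<Omega> (v i) (G i)" "\<Omega> \<in> sets lebesgue"
 shows "weak_gradient \<Omega> (\<lambda>x. \<Sum>i\<in>I. c i * v i x) (\<lambda>x. \<Sum>i\<in>I. c i *\<^sub>R G i x)"
 using assms(1,2)
proof (induction I)
 case empty thus ?case by (simp add: weak_gradient_zero assms(3))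
next
 case (insert i I)
 have "weak_gradient \<Omega> (\<lambda>x. (\<Sum>i\<in>I. c i * v i x) + c i * v i x) (\<lambda>x. (\<Sum>i\<in>I. c i *\<^sub>R G i x) + c i *\<^sub>R G i x)"
  using insert by (intro weak_gradient_comb assms(3)) auto
 thus ?case using insert by (simp add: add.commute)
qed

lemma H1_space_zero: "\<Omega> \<in> sets lebesgue \<Longrightarrow> (\<lambda>x. 0) \<in> H1_space \<Omega>"
 using weak_gradient_zero[of \<Omega>] by (auto simp: H1_space_def L2_space_def intro!: exI[of _ "\<lambda>x. 0"])

lemma H1_space_sum:
 assumes "finite I" "\<And>i. i \<in> I \<Longrightarrow> v i \<in> H1_space \<Omega>" "\<Omega> \<in> sets lebesgue"
 shows "(\<lambda>x. \<Sum>i\<in>I. c i * v i x) \<in> H1_space \<Omega>"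
 using assms(1,2)
proof (induction I)
 case empty thus ?case by (simp add: H1_space_zero assms(3))
next
 case (insert i I)
 have "(\<lambda>x. (\<Sum>i\<in>I. c i * v i x) + c i * v i x) \<in> H1_space \<Omega>"
  using insert by (intro H1_space_comb assms(3)) auto
 thus ?case using insert by (simp add: add.commute)
qed

context full_simplex begin

lemma bubble_weak_gradient: "S \<in> sets lebesgue \<Longrightarrow> weak_gradient S (bubble T) bubble_grad"
proof -
 assume S: "S \<in> sets lebesgue"
 obtain L where "L-lipschitz_on UNIV (bubble T)" using bubble_lipschitz by blast
 thus ?thesis
  by (rule weak_gradient_lipschitz[OF _ negligible_frontier_T GDERIV_bubble bubble_grad_measurable S])
qed

lemma bubble_grad_bounded: obtains B where "B > 0" "\<And>x. norm (bubble_grad x) \<le> B"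
proof -
 obtain B where B: "B > 0" "\<And>x. x \<in> T \<Longrightarrow> norm (bprod_grad x) \<le> B"
  by (rule compact_continuous_bound[OF compact_simplex_T continuous_bprod_grad]) blast
 have "norm (bubble_grad x) \<le> B" for x
  using B interior_subset[of T] by (cases "x \<in> interior T") (auto simp: bubble_grad_def)
 thus thesis using that B(1) by blast
qed

lemma bubble_continuous: "continuous_on S (bubble T)"
 using bubble_lipschitz lipschitz_on_continuous_on continuous_on_subset by blast

lemma bubble_H1: "bounded S \<Longrightarrow> S \<in> sets lebesgue \<Longrightarrow> bubble T \<in> H1_space S"
proof -
 assume S: "bounded S" "S \<in> sets lebesgue"
 have fin: "finite_measure (lebesgue_on S)"
  by (rule finite_measure_lebesgue_on) (use S bounded_set_imp_lmeasurable in blast)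
 obtain B where B: "B > 0" "\<And>x. x \<in> T \<Longrightarrow> norm (bubble T x) \<le> B"
  by (rule compact_continuous_bound[OF compact_simplex_T bubble_continuous]) blast
 have B': "norm (bubble T x) \<le> B" for x using B by (cases "x \<in> T") (auto simp: bubble_def)
 have "bubble T \<in> L2_space (lebesgue_on S)"
  by (rule bounded_imp_L2[OF _ fin, of _ B])
    (use B' continuous_imp_measurable_on_sets_lebesgue[OF bubble_continuous S(2)] in auto)
 moreover obtain B2 where B2: "B2 > 0" "\<And>x. norm (bubble_grad x) \<le> B2" by (rule bubble_grad_bounded) blast
 have "bubble_grad \<in> borel_measurable (lebesgue_on S)"
  using bubble_grad_measurable by (intro measurable_restrict_space1 measurable_completion) auto
 hence "bubble_grad \<in> L2_space (lebesgue_on S)"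
  by (rule bounded_imp_L2[OF _ fin, of _ B2]) (use B2 in auto)
 ultimately show ?thesis using bubble_weak_gradient[OF S(2)] by (auto simp: H1_space_def)
qed

text \<open>The bubble is a Lipschitz function with compact support.\<close>

lemma integral_bubble_grad: "(LINT x|lebesgue_on T. bubble_grad x) = 0"
proof -
 obtain L where L: "L-lipschitz_on UNIV (bubble T)" using bubble_lipschitz by blast
 obtain R where R: "T \<subseteq> ball 0 R" using compact_imp_bounded[OF compact_simplex_T] bounded_subset_ballD by blast
 have "T \<in> sets borel" using compact_simplex_T by (rule borel_compact)
 hence "(LINT x|lebesgue_on T. bubble_grad x) = (LINT x|lborel. bubble_grad x)"
 proof (intro integral_lebesgue_on_eq_lborel bubble_grad_measurable)
  show "bubble_grad x = 0" if "x \<notin> T" for x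
   using that interior_subset[of T] by (auto simp: bubble_grad_def indicator_def)
 qed simp
 also have "\<dots> = 0"
  by (rule integral_gradient_zero[OF L _ negligible_frontier_T GDERIV_bubble bubble_grad_measurable])
    (use R in \<open>auto simp: bubble_def\<close>)
 finally show ?thesis .
qed

lemma affine_zero:
 assumes "\<And>x. x \<in> T \<Longrightarrow> v x = a \<bullet> x + k" "\<And>p. p \<in> C \<Longrightarrow> v p = 0" "x \<in> T"
 shows "v x = 0"
proof -
 have CT: "p \<in> T" if "p \<in> C" for p using that by (simp add: vertices_def extreme_point_of_def)
 have "v x = a \<bullet> (\<Sum>p\<in>C. bary p x *\<^sub>R p) + k * (\<Sum>p\<in>C. bary p x)"
  using assms(1)[OF assms(3)] barycentric[of x] by simp
 also have "\<dots> = (\<Sum>p\<in>C. bary p x * (a \<bullet> p + k))"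
  by (simp add: inner_sum_right sum_distrib_left distrib_left sum.distrib mult.commute)
 also have "\<dots> = 0"
  by (rule sum.neutral) (use assms(1)[OF CT] assms(2) in force)
 finally show ?thesis .
qed

lemma vertex_not_interior: "p \<in> C \<Longrightarrow> p \<notin> interior T"
proof
 assume p: "p \<in> C" "p \<in> interior T"
 have "card C \<ge> 2" using vertices_simplex(3) dim_ge_2 by simp
 then obtain q where q: "q \<in> C" "q \<noteq> p"
  by (metis card_le_Suc0_iff_eq card.infinite not_less_eq_eq numeral_2_eq_2 p(1) not_numeral_le_zero)
 hence "bary q p = 0" using p(1) by (simp add: bary_vertex)
 moreover have "bary q p > 0" using p(2) q(1) interior_simplex_bary by blast
 ultimately show False by simp
qed

end

context polyhedral_domain begin

lemma wgrad_affine_cell: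
 assumes v: "v \<in> H1_space \<Omega>" and T: "T \<in> \<T>" and aff: "\<And>x. x \<in> T \<Longrightarrow> v x = a \<bullet> x + k"
 shows "AE x in lebesgue_on T. grad v x = a"
proof -
 interpret A: full_simplex T by (rule cell[OF T])
 have iL: "interior T \<in> sets lebesgue" by simp
 have 1: "weak_gradient (interior T) v (grad v)"
  by (rule weak_gradient_subset[OF H1_wgrad(2)[OF open_domain v] domain_lebesgue iL interior_cell[OF T]])
 have lip: "(norm a)-lipschitz_on UNIV (\<lambda>x. a \<bullet> x + k)"
  using Cauchy_Schwarz_ineq2[of a] by (intro lipschitz_onI) (auto simp: dist_norm simp flip: inner_diff_right)
 have "weak_gradient (interior T) (\<lambda>x. a \<bullet> x + k) (\<lambda>x. a)"
 proof (rule weak_gradient_lipschitz[OF lip, of "{}"])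
  show "GDERIV (\<lambda>x. a \<bullet> x + k) x :> a" for x
   unfolding gderiv_def by (auto intro!: derivative_eq_intros simp: inner_commute)
 qed auto
 hence 2: "weak_gradient (interior T) v (\<lambda>x. a)"
  by (rule weak_gradient_cong[rotated]) (use aff interior_subset[of T] in auto)
 have "AE x in lebesgue_on (interior T). grad v x = a" by (rule weak_gradient_unique[OF open_interior 1 2])
 moreover have "negligible (T - interior T)"
  by (rule negligible_subset[OF A.negligible_frontier_T]) (use closure_subset[of T] in \<open>auto simp: frontier_def\<close>)
 ultimately show ?thesis by (intro AE_lebesgue_on_mono[OF iL cell_lebesgue[OF T]])
qed

lemma bubble_other_cell:
 assumes "T \<in> \<T>" "T' \<in> \<T>" "T' \<noteq> T" "x \<in> T"
 shows "x \<notin> interior T'"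
 using cell_subset_imp_eq[of T' T x] cell_subset_eq[of T' T] assms by blast

lemma bubble_sum_cell:
 assumes "T \<in> \<T>" "x \<in> T"
 shows "(\<Sum>T'\<in>\<T>. c T' * bubble T' x) = c T * bubble T x"
proof -
 have "(\<Sum>T'\<in>\<T> - {T}. c T' * bubble T' x) = 0"
  by (rule sum.neutral) (use bubble_other_cell[OF assms(1) _ _ assms(2)] full_simplex.bubble_zero[OF cell] in auto)
 thus ?thesis using sum.remove[OF finite_mesh assms(1), of "\<lambda>T'. c T' * bubble T' x"] by simp
qed

lemma bubble_sum_zero:
 assumes "\<And>T. T \<in> \<T> \<Longrightarrow> x \<notin> interior T"
 shows "(\<Sum>T'\<in>\<T>. c T' * bubble T' x) = 0"
 by (rule sum.neutral) (use assms full_simplex.bubble_zero[OF cell] in auto)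

lemma bubble_space_facts:
 assumes b: "b \<in> bubble_space \<T>"
 shows "b \<in> H1_space \<Omega>" "continuous_on S b" "x \<in> frontier \<Omega> \<Longrightarrow> b x = 0" "x \<notin> closure \<Omega> \<Longrightarrow> b x = 0"
  "T \<in> \<T> \<Longrightarrow> p \<in> vertices T \<Longrightarrow> b p = 0"
proof -
 obtain c where c: "b = (\<lambda>x. \<Sum>T\<in>\<T>. c T * bubble T x)" using b by (auto simp: bubble_space_def)
 show "b \<in> H1_space \<Omega>" unfolding c
  by (rule H1_space_sum[OF finite_mesh full_simplex.bubble_H1[OF cell bounded_domain domain_lebesgue] domain_lebesgue])
 show "continuous_on S b" unfolding c
  using full_simplex.bubble_continuous[OF cell] by (intro continuous_intros) auto
 show "b x = 0" if "x \<in> frontier \<Omega>" unfolding c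
  by (rule bubble_sum_zero) (use frontier_domain_cell that in blast)
 show "b x = 0" if "x \<notin> closure \<Omega>" unfolding c
  by (rule bubble_sum_zero) (use interior_cell closure_subset that in blast)
 show "b p = 0" if T: "T \<in> \<T>" "p \<in> vertices T"
 proof -
  interpret A: full_simplex T by (rule cell[OF T(1)])
  have "p \<in> T" using T(2) by (simp add: vertices_def extreme_point_of_def)
  thus ?thesis unfolding c using bubble_sum_cell[OF T(1), of p c] A.bubble_zero[OF A.vertex_not_interior[OF T(2)]] by simp
 qed
qed

lemma bubble_space_comb:
 assumes "b \<in> bubble_space \<T>" "b' \<in> bubble_space \<T>"
 shows "(\<lambda>x. b x + k * b' x) \<in> bubble_space \<T>"
proof -
 obtain c c' where c: "b = (\<lambda>x. \<Sum>T\<in>\<T>. c T * bubble T x)" "b' = (\<lambda>x. \<Sum>T\<in>\<T>. c' T * bubble T x)"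
  using assms by (auto simp: bubble_space_def)
 have "(\<lambda>x. b x + k * b' x) = (\<lambda>x. \<Sum>T\<in>\<T>. (c T + k * c' T) * bubble T x)"
  unfolding c by (simp add: fun_eq_iff sum.distrib sum_distrib_left distrib_right mult.assoc)
 thus ?thesis unfolding bubble_space_def by (intro CollectI exI[of _ "\<lambda>T. c T + k * c' T"])
qed

lemma bubble_space_zero: "(\<lambda>x. 0) \<in> bubble_space \<T>"
 unfolding bubble_space_def by (intro CollectI exI[of _ "\<lambda>T. 0"]) simp

end

locale mixed_domain = trace_domain \<Omega> \<T> for \<Omega> :: "'a::euclidean_space set" and \<T> +
 fixes \<Gamma> :: "'a set"
 assumes \<Gamma>: "\<Gamma> \<subseteq> frontier \<Omega>" "\<Gamma> \<in> sets borel"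
begin

abbreviation "Vh \<equiv> P1D_space \<Omega> \<Gamma> \<T>"
abbreviation "Vhb \<equiv> P1bD_space \<Omega> \<Gamma> \<T>"

lemma P1D_facts:
 assumes v: "v \<in> Vh"
 shows "v \<in> H1_space \<Omega>" "continuous_on (closure \<Omega>) v" "v \<in> H1D_space \<Omega> \<Gamma>" "x \<notin> closure \<Omega> \<Longrightarrow> v x = 0"
  "T \<in> \<T> \<Longrightarrow> \<exists>a k. \<forall>x\<in>T. v x = a \<bullet> x + k"
 using v by (auto simp: P1D_space_def P1_space_def H1D_space_def)

lemma H1D_comb:
 assumes u: "u \<in> H1D_space \<Omega> \<Gamma>" "continuous_on (closure \<Omega>) u" and v: "v \<in> H1D_space \<Omega> \<Gamma>" "continuous_on (closure \<Omega>) v"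
 shows "(\<lambda>x. u x + c * v x) \<in> H1D_space \<Omega> \<Gamma>"
proof -
 have H: "u \<in> H1_space \<Omega>" "v \<in> H1_space \<Omega>" using u v by (auto simp: H1D_space_def)
 have "AE x in surface_on \<Gamma>. u x = 0" "AE x in surface_on \<Gamma>. v x = 0"
  using H1D_continuous_iff[OF H(1) u(2) \<Gamma>] H1D_continuous_iff[OF H(2) v(2) \<Gamma>] u(1) v(1) by auto
 hence "AE x in surface_on \<Gamma>. u x + c * v x = 0" by eventually_elim simp
 moreover have "continuous_on (closure \<Omega>) (\<lambda>x. u x + c * v x)" using u(2) v(2) by (intro continuous_intros)
 ultimately show ?thesis
  using H1D_continuous_iff[OF H1_space_comb[OF H domain_lebesgue, of c] _ \<Gamma>] by blast
qed

lemma P1D_subspace: "fun_space Vh"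
 unfolding fun_space_def
proof (intro conjI ballI allI)
 have z: "(\<lambda>x. 0) \<in> H1D_space \<Omega> \<Gamma>"
  using H1D_continuous_iff[OF H1_space_zero[OF domain_lebesgue] _ \<Gamma>] by simp
 thus "(\<lambda>x. 0) \<in> Vh" unfolding P1D_space_def P1_space_def
  by (auto intro!: exI[of _ "0::'a"] exI[of _ "0::real"])
 fix u v c assume u: "u \<in> Vh" and v: "v \<in> Vh"
 have "\<exists>a k. \<forall>x\<in>T. u x + c * v x = a \<bullet> x + k" if T: "T \<in> \<T>" for T
 proof -
  obtain a k a' k' where "\<forall>x\<in>T. u x = a \<bullet> x + k" "\<forall>x\<in>T. v x = a' \<bullet> x + k'"
   using P1D_facts(5)[OF u T] P1D_facts(5)[OF v T] by blast
  thus ?thesis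
   by (intro exI[of _ "a + c *\<^sub>R a'"] exI[of _ "k + c * k'"]) (simp add: inner_add_left algebra_simps)
 qed
 thus "(\<lambda>x. u x + c * v x) \<in> Vh"
  using H1D_comb[OF P1D_facts(3,2)[OF u] P1D_facts(3,2)[OF v], of c] P1D_facts(2,4)[OF u] P1D_facts(2,4)[OF v]
  unfolding P1D_space_def P1_space_def by (auto intro!: continuous_intros)
qed

lemma bubble_H1D: "b \<in> bubble_space \<T> \<Longrightarrow> b \<in> H1D_space \<Omega> \<Gamma>"
proof -
 assume b: "b \<in> bubble_space \<T>"
 have "AE x in surface_on \<Gamma>. b x = 0" by (rule AE_I2) (use bubble_space_facts(3)[OF b] \<Gamma>(1) in auto)
 thus ?thesis using H1D_continuous_iff[OF bubble_space_facts(1,2)[OF b] \<Gamma>] by simp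
qed

lemma P1bD_cases:
 assumes "v \<in> Vhb"
 obtains vh vb where "vh \<in> Vh" "vb \<in> bubble_space \<T>" "v = (\<lambda>x. vh x + vb x)"
 using assms by (auto simp: P1bD_space_def)

lemma P1bD_subspace: "fun_space Vhb"
 unfolding fun_space_def
proof (intro conjI ballI allI)
 show "(\<lambda>x. 0) \<in> Vhb" unfolding P1bD_space_def
  by (intro CollectI bexI[OF _ subspace_zero[OF P1D_subspace]] bexI[OF _ bubble_space_zero]) simp
 fix u v c assume u: "u \<in> Vhb" and v: "v \<in> Vhb"
 obtain uh ub where ud: "uh \<in> Vh" "ub \<in> bubble_space \<T>" "u = (\<lambda>x. uh x + ub x)" using P1bD_cases[OF u] by blast
 obtain vh vb where vd: "vh \<in> Vh" "vb \<in> bubble_space \<T>" "v = (\<lambda>x. vh x + vb x)" using P1bD_cases[OF v] by blast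
 show "(\<lambda>x. u x + c * v x) \<in> Vhb" unfolding P1bD_space_def
  by (intro CollectI bexI[OF _ subspace_comb[OF P1D_subspace ud(1) vd(1), of c]] bexI[OF _ bubble_space_comb[OF ud(2) vd(2), of c]])
    (simp add: ud(3) vd(3) algebra_simps)
qed

lemma P1bD_facts:
 assumes v: "v \<in> Vhb"
 shows "v \<in> H1_space \<Omega>" "continuous_on (closure \<Omega>) v" "v \<in> H1D_space \<Omega> \<Gamma>"
proof -
 obtain vh vb where d: "vh \<in> Vh" "vb \<in> bubble_space \<T>" "v = (\<lambda>x. vh x + vb x)" using P1bD_cases[OF v] by blast
 show "continuous_on (closure \<Omega>) v" unfolding d(3)
  by (intro continuous_intros P1D_facts(2)[OF d(1)] bubble_space_facts(2)[OF d(2)])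
 show "v \<in> H1D_space \<Omega> \<Gamma>"
  using H1D_comb[OF P1D_facts(3,2)[OF d(1)] bubble_H1D[OF d(2)] bubble_space_facts(2)[OF d(2)], of 1] d(3) by simp
 thus "v \<in> H1_space \<Omega>" by (simp add: H1D_space_def)
qed

lemma P1D_zero:
 assumes v: "v \<in> Vh" and z: "\<And>T p. T \<in> \<T> \<Longrightarrow> p \<in> vertices T \<Longrightarrow> v p = 0"
 shows "v = (\<lambda>x. 0)"
proof
 fix x show "v x = 0"
 proof (cases "x \<in> closure \<Omega>")
  case True
  then obtain T where T: "T \<in> \<T>" "x \<in> T" using Union_mesh by auto
  interpret A: full_simplex T by (rule cell[OF T(1)])
  obtain a k where ak: "\<forall>x\<in>T. v x = a \<bullet> x + k" using P1D_facts(5)[OF v T(1)] by blast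
  show ?thesis by (rule A.affine_zero[of v a k x]) (use ak z[OF T(1)] T(2) in auto)
 qed (use P1D_facts(4)[OF v] in blast)
qed

text \<open>Bubbles vanish at the vertices, so the piecewise linear part of a function is determined by its values there.\<close>

lemma kappa_eq:
 assumes vh: "vh \<in> Vh" and vb: "vb \<in> bubble_space \<T>"
 shows "kappa \<Omega> \<Gamma> \<T> (\<lambda>x. vh x + vb x) = vh"
 unfolding kappa_def
proof (rule the_equality)
 show "vh \<in> Vh \<and> (\<exists>w\<^sub>b\<in>bubble_space \<T>. (\<lambda>x. vh x + vb x) = (\<lambda>x. vh x + w\<^sub>b x))" using assms by blast
 fix w assume "w \<in> Vh \<and> (\<exists>w\<^sub>b\<in>bubble_space \<T>. (\<lambda>x. vh x + vb x) = (\<lambda>x. w x + w\<^sub>b x))"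
 then obtain wb where w: "w \<in> Vh" "wb \<in> bubble_space \<T>" "(\<lambda>x. vh x + vb x) = (\<lambda>x. w x + wb x)" by blast
 have "(\<lambda>x. w x - vh x) = (\<lambda>x. 0)"
 proof (rule P1D_zero[OF subspace_diff[OF P1D_subspace w(1) vh]])
  fix T p assume "T \<in> \<T>" "p \<in> vertices T"
  thus "w p - vh p = 0"
   using fun_cong[OF w(3), of p] bubble_space_facts(5)[OF vb] bubble_space_facts(5)[OF w(2)] by simp
 qed
 thus "w = vh" by (simp add: fun_eq_iff)
qed

lemma kappa_in: "v \<in> Vhb \<Longrightarrow> kappa \<Omega> \<Gamma> \<T> v \<in> Vh"
 using P1bD_cases kappa_eq by metis

lemma kappa_diff:
 assumes "u \<in> Vhb" "v \<in> Vhb"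
 shows "kappa \<Omega> \<Gamma> \<T> (\<lambda>x. u x - v x) = (\<lambda>x. kappa \<Omega> \<Gamma> \<T> u x - kappa \<Omega> \<Gamma> \<T> v x)"
proof -
 obtain uh ub where ud: "uh \<in> Vh" "ub \<in> bubble_space \<T>" "u = (\<lambda>x. uh x + ub x)" using P1bD_cases[OF assms(1)] by blast
 obtain vh vb where vd: "vh \<in> Vh" "vb \<in> bubble_space \<T>" "v = (\<lambda>x. vh x + vb x)" using P1bD_cases[OF assms(2)] by blast
 have "kappa \<Omega> \<Gamma> \<T> (\<lambda>x. (uh x - vh x) + (ub x - vb x)) = (\<lambda>x. uh x - vh x)"
  using kappa_eq[OF subspace_diff[OF P1D_subspace ud(1) vd(1)] bubble_space_comb[OF ud(2) vd(2), of "-1"]] by simp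
 thus ?thesis unfolding ud(3) vd(3) kappa_eq[OF ud(1,2)] kappa_eq[OF vd(1,2)] by (simp add: algebra_simps)
qed

definition nodes :: "'a set" where
 "nodes = (\<Union>T\<in>\<T>. vertices T \<union> {full_simplex.center T})"

lemma finite_nodes: "finite nodes"
 unfolding nodes_def using finite_mesh full_simplex.vertices_simplex(1)[OF cell] by auto

text \<open>The values at the vertices determine the piecewise linear part, and then the values at the centers determine the bubble coefficients.\<close>

lemma nodes_determine: "determined_by nodes Vhb"
 unfolding determined_by_def
proof (intro ballI impI)
 fix v assume v: "v \<in> Vhb" and z: "\<forall>x\<in>nodes. v x = 0"
 obtain vh vb where d: "vh \<in> Vh" "vb \<in> bubble_space \<T>" "v = (\<lambda>x. vh x + vb x)" using P1bD_cases[OF v] by blast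
 have "vh = (\<lambda>x. 0)"
 proof (rule P1D_zero[OF d(1)])
  fix T p assume T: "T \<in> \<T>" "p \<in> vertices T"
  hence "p \<in> nodes" by (auto simp: nodes_def)
  hence "vh p + vb p = 0" using z unfolding d(3) by blast
  thus "vh p = 0" using bubble_space_facts(5)[OF d(2) T] by simp
 qed
 hence vb: "v = vb" using d(3) by simp
 obtain c where c: "vb = (\<lambda>x. \<Sum>T\<in>\<T>. c T * bubble T x)" using d(2) by (auto simp: bubble_space_def)
 have "c T = 0" if T: "T \<in> \<T>" for T
 proof -
  interpret A: full_simplex T by (rule cell[OF T])
  have cT: "A.center \<in> T" using A.center_interior interior_subset by blast
  have "A.center \<in> nodes" using T by (auto simp: nodes_def)
  hence "c T * bubble T A.center = 0" using z vb c bubble_sum_cell[OF T cT, of c] by simp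
  thus ?thesis using A.bubble_pos[OF A.center_interior] by simp
 qed
 thus "v = (\<lambda>x. 0)" using vb c by simp
qed

lemma P1bD_cell_gradient:
 assumes vh: "vh \<in> Vh" and vb: "vb \<in> bubble_space \<T>" and T: "T \<in> \<T>"
 obtains a k c where "\<And>x. x \<in> T \<Longrightarrow> vh x = a \<bullet> x + k" "\<And>x. x \<in> T \<Longrightarrow> vb x = c * bubble T x"
  "AE x in lebesgue_on T. grad vh x = a"
  "AE x in lebesgue_on T. grad (\<lambda>x. vh x + vb x) x = a + c *\<^sub>R full_simplex.bubble_grad T x"
proof -
 interpret A: full_simplex T by (rule cell[OF T])
 obtain a k where ak: "\<forall>x\<in>T. vh x = a \<bullet> x + k" using P1D_facts(5)[OF vh T] by blast
 have 1: "AE x in lebesgue_on T. grad vh x = a" by (rule wgrad_affine_cell[OF P1D_facts(1)[OF vh] T]) (use ak in blast)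
 obtain c where c: "vb = (\<lambda>x. \<Sum>T\<in>\<T>. c T * bubble T x)" using vb by (auto simp: bubble_space_def)
 have sum: "weak_gradient \<Omega> vb (\<lambda>x. \<Sum>T\<in>\<T>. c T *\<^sub>R full_simplex.bubble_grad T x)"
  unfolding c using full_simplex.bubble_weak_gradient[OF cell domain_lebesgue]
  by (intro weak_gradient_sum[OF finite_mesh _ domain_lebesgue])
 have 2: "AE x in lebesgue_on T. grad vb x = (\<Sum>T\<in>\<T>. c T *\<^sub>R full_simplex.bubble_grad T x)"
  by (rule AE_lebesgue_on_mono[OF domain_lebesgue cell_lebesgue[OF T] negligible_cell_diff[OF T] wgrad_eq[OF open_domain sum]])
 have 3: "(\<Sum>T'\<in>\<T>. c T' *\<^sub>R full_simplex.bubble_grad T' x) = c T *\<^sub>R A.bubble_grad x" if x: "x \<in> T" for x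
 proof -
  have "(\<Sum>T'\<in>\<T> - {T}. c T' *\<^sub>R full_simplex.bubble_grad T' x) = 0"
  proof (rule sum.neutral, rule ballI)
   fix T' assume T': "T' \<in> \<T> - {T}"
   interpret B: full_simplex T' by (rule cell) (use T' in simp)
   have "x \<notin> interior T'" using bubble_other_cell[OF T _ _ x, of T'] T' by auto
   thus "c T' *\<^sub>R B.bubble_grad x = 0" by (simp add: B.bubble_grad_def)
  qed
  thus ?thesis using sum.remove[OF finite_mesh T, of "\<lambda>T'. c T' *\<^sub>R full_simplex.bubble_grad T' x"] by simp
 qed
 have 4: "AE x in lebesgue_on T. grad (\<lambda>x. vh x + 1 * vb x) x = grad vh x + 1 *\<^sub>R grad vb x"
  by (rule AE_lebesgue_on_mono[OF domain_lebesgue cell_lebesgue[OF T] negligible_cell_diff[OF T]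
    wgrad_comb[OF open_domain P1D_facts(1)[OF vh] bubble_space_facts(1)[OF vb]]])
 have "AE x in lebesgue_on T. grad (\<lambda>x. vh x + vb x) x = a + c T *\<^sub>R A.bubble_grad x"
  using 1 2 4 AE_space
 proof eventually_elim
  case (elim x)
  hence "x \<in> T" using cell_lebesgue[OF T] by (simp add: space_restrict_space)
  thus ?case using elim 3[of x] by simp
 qed
 moreover have "vb x = c T * bubble T x" if "x \<in> T" for x unfolding c by (rule bubble_sum_cell[OF T that])
 ultimately show thesis using that[of a k "c T"] ak 1 by blast
qed

text \<open>On a cell the gradient of the piecewise linear part is constant, and the gradient of a bubble has mean value zero; the two
are orthogonal.\<close>

lemma kappa_seminorm_le:
 assumes v: "v \<in> Vhb" and T: "T \<in> \<T>"
 shows "H1_seminorm \<Omega> T (kappa \<Omega> \<Gamma> \<T> v) \<le> H1_seminorm \<Omega> T v"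
proof -
 interpret A: full_simplex T by (rule cell[OF T])
 let ?M = "lebesgue_on T"
 obtain vh vb where d: "vh \<in> Vh" "vb \<in> bubble_space \<T>" "v = (\<lambda>x. vh x + vb x)" using P1bD_cases[OF v] by blast
 obtain a k c where g: "AE x in ?M. grad vh x = a" "AE x in ?M. grad v x = a + c *\<^sub>R A.bubble_grad x"
  unfolding d(3) by (rule P1bD_cell_gradient[OF d(1,2) T]) blast
 have k: "kappa \<Omega> \<Gamma> \<T> v = vh" unfolding d(3) by (rule kappa_eq[OF d(1,2)])
 have fin: "finite_measure ?M" by (rule finite_measure_cell[OF T])
 have meas: "grad u \<in> borel_measurable ?M" if "u \<in> H1_space \<Omega>" for u
  using L2_space_cell[OF H1_wgrad(1)[OF open_domain that] T] by (simp add: L2_space_def)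
 have bm: "A.bubble_grad \<in> borel_measurable ?M"
  using A.bubble_grad_measurable by (intro measurable_restrict_space1 measurable_completion) auto
 obtain B where B: "B > 0" "\<And>x. norm (A.bubble_grad x) \<le> B" by (rule A.bubble_grad_bounded) blast
 have bL: "A.bubble_grad \<in> L2_space ?M" by (rule bounded_imp_L2[OF bm fin, of B]) (use B in auto)
 have aL: "(\<lambda>x. a) \<in> L2_space ?M" by (rule bounded_imp_L2[OF _ fin, of _ "norm a"]) auto
 have sL: "(\<lambda>x. a + c *\<^sub>R A.bubble_grad x) \<in> L2_space ?M" by (rule L2_space_comb[OF aL bL])
 have n1: "(norm a)\<^sup>2 * measure ?M T = (H1_seminorm \<Omega> T vh)\<^sup>2"
 proof -
  have "H1_seminorm \<Omega> T vh = L2_norm ?M (\<lambda>x. a)"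
   unfolding H1_seminorm_def by (rule L2_norm_cong_AE[OF meas[OF P1D_facts(1)[OF d(1)]] _ g(1)]) simp
  thus ?thesis by (simp add: L2_norm_square)
 qed
 have n2: "H1_seminorm \<Omega> T v = L2_norm ?M (\<lambda>x. a + c *\<^sub>R A.bubble_grad x)"
  unfolding H1_seminorm_def using sL
  by (intro L2_norm_cong_AE[OF meas[OF P1bD_facts(1)[OF v]] _ g(2)]) (simp add: L2_space_def)
 have i1: "integrable ?M A.bubble_grad" by (rule L2_integrable_finite[OF bL fin])
 have i2: "integrable ?M (\<lambda>x. (norm (A.bubble_grad x))\<^sup>2)" using bL by (simp add: L2_space_def)
 have i0: "integrable ?M (\<lambda>x. (norm a)\<^sup>2)" using finite_measure.integrable_const[OF fin] .
 have "(LINT x|?M. (norm (a + c *\<^sub>R A.bubble_grad x))\<^sup>2)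
   = (LINT x|?M. (norm a)\<^sup>2) + 2 * c * (LINT x|?M. a \<bullet> A.bubble_grad x) + c\<^sup>2 * (LINT x|?M. (norm (A.bubble_grad x))\<^sup>2)"
  unfolding norm_comb_square using i0 i1 i2 by simp
 also have "(LINT x|?M. a \<bullet> A.bubble_grad x) = 0" using i1 A.integral_bubble_grad by simp
 finally have "(H1_seminorm \<Omega> T v)\<^sup>2 = (H1_seminorm \<Omega> T vh)\<^sup>2 + c\<^sup>2 * (LINT x|?M. (norm (A.bubble_grad x))\<^sup>2)"
  unfolding n2 L2_norm_square using n1 by (simp add: mult.commute)
 moreover have "(LINT x|?M. (norm (A.bubble_grad x))\<^sup>2) \<ge> 0" by simp
 ultimately have "(H1_seminorm \<Omega> T vh)\<^sup>2 \<le> (H1_seminorm \<Omega> T v)\<^sup>2" by simp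
 hence "H1_seminorm \<Omega> T vh \<le> H1_seminorm \<Omega> T v"
  by (rule power2_le_imp_le) (simp add: H1_seminorm_def)
 thus ?thesis by (simp add: k)
qed

end

section \<open>Coercivity\<close>

lemma flux_cong: "(\<And>y. y \<in> F \<Longrightarrow> q y = q' y) \<Longrightarrow> flux F n c q = flux F n c q'"
 unfolding flux_def by (intro LINT_cong refl) (auto simp: indicator_def)

lemma W1inf_wgrad:
 assumes "open \<Omega>" "v \<in> W1inf_space \<Omega>"
 shows "wgrad \<Omega> v \<in> Linf_space (lebesgue_on \<Omega>)" "weak_gradient \<Omega> v (wgrad \<Omega> v)"
proof -
 obtain G C where G: "G \<in> borel_measurable (lebesgue_on \<Omega>)" "AE x in lebesgue_on \<Omega>. norm (G x) \<le> C" "weak_gradient \<Omega> v G"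
  using assms(2) by (auto simp: W1inf_space_def Linf_space_def)
 have eq: "AE x in lebesgue_on \<Omega>. wgrad \<Omega> v x = G x" by (rule wgrad_eq[OF assms(1) G(3)])
 have "wgrad \<Omega> v \<in> borel_measurable (lebesgue_on \<Omega>)"
  by (rule AE_eq_measurable_lebesgue_on[OF _ G(1) eq]) (use assms in auto)
 moreover have "AE x in lebesgue_on \<Omega>. norm (wgrad \<Omega> v x) \<le> C" using eq G(2) by eventually_elim simp
 ultimately show "wgrad \<Omega> v \<in> Linf_space (lebesgue_on \<Omega>)" by (auto simp: Linf_space_def)
 show "weak_gradient \<Omega> v (wgrad \<Omega> v)" by (rule weak_gradient_wgrad[OF G(3)])
qed

lemma Linf_integrable:
 fixes f :: "'x \<Rightarrow> 'b::euclidean_space"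
 assumes "f \<in> Linf_space M" "finite_measure M"
 shows "integrable M f"
 using assms by (auto simp: Linf_space_def intro: finite_measure.integrable_const_bound)

lemma integrable_Linf_mult:
 fixes f :: "'x \<Rightarrow> real"
 assumes s: "s \<in> Linf_space M" and f: "integrable M f"
 shows "integrable M (\<lambda>x. s x * f x)"
proof -
 obtain C where C: "AE x in M. norm (s x) \<le> C" and m: "s \<in> borel_measurable M" using s by (auto simp: Linf_space_def)
 show ?thesis
 proof (rule integrable_dominated)
  show "integrable M (\<lambda>x. C * f x)" using f by simp
  show "(\<lambda>x. s x * f x) \<in> borel_measurable M" using m f by auto
  show "AE x in M. norm (s x * f x) \<le> norm (C * f x)"
   using C by eventually_elim (auto simp: abs_mult intro!: mult_right_mono)
 qed
qed

lemma L2_Linf_scale: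
 fixes f :: "'x \<Rightarrow> real" and s :: "'x \<Rightarrow> real"
 assumes "s \<in> Linf_space M" "f \<in> L2_space M"
 shows "(\<lambda>x. s x * f x) \<in> L2_space M"
proof -
 obtain C where C: "AE x in M. norm (s x) \<le> C" and m: "s \<in> borel_measurable M" using assms by (auto simp: Linf_space_def)
 show ?thesis
 proof (rule L2_space_bound[OF _ assms(2)])
  show "(\<lambda>x. s x * f x) \<in> borel_measurable M" using m assms(2) by (auto simp: L2_space_def)
  show "AE x in M. norm (s x * f x) \<le> C * norm (f x)"
   using C by eventually_elim (auto simp: abs_mult intro!: mult_right_mono)
 qed
qed

lemma L2_Linf_inner:
 fixes f :: "'x \<Rightarrow> 'b::euclidean_space" and s :: "'x \<Rightarrow> 'b"
 assumes "s \<in> Linf_space M" "f \<in> L2_space M"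
 shows "(\<lambda>x. s x \<bullet> f x) \<in> L2_space M"
proof -
 obtain C where C: "AE x in M. norm (s x) \<le> C" and m: "s \<in> borel_measurable M" using assms by (auto simp: Linf_space_def)
 show ?thesis
 proof (rule L2_space_bound[OF _ assms(2)])
  show "(\<lambda>x. s x \<bullet> f x) \<in> borel_measurable M" using m assms(2) by (auto simp: L2_space_def)
  show "AE x in M. norm (s x \<bullet> f x) \<le> C * norm (f x)"
   using C
  proof eventually_elim
   case (elim x)
   have "norm (s x \<bullet> f x) \<le> norm (s x) * norm (f x)" unfolding real_norm_def by (rule Cauchy_Schwarz_ineq2)
   also have "\<dots> \<le> C * norm (f x)" using elim by (intro mult_right_mono) auto
   finally show ?case .
  qed
 qed
qed

context full_simplex begin

lemma open_facet_disc:
 assumes p: "p \<in> C" and y: "y \<in> open_facet p"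
 obtains r where "r > 0" "\<And>x. fnormal p \<bullet> x = foffset p \<Longrightarrow> dist x y < r \<Longrightarrow> x \<in> open_facet p"
proof -
 have "open (\<Inter>q\<in>C - {p}. {x. 0 < bary q x})"
 proof (rule open_INT)
  show "finite (C - {p})" using vertices_simplex(1) by simp
  show "\<forall>q\<in>C - {p}. open {x. 0 < bary q x}"
   using continuous_bary by (intro ballI open_Collect_less continuous_on_const) auto
 qed
 moreover have "y \<in> (\<Inter>q\<in>C - {p}. {x. 0 < bary q x})" using y by (auto simp: open_facet_def)
 ultimately obtain r where r: "r > 0" "ball y r \<subseteq> (\<Inter>q\<in>C - {p}. {x. 0 < bary q x})" by (meson openE)
 have "x \<in> open_facet p" if x: "fnormal p \<bullet> x = foffset p" "dist x y < r" for x
 proof -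
  have "bary p x = 0" using x(1) fnormal_le_iff(3)[OF p] by simp
  moreover have "x \<in> ball y r" using x(2) by (simp add: dist_commute)
  ultimately show ?thesis using r(2) unfolding open_facet_def by blast
 qed
 thus thesis using that r(1) by blast
qed

end

context mixed_domain begin

lemma finite_measure_domain: "finite_measure vol"
 by (rule finite_measure_lebesgue_on) (use bounded_domain domain_lebesgue bounded_set_imp_lmeasurable in blast)

lemma continuous_Linf:
 fixes v :: "'a \<Rightarrow> 'b::euclidean_space"
 assumes v: "continuous_on (closure \<Omega>) v"
 shows "v \<in> Linf_space vol"
proof -
 obtain B where B: "B > 0" "\<And>x. x \<in> closure \<Omega> \<Longrightarrow> norm (v x) \<le> B"
  by (rule compact_continuous_bound[OF compact_closure_domain v]) blast
 have "v \<in> borel_measurable vol"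
  by (rule continuous_imp_measurable_on_sets_lebesgue[OF continuous_on_subset[OF v closure_subset] domain_lebesgue])
 moreover have "AE x in vol. norm (v x) \<le> B"
  by (rule AE_I2) (use B(2) closure_subset[of \<Omega>] domain_lebesgue in \<open>auto simp: space_restrict_space\<close>)
 ultimately show ?thesis by (auto simp: Linf_space_def)
qed

text \<open>The square of this polynomial is the test function of the divergence theorem below.\<close>

lemma P1bD_cell_polynomial:
 assumes v: "v \<in> Vhb" and T: "T \<in> \<T>"
 obtains p Dp where "\<And>x. GDERIV p x :> Dp x" "continuous_on UNIV Dp" "\<And>x. x \<in> T \<Longrightarrow> v x = p x"
  "AE x in lebesgue_on T. grad v x = Dp x"
proof -
 interpret A: full_simplex T by (rule cell[OF T])
 obtain vh vb where d: "vh \<in> Vh" "vb \<in> bubble_space \<T>" "v = (\<lambda>x. vh x + vb x)" using P1bD_cases[OF v] by blast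
 obtain a k c where vh: "\<And>x. x \<in> T \<Longrightarrow> vh x = a \<bullet> x + k" and vb: "\<And>x. x \<in> T \<Longrightarrow> vb x = c * bubble T x"
  and g: "AE x in lebesgue_on T. grad v x = a + c *\<^sub>R A.bubble_grad x"
  unfolding d(3) by (rule P1bD_cell_gradient[OF d(1,2) T]) blast
 define p where "p x = a \<bullet> x + k + c * A.bprod x" for x
 define Dp where "Dp x = a + c *\<^sub>R A.bprod_grad x" for x
 have D: "GDERIV p x :> Dp x" for x
  using A.GDERIV_bprod[of x] unfolding gderiv_def p_def Dp_def
  by (auto intro!: derivative_eq_intros simp: inner_add_right inner_commute)
 have cD: "continuous_on S Dp" for S unfolding Dp_def by (intro continuous_intros A.continuous_bprod_grad)
 have eq: "v x = p x" if "x \<in> T" for x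
  using that vh vb unfolding d(3) p_def by (simp add: A.bubble_eq)
 have "AE x in lebesgue. x \<notin> frontier T"
  using A.negligible_frontier_T by (intro AE_not_in) (simp add: negligible_iff_null_sets)
 hence "AE x in lebesgue. x \<in> T \<longrightarrow> x \<in> interior T"
  by eventually_elim (use closure_subset[of T] in \<open>auto simp: frontier_def\<close>)
 hence "AE x in lebesgue_on T. x \<in> interior T"
  using cell_lebesgue[OF T] by (simp add: AE_restrict_space_iff)
 with g have "AE x in lebesgue_on T. grad v x = Dp x"
  by eventually_elim (simp add: Dp_def A.bubble_grad_def)
 thus thesis using that[of p Dp] D cD eq by blast
qed

text \<open>Where the flux density is negative at a point of a boundary facet, it is so on a disc in the facet. By the inflow condition the disc belongs to the Dirichlet
boundary, on which \<open>v\<close> vanishes almost everywhere; but a disc has positive measure.\<close>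

lemma boundary_inflow_nonneg:
 assumes \<beta>: "continuous_on (closure \<Omega>) \<beta>" and inflow: "{x \<in> frontier \<Omega>. \<exists>\<nu>. outward_normal \<Omega> x \<nu> \<and> \<beta> x \<bullet> \<nu> < 0} \<subseteq> \<Gamma>"
  and v: "v \<in> Vhb"
 shows "0 \<le> (\<Sum>T\<in>\<T>. \<Sum>p\<in>vertices T. facet_flux T p (\<lambda>x. (v x)\<^sup>2 *\<^sub>R \<beta> x))"
proof (rule boundary_flux_nonneg)
 show "continuous_on (closure \<Omega>) (\<lambda>x. (v x)\<^sup>2 *\<^sub>R \<beta> x)" using \<beta> P1bD_facts(2)[OF v] by (intro continuous_intros)
 fix T p y assume z: "(T, p) \<in> facets"
  and out: "\<forall>x\<in>ofacet T p. x \<in> frontier \<Omega> \<and> outward_normal \<Omega> x (full_simplex.fnormal T p)"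
  and y: "y \<in> ofacet T p"
 have T: "T \<in> \<T>" "p \<in> vertices T" using z by (auto simp: facets_def)
 interpret A: full_simplex T by (rule cell[OF T(1)])
 let ?N = "A.fnormal p" and ?c = "A.foffset p"
 show "0 \<le> ((v y)\<^sup>2 *\<^sub>R \<beta> y) \<bullet> ?N"
 proof (rule ccontr)
  assume "\<not> ?thesis"
  hence neg: "v y \<noteq> 0" "\<beta> y \<bullet> ?N < 0" by (auto simp: not_le mult_less_0_iff)
  have yc: "y \<in> closure \<Omega>" using out y by (auto simp: frontier_def)
  obtain r1 where r1: "r1 > 0" "\<And>x. ?N \<bullet> x = ?c \<Longrightarrow> dist x y < r1 \<Longrightarrow> x \<in> A.open_facet p"
   by (rule A.open_facet_disc[OF T(2) y]) blast
  define h where "h x = min \<bar>v x\<bar> (- (\<beta> x \<bullet> ?N))" for x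
  have ch: "continuous_on (closure \<Omega>) h" unfolding h_def using \<beta> P1bD_facts(2)[OF v] by (intro continuous_intros)
  have hy: "h y > 0" using neg by (simp add: h_def)
  obtain r2 where r2: "r2 > 0" "\<And>x. x \<in> closure \<Omega> \<Longrightarrow> dist x y < r2 \<Longrightarrow> dist (h x) (h y) < h y"
   using ch yc hy unfolding continuous_on_iff by blast
  define r where "r = min r1 r2"
  have r: "r > 0" using r1 r2 by (simp add: r_def)
  let ?D = "{x. ?N \<bullet> x = ?c \<and> dist x y < r}"
  have Dprop: "x \<in> \<Gamma> \<and> v x \<noteq> 0" if x: "x \<in> ?D" for x
  proof -
   have xo: "x \<in> A.open_facet p" using x r1(2) by (simp add: r_def)
   hence xf: "x \<in> frontier \<Omega>" "outward_normal \<Omega> x ?N" using out by auto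
   hence "x \<in> closure \<Omega>" by (simp add: frontier_def)
   hence "h x > 0" using r2(2)[of x] x by (auto simp: r_def dist_real_def)
   hence "v x \<noteq> 0" "\<beta> x \<bullet> ?N < 0" by (auto simp: h_def)
   thus ?thesis using xf inflow by blast
  qed
  have Db: "?D \<in> sets borel"
  proof -
   have "?D = {x. ?N \<bullet> x = ?c} \<inter> ball y r" by (auto simp: dist_commute)
   moreover have "closed {x. ?N \<bullet> x = ?c}" by (rule closed_hyperplane)
   ultimately show ?thesis by (simp add: borel_closed sets.Int)
  qed
  have "AE x in surface_on \<Gamma>. v x = 0"
   using H1D_continuous_iff[OF P1bD_facts(1,2)[OF v] \<Gamma>] P1bD_facts(3)[OF v] by simp
  hence "AE x in surface_measure. x \<in> \<Gamma> \<longrightarrow> v x = 0" by (simp add: AE_surface_on[OF \<Gamma>(2)])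
  hence "AE x in surface_measure. x \<notin> ?D"
  proof eventually_elim
   case (elim x) thus ?case using Dprop[of x] by blast
  qed
  hence "emeasure surface_measure ?D = 0"
   using Db by (subst (asm) AE_iff_measurable[of ?D]) auto
  hence "hsurf ?D = 0" using surface_hausdorff[OF Db] by simp
  moreover have "hsurf ?D > 0"
  proof (rule hausdorff_outer_plane_pos[OF dim2 A.norm_fnormal[OF T(2)] _ r subset_refl])
   show "?N \<bullet> y = ?c" using y A.fnormal_le_iff(3)[OF T(2)] by (simp add: A.open_facet_def)
  qed
  ultimately show False by simp
 qed
qed

lemma wdiv_Linf:
 assumes \<beta>: "\<forall>b\<in>Basis. (\<lambda>x. \<beta> x \<bullet> b) \<in> W1inf_space \<Omega>"
 shows "wdiv \<Omega> \<beta> \<in> Linf_space vol"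
proof -
 define G where "G b = grad (\<lambda>y. \<beta> y \<bullet> b)" for b
 have G: "G b \<in> Linf_space vol" if "b \<in> Basis" for b
  unfolding G_def using W1inf_wgrad(1)[OF open_domain] \<beta> that by blast
 hence "\<forall>b\<in>Basis. \<exists>C. AE x in vol. norm (G b x) \<le> C" by (auto simp: Linf_space_def)
 then obtain C where "\<forall>b\<in>Basis. AE x in vol. norm (G b x) \<le> C b" by metis
 hence "AE x in vol. \<forall>b\<in>Basis. norm (G b x) \<le> C b" by (intro AE_finite_allI) auto
 hence "AE x in vol. norm (wdiv \<Omega> \<beta> x) \<le> (\<Sum>b\<in>Basis. C b)"
 proof eventually_elim
  case (elim x)
  have "\<bar>\<Sum>b\<in>Basis. G b x \<bullet> b\<bar> \<le> (\<Sum>b\<in>Basis. \<bar>G b x \<bullet> b\<bar>)" by (rule sum_abs)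
  also have "\<dots> \<le> (\<Sum>b\<in>Basis. C b)"
   by (rule sum_mono) (use elim Basis_le_norm order_trans in blast)
  finally show ?case by (simp add: wdiv_def G_def)
 qed
 moreover have "wdiv \<Omega> \<beta> \<in> borel_measurable vol"
  unfolding wdiv_def[abs_def] G_def[symmetric] using G
  by (intro borel_measurable_sum borel_measurable_inner) (auto simp: Linf_space_def)
 ultimately show ?thesis by (auto simp: Linf_space_def)
qed

text \<open>The integrated form of \<open>(\<beta> \<bullet> \<nabla>v) v = 1/2 (div (\<beta> v\<^sup>2) - v\<^sup>2 div \<beta>)\<close>. The divergence theorem is applied cell by cell, as \<open>v\<^sup>2\<close> is smooth
only there.\<close>

lemma transport_nonneg:
 assumes \<beta>: "\<forall>b\<in>Basis. (\<lambda>x. \<beta> x \<bullet> b) \<in> W1inf_space \<Omega>" "continuous_on (closure \<Omega>) \<beta>"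
  and inflow: "{x \<in> frontier \<Omega>. \<exists>\<nu>. outward_normal \<Omega> x \<nu> \<and> \<beta> x \<bullet> \<nu> < 0} \<subseteq> \<Gamma>"
  and v: "v \<in> Vhb"
 shows "0 \<le> 2 * (LINT x|vol. (\<beta> x \<bullet> grad v x) * v x) + (LINT x|vol. wdiv \<Omega> \<beta> x * (v x)\<^sup>2)"
proof -
 have vL: "v \<in> L2_space vol" using P1bD_facts(1)[OF v] by (simp add: H1_space_def)
 have gL: "grad v \<in> L2_space vol" by (rule H1_wgrad(1)[OF open_domain P1bD_facts(1)[OF v]])
 have bgL: "(\<lambda>x. \<beta> x \<bullet> grad v x) \<in> L2_space vol"
  by (rule L2_Linf_inner[OF continuous_Linf[OF \<beta>(2)] gL])
 have i1: "integrable vol (\<lambda>x. (\<beta> x \<bullet> grad v x) * v x)"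
  using L2_inner_integrable[OF bgL vL] by simp
 have i2: "integrable vol (\<lambda>x. wdiv \<Omega> \<beta> x * (v x)\<^sup>2)"
  by (rule integrable_Linf_mult[OF wdiv_Linf[OF \<beta>(1)]]) (use vL in \<open>simp add: L2_space_def\<close>)
 have cell_id: "2 * (LINT x|lebesgue_on T. (\<beta> x \<bullet> grad v x) * v x) + (LINT x|lebesgue_on T. wdiv \<Omega> \<beta> x * (v x)\<^sup>2)
  = (\<Sum>p\<in>vertices T. facet_flux T p (\<lambda>x. (v x)\<^sup>2 *\<^sub>R \<beta> x))"
  if T: "T \<in> \<T>" for T
 proof -
  interpret A: full_simplex T by (rule cell[OF T])
  interpret P: polytope "vertices T" A.fnormal A.foffset T by (rule A.simplex_polytope)
  obtain p Dp where p: "\<And>x. GDERIV p x :> Dp x" "continuous_on UNIV Dp" "\<And>x. x \<in> T \<Longrightarrow> v x = p x"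
   "AE x in lebesgue_on T. grad v x = Dp x" by (rule P1bD_cell_polynomial[OF v T]) blast
  have cp: "continuous_on UNIV p"
   by (rule GDERIV_continuous[OF p(1)])
  have D: "GDERIV (\<lambda>x. (p x)\<^sup>2) x :> (2 * p x) *\<^sub>R Dp x" for x
   using GDERIV_mult[OF p(1)[of x] p(1)[of x]] by (simp only: power2_eq_square scaleR_left_distrib mult_2)
  have cD: "continuous_on UNIV (\<lambda>x. (2 * p x) *\<^sub>R Dp x)" by (intro continuous_intros cp p(2))
  have sub: "{x. \<forall>i\<in>vertices T. A.fnormal i \<bullet> x < A.foffset i} \<subseteq> \<Omega>"
   using A.fnormal_le_iff(2) A.interior_simplex_bary interior_cell[OF T] by blast
  have G: "integrable (lebesgue_on T) (grad (\<lambda>x. \<beta> x \<bullet> b))" if "b \<in> Basis" for b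
   by (rule integrable_lebesgue_on_mono[OF domain_lebesgue cell_lebesgue[OF T] negligible_cell_diff[OF T]
      Linf_integrable[OF W1inf_wgrad(1)[OF open_domain] finite_measure_domain]]) (use \<beta>(1) that in blast)
  have "(LINT x|lebesgue_on T. \<beta> x \<bullet> ((2 * p x) *\<^sub>R Dp x)) + (LINT x|lebesgue_on T. (p x)\<^sup>2 * (\<Sum>b\<in>Basis. grad (\<lambda>y. \<beta> y \<bullet> b) x \<bullet> b))
   = (\<Sum>q\<in>vertices T. flux {y\<in>T. A.fnormal q \<bullet> y = A.foffset q} (A.fnormal q) (A.foffset q) (\<lambda>x. (p x)\<^sup>2 *\<^sub>R \<beta> x))"
   by (rule P.divergence_theorem[OF domain_lebesgue sub continuous_on_subset[OF \<beta>(2) cell_subset[OF T]] _ G D cD])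
     (use W1inf_wgrad(2)[OF open_domain] \<beta>(1) in blast)
  also have "\<dots> = (\<Sum>q\<in>vertices T. flux (A.facet q) (A.fnormal q) (A.foffset q) (\<lambda>x. (v x)\<^sup>2 *\<^sub>R \<beta> x))"
  proof (rule sum.cong[OF refl])
   fix q assume q: "q \<in> vertices T"
   have "{y\<in>T. A.fnormal q \<bullet> y = A.foffset q} = A.facet q" using A.fnormal_le_iff(3)[OF q] by (auto simp: A.facet_def)
   thus "flux {y\<in>T. A.fnormal q \<bullet> y = A.foffset q} (A.fnormal q) (A.foffset q) (\<lambda>x. (p x)\<^sup>2 *\<^sub>R \<beta> x)
    = flux (A.facet q) (A.fnormal q) (A.foffset q) (\<lambda>x. (v x)\<^sup>2 *\<^sub>R \<beta> x)"
    by (simp only:) (rule flux_cong, use p(3) in \<open>simp add: A.facet_def\<close>)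
  qed
  also have "(LINT x|lebesgue_on T. \<beta> x \<bullet> ((2 * p x) *\<^sub>R Dp x)) = 2 * (LINT x|lebesgue_on T. (\<beta> x \<bullet> grad v x) * v x)"
  proof -
   have m1: "(\<lambda>x. (\<beta> x \<bullet> grad v x) * v x) \<in> borel_measurable (lebesgue_on T)"
    using measurable_lebesgue_on_mono[OF domain_lebesgue cell_lebesgue[OF T] negligible_cell_diff[OF T] borel_measurable_integrable[OF i1]] .
   have m2: "(\<lambda>x. \<beta> x \<bullet> ((2 * p x) *\<^sub>R Dp x)) \<in> borel_measurable (lebesgue_on T)"
    by (rule continuous_imp_measurable_on_sets_lebesgue[OF _ cell_lebesgue[OF T]])
      (intro continuous_intros continuous_on_subset[OF \<beta>(2) cell_subset[OF T]] continuous_on_subset[OF cD] continuous_on_subset[OF cp] continuous_on_subset[OF p(2)] subset_UNIV)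
   have "(LINT x|lebesgue_on T. \<beta> x \<bullet> ((2 * p x) *\<^sub>R Dp x)) = (LINT x|lebesgue_on T. 2 * ((\<beta> x \<bullet> grad v x) * v x))"
   proof (rule integral_cong_AE[OF m2])
    show "(\<lambda>x. 2 * ((\<beta> x \<bullet> grad v x) * v x)) \<in> borel_measurable (lebesgue_on T)" using m1 by simp
    show "AE x in lebesgue_on T. \<beta> x \<bullet> ((2 * p x) *\<^sub>R Dp x) = 2 * ((\<beta> x \<bullet> grad v x) * v x)"
     using p(4) AE_space
    proof eventually_elim
     case (elim x)
     hence "x \<in> T" using cell_lebesgue[OF T] by (simp add: space_restrict_space)
     thus ?case using elim p(3)[of x] by simp
    qed
   qed
   thus ?thesis by simp
  qed
  also have "(LINT x|lebesgue_on T. (p x)\<^sup>2 * (\<Sum>b\<in>Basis. grad (\<lambda>y. \<beta> y \<bullet> b) x \<bullet> b)) = (LINT x|lebesgue_on T. wdiv \<Omega> \<beta> x * (v x)\<^sup>2)"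
   by (rule LINT_cong[OF refl])
     (use p(3) cell_lebesgue[OF T] in \<open>simp add: space_restrict_space wdiv_def mult.commute\<close>)
  finally show ?thesis .
 qed
 have "2 * (LINT x|vol. (\<beta> x \<bullet> grad v x) * v x) + (LINT x|vol. wdiv \<Omega> \<beta> x * (v x)\<^sup>2)
  = (\<Sum>T\<in>\<T>. 2 * (LINT x|lebesgue_on T. (\<beta> x \<bullet> grad v x) * v x) + (LINT x|lebesgue_on T. wdiv \<Omega> \<beta> x * (v x)\<^sup>2))"
  unfolding integral_domain_sum[OF i1] integral_domain_sum[OF i2] by (simp add: sum.distrib sum_distrib_left)
 also have "\<dots> = (\<Sum>T\<in>\<T>. \<Sum>p\<in>vertices T. facet_flux T p (\<lambda>x. (v x)\<^sup>2 *\<^sub>R \<beta> x))"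
  by (rule sum.cong[OF refl cell_id])
 finally show ?thesis using boundary_inflow_nonneg[OF \<beta>(2) inflow v] by simp
qed

lemma bilinear_B_coercive:
 assumes \<beta>: "\<forall>b\<in>Basis. (\<lambda>x. \<beta> x \<bullet> b) \<in> W1inf_space \<Omega>" "continuous_on (closure \<Omega>) \<beta>"
  and inflow: "{x \<in> frontier \<Omega>. \<exists>\<nu>. outward_normal \<Omega> x \<nu> \<and> \<beta> x \<bullet> \<nu> < 0} \<subseteq> \<Gamma>"
  and \<sigma>: "\<sigma> \<in> Linf_space vol" "AE x in vol. \<sigma> x - wdiv \<Omega> \<beta> x / 2 \<ge> \<gamma>"
  and v: "v \<in> Vhb"
 shows "\<epsilon> * (H1_seminorm \<Omega> \<Omega> v)\<^sup>2 + \<gamma> * (L2_norm vol v)\<^sup>2 \<le> bilinear_B \<Omega> \<epsilon> \<beta> \<sigma> v v"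
proof -
 have vL: "v \<in> L2_space vol" using P1bD_facts(1)[OF v] by (simp add: H1_space_def)
 have vi: "integrable vol (\<lambda>x. (v x)\<^sup>2)" using vL by (simp add: L2_space_def)
 have i1: "integrable vol (\<lambda>x. \<sigma> x * (v x)\<^sup>2)" by (rule integrable_Linf_mult[OF \<sigma>(1) vi])
 have i2: "integrable vol (\<lambda>x. wdiv \<Omega> \<beta> x * (v x)\<^sup>2)" by (rule integrable_Linf_mult[OF wdiv_Linf[OF \<beta>(1)] vi])
 have "\<gamma> * (LINT x|vol. (v x)\<^sup>2) = (LINT x|vol. \<gamma> * (v x)\<^sup>2)" by simp
 also have "\<dots> \<le> (LINT x|vol. \<sigma> x * (v x)\<^sup>2 - wdiv \<Omega> \<beta> x * (v x)\<^sup>2 / 2)"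
 proof (rule integral_mono_AE)
  show "AE x in vol. \<gamma> * (v x)\<^sup>2 \<le> \<sigma> x * (v x)\<^sup>2 - wdiv \<Omega> \<beta> x * (v x)\<^sup>2 / 2"
   using \<sigma>(2)
  proof eventually_elim
   case (elim x)
   have "\<gamma> * (v x)\<^sup>2 \<le> (\<sigma> x - wdiv \<Omega> \<beta> x / 2) * (v x)\<^sup>2" by (rule mult_right_mono[OF elim]) simp
   thus ?case by (simp add: left_diff_distrib)
  qed
 qed (use vi i1 i2 in auto)
 also have "\<dots> = (LINT x|vol. \<sigma> x * (v x)\<^sup>2) - (LINT x|vol. wdiv \<Omega> \<beta> x * (v x)\<^sup>2) / 2"
  using i1 i2 by simp
 also have "\<dots> \<le> (LINT x|vol. \<sigma> x * (v x)\<^sup>2) + (LINT x|vol. (\<beta> x \<bullet> grad v x) * v x)"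
  using transport_nonneg[OF \<beta> inflow v] by simp
 finally have "\<gamma> * (LINT x|vol. (v x)\<^sup>2) \<le> (LINT x|vol. \<sigma> x * (v x)\<^sup>2) + (LINT x|vol. (\<beta> x \<bullet> grad v x) * v x)" .
 moreover have "(H1_seminorm \<Omega> \<Omega> v)\<^sup>2 = (LINT x|vol. grad v x \<bullet> grad v x)"
  by (simp add: H1_seminorm_def L2_norm_square power2_norm_eq_inner)
 moreover have "(L2_norm vol v)\<^sup>2 = (LINT x|vol. (v x)\<^sup>2)" by (simp add: L2_norm_square)
 moreover have "(LINT x|vol. \<sigma> x * v x * v x) = (LINT x|vol. \<sigma> x * (v x)\<^sup>2)"
  by (simp add: power2_eq_square mult.assoc)
 ultimately show ?thesis by (simp add: bilinear_B_def)
qed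

end

section \<open>The fixed point argument\<close>

lemma Linf_norm_le:
 fixes f :: "'x \<Rightarrow> 'b::real_normed_vector"
 assumes f: "f \<in> borel_measurable M" and le: "AE x in M. norm (f x) \<le> C" and C: "0 \<le> C"
 shows "Linf_norm M f \<le> C"
proof -
 have "esssup M (\<lambda>x. ereal (norm (f x))) \<le> ereal C"
  by (rule esssup_I) (use le f in auto)
 thus ?thesis unfolding Linf_norm_def using C
  by (cases "esssup M (\<lambda>x. ereal (norm (f x)))") auto
qed

lemma Hhalf_norm_sq_scale_le:
 fixes A :: "'a::euclidean_space set"
 assumes fin: "finite_measure (surface_on A)" and w: "w \<in> borel_measurable (surface_on A)" and k: "0 \<le> k"
 shows "Hhalf_norm_sq A (\<lambda>x. k * w x) = ennreal (k\<^sup>2) * Hhalf_norm_sq A w"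
proof -
 let ?M = "surface_on A"
 interpret finite_measure ?M by (rule fin)
 have id: "(\<lambda>x. x) \<in> ?M \<rightarrow>\<^sub>M borel"
  unfolding surface_on_def by (intro measurable_restrict_space1) (simp cong: measurable_cong_sets)
 define Q where "Q x y = (w x - w y)\<^sup>2 / norm (x - y) ^ DIM('a)" for x y
 have fm: "(\<lambda>z. w (fst z)) \<in> borel_measurable (?M \<Otimes>\<^sub>M ?M)" "(\<lambda>z. w (snd z)) \<in> borel_measurable (?M \<Otimes>\<^sub>M ?M)"
  "(\<lambda>z. fst z) \<in> borel_measurable (?M \<Otimes>\<^sub>M ?M)" "(\<lambda>z. snd z) \<in> borel_measurable (?M \<Otimes>\<^sub>M ?M)"
  using measurable_compose[OF measurable_fst w] measurable_compose[OF measurable_snd w]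
   measurable_compose[OF measurable_fst id] measurable_compose[OF measurable_snd id] by auto
 have Qm: "(\<lambda>z. ennreal (Q (fst z) (snd z))) \<in> borel_measurable (?M \<Otimes>\<^sub>M ?M)"
  unfolding Q_def using fm by measurable
 have Qy: "(\<lambda>y. ennreal (Q x y)) \<in> borel_measurable ?M" if "x \<in> space ?M" for x
  using measurable_compose_Pair1[OF that Qm] by simp
 have Qi: "(\<lambda>x. \<integral>\<^sup>+y. ennreal (Q x y) \<partial>?M) \<in> borel_measurable ?M"
  using borel_measurable_nn_integral_fst[OF Qm] by simp
 have kQ: "ennreal ((k * w x - k * w y)\<^sup>2 / norm (x - y) ^ DIM('a)) = ennreal (k\<^sup>2) * ennreal (Q x y)" for x y
 proof -
  have eq: "(k * w x - k * w y)\<^sup>2 / norm (x - y) ^ DIM('a) = k\<^sup>2 * Q x y"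
   unfolding Q_def right_diff_distrib[symmetric] power_mult_distrib by simp
  show ?thesis unfolding eq by (rule ennreal_mult') simp
 qed
 have 1: "(\<integral>\<^sup>+x. ennreal ((k * w x)\<^sup>2) \<partial>?M) = ennreal (k\<^sup>2) * (\<integral>\<^sup>+x. ennreal ((w x)\<^sup>2) \<partial>?M)"
  using w by (simp add: power_mult_distrib ennreal_mult nn_integral_cmult)
 have 2: "(\<integral>\<^sup>+x. (\<integral>\<^sup>+y. ennreal ((k * w x - k * w y)\<^sup>2 / norm (x - y) ^ DIM('a)) \<partial>?M) \<partial>?M)
  = ennreal (k\<^sup>2) * (\<integral>\<^sup>+x. (\<integral>\<^sup>+y. ennreal (Q x y) \<partial>?M) \<partial>?M)"
 proof -
  have "(\<integral>\<^sup>+x. (\<integral>\<^sup>+y. ennreal ((k * w x - k * w y)\<^sup>2 / norm (x - y) ^ DIM('a)) \<partial>?M) \<partial>?M)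
   = (\<integral>\<^sup>+x. ennreal (k\<^sup>2) * (\<integral>\<^sup>+y. ennreal (Q x y) \<partial>?M) \<partial>?M)"
   unfolding kQ by (intro nn_integral_cong nn_integral_cmult Qy)
  also have "\<dots> = ennreal (k\<^sup>2) * (\<integral>\<^sup>+x. (\<integral>\<^sup>+y. ennreal (Q x y) \<partial>?M) \<partial>?M)"
   by (rule nn_integral_cmult[OF Qi])
  finally show ?thesis .
 qed
 show ?thesis unfolding Hhalf_norm_sq_def 1 2 unfolding Q_def by (simp add: distrib_left)
qed

text \<open>The supremum is over a bounded set because the \<open>H\<^sup>1\<^sup>/\<^sup>2\<close> norm dominates the \<open>L\<^sup>2\<close> norm. The estimate is then a matter of
scaling; if the norm of \<open>w\<close> is zero, all multiples of \<open>w\<close> are admissible.\<close>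

lemma Hhalf_dual_norm_bound:
 fixes A :: "'a::euclidean_space set"
 assumes fin: "finite_measure (surface_on A)" and g: "g \<in> L2_space (surface_on A)" and w: "w \<in> Hhalf_space A"
 shows "\<bar>\<integral>x. g x * w x \<partial>surface_on A\<bar> \<le> Hhalf_dual_norm A g * Hhalf_norm A w" "Hhalf_dual_norm A g \<ge> 0"
proof -
 let ?M = "surface_on A" and ?U = "{w \<in> Hhalf_space A. Hhalf_norm A w \<le> 1}"
 let ?G = "Hhalf_dual_norm A g" and ?I = "\<bar>\<integral>x. g x * w x \<partial>surface_on A\<bar>"
 have bd: "\<bar>\<integral>x. g x * v x \<partial>?M\<bar> \<le> L2_norm ?M g" if v: "v \<in> ?U" for v
 proof -
  have vm: "v \<in> borel_measurable ?M" and vf: "Hhalf_norm_sq A v < \<infinity>" using v by (auto simp: Hhalf_space_def)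
  have le: "(\<integral>\<^sup>+x. ennreal ((v x)\<^sup>2) \<partial>?M) \<le> Hhalf_norm_sq A v" by (simp add: Hhalf_norm_sq_def)
  have "integrable ?M (\<lambda>x. (v x)\<^sup>2)"
   by (rule integrableI_nonneg) (use vm le vf in \<open>auto intro: le_less_trans\<close>)
  hence vL: "v \<in> L2_space ?M" and vi: "integrable ?M (\<lambda>x. (v x)\<^sup>2)" using vm by (auto simp: L2_space_def)
  have "ennreal (LINT x|?M. (v x)\<^sup>2) \<le> Hhalf_norm_sq A v" using le nn_integral_eq_integral[OF vi] by simp
  hence "(LINT x|?M. (v x)\<^sup>2) \<le> enn2real (Hhalf_norm_sq A v)"
   using vf by (metis enn2real_ennreal enn2real_mono infinity_ennreal_def integral_nonneg_AE AE_I2 zero_le_power2)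
  hence "L2_norm ?M v \<le> Hhalf_norm A v" by (simp add: L2_norm_def Hhalf_norm_def)
  hence v1: "L2_norm ?M v \<le> 1" using v by simp
  have "\<bar>\<integral>x. g x * v x \<partial>?M\<bar> \<le> L2_norm ?M g * L2_norm ?M v" using L2_cauchy_schwarz[OF g vL] by simp
  also have "\<dots> \<le> L2_norm ?M g * 1" by (rule mult_left_mono[OF v1]) simp
  finally show ?thesis by simp
 qed
 have bdd: "bdd_above ((\<lambda>v. \<bar>\<integral>x. g x * v x \<partial>?M\<bar>) ` ?U)" using bd by (intro bdd_aboveI2)
 have up: "\<bar>\<integral>x. g x * v x \<partial>?M\<bar> \<le> ?G" if "v \<in> ?U" for v
  unfolding Hhalf_dual_norm_def by (rule cSUP_upper[OF that bdd])
 have wm: "w \<in> borel_measurable ?M" and wf: "Hhalf_norm_sq A w < \<infinity>" using w by (auto simp: Hhalf_space_def)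
 have scale: "k * ?I \<le> ?G" if k: "0 \<le> k" "k * Hhalf_norm A w \<le> 1" for k
 proof -
  have sq: "Hhalf_norm_sq A (\<lambda>x. k * w x) = ennreal (k\<^sup>2) * Hhalf_norm_sq A w"
   by (rule Hhalf_norm_sq_scale_le[OF fin wm k(1)])
  have "Hhalf_norm A (\<lambda>x. k * w x) = k * Hhalf_norm A w"
   unfolding Hhalf_norm_def sq using k(1) by (simp add: enn2real_mult real_sqrt_mult)
  moreover have "Hhalf_norm_sq A (\<lambda>x. k * w x) < \<infinity>"
   unfolding sq using wf by (simp add: ennreal_mult_less_top)
  ultimately have "(\<lambda>x. k * w x) \<in> ?U" using wm k(2) by (auto simp: Hhalf_space_def)
  hence "\<bar>\<integral>x. g x * (k * w x) \<partial>?M\<bar> \<le> ?G" by (rule up)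
  moreover have "(LINT x|?M. g x * (k * w x)) = k * (LINT x|?M. g x * w x)"
   by (simp add: mult.left_commute)
  ultimately show ?thesis using k(1) by (simp add: abs_mult)
 qed
 show G0: "?G \<ge> 0" using scale[of 0] by simp
 show "?I \<le> ?G * Hhalf_norm A w"
 proof (cases "Hhalf_norm A w = 0")
  case True
  have "?I = 0"
  proof (rule ccontr)
   assume "?I \<noteq> 0"
   hence "?I > 0" by simp
   hence "(?G + 1) / ?I * ?I \<le> ?G" using scale[of "(?G + 1) / ?I"] True G0 by (simp add: divide_nonneg_nonneg)
   thus False using \<open>?I > 0\<close> by simp
  qed
  thus ?thesis using True by simp
 next
  case False
  moreover have "Hhalf_norm A w \<ge> 0" by (simp add: Hhalf_norm_def)
  ultimately have pos: "Hhalf_norm A w > 0" by simp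
  hence "1 / Hhalf_norm A w * ?I \<le> ?G" by (intro scale) auto
  thus ?thesis using pos by (simp add: field_simps)
 qed
qed

lemma linear_add_functions:
 "linear_form V L \<Longrightarrow> linear_form V M \<Longrightarrow> linear_form V (\<lambda>v. L v + M v)"
 by (simp add: linear_form_def algebra_simps)

lemma bilinear_scale: "bilinear_form V a \<Longrightarrow> bilinear_form V (\<lambda>u v. k * a u v)"
 unfolding bilinear_form_def linear_form_def by (simp add: algebra_simps)

lemma bilinear_add:
 "bilinear_form V a \<Longrightarrow> bilinear_form V b \<Longrightarrow> bilinear_form V (\<lambda>u v. a u v + b u v)"
 unfolding bilinear_form_def linear_form_def by (simp add: algebra_simps)

lemma bilinear_sum:
 "(\<And>i. i \<in> I \<Longrightarrow> bilinear_form V (a i)) \<Longrightarrow> bilinear_form V (\<lambda>u v. \<Sum>i\<in>I. a i u v)"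
 unfolding bilinear_form_def linear_form_def by (simp add: sum.distrib sum_distrib_left)

lemma L2_inner_comb:
 fixes u v w z :: "'x \<Rightarrow> 'b::euclidean_space"
 assumes L: "u \<in> L2_space M" "v \<in> L2_space M" "w \<in> L2_space M"
  and z: "z \<in> borel_measurable M" "AE x in M. z x = u x + c *\<^sub>R v x"
 shows "(LINT x|M. z x \<bullet> w x) = (LINT x|M. u x \<bullet> w x) + c * (LINT x|M. v x \<bullet> w x)"
proof -
 have wm: "w \<in> borel_measurable M" "u \<in> borel_measurable M" "v \<in> borel_measurable M" using L by (auto simp: L2_space_def)
 have "(LINT x|M. z x \<bullet> w x) = (LINT x|M. (u x \<bullet> w x) + c * (v x \<bullet> w x))"
 proof (rule integral_cong_AE)
  show "AE x in M. z x \<bullet> w x = u x \<bullet> w x + c * (v x \<bullet> w x)" using z(2) by eventually_elim (simp add: inner_add_left)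
 qed (use z(1) wm in auto)
 also have "\<dots> = (LINT x|M. u x \<bullet> w x) + c * (LINT x|M. v x \<bullet> w x)"
  using L2_inner_integrable[OF L(1,3)] L2_inner_integrable[OF L(2,3)] by simp
 finally show ?thesis .
qed

text \<open>The forms of the scheme are \<open>L\<^sup>2\<close> products of two operators that are linear only almost everywhere, since a weak gradient is a
chosen representative.\<close>

lemma bilinear_from_L2:
 fixes P :: "('x \<Rightarrow> real) \<Rightarrow> 'y \<Rightarrow> 'b::euclidean_space"
 assumes V: "fun_space V"
  and P: "\<And>v. v \<in> V \<Longrightarrow> P v \<in> L2_space M" "\<And>u v c. u \<in> V \<Longrightarrow> v \<in> V \<Longrightarrow> AE x in M. P (\<lambda>x. u x + c * v x) x = P u x + c *\<^sub>R P v x"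
  and Q: "\<And>v. v \<in> V \<Longrightarrow> Q v \<in> L2_space M" "\<And>u v c. u \<in> V \<Longrightarrow> v \<in> V \<Longrightarrow> AE x in M. Q (\<lambda>x. u x + c * v x) x = Q u x + c *\<^sub>R Q v x"
 shows "bilinear_form V (\<lambda>u v. \<integral>x. P u x \<bullet> Q v x \<partial>M)"
 unfolding bilinear_form_def linear_form_def
proof (intro conjI ballI allI)
 fix u v w c assume u: "u \<in> V" and v: "v \<in> V" and w: "w \<in> V"
 have m: "P (\<lambda>x. v x + c * w x) \<in> borel_measurable M" "Q (\<lambda>x. v x + c * w x) \<in> borel_measurable M"
  using P(1)[OF subspace_comb[OF V v w]] Q(1)[OF subspace_comb[OF V v w]] by (auto simp: L2_space_def)
 show "(LINT x|M. P (\<lambda>x. v x + c * w x) x \<bullet> Q u x) = (LINT x|M. P v x \<bullet> Q u x) + c * (LINT x|M. P w x \<bullet> Q u x)"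
  by (rule L2_inner_comb[OF P(1)[OF v] P(1)[OF w] Q(1)[OF u] m(1) P(2)[OF v w]])
 show "(LINT x|M. P u x \<bullet> Q (\<lambda>x. v x + c * w x) x) = (LINT x|M. P u x \<bullet> Q v x) + c * (LINT x|M. P u x \<bullet> Q w x)"
  using L2_inner_comb[OF Q(1)[OF v] Q(1)[OF w] P(1)[OF u] m(2) Q(2)[OF v w]] by (simp only: inner_commute[of "P u _"])
qed

text \<open>The smallness condition enters only as the hypothesis of \<open>unique_solution\<close>.\<close>

locale dd_scheme = mixed_domain \<Omega> \<T> \<Gamma> for \<Omega> :: "'a::euclidean_space set" and \<T> \<Gamma> +
 fixes \<Gamma>\<^sub>N :: "'a set" and \<epsilon> \<gamma> c\<^sub>\<sigma> c\<^sub>0 c\<^sub>1 c\<^sub>3 :: real and \<beta> :: "'a \<Rightarrow> 'a" and \<sigma> f g :: "'a \<Rightarrow> real"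
 assumes \<Gamma>N: "\<Gamma>\<^sub>N \<subseteq> frontier \<Omega>" "\<Gamma>\<^sub>N \<in> sets borel"
  and eps: "\<epsilon> > 0"
  and beta: "\<forall>b\<in>Basis. (\<lambda>x. \<beta> x \<bullet> b) \<in> W1inf_space \<Omega>" "continuous_on (closure \<Omega>) \<beta>"
  and sigma: "\<sigma> \<in> Linf_space vol"
  and f: "f \<in> L2_space vol" and g: "g \<in> L2_space (surface_on \<Gamma>\<^sub>N)"
  and inflow: "{x \<in> frontier \<Omega>. \<exists>\<nu>. outward_normal \<Omega> x \<nu> \<and> \<beta> x \<bullet> \<nu> < 0} \<subseteq> \<Gamma>"
  and gamma: "\<gamma> \<ge> 0" "AE x in vol. \<sigma> x - wdiv \<Omega> \<beta> x / 2 \<ge> \<gamma>"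
   "Linf_norm vol \<sigma> \<le> c\<^sub>\<sigma> * \<gamma>"
  and c0: "c\<^sub>0 > 0" "\<forall>v\<in>H1D_space \<Omega> \<Gamma>. L2_norm vol v \<le> c\<^sub>0 * H1_seminorm \<Omega> \<Omega> v"
  and c1: "\<forall>v\<^sub>h\<in>P1D_space \<Omega> \<Gamma> \<T>. \<forall>v\<^sub>b\<in>bubble_space \<T>. \<forall>T\<in>\<T>.
     L2_norm (lebesgue_on T) v\<^sub>h \<le> c\<^sub>1 * L2_norm (lebesgue_on T) (\<lambda>x. v\<^sub>h x + v\<^sub>b x)"
  and c3: "c\<^sub>3 > 0" "\<forall>v\<in>H1D_space \<Omega> \<Gamma>. \<forall>w. is_trace \<Omega> v w \<longrightarrow>
     w \<in> Hhalf_space \<Gamma>\<^sub>N \<and> Hhalf_norm \<Gamma>\<^sub>N w \<le> c\<^sub>3 * H1_seminorm \<Omega> \<Omega> v"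
begin

abbreviation "\<kappa> \<equiv> kappa \<Omega> \<Gamma> \<T>"
abbreviation "\<xi> \<equiv> xi \<Omega> \<epsilon> \<beta> \<sigma> f"
abbreviation "res \<equiv> residual \<Omega> \<beta> \<sigma> f"
abbreviation "Asc \<equiv> A_scale \<Omega> \<beta> \<sigma>"
abbreviation "M3T \<equiv> M3 \<epsilon> \<gamma> \<beta> \<sigma>"
abbreviation "M4T \<equiv> M4_loc \<epsilon> \<gamma> \<beta> \<sigma> f c\<^sub>1"
abbreviation "sn \<equiv> H1_seminorm \<Omega>"

definition energy :: "('a \<Rightarrow> real) \<Rightarrow> ('a \<Rightarrow> real) \<Rightarrow> real" where
 "energy u v = \<epsilon> * (LINT x|vol. grad u x \<bullet> grad v x) + \<gamma> * (LINT x|vol. u x \<bullet> v x)"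

definition load :: "('a \<Rightarrow> real) \<Rightarrow> real" where
 "load v = (LINT x|vol. f x * v x) + (LINT x|surface_on \<Gamma>\<^sub>N. g x * v x)"

abbreviation "form \<equiv> DD_form \<Omega> \<Gamma> \<T> \<epsilon> \<beta> \<sigma> f"
abbreviation "art \<equiv> \<lambda>T w. \<xi> T (\<kappa> w)"

lemma L2_facts:
 assumes "v \<in> H1_space \<Omega>"
 shows "v \<in> L2_space vol" "grad v \<in> L2_space vol"
  "T \<in> \<T> \<Longrightarrow> v \<in> L2_space (lebesgue_on T)" "T \<in> \<T> \<Longrightarrow> grad v \<in> L2_space (lebesgue_on T)"
 using H1_wgrad(1)[OF open_domain assms] assms L2_space_cell by (auto simp: H1_space_def)

lemma wgrad_comb_cell:
 assumes "u \<in> H1_space \<Omega>" "v \<in> H1_space \<Omega>" "T \<in> \<T>"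
 shows "AE x in lebesgue_on T. grad (\<lambda>x. u x + c * v x) x = grad u x + c *\<^sub>R grad v x"
 by (rule AE_lebesgue_on_mono[OF domain_lebesgue cell_lebesgue[OF assms(3)] negligible_cell_diff[OF assms(3)]
    wgrad_comb[OF open_domain assms(1,2)]])

lemmas Vhb_L2 = L2_facts[OF P1bD_facts(1)]

lemma load_linear: "linear_form Vhb load"
 unfolding load_def
proof (rule linear_add_functions)
 show "linear_form Vhb (\<lambda>v. \<integral>x. f x * v x \<partial>vol)"
  unfolding linear_form_def
  using L2_inner_integrable[OF f Vhb_L2(1)] by (simp add: distrib_left mult.left_commute)
 have "integrable (surface_on \<Gamma>\<^sub>N) (\<lambda>x. g x * v x)" if "v \<in> Vhb" for v
  using L2_inner_integrable[OF g continuous_L2_surface[OF P1bD_facts(2)[OF that] \<Gamma>N]] by simp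
 thus "linear_form Vhb (\<lambda>v. \<integral>x. g x * v x \<partial>surface_on \<Gamma>\<^sub>N)"
  unfolding linear_form_def by (simp add: distrib_left mult.left_commute)
qed

lemma grad_bilinear: "bilinear_form Vhb (\<lambda>u v. \<integral>x. grad u x \<bullet> grad v x \<partial>vol)"
 by (rule bilinear_from_L2[OF P1bD_subspace]) (use Vhb_L2 wgrad_comb[OF open_domain] P1bD_facts(1) in auto)

lemma grad_bilinear_cell: "T \<in> \<T> \<Longrightarrow> bilinear_form Vhb (\<lambda>u v. \<integral>x. grad u x \<bullet> grad v x \<partial>lebesgue_on T)"
 by (rule bilinear_from_L2[OF P1bD_subspace]) (use Vhb_L2 wgrad_comb_cell P1bD_facts(1) in auto)

lemma energy_bilinear: "bilinear_form Vhb energy"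
 unfolding energy_def[abs_def]
 by (intro bilinear_add bilinear_scale grad_bilinear bilinear_from_L2[OF P1bD_subspace]) (use Vhb_L2 in auto)

lemma beta_Linf: "\<beta> \<in> Linf_space vol" by (rule continuous_Linf[OF beta(2)])

lemma form_bilinear: "bilinear_form Vhb (form w)"
proof -
 have bg: "(\<lambda>x. \<beta> x \<bullet> grad v x) \<in> L2_space vol" if "v \<in> Vhb" for v
  by (rule L2_Linf_inner[OF beta_Linf Vhb_L2(2)[OF that]])
 have sv: "(\<lambda>x. \<sigma> x * v x) \<in> L2_space vol" if "v \<in> Vhb" for v
  by (rule L2_Linf_scale[OF sigma Vhb_L2(1)[OF that]])
 have "bilinear_form Vhb (\<lambda>u v. \<integral>x. (\<beta> x \<bullet> grad u x) \<bullet> v x \<partial>vol)"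
 proof (rule bilinear_from_L2[OF P1bD_subspace bg])
  fix u v c assume uv: "u \<in> Vhb" "v \<in> Vhb"
  show "AE x in vol. \<beta> x \<bullet> grad (\<lambda>x. u x + c * v x) x = \<beta> x \<bullet> grad u x + c *\<^sub>R (\<beta> x \<bullet> grad v x)"
   using wgrad_comb[OF open_domain P1bD_facts(1)[OF uv(1)] P1bD_facts(1)[OF uv(2)], of c]
   by eventually_elim (simp add: inner_add_right)
 qed (use Vhb_L2 in auto)
 moreover have "bilinear_form Vhb (\<lambda>u v. \<integral>x. (\<sigma> x * u x) \<bullet> v x \<partial>vol)"
  by (rule bilinear_from_L2[OF P1bD_subspace sv]) (use Vhb_L2 in \<open>auto simp: algebra_simps\<close>)
 moreover have "bilinear_form Vhb (\<lambda>u v. \<Sum>T\<in>\<T>. art T w * (LINT x|lebesgue_on T. grad u x \<bullet> grad v x))"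
  by (intro bilinear_sum bilinear_scale grad_bilinear_cell)
 ultimately have "bilinear_form Vhb (\<lambda>u v. \<epsilon> * (LINT x|vol. grad u x \<bullet> grad v x)
   + (LINT x|vol. (\<beta> x \<bullet> grad u x) \<bullet> v x) + (LINT x|vol. (\<sigma> x * u x) \<bullet> v x)
   + (\<Sum>T\<in>\<T>. art T w * (LINT x|lebesgue_on T. grad u x \<bullet> grad v x)))"
  by (intro bilinear_add bilinear_scale grad_bilinear)
 thus ?thesis by (simp add: DD_form_def[abs_def] bilinear_B_def[abs_def] DD_term_def[abs_def])
qed

lemma energy_self: "energy v v = \<epsilon> * (sn \<Omega> v)\<^sup>2 + \<gamma> * (L2_norm vol v)\<^sup>2"
proof -
 have "(sn \<Omega> v)\<^sup>2 = (LINT x|vol. grad v x \<bullet> grad v x)"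
  by (simp add: H1_seminorm_def L2_norm_square power2_norm_eq_inner)
 moreover have "(L2_norm vol v)\<^sup>2 = (LINT x|vol. v x \<bullet> v x)"
  by (simp only: L2_norm_square power2_norm_eq_inner)
 ultimately show ?thesis by (simp only: energy_def)
qed

lemma energy_nonneg: "energy v v \<ge> 0"
 unfolding energy_self using eps gamma(1) by simp

lemma energy_commute: "energy u v = energy v u"
 by (simp add: energy_def inner_commute mult.commute)

text \<open>If the gradient vanishes, so does the function, by the Poincare inequality; almost everywhere at first, and by continuity at all nodes.\<close>

lemma energy_pos:
 assumes v: "v \<in> Vhb" "v \<noteq> (\<lambda>x. 0)"
 shows "energy v v > 0"
proof (rule ccontr)
 assume "\<not> ?thesis"
 hence e0: "energy v v = 0" using energy_nonneg[of v] by simp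
 have "\<epsilon> * (sn \<Omega> v)\<^sup>2 \<ge> 0" "\<gamma> * (L2_norm vol v)\<^sup>2 \<ge> 0" using eps gamma(1) by auto
 hence "\<epsilon> * (sn \<Omega> v)\<^sup>2 = 0" using e0 unfolding energy_self by linarith
 hence "sn \<Omega> v = 0" using eps by simp
 hence "L2_norm vol v \<le> 0" using c0(2) P1bD_facts(3)[OF v(1)] by (metis mult_zero_right)
 hence "(LINT x|vol. (v x)\<^sup>2) = 0" using L2_norm_square[of "vol" v] L2_norm_nonneg[of "vol" v] by simp
 moreover have "integrable vol (\<lambda>x. (v x)\<^sup>2)" using Vhb_L2(1)[OF v(1)] by (simp add: L2_space_def)
 ultimately have "AE x in vol. (v x)\<^sup>2 = 0" by (subst (asm) integral_nonneg_eq_0_iff_AE) auto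
 hence "AE x in lebesgue. x \<in> \<Omega> \<longrightarrow> v x = 0" using domain_lebesgue by (simp add: AE_restrict_space_iff)
 hence ae: "AE x\<in>\<Omega> in lebesgue. x \<in> {x \<in> closure \<Omega>. v x = 0}"
  by eventually_elim (use closure_subset[of \<Omega>] in auto)
 have cl: "closed {x \<in> closure \<Omega>. v x = 0}"
  by (rule continuous_closed_preimage_constant[OF P1bD_facts(2)[OF v(1)] closed_closure])
 have "\<Omega> \<subseteq> {x \<in> closure \<Omega>. v x = 0}" using mem_closed_if_AE_lebesgue_open[OF open_domain cl ae] by blast
 hence "closure \<Omega> \<subseteq> {x \<in> closure \<Omega>. v x = 0}" by (rule closure_minimal[OF _ cl])
 moreover have "nodes \<subseteq> closure \<Omega>"
 proof
  fix x assume "x \<in> nodes"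
  then obtain T where T: "T \<in> \<T>" "x \<in> vertices T \<or> x = full_simplex.center T" by (auto simp: nodes_def)
  interpret A: full_simplex T by (rule cell[OF T(1)])
  have "x \<in> T" using T(2) A.center_interior interior_subset[of T] by (auto simp: vertices_def extreme_point_of_def)
  thus "x \<in> closure \<Omega>" using cell_subset[OF T(1)] by blast
 qed
 ultimately have "\<forall>x\<in>nodes. v x = 0" by blast
 thus False using nodes_determine v unfolding determined_by_def by blast
qed

lemma tau_pos: "T \<in> \<T> \<Longrightarrow> tau f T > 0"
proof (cases "AE x in lebesgue_on T. f x = 0")
 case False
 assume T: "T \<in> \<T>"
 have i: "integrable (lebesgue_on T) (\<lambda>x. (norm (f x))\<^sup>2)" using L2_space_cell[OF f T] by (simp add: L2_space_def)
 have "L2_norm (lebesgue_on T) f \<noteq> 0"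
 proof
  assume "L2_norm (lebesgue_on T) f = 0"
  hence "(LINT x|lebesgue_on T. (norm (f x))\<^sup>2) = 0" using L2_norm_square[of "lebesgue_on T" f] by simp
  hence "AE x in lebesgue_on T. (norm (f x))\<^sup>2 = 0" using integral_nonneg_eq_0_iff_AE[OF i] by simp
  thus False using False by simp
 qed
 thus ?thesis using False L2_norm_nonneg[of "lebesgue_on T" f] by (simp add: tau_def less_le)
qed (simp add: tau_def)

lemma norm_f_le_tau: "L2_norm (lebesgue_on T) f \<le> tau f T"
proof (cases "AE x in lebesgue_on T. f x = 0")
 case True
 hence "(LINT x|lebesgue_on T. (norm (f x))\<^sup>2) = 0" by (intro integral_eq_zero_AE) (auto elim: AE_mp)
 thus ?thesis using True by (simp add: tau_def L2_norm_def)
qed (simp add: tau_def)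

lemma A_scale_nonneg: "Asc T w \<ge> 0"
 by (simp add: A_scale_def H1_seminorm_def Linf_norm_nonneg)

lemma diam_nonneg: "T \<in> \<T> \<Longrightarrow> 0 \<le> diameter T"
 by (rule diameter_ge_0[OF compact_imp_bounded[OF cell_compact]])

lemma art_nonneg: "T \<in> \<T> \<Longrightarrow> art T w \<ge> 0"
 using tau_pos[of T] A_scale_nonneg diam_nonneg
 by (auto simp: xi_def intro!: divide_nonneg_nonneg add_nonneg_nonneg mult_nonneg_nonneg less_imp_le)

lemma form_coercive: "v \<in> Vhb \<Longrightarrow> energy v v \<le> form w v v"
proof -
 assume v: "v \<in> Vhb"
 have "energy v v \<le> bilinear_B \<Omega> \<epsilon> \<beta> \<sigma> v v"
  unfolding energy_self by (rule bilinear_B_coercive[OF beta inflow sigma gamma(2) v])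
 moreover have "0 \<le> (\<Sum>T\<in>\<T>. DD_term \<Omega> \<Gamma> \<T> \<epsilon> \<beta> \<sigma> f T w v v)"
  unfolding DD_term_def by (intro sum_nonneg integral_nonneg_AE AE_I2) (simp add: art_nonneg)
 ultimately show ?thesis by (simp add: DD_form_def)
qed

lemma beta_cell: "T \<in> \<T> \<Longrightarrow> \<beta> \<in> Linf_space (lebesgue_on T)"
 and sigma_cell: "T \<in> \<T> \<Longrightarrow> \<sigma> \<in> Linf_space (lebesgue_on T)"
 using Linf_space_lebesgue_on_mono[OF domain_lebesgue cell_lebesgue negligible_cell_diff] beta_Linf sigma by blast+

definition advect :: "('a \<Rightarrow> real) \<Rightarrow> 'a \<Rightarrow> real" where
 "advect w x = \<beta> x \<bullet> grad w x + \<sigma> x * w x"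

lemma advect_bound:
 assumes w: "w \<in> H1_space \<Omega>" and T: "T \<in> \<T>"
 shows "advect w \<in> L2_space (lebesgue_on T)" "L2_norm (lebesgue_on T) (advect w) \<le> Asc T w"
proof -
 let ?M = "lebesgue_on T"
 have b: "(\<lambda>x. \<beta> x \<bullet> grad w x) \<in> L2_space ?M" by (rule L2_Linf_inner[OF beta_cell[OF T] L2_facts(4)[OF w T]])
 have s: "(\<lambda>x. \<sigma> x * w x) \<in> L2_space ?M" by (rule L2_Linf_scale[OF sigma_cell[OF T] L2_facts(3)[OF w T]])
 show "advect w \<in> L2_space ?M" unfolding advect_def[abs_def] using L2_space_comb[OF b s, of 1] by simp
 have 1: "L2_norm ?M (\<lambda>x. \<beta> x \<bullet> grad w x) \<le> Linf_norm ?M \<beta> * L2_norm ?M (grad w)"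
 proof (rule L2_norm_bound[OF _ L2_facts(4)[OF w T] _ Linf_norm_nonneg])
  show "(\<lambda>x. \<beta> x \<bullet> grad w x) \<in> borel_measurable ?M" using b by (simp add: L2_space_def)
  show "AE x in ?M. norm (\<beta> x \<bullet> grad w x) \<le> Linf_norm ?M \<beta> * norm (grad w x)"
   using AE_le_Linf_norm[OF beta_cell[OF T]]
  proof eventually_elim
   case (elim x)
   have "norm (\<beta> x \<bullet> grad w x) \<le> norm (\<beta> x) * norm (grad w x)" unfolding real_norm_def by (rule Cauchy_Schwarz_ineq2)
   also have "\<dots> \<le> Linf_norm ?M \<beta> * norm (grad w x)" using elim by (intro mult_right_mono) auto
   finally show ?case .
  qed
 qed
 have 2: "L2_norm ?M (\<lambda>x. \<sigma> x * w x) \<le> Linf_norm ?M \<sigma> * L2_norm ?M w"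
 proof (rule L2_norm_bound[OF _ L2_facts(3)[OF w T] _ Linf_norm_nonneg])
  show "(\<lambda>x. \<sigma> x * w x) \<in> borel_measurable ?M" using s by (simp add: L2_space_def)
  show "AE x in ?M. norm (\<sigma> x * w x) \<le> Linf_norm ?M \<sigma> * norm (w x)"
   using AE_le_Linf_norm[OF sigma_cell[OF T]] by eventually_elim (auto simp: abs_mult intro!: mult_right_mono)
 qed
 show "L2_norm ?M (advect w) \<le> Asc T w"
  using L2_norm_triangle[OF b s] 1 2 unfolding advect_def[abs_def] A_scale_def H1_seminorm_def by linarith
qed

text \<open>The denominator changes by at most \<open>d\<close> as well, and the quotient \<open>R' / (A' + t)\<close> that multiplies this change is at most \<open>1\<close>.\<close>

lemma quotient_lipschitz:
 fixes R R' A A' t d :: real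
 assumes "t > 0" "A \<ge> 0" "A' \<ge> 0" "R' \<ge> 0" "R' \<le> A' + t" "\<bar>R - R'\<bar> \<le> d" "\<bar>A - A'\<bar> \<le> d"
 shows "\<bar>R / (A + t) - R' / (A' + t)\<bar> \<le> 2 * d / t"
proof -
 have pos: "A + t > 0" "A' + t > 0" using assms by auto
 have d: "d \<ge> 0" using assms(6) by linarith
 define q where "q = R' / (A' + t)"
 have q: "0 \<le> q" "q \<le> 1" using pos assms by (auto simp: q_def divide_le_eq)
 have "\<bar>q * (A' - A)\<bar> = q * \<bar>A - A'\<bar>" using q(1) by (simp add: abs_mult abs_minus_commute)
 also have "\<dots> \<le> 1 * d" using q assms(7) by (intro mult_mono) auto
 finally have qd: "\<bar>q * (A' - A)\<bar> \<le> d" by simp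
 have "\<bar>(R - R') + q * (A' - A)\<bar> \<le> \<bar>R - R'\<bar> + \<bar>q * (A' - A)\<bar>" by (rule abs_triangle_ineq)
 also have "\<dots> \<le> 2 * d" using qd assms(6) by simp
 finally have "\<bar>(R - R') + q * (A' - A)\<bar> \<le> 2 * d" .
 moreover have "R / (A + t) - R' / (A' + t) = ((R - R') + q * (A' - A)) / (A + t)"
  using pos unfolding q_def by (simp add: field_simps)
 ultimately have "\<bar>R / (A + t) - R' / (A' + t)\<bar> \<le> 2 * d / (A + t)"
  using pos by (simp add: divide_right_mono)
 also have "\<dots> \<le> 2 * d / t" using assms(1,2) d by (intro divide_left_mono) auto
 finally show ?thesis .
qed

text \<open>Residual and scale are both Lipschitz with respect to \<open>A\<^sub>T(w - w')\<close>, and \<open>\<tau>\<close> bounds the contribution of \<open>f\<close> to the residual, which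
is what keeps the quotient at most one.\<close>

lemma xi_lipschitz:
 assumes w: "w \<in> Vh" and w': "w' \<in> Vh" and T: "T \<in> \<T>"
 shows "\<bar>xi \<Omega> \<epsilon> \<beta> \<sigma> f T w - \<xi> T w'\<bar> \<le> diameter T * (2 * Asc T (\<lambda>x. w x - w' x) / tau f T)"
proof -
 let ?M = "lebesgue_on T" and ?z = "\<lambda>x. w x - w' x"
 have zV: "?z \<in> Vh" by (rule subspace_diff[OF P1D_subspace w w'])
 note H = P1D_facts(1)[OF w] P1D_facts(1)[OF w'] P1D_facts(1)[OF zV]
 have fL: "f \<in> L2_space ?M" by (rule L2_space_cell[OF f T])
 have res_eq: "res v = (\<lambda>x. advect v x - f x)" for v by (simp add: residual_def advect_def fun_eq_iff)
 have resL: "res v \<in> L2_space ?M" if "v \<in> H1_space \<Omega>" for v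
  unfolding res_eq by (rule L2_space_diff[OF advect_bound(1)[OF that T] fL])
 have g: "AE x in ?M. grad ?z x = grad w x - grad w' x"
  using wgrad_comb_cell[OF H(1,2) T, of "-1"] by simp
 let ?R = "L2_norm ?M (res w)" and ?R' = "L2_norm ?M (res w')"
 let ?A = "Asc T w" and ?A' = "Asc T w'" and ?d = "Asc T ?z"
 have "\<bar>?R / (?A + tau f T) - ?R' / (?A' + tau f T)\<bar> \<le> 2 * ?d / tau f T"
 proof (rule quotient_lipschitz[OF tau_pos[OF T] A_scale_nonneg A_scale_nonneg L2_norm_nonneg])
  have "L2_norm ?M (\<lambda>x. advect w' x + (-1) *\<^sub>R f x) \<le> L2_norm ?M (advect w') + L2_norm ?M (\<lambda>x. (-1) *\<^sub>R f x)"
   using L2_space_comb[OF _ fL, of "\<lambda>x. 0" "-1"]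
   by (intro L2_norm_triangle[OF advect_bound(1)[OF H(2) T]]) (auto simp: L2_space_def)
  also have "L2_norm ?M (\<lambda>x. (-1) *\<^sub>R f x) = L2_norm ?M f" unfolding L2_norm_scale by simp
  finally show "?R' \<le> ?A' + tau f T"
   using advect_bound(2)[OF H(2) T] norm_f_le_tau[of T] unfolding res_eq by simp
  have "\<bar>?R - ?R'\<bar> \<le> L2_norm ?M (\<lambda>x. res w x - res w' x)"
   by (rule L2_norm_diff_le[OF resL[OF H(1)] resL[OF H(2)]])
  also have "\<dots> = L2_norm ?M (advect ?z)"
  proof (rule L2_norm_cong_AE)
   show "(\<lambda>x. res w x - res w' x) \<in> borel_measurable ?M"
    using L2_space_diff[OF resL[OF H(1)] resL[OF H(2)]] by (simp add: L2_space_def)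
   show "advect ?z \<in> borel_measurable ?M" using advect_bound(1)[OF H(3) T] by (simp add: L2_space_def)
   show "AE x in ?M. res w x - res w' x = advect ?z x"
    using g by eventually_elim (simp add: residual_def advect_def inner_diff_right right_diff_distrib)
  qed
  also have "\<dots> \<le> ?d" by (rule advect_bound(2)[OF H(3) T])
  finally show "\<bar>?R - ?R'\<bar> \<le> ?d" .
  have "\<bar>sn T w - sn T w'\<bar> \<le> L2_norm ?M (\<lambda>x. grad w x - grad w' x)"
   unfolding H1_seminorm_def by (rule L2_norm_diff_le[OF L2_facts(4)[OF H(1) T] L2_facts(4)[OF H(2) T]])
  also have "\<dots> = sn T ?z"
   unfolding H1_seminorm_def
  proof (rule L2_norm_cong_AE[symmetric])
   show "grad ?z \<in> borel_measurable ?M" using L2_facts(4)[OF H(3) T] by (simp add: L2_space_def)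
   show "(\<lambda>x. grad w x - grad w' x) \<in> borel_measurable ?M"
    using L2_space_diff[OF L2_facts(4)[OF H(1) T] L2_facts(4)[OF H(2) T]] by (simp add: L2_space_def)
  qed (rule g)
  finally have s1: "\<bar>sn T w - sn T w'\<bar> \<le> sn T ?z" .
  have s2: "\<bar>L2_norm ?M w - L2_norm ?M w'\<bar> \<le> L2_norm ?M ?z"
   by (rule L2_norm_diff_le[OF L2_facts(3)[OF H(1) T] L2_facts(3)[OF H(2) T]])
  have "?A - ?A' = Linf_norm ?M \<beta> * (sn T w - sn T w') + Linf_norm ?M \<sigma> * (L2_norm ?M w - L2_norm ?M w')"
   by (simp add: A_scale_def algebra_simps)
  moreover have "\<bar>Linf_norm ?M \<beta> * (sn T w - sn T w')\<bar> \<le> Linf_norm ?M \<beta> * sn T ?z"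
   unfolding abs_mult using s1 Linf_norm_nonneg[of ?M \<beta>] by (simp add: mult_left_mono)
  moreover have "\<bar>Linf_norm ?M \<sigma> * (L2_norm ?M w - L2_norm ?M w')\<bar> \<le> Linf_norm ?M \<sigma> * L2_norm ?M ?z"
   unfolding abs_mult using s2 Linf_norm_nonneg[of ?M \<sigma>] by (simp add: mult_left_mono)
  ultimately show "\<bar>?A - ?A'\<bar> \<le> ?d" unfolding A_scale_def by linarith
 qed
 hence "diameter T * \<bar>?R / (?A + tau f T) - ?R' / (?A' + tau f T)\<bar> \<le> diameter T * (2 * ?d / tau f T)"
  by (rule mult_left_mono) (rule diam_nonneg[OF T])
 moreover have "\<bar>diameter T * ?R / (?A + tau f T) - diameter T * ?R' / (?A' + tau f T)\<bar> = diameter T * \<bar>?R / (?A + tau f T) - ?R' / (?A' + tau f T)\<bar>"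
 proof -
  have "diameter T * ?R / (?A + tau f T) - diameter T * ?R' / (?A' + tau f T) = diameter T * (?R / (?A + tau f T) - ?R' / (?A' + tau f T))"
   by (simp add: right_diff_distrib)
  thus ?thesis using diam_nonneg[OF T] by (simp add: abs_mult)
 qed
 moreover have "0 \<le> diameter T * (2 * ?d / tau f T)"
  using diam_nonneg[OF T] tau_pos[OF T] A_scale_nonneg by simp
 ultimately show ?thesis by (simp add: xi_def)
qed

text \<open>For \<open>\<gamma> = 0\<close> the second bound says that \<open>\<sigma>\<close> vanishes, which the bound of \<open>\<sigma>\<close> by \<open>c\<^sub>\<sigma> \<gamma>\<close> enforces.\<close>

lemma M3_bound:
 assumes T: "T \<in> \<T>"
 shows "Linf_norm (lebesgue_on T) \<beta> \<le> M3T T * sqrt \<epsilon>" "Linf_norm (lebesgue_on T) \<sigma> \<le> M3T T * sqrt \<gamma>"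
  "M3T T \<ge> 0"
proof -
 have "Linf_norm (lebesgue_on T) \<beta> / sqrt \<epsilon> \<le> M3T T" by (simp add: M3_def)
 thus "Linf_norm (lebesgue_on T) \<beta> \<le> M3T T * sqrt \<epsilon>" using eps by (simp add: divide_le_eq)
 have "0 \<le> Linf_norm (lebesgue_on T) \<beta> / sqrt \<epsilon>" using eps by (simp add: Linf_norm_nonneg)
 thus "M3T T \<ge> 0" by (auto simp: M3_def max_def)
 show "Linf_norm (lebesgue_on T) \<sigma> \<le> M3T T * sqrt \<gamma>"
 proof (cases "\<gamma> > 0")
  case True
  hence "Linf_norm (lebesgue_on T) \<sigma> / sqrt \<gamma> \<le> M3T T" by (simp add: M3_def)
  thus ?thesis using True by (simp add: divide_le_eq)
 next
  case False
  hence g0: "\<gamma> = 0" using gamma(1) by simp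
  hence le0: "Linf_norm vol \<sigma> \<le> 0" using gamma(3) by simp
  have "AE x in vol. norm (\<sigma> x) \<le> 0"
   using AE_le_Linf_norm[OF sigma] by eventually_elim (use le0 in linarith)
  hence "AE x in lebesgue_on T. norm (\<sigma> x) \<le> 0"
   by (rule AE_lebesgue_on_mono[OF domain_lebesgue cell_lebesgue[OF T] negligible_cell_diff[OF T]])
  hence "Linf_norm (lebesgue_on T) \<sigma> \<le> 0"
   using sigma_cell[OF T] by (intro Linf_norm_le) (auto simp: Linf_space_def)
  thus ?thesis by (simp add: g0)
 qed
qed

text \<open>The factor \<open>2\<close> in \<open>M\<^sub>4\<^sub>,\<^sub>T\<close> comes from the quotient, \<open>\<surd>2\<close> from \<open>x + y \<le> \<surd>2 \<surd>(x\<^sup>2 + y\<^sup>2)\<close>, and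
\<open>max {1, c\<^sub>1}\<close> from passing to the piecewise linear part.\<close>

lemma art_lipschitz:
 assumes w: "w \<in> Vhb" and w': "w' \<in> Vhb" and T: "T \<in> \<T>"
 shows "\<bar>art T w - art T w'\<bar> \<le> diameter T * M4T T * edist energy w w'"
proof -
 let ?M = "lebesgue_on T" and ?z = "\<lambda>x. w x - w' x"
 have z: "?z \<in> Vhb" by (rule subspace_diff[OF P1bD_subspace w w'])
 define a b where "a = sn T ?z" and "b = L2_norm ?M ?z"
 define m where "m = max 1 c\<^sub>1"
 have ab: "a \<ge> 0" "b \<ge> 0" by (simp_all add: a_def b_def H1_seminorm_def)
 have ka: "sn T (\<kappa> ?z) \<le> m * a"
 proof -
  have "sn T (\<kappa> ?z) \<le> 1 * a" using kappa_seminorm_le[OF z T] by (simp add: a_def)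
  also have "\<dots> \<le> m * a" by (rule mult_right_mono) (use ab in \<open>auto simp: m_def\<close>)
  finally show ?thesis .
 qed
 have kb: "L2_norm ?M (\<kappa> ?z) \<le> m * b"
 proof -
  obtain zh zb where d: "zh \<in> Vh" "zb \<in> bubble_space \<T>" "?z = (\<lambda>x. zh x + zb x)" using P1bD_cases[OF z] by blast
  have "L2_norm ?M zh \<le> c\<^sub>1 * L2_norm ?M ?z" unfolding d(3) using c1 d(1,2) T by blast
  moreover have "\<kappa> ?z = zh" unfolding d(3) by (rule kappa_eq[OF d(1,2)])
  moreover have "c\<^sub>1 * b \<le> m * b" by (rule mult_right_mono) (use ab in \<open>auto simp: m_def\<close>)
  ultimately show ?thesis by (simp add: b_def)
 qed
 have m: "m \<ge> 0" by (simp add: m_def)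
 let ?M3 = "M3T T"
 have "Asc T (\<kappa> ?z) \<le> (?M3 * sqrt \<epsilon>) * (m * a) + (?M3 * sqrt \<gamma>) * (m * b)"
  unfolding A_scale_def using M3_bound[OF T] ka kb ab m eps gamma(1)
  by (intro add_mono mult_mono) (auto simp: Linf_norm_nonneg H1_seminorm_def)
 also have "\<dots> = m * ?M3 * (sqrt \<epsilon> * a + sqrt \<gamma> * b)" by (simp add: algebra_simps)
 also have "\<dots> \<le> m * ?M3 * (sqrt 2 * edist energy w w')"
 proof (rule mult_left_mono)
  have aO: "a \<le> sn \<Omega> ?z" unfolding a_def H1_seminorm_def by (rule L2_norm_cell_le[OF Vhb_L2(2)[OF z] T])
  have bO: "b \<le> L2_norm vol ?z" unfolding b_def by (rule L2_norm_cell_le[OF Vhb_L2(1)[OF z] T])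
  have "(sqrt \<epsilon> * a + sqrt \<gamma> * b)\<^sup>2 \<le> 2 * (\<epsilon> * a\<^sup>2 + \<gamma> * b\<^sup>2)"
  proof -
   have "(x + y)\<^sup>2 \<le> 2 * (x\<^sup>2 + y\<^sup>2)" for x y :: real using zero_le_power2[of "x - y"] by (simp add: power2_eq_square algebra_simps)
   from this[of "sqrt \<epsilon> * a" "sqrt \<gamma> * b"] show ?thesis using eps gamma(1) by (simp add: power_mult_distrib)
  qed
  also have "\<dots> \<le> 2 * energy ?z ?z"
   unfolding energy_self using aO bO ab eps gamma(1) by (intro mult_left_mono add_mono power_mono) auto
  finally have "sqrt \<epsilon> * a + sqrt \<gamma> * b \<le> sqrt (2 * energy ?z ?z)" by (rule real_le_rsqrt)
  thus "sqrt \<epsilon> * a + sqrt \<gamma> * b \<le> sqrt 2 * edist energy w w'" by (simp add: edist_def real_sqrt_mult)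
  show "0 \<le> m * ?M3" using m M3_bound(3)[OF T] by simp
 qed
 finally have A: "Asc T (\<kappa> ?z) \<le> m * ?M3 * (sqrt 2 * edist energy w w')" .
 have "\<bar>art T w - art T w'\<bar> \<le> diameter T * (2 * Asc T (\<kappa> ?z) / tau f T)"
  using xi_lipschitz[OF kappa_in[OF w] kappa_in[OF w'] T] by (simp add: kappa_diff[OF w w'])
 also have "\<dots> \<le> diameter T * (2 * (m * ?M3 * (sqrt 2 * edist energy w w')) / tau f T)"
  using A tau_pos[OF T] diam_nonneg[OF T]
  by (intro mult_left_mono divide_right_mono) auto
 also have "\<dots> = diameter T * M4T T * edist energy w w'"
  by (simp add: M4_loc_def m_def)
 finally show ?thesis .
qed

abbreviation "h \<equiv> mesh_size \<T>"
abbreviation "M \<equiv> M4 \<epsilon> \<gamma> \<beta> \<sigma> f c\<^sub>1 \<T>"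
text \<open>An upper bound for the dual norm of the load functional with respect to the energy norm.\<close>

definition CF :: real where
 "CF = L2_norm vol f / max (sqrt \<gamma>) (sqrt \<epsilon> / c\<^sub>0) + c\<^sub>3 / sqrt \<epsilon> * Hhalf_dual_norm \<Gamma>\<^sub>N g"

lemma h_M_bounds: "T \<in> \<T> \<Longrightarrow> diameter T * M4T T \<le> h * M" "h \<ge> 0" "M \<ge> 0"
proof -
 note d0 = diam_nonneg
 have m0: "0 \<le> M4T T" if "T \<in> \<T>" for T
  using M3_bound(3)[OF that] tau_pos[OF that] by (simp add: M4_loc_def)
 have d: "diameter T \<le> h" and mm: "M4T T \<le> M" if "T \<in> \<T>" for T
  using finite_mesh that by (simp_all add: mesh_size_def M4_def)
 obtain T0 where T0: "T0 \<in> \<T>" using mesh_nonempty by blast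
 show h0: "h \<ge> 0" and "M \<ge> 0" using d0[OF T0] d[OF T0] m0[OF T0] mm[OF T0] by linarith+
 show "diameter T * M4T T \<le> h * M" if "T \<in> \<T>"
  using d[OF that] mm[OF that] m0[OF that] h0 by (intro mult_mono) auto
qed

text \<open>The \<open>L\<^sup>2\<close> norm of \<open>v\<close> is controlled by the energy norm in two ways, through \<open>\<gamma>\<close> and through the Poincare inequality; the better one counts.\<close>

lemma load_bound:
 assumes v: "v \<in> Vhb"
 shows "load v \<le> CF * sqrt (energy v v)" "CF \<ge> 0"
proof -
 let ?E = "sqrt (energy v v)" and ?s = "sn \<Omega> v" and ?n = "L2_norm vol v"
 let ?G = "Hhalf_dual_norm \<Gamma>\<^sub>N g"
 note tr = c3(2)[rule_format, OF P1bD_facts(3)[OF v] is_trace_continuous[OF P1bD_facts(1,2)[OF v]]]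
 note db = Hhalf_dual_norm_bound[OF finite_surface_on[OF \<Gamma>N] g tr[THEN conjunct1]]
 have s0: "?s \<ge> 0" by (simp add: H1_seminorm_def)
 have es: "sqrt \<epsilon> * ?s \<le> ?E"
  using eps gamma(1) s0 by (intro real_le_rsqrt) (simp add: power_mult_distrib energy_self)
 have gn: "sqrt \<gamma> * ?n \<le> ?E"
  using eps gamma(1) by (intro real_le_rsqrt) (simp add: power_mult_distrib energy_self)
 have "sqrt \<epsilon> / c\<^sub>0 * ?n \<le> sqrt \<epsilon> / c\<^sub>0 * (c\<^sub>0 * ?s)"
  using c0 P1bD_facts(3)[OF v] eps by (intro mult_left_mono) auto
 hence en: "sqrt \<epsilon> / c\<^sub>0 * ?n \<le> ?E" using es c0(1) by simp
 let ?m = "max (sqrt \<gamma>) (sqrt \<epsilon> / c\<^sub>0)"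
 have m: "?m > 0" using eps c0(1) by (simp add: less_max_iff_disj)
 have mn: "?m * ?n \<le> ?E" using gn en by (simp add: max_def)
 show "CF \<ge> 0" using m c3(1) eps db(2) unfolding CF_def by (intro add_nonneg_nonneg mult_nonneg_nonneg divide_nonneg_pos) auto
 have "(LINT x|vol. f x * v x) \<le> L2_norm vol f * ?n"
  using L2_cauchy_schwarz[OF f Vhb_L2(1)[OF v]] by simp
 also have "\<dots> \<le> L2_norm vol f * (?E / ?m)"
  using mn m by (intro mult_left_mono) (auto simp: le_divide_eq mult.commute)
 finally have 1: "(LINT x|vol. f x * v x) \<le> L2_norm vol f / ?m * ?E" by simp
 have "(LINT x|surface_on \<Gamma>\<^sub>N. g x * v x) \<le> ?G * Hhalf_norm \<Gamma>\<^sub>N v" using db(1) by linarith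
 also have "\<dots> \<le> ?G * (c\<^sub>3 * (?E / sqrt \<epsilon>))"
 proof (rule mult_left_mono[OF _ db(2)])
  have "?s \<le> ?E / sqrt \<epsilon>" using es eps by (simp add: le_divide_eq mult.commute)
  hence "c\<^sub>3 * ?s \<le> c\<^sub>3 * (?E / sqrt \<epsilon>)" using c3(1) by (intro mult_left_mono) auto
  thus "Hhalf_norm \<Gamma>\<^sub>N v \<le> c\<^sub>3 * (?E / sqrt \<epsilon>)" using tr by linarith
 qed
 finally have 2: "(LINT x|surface_on \<Gamma>\<^sub>N. g x * v x) \<le> c\<^sub>3 / sqrt \<epsilon> * ?G * ?E" by (simp add: mult_ac)
 show "load v \<le> CF * ?E" unfolding load_def CF_def distrib_right using 1 2 by linarith
qed

lemma solution_bound: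
 assumes u: "u \<in> Vhb" and sol: "\<forall>v\<in>Vhb. form w u v = load v"
 shows "sqrt (energy u u) \<le> CF"
proof (cases "energy u u = 0")
 case False
 hence pos: "sqrt (energy u u) > 0" using energy_nonneg[of u] by simp
 have "sqrt (energy u u) * sqrt (energy u u) = energy u u" using energy_nonneg[of u] by simp
 also have "\<dots> \<le> load u" using form_coercive[OF u, of w] sol u by simp
 also have "\<dots> \<le> CF * sqrt (energy u u)" by (rule load_bound(1)[OF u])
 finally show ?thesis by (rule mult_right_le_imp_le[OF _ pos])
qed (use load_bound(2)[OF u] in simp)

text \<open>Only the artificial diffusion depends on \<open>w\<close>, so the difference of the two equations, tested with \<open>u - u'\<close>, leaves the differences of \<open>\<xi>\<^sub>T\<close> times
gradients of \<open>u'\<close> and \<open>u - u'\<close>. The Cauchy-Schwarz inequality for the sum over the cells and the bound for \<open>u'\<close> give the factor.\<close>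

lemma contraction:
 assumes w: "w \<in> Vhb" "w' \<in> Vhb" and u: "u \<in> Vhb" "u' \<in> Vhb"
  and sol: "\<forall>v\<in>Vhb. form w u v = load v" "\<forall>v\<in>Vhb. form w' u' v = load v"
 shows "edist energy u u' \<le> h * CF * M / \<epsilon> * edist energy w w'"
proof -
 let ?z = "\<lambda>x. u x - u' x" and ?D = "edist energy w w'"
 have z: "?z \<in> Vhb" by (rule subspace_diff[OF P1bD_subspace u])
 have D0: "?D \<ge> 0" using energy_nonneg by (simp add: edist_def)
 define J where "J T = (LINT x|lebesgue_on T. grad u' x \<bullet> grad ?z x)" for T
 have formd: "form w0 u' ?z = bilinear_B \<Omega> \<epsilon> \<beta> \<sigma> u' ?z + (\<Sum>T\<in>\<T>. art T w0 * J T)" for w0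
  by (simp add: DD_form_def DD_term_def J_def)
 have "energy ?z ?z \<le> form w ?z ?z" by (rule form_coercive[OF z])
 also have "\<dots> = form w u ?z - form w u' ?z"
  using bilinear_left[OF form_bilinear u z, of w "-1"] by simp
 also have "\<dots> = form w' u' ?z - form w u' ?z" using sol z by simp
 also have "\<dots> = (\<Sum>T\<in>\<T>. (art T w' - art T w) * J T)"
  unfolding formd by (simp add: sum_subtractf left_diff_distrib)
 also have "\<dots> \<le> (\<Sum>T\<in>\<T>. (h * M * ?D) * (sn T u' * sn T ?z))"
 proof (rule sum_mono)
  fix T assume T: "T \<in> \<T>"
  have 1: "\<bar>art T w' - art T w\<bar> \<le> h * M * ?D"
  proof -
   have "\<bar>art T w - art T w'\<bar> \<le> diameter T * M4T T * ?D" by (rule art_lipschitz[OF w T])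
   also have "\<dots> \<le> h * M * ?D" by (rule mult_right_mono[OF h_M_bounds(1)[OF T] D0])
   finally show ?thesis by (simp add: abs_minus_commute)
  qed
  have 2: "\<bar>J T\<bar> \<le> sn T u' * sn T ?z"
   unfolding J_def H1_seminorm_def by (rule L2_cauchy_schwarz[OF Vhb_L2(4)[OF u(2) T] Vhb_L2(4)[OF z T]])
  have "(art T w' - art T w) * J T \<le> \<bar>art T w' - art T w\<bar> * \<bar>J T\<bar>" by (metis abs_ge_self abs_mult)
  also have "\<dots> \<le> (h * M * ?D) * (sn T u' * sn T ?z)"
   using 1 2 D0 h_M_bounds(2,3) by (intro mult_mono) auto
  finally show "(art T w' - art T w) * J T \<le> (h * M * ?D) * (sn T u' * sn T ?z)" .
 qed
 also have "\<dots> = (h * M * ?D) * (\<Sum>T\<in>\<T>. sn T u' * sn T ?z)" by (simp only: sum_distrib_left)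
 also have "\<dots> \<le> (h * M * ?D) * (sn \<Omega> u' * sn \<Omega> ?z)"
 proof (rule mult_left_mono)
  have "(\<Sum>T\<in>\<T>. sn T u' * sn T ?z) \<le> L2_set (\<lambda>T. sn T u') \<T> * L2_set (\<lambda>T. sn T ?z) \<T>"
   using L2_set_mult_ineq[of "\<lambda>T. sn T u'" "\<lambda>T. sn T ?z" \<T>] by (simp add: H1_seminorm_def)
  moreover have "L2_set (\<lambda>T. sn T v) \<T> = sn \<Omega> v" if "v \<in> Vhb" for v
   unfolding L2_set_def H1_seminorm_def L2_norm_cell_square_sum[OF Vhb_L2(2)[OF that], symmetric] by simp
  ultimately show "(\<Sum>T\<in>\<T>. sn T u' * sn T ?z) \<le> sn \<Omega> u' * sn \<Omega> ?z"
   using u(2) z by simp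
 qed (use D0 h_M_bounds(2,3) in simp)
 also have "\<dots> \<le> (h * M * ?D) * (CF / sqrt \<epsilon> * (sqrt (energy ?z ?z) / sqrt \<epsilon>))"
 proof (rule mult_left_mono)
  have es: "sn \<Omega> v \<le> sqrt (energy v v) / sqrt \<epsilon>" for v
  proof -
   have "sqrt \<epsilon> * sn \<Omega> v \<le> sqrt (energy v v)"
    using eps gamma(1) by (intro real_le_rsqrt) (simp add: power_mult_distrib energy_self)
   thus ?thesis using eps by (simp add: le_divide_eq mult.commute)
  qed
  have "sn \<Omega> u' \<le> CF / sqrt \<epsilon>"
   using es[of u'] divide_right_mono[OF solution_bound[OF u(2) sol(2)], of "sqrt \<epsilon>"] eps by simp
  thus "sn \<Omega> u' * sn \<Omega> ?z \<le> CF / sqrt \<epsilon> * (sqrt (energy ?z ?z) / sqrt \<epsilon>)"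
   using es[of ?z] load_bound(2)[OF z] eps by (intro mult_mono) (auto simp: H1_seminorm_def)
 qed (use D0 h_M_bounds(2,3) in simp)
 also have "\<dots> = (h * CF * M / \<epsilon> * ?D) * sqrt (energy ?z ?z)" using eps by (simp add: field_simps)
 finally have le: "energy ?z ?z \<le> (h * CF * M / \<epsilon> * ?D) * sqrt (energy ?z ?z)" .
 show ?thesis
 proof (cases "energy ?z ?z = 0")
  case True
  thus ?thesis using D0 h_M_bounds(2,3) load_bound(2)[OF z] eps by (simp add: edist_def[of energy u u'])
 next
  case False
  hence pos: "sqrt (energy ?z ?z) > 0" using energy_nonneg[of ?z] by simp
  have "sqrt (energy ?z ?z) * sqrt (energy ?z ?z) \<le> (h * CF * M / \<epsilon> * ?D) * sqrt (energy ?z ?z)"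
   using le energy_nonneg[of ?z] by simp
  thus ?thesis unfolding edist_def[of energy u u'] by (rule mult_right_le_imp_le[OF _ pos])
 qed
qed

theorem unique_solution:
 assumes small: "h * CF * M < \<epsilon>"
 shows "\<exists>!u. u \<in> Vhb \<and> (\<forall>v\<in>Vhb. form u u v = load v)"
proof (rule contraction_unique_solution[OF finite_nodes nodes_determine P1bD_subspace energy_bilinear energy_commute energy_pos form_bilinear form_coercive load_linear _ _ contraction])
 have "CF \<ge> 0" by (rule load_bound(2)[OF subspace_zero[OF P1bD_subspace]])
 thus "0 \<le> h * CF * M / \<epsilon>" using h_M_bounds(2,3) eps by simp
 show "h * CF * M / \<epsilon> < 1" using small eps by simp
qed

end

text \<open>If \<open>C\<close> or \<open>M\<close> is zero, its inverse is \<open>\<infinity>\<close> and the product on the left-hand side of the conclusion is zero.\<close>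

lemma ereal_smallness:
 fixes h e C M :: real
 assumes "ereal h < ereal e * inverse (ereal C) * inverse (ereal M)" "e > 0" "C \<ge> 0" "M \<ge> 0"
 shows "h * C * M < e"
proof (cases "C = 0 \<or> M = 0")
 case False
 hence "C > 0" "M > 0" using assms by auto
 hence "h < e / C / M" using assms(1) by (simp add: divide_inverse)
 thus ?thesis using \<open>C > 0\<close> \<open>M > 0\<close> by (simp add: field_simps)
qed (use assms in auto)

theorem theorem4p2:
  fixes \<Omega> \<Gamma>\<^sub>D \<Gamma>\<^sub>N :: "'a::euclidean_space set"
    and \<epsilon> \<gamma> c\<^sub>\<sigma> c\<^sub>0 c\<^sub>1 c\<^sub>3 \<rho> :: real
    and \<beta> :: "'a \<Rightarrow> 'a"
    and \<sigma> f g :: "'a \<Rightarrow> real"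
    and \<T> :: "'a set set"
  assumes dim: "DIM('a) = 2 \<or> DIM('a) = 3"
    and domain: "lipschitz_domain \<Omega>"
    and boundary: "frontier \<Omega> = closure \<Gamma>\<^sub>D \<union> closure \<Gamma>\<^sub>N" "\<Gamma>\<^sub>D \<inter> \<Gamma>\<^sub>N = {}"
      "\<Gamma>\<^sub>D \<in> sets borel" "\<Gamma>\<^sub>N \<in> sets borel"
    and eps: "\<epsilon> > 0"
    and beta: "\<forall>b\<in>Basis. (\<lambda>x. \<beta> x \<bullet> b) \<in> W1inf_space \<Omega>" "continuous_on (closure \<Omega>) \<beta>"
    and sigma: "\<sigma> \<in> Linf_space (lebesgue_on \<Omega>)" "AE x in lebesgue_on \<Omega>. 0 \<le> \<sigma> x"
    and f: "f \<in> L2_space (lebesgue_on \<Omega>)"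
    and g: "g \<in> L2_space (surface_on \<Gamma>\<^sub>N)"
    and A1: "emeasure surface_measure \<Gamma>\<^sub>D > 0"
      "{x \<in> frontier \<Omega>. \<exists>\<nu>. outward_normal \<Omega> x \<nu> \<and> \<beta> x \<bullet> \<nu> < 0} \<subseteq> \<Gamma>\<^sub>D"
    and A2: "\<gamma> \<ge> 0" "c\<^sub>\<sigma> \<ge> 0"
      "AE x in lebesgue_on \<Omega>. \<sigma> x - wdiv \<Omega> \<beta> x / 2 \<ge> \<gamma>"
      "Linf_norm (lebesgue_on \<Omega>) \<sigma> \<le> c\<^sub>\<sigma> * \<gamma>"
    and mesh: "mesh \<Omega> \<T>" "shape_regular \<rho> \<T>"
    and c0: "c\<^sub>0 > 0"
      "\<forall>v\<in>H1D_space \<Omega> \<Gamma>\<^sub>D. L2_norm (lebesgue_on \<Omega>) v \<le> c\<^sub>0 * H1_seminorm \<Omega> \<Omega> v"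
    and c1: "c\<^sub>1 > 0"
      "\<forall>v\<^sub>h\<in>P1D_space \<Omega> \<Gamma>\<^sub>D \<T>. \<forall>v\<^sub>b\<in>bubble_space \<T>. \<forall>T\<in>\<T>.
         L2_norm (lebesgue_on T) v\<^sub>h \<le> c\<^sub>1 * L2_norm (lebesgue_on T) (\<lambda>x. v\<^sub>h x + v\<^sub>b x)"
    and c3: "c\<^sub>3 > 0"
      "\<forall>v\<in>H1D_space \<Omega> \<Gamma>\<^sub>D. \<forall>w. is_trace \<Omega> v w \<longrightarrow>
         w \<in> Hhalf_space \<Gamma>\<^sub>N \<and> Hhalf_norm \<Gamma>\<^sub>N w \<le> c\<^sub>3 * H1_seminorm \<Omega> \<Omega> v"
    and small: "ereal (mesh_size \<T>) <
       ereal \<epsilon>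
       * inverse (ereal (L2_norm (lebesgue_on \<Omega>) f / max (sqrt \<gamma>) (sqrt \<epsilon> / c\<^sub>0)
                         + c\<^sub>3 / sqrt \<epsilon> * Hhalf_dual_norm \<Gamma>\<^sub>N g))
       * inverse (ereal (M4 \<epsilon> \<gamma> \<beta> \<sigma> f c\<^sub>1 \<T>))"
  shows "\<exists>!u. u \<in> P1bD_space \<Omega> \<Gamma>\<^sub>D \<T> \<and>
    (\<forall>v\<in>P1bD_space \<Omega> \<Gamma>\<^sub>D \<T>.
       DD_form \<Omega> \<Gamma>\<^sub>D \<T> \<epsilon> \<beta> \<sigma> f u u v =
         (\<integral>x. f x * v x \<partial>lebesgue_on \<Omega>) + (\<integral>x. g x * v x \<partial>surface_on \<Gamma>\<^sub>N))"
proof -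
 interpret dd_scheme \<Omega> \<T> \<Gamma>\<^sub>D \<Gamma>\<^sub>N \<epsilon> \<gamma> c\<^sub>\<sigma> c\<^sub>0 c\<^sub>1 c\<^sub>3 \<beta> \<sigma> f g
 proof unfold_locales
  show "DIM('a) \<ge> 2" using dim by auto
  show "\<exists>A. emeasure (surface_measure :: 'a measure) A > 0" using A1(1) by blast
  show "\<Gamma>\<^sub>D \<subseteq> frontier \<Omega>" "\<Gamma>\<^sub>N \<subseteq> frontier \<Omega>"
   unfolding boundary(1) using closure_subset by blast+
 qed (fact assms)+
 have "CF \<ge> 0" by (rule load_bound(2)[OF subspace_zero[OF P1bD_subspace]])
 hence "mesh_size \<T> * CF * M4 \<epsilon> \<gamma> \<beta> \<sigma> f c\<^sub>1 \<T> < \<epsilon>"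
  using ereal_smallness[OF small[folded CF_def] eps] h_M_bounds(3) by blast
 thus ?thesis using unique_solution unfolding load_def by blast
qed

end
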